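(* Let $\mathcal F$ be a linear singular foliation on a real finite-dimensional vector space $V$, let $p\in V$ be the origin, and let $$0\to\Gamma(E_n)\xrightarrow{\partial_n}\cdots\xrightarrow{\partial_1}\Gamma(E_0)\xrightarrow{\rho}\mathcal F\to0$$ be a resolution of $\mathcal F$, minimal at $p$, endowed with an $L_\infty$-algebroid structure with anchor $\rho$, unary bracket $\partial$ and binary bracket $\ell_2$. Then: (i) The map $\mathrm{lin}:\mathcal F\to\mathcal F$, $X\mapsto X^{(1)}\in\mathcal F$, descends to an injective Lie algebra homomorphism $\overline{\mathrm{lin}}:\mathcal F/I_p\mathcal F\to\mathcal F$, where $X^{(1)}$ denotes the linear part of the vector field $X$ at the origin. (ii) Let $i=0,\dots,n$. For $X\in\mathcal F(V)$ and $\alpha\otimes Y\in\Gamma(\wedge^iV^* )\otimes_{C^\infty(V)}\mathcal F(V)$, the assignment $$(X+I_p\mathcal F)\cdot(\alpha\otimes Y):=[X^{(1)},\alpha\otimes Y]_{FN}=\mathcal L_{X^{(1)}}(\alpha)\otimes Y+\alpha\otimes[X^{(1)},Y]$$ defines a representation of $\mathcal F/I_p\mathcal F$ on $\Gamma(\wedge^iV^* )\otimes_{C^\infty(V)}\mathcal F(V)$, compatible with the differential $d_\bullet$. Consequently there is a well-defined action on the cohomology groups. (iii) The $\mathcal F/I_p\mathcal F$-action on $H^i(\Gamma(\wedge^\bullet V^* )\otimes_{C^\infty(V)}\mathcal F(V),d_\bullet\otimes\mathrm{id})$ induced by the action in (ii) is equivalent (isomorphic as a representation) to the $\mathcal F/I_p\mathcal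 F$-action on $(E_i)_p$ given by $\ell_2$.
   Context: A foliation on $V$ is linear if it is generated, as a $C^\infty(V)$-module, by linear vector fields, namely those induced by the linear action of a Lie subalgebra of $\mathfrak{gl}(V)$. $I_p\subseteq C^\infty(V)$ is the ideal of functions vanishing at $p$. Minimal at $p$ means that the bundle maps $\partial_i$, $i\ge1$, vanish at $p$; $(E_i)_p$ is the fiber at $p$. An $L_\infty$-algebroid structure on the complex consists of graded skew-symmetric multibrackets $\ell_k$ of degree $2-k$ ($E_i$ in degree $-i$), $\ell_1=\partial$, with $\ell_k$ being $C^\infty$-multilinear for $k\ne2$ and $\ell_2$ satisfying the Leibniz rule with anchor $\rho$ on $E_0$ (zero on $E_i$, $i>0$), and satisfying the higher Jacobi identities. Since $\rho$ vanishes at $p$, the brackets restrict to the fibers at $p$; $(E_0)_p$ with $\ell_2$ is a Lie algebra, canonically identified via $\rho$ with the isotropy Lie algebra $\mathcal F/I_p\mathcal F$, and it acts on each $(E_i)_p$ by $\ell_2$. $\Gamma(\wedge^iV^* )=C^\infty(V,\wedge^iV^* )$ is identified with the differential $i$-forms on $V$, $\mathcal L$ is the Lie derivative, $[-,-]_{FN}$ is the Frölicher–Nijenhuis bracket, and $d_i:\Gamma(\wedge^iV^* )\to\Gamma(\wedge^{i-1}V^* )$ is contraction with the Euler vector field; $H^i$ is the (co)homology at the $\wedge^i$ term, with $\wedge^{-1}V^*=0$. *)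

theory Defs
  imports "HOL-Analysis.Analysis" "HOL-Algebra.Module" "HOL-Algebra.AbelCoset"
begin

section \<open>Modules, quotients and tensor products\<close>

text \<open>Algebraic structures are the records of HOL-Algebra. A real vector space is a module over
  \<open>real_ring\<close>; the multiplicative fields of a module record play no role and are left
  undefined.\<close>

definition real_ring :: "real ring" where
  "real_ring = \<lparr>carrier = UNIV, mult = (*), one = 1, zero = 0, add = (+)\<rparr>"

definition generated_submodule ::
  "('r, 'c) ring_scheme \<Rightarrow> ('r, 'm, 'd) module_scheme \<Rightarrow> 'm set \<Rightarrow> 'm set" where
  "generated_submodule R M S = \<Inter>{N. submodule N R M \<and> S \<subseteq> N}"

definition quot_module :: "('r, 'm, 'd) module_scheme \<Rightarrow> 'm set \<Rightarrow> ('r, 'm set) module" where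
  "quot_module M N =
     \<lparr>carrier = a_rcosets\<^bsub>M\<^esub> N, mult = undefined, one = undefined, zero = N, add = set_add M,
      smult = (\<lambda>r C. \<Union>x\<in>C. N +>\<^bsub>M\<^esub> (r \<odot>\<^bsub>M\<^esub> x))\<rparr>"

definition linear_maps ::
  "('r, 'c) ring_scheme \<Rightarrow> ('r, 'm, 'd) module_scheme \<Rightarrow> ('r, 'n, 'e) module_scheme \<Rightarrow> ('m \<Rightarrow> 'n) set"
  where
  "linear_maps R M N = {f \<in> carrier M \<rightarrow> carrier N.
     (\<forall>x\<in>carrier M. \<forall>y\<in>carrier M. f (x \<oplus>\<^bsub>M\<^esub> y) = f x \<oplus>\<^bsub>N\<^esub> f y) \<and>
     (\<forall>r\<in>carrier R. \<forall>x\<in>carrier M. f (r \<odot>\<^bsub>M\<^esub> x) = r \<odot>\<^bsub>N\<^esub> f x)}"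

text \<open>The tensor product \<open>M \<otimes>\<^sub>R N\<close>: a list \<open>[(m\<^sub>1, n\<^sub>1), \<dots>, (m\<^sub>k, n\<^sub>k)]\<close> stands for the formal sum
  of the \<open>m\<^sub>j \<otimes> n\<^sub>j\<close>, and \<open>tensor_eq\<close> is the congruence generated by commutativity of the sum,
  biadditivity and \<open>R\<close>-balancedness.\<close>

inductive tensor_eq ::
  "('r, 'c) ring_scheme \<Rightarrow> ('r, 'm, 'd) module_scheme \<Rightarrow> ('r, 'n, 'e) module_scheme \<Rightarrow>
    ('m \<times> 'n) list \<Rightarrow> ('m \<times> 'n) list \<Rightarrow> bool"
  for R M N where
  refl: "set xs \<subseteq> carrier M \<times> carrier N \<Longrightarrow> tensor_eq R M N xs xs"
| sym: "tensor_eq R M N xs ys \<Longrightarrow> tensor_eq R M N ys xs"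
| trans: "tensor_eq R M N xs ys \<Longrightarrow> tensor_eq R M N ys zs \<Longrightarrow> tensor_eq R M N xs zs"
| append: "tensor_eq R M N xs xs' \<Longrightarrow> tensor_eq R M N ys ys' \<Longrightarrow> tensor_eq R M N (xs @ ys) (xs' @ ys')"
| commute: "set xs \<subseteq> carrier M \<times> carrier N \<Longrightarrow> set ys \<subseteq> carrier M \<times> carrier N \<Longrightarrow>
    tensor_eq R M N (xs @ ys) (ys @ xs)"
| zero: "n \<in> carrier N \<Longrightarrow> tensor_eq R M N [(\<zero>\<^bsub>M\<^esub>, n)] []"
| add_left: "m \<in> carrier M \<Longrightarrow> m' \<in> carrier M \<Longrightarrow> n \<in> carrier N \<Longrightarrow>
    tensor_eq R M N [(m \<oplus>\<^bsub>M\<^esub> m', n)] [(m, n), (m', n)]"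
| add_right: "m \<in> carrier M \<Longrightarrow> n \<in> carrier N \<Longrightarrow> n' \<in> carrier N \<Longrightarrow>
    tensor_eq R M N [(m, n \<oplus>\<^bsub>N\<^esub> n')] [(m, n), (m, n')]"
| balanced: "r \<in> carrier R \<Longrightarrow> m \<in> carrier M \<Longrightarrow> n \<in> carrier N \<Longrightarrow>
    tensor_eq R M N [(r \<odot>\<^bsub>M\<^esub> m, n)] [(m, r \<odot>\<^bsub>N\<^esub> n)]"

definition tensor_class ::
  "('r, 'c) ring_scheme \<Rightarrow> ('r, 'm, 'd) module_scheme \<Rightarrow> ('r, 'n, 'e) module_scheme \<Rightarrow>
    ('m \<times> 'n) list \<Rightarrow> ('m \<times> 'n) list set" where
  "tensor_class R M N xs = {ys. tensor_eq R M N xs ys}"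

definition tensor_module ::
  "('r, 'c) ring_scheme \<Rightarrow> ('r, 'm, 'd) module_scheme \<Rightarrow> ('r, 'n, 'e) module_scheme \<Rightarrow>
    ('r, ('m \<times> 'n) list set) module" where
  "tensor_module R M N =
     \<lparr>carrier = tensor_class R M N ` {xs. set xs \<subseteq> carrier M \<times> carrier N},
      mult = undefined, one = undefined,
      zero = tensor_class R M N [],
      add = (\<lambda>C D. \<Union>xs\<in>C. \<Union>ys\<in>D. tensor_class R M N (xs @ ys)),
      smult = (\<lambda>r C. \<Union>xs\<in>C. tensor_class R M N (map (\<lambda>(m, n). (r \<odot>\<^bsub>M\<^esub> m, n)) xs))\<rparr>"

definition pure_tensor ::
  "('r, 'c) ring_scheme \<Rightarrow> ('r, 'm, 'd) module_scheme \<Rightarrow> ('r, 'n, 'e) module_scheme \<Rightarrow>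
    'm \<Rightarrow> 'n \<Rightarrow> ('m \<times> 'n) list set" where
  "pure_tensor R M N m n = tensor_class R M N [(m, n)]"

text \<open>\<open>f \<otimes> id\<close> on a tensor product, for a linear map \<open>f\<close> into \<open>M'\<close>.\<close>

definition tensor_map_left ::
  "('r, 'c) ring_scheme \<Rightarrow> ('r, 'm', 'd) module_scheme \<Rightarrow> ('r, 'n, 'e) module_scheme \<Rightarrow>
    ('m \<Rightarrow> 'm') \<Rightarrow> ('m \<times> 'n) list set \<Rightarrow> ('m' \<times> 'n) list set" where
  "tensor_map_left R M' N f C = (\<Union>xs\<in>C. tensor_class R M' N (map (\<lambda>(m, n). (f m, n)) xs))"


section \<open>Lie algebras and representations\<close>

record 'a lie_alg = "(real, 'a) module" +
  lbr :: "'a \<Rightarrow> 'a \<Rightarrow> 'a"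

definition lie_algebra :: "('a, 'z) lie_alg_scheme \<Rightarrow> bool" where
  "lie_algebra L \<longleftrightarrow> Module.module real_ring L \<and>
     (\<forall>x\<in>carrier L. lbr L x \<in> linear_maps real_ring L L \<and> (\<lambda>y. lbr L y x) \<in> linear_maps real_ring L L) \<and>
     (\<forall>x\<in>carrier L. lbr L x x = \<zero>\<^bsub>L\<^esub>) \<and>
     (\<forall>x\<in>carrier L. \<forall>y\<in>carrier L. \<forall>z\<in>carrier L.
        lbr L x (lbr L y z) \<oplus>\<^bsub>L\<^esub> lbr L y (lbr L z x) \<oplus>\<^bsub>L\<^esub> lbr L z (lbr L x y) = \<zero>\<^bsub>L\<^esub>)"

definition lie_hom :: "('a, 'y) lie_alg_scheme \<Rightarrow> ('b, 'z) lie_alg_scheme \<Rightarrow> ('a \<Rightarrow> 'b) \<Rightarrow> bool" where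
  "lie_hom L M f \<longleftrightarrow> lie_algebra L \<and> lie_algebra M \<and> f \<in> linear_maps real_ring L M \<and>
     (\<forall>x\<in>carrier L. \<forall>y\<in>carrier L. f (lbr L x y) = lbr M (f x) (f y))"

definition lie_quot :: "('a, 'z) lie_alg_scheme \<Rightarrow> 'a set \<Rightarrow> 'a set lie_alg" where
  "lie_quot L N = module.extend (quot_module L N)
     \<lparr>lbr = (\<lambda>C D. \<Union>x\<in>C. \<Union>y\<in>D. N +>\<^bsub>L\<^esub> lbr L x y)\<rparr>"

definition lie_rep ::
  "('a, 'y) lie_alg_scheme \<Rightarrow> (real, 'm, 'z) module_scheme \<Rightarrow> ('a \<Rightarrow> 'm \<Rightarrow> 'm) \<Rightarrow> bool" where
  "lie_rep L W act \<longleftrightarrow> lie_algebra L \<and> Module.module real_ring W \<and>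
     (\<forall>x\<in>carrier L. act x \<in> linear_maps real_ring W W) \<and>
     (\<forall>w\<in>carrier W. (\<lambda>x. act x w) \<in> linear_maps real_ring L W) \<and>
     (\<forall>x\<in>carrier L. \<forall>y\<in>carrier L. \<forall>w\<in>carrier W.
        act (lbr L x y) w = act x (act y w) \<ominus>\<^bsub>W\<^esub> act y (act x w))"

definition rep_equivalent ::
  "('a, 'x) lie_alg_scheme \<Rightarrow> (real, 'm, 'y) module_scheme \<Rightarrow> ('a \<Rightarrow> 'm \<Rightarrow> 'm) \<Rightarrow>
    (real, 'n, 'z) module_scheme \<Rightarrow> ('a \<Rightarrow> 'n \<Rightarrow> 'n) \<Rightarrow> bool" where
  "rep_equivalent L W act W' act' \<longleftrightarrow> lie_rep L W act \<and> lie_rep L W' act' \<and>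
     (\<exists>\<phi>\<in>linear_maps real_ring W W'. bij_betw \<phi> (carrier W) (carrier W') \<and>
        (\<forall>x\<in>carrier L. \<forall>w\<in>carrier W. \<phi> (act x w) = act' x (\<phi> w)))"

text \<open>The action induced by \<open>act\<close> on a quotient by \<open>N\<close> (well defined if \<open>N\<close> is invariant).\<close>

definition quot_act ::
  "('r, 'm, 'z) module_scheme \<Rightarrow> 'm set \<Rightarrow> ('a \<Rightarrow> 'm \<Rightarrow> 'm) \<Rightarrow> 'a \<Rightarrow> 'm set \<Rightarrow> 'm set" where
  "quot_act M N act a K = (\<Union>z\<in>K. N +>\<^bsub>M\<^esub> act a z)"


section \<open>Smooth functions, vector fields and forms\<close>

text \<open>The norm on the model space only serves to express differentiability: on a finite-dimensional
  space all norms are equivalent. Smoothness is meant on open sets.\<close>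

primrec Ck_on ::
  "nat \<Rightarrow> 'v::real_normed_vector set \<Rightarrow> ('v \<Rightarrow> 'w::real_normed_vector) \<Rightarrow> bool" where
  "Ck_on 0 U f \<longleftrightarrow> continuous_on U f"
| "Ck_on (Suc k) U f \<longleftrightarrow> (\<forall>x\<in>U. f differentiable (at x)) \<and>
     (\<forall>v. Ck_on k U (\<lambda>x. frechet_derivative f (at x) v))"

definition smooth_on :: "'v::real_normed_vector set \<Rightarrow> ('v \<Rightarrow> 'w::real_normed_vector) \<Rightarrow> bool" where
  "smooth_on U f \<longleftrightarrow> (\<forall>k. Ck_on k U f)"

abbreviation smooth :: "('v::real_normed_vector \<Rightarrow> 'w::real_normed_vector) \<Rightarrow> bool" where
  "smooth \<equiv> smooth_on UNIV"

definition smooth_ring :: "('v::real_normed_vector \<Rightarrow> real) ring" where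
  "smooth_ring = \<lparr>carrier = {f. smooth f}, mult = (\<lambda>f g x. f x * g x), one = (\<lambda>_. 1),
     zero = (\<lambda>_. 0), add = (\<lambda>f g x. f x + g x)\<rparr>"

text \<open>Restriction of scalars from \<open>C\<^sup>\<infinity>(V)\<close> to the constants.\<close>

definition real_form :: "('v \<Rightarrow> real, 'm, 'z) module_scheme \<Rightarrow> (real, 'm) module" where
  "real_form M = \<lparr>carrier = carrier M, mult = undefined, one = undefined, zero = \<zero>\<^bsub>M\<^esub>,
     add = add M, smult = (\<lambda>c. smult M (\<lambda>_. c))\<rparr>"

definition vector_fields :: "('v::real_normed_vector \<Rightarrow> real, 'v \<Rightarrow> 'v) module" where
  "vector_fields = \<lparr>carrier = {X. smooth X}, mult = undefined, one = undefined, zero = (\<lambda>_. 0),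
     add = (\<lambda>X Y x. X x + Y x), smult = (\<lambda>f X x. f x *\<^sub>R X x)\<rparr>"

definition lie_bracket ::
  "('v::real_normed_vector \<Rightarrow> 'v) \<Rightarrow> ('v \<Rightarrow> 'v) \<Rightarrow> 'v \<Rightarrow> 'v" where
  "lie_bracket X Y x = frechet_derivative Y (at x) (X x) - frechet_derivative X (at x) (Y x)"

definition lin_part :: "('v::real_normed_vector \<Rightarrow> 'v) \<Rightarrow> 'v \<Rightarrow> 'v" where
  "lin_part X = frechet_derivative X (at 0)"

text \<open>An element of \<open>\<wedge>\<^sup>iV\<^sup>*\<close> is an alternating multilinear function on lists of length \<open>i\<close>,
  extended by \<open>0\<close> to all other lists.\<close>

definition alternating_form :: "nat \<Rightarrow> ('v::real_vector list \<Rightarrow> real) \<Rightarrow> bool" where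
  "alternating_form i \<omega> \<longleftrightarrow>
     (\<forall>vs. length vs \<noteq> i \<longrightarrow> \<omega> vs = 0) \<and>
     (\<forall>vs j. length vs = i \<and> j < i \<longrightarrow> linear (\<lambda>v. \<omega> (vs[j := v]))) \<and>
     (\<forall>vs. \<not> distinct vs \<longrightarrow> \<omega> vs = 0)"

type_synonym 'v form = "'v \<Rightarrow> 'v list \<Rightarrow> real"

definition forms :: "nat \<Rightarrow> ('v::real_normed_vector \<Rightarrow> real, 'v form) module" where
  "forms i = \<lparr>carrier = {\<alpha>. (\<forall>x. alternating_form i (\<alpha> x)) \<and> (\<forall>vs. smooth (\<lambda>x. \<alpha> x vs))},
     mult = undefined, one = undefined, zero = (\<lambda>_ _. 0),
     add = (\<lambda>\<alpha> \<beta> x vs. \<alpha> x vs + \<beta> x vs), smult = (\<lambda>f \<alpha> x vs. f x * \<alpha> x vs)\<rparr>"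

definition euler_contraction :: "'v::real_normed_vector form \<Rightarrow> 'v form" where
  "euler_contraction \<alpha> = (\<lambda>x vs. \<alpha> x (x # vs))"

text \<open>The usual formula
  \<open>(\<L>\<^sub>X \<alpha>)(V\<^sub>1, \<dots>, V\<^sub>i) = X(\<alpha>(V\<^sub>1, \<dots>, V\<^sub>i)) - \<Sum>\<^sub>j \<alpha>(V\<^sub>1, \<dots>, [X, V\<^sub>j], \<dots>, V\<^sub>i)\<close>,
  evaluated on constant vector fields.\<close>

definition lie_derivative ::
  "('v::real_normed_vector \<Rightarrow> 'v) \<Rightarrow> 'v form \<Rightarrow> 'v form" where
  "lie_derivative X \<alpha> = (\<lambda>x vs. frechet_derivative (\<lambda>y. \<alpha> y vs) (at x) (X x)
     - (\<Sum>j<length vs. \<alpha> x (vs[j := lie_bracket X (\<lambda>_. vs ! j) x])))"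

text \<open>Vector-valued forms, i.e. elements of \<open>\<Omega>\<^sup>i(V; TV)\<close>, are represented like scalar forms.\<close>

type_synonym 'v vform = "'v \<Rightarrow> 'v list \<Rightarrow> 'v"

definition form_times_field :: "'v::real_normed_vector form \<Rightarrow> ('v \<Rightarrow> 'v) \<Rightarrow> 'v vform" where
  "form_times_field \<alpha> Y = (\<lambda>x vs. \<alpha> x vs *\<^sub>R Y x)"

definition field_as_vform :: "('v::real_normed_vector \<Rightarrow> 'v) \<Rightarrow> 'v vform" where
  "field_as_vform X = (\<lambda>x vs. if vs = [] then X x else 0)"

text \<open>The Froelicher--Nijenhuis bracket of \<open>K \<in> \<Omega>\<^sup>k(V; TV)\<close> and \<open>L \<in> \<Omega>\<^sup>l(V; TV)\<close>, given by the global
  formula of Kolar, Michor and Slovak (Natural Operations in Differential Geometry, 8.9) evaluated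
  on constant vector fields; the two summands of that formula that contain brackets of the
  arguments then vanish. Summands with \<open>(k - 1)!\<close> or \<open>(l - 1)!\<close> in the denominator are absent for
  \<open>k = 0\<close> or \<open>l = 0\<close> respectively.\<close>

definition fn_bracket ::
  "nat \<Rightarrow> nat \<Rightarrow> 'v::real_normed_vector vform \<Rightarrow> 'v vform \<Rightarrow> 'v vform" where
  "fn_bracket k l K L x vs =
    (if length vs \<noteq> k + l then 0 else
      (let P = {\<sigma>. \<sigma> permutes {..<k + l}};
           s = (\<lambda>\<sigma>. real_of_int (sign \<sigma>));
           arg = (\<lambda>\<sigma> a b. map (\<lambda>j. vs ! \<sigma> j) [a..<b])
       in (1 / (fact k * fact l)) *\<^sub>R
            (\<Sum>\<sigma>\<in>P. s \<sigma> *\<^sub>R lie_bracket (\<lambda>y. K y (arg \<sigma> 0 k)) (\<lambda>y. L y (arg \<sigma> k (k + l))) x)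
        - (if l = 0 then 0 else (1 / (fact k * fact (l - 1))) *\<^sub>R
            (\<Sum>\<sigma>\<in>P. s \<sigma> *\<^sub>R L x (lie_bracket (\<lambda>y. K y (arg \<sigma> 0 k)) (\<lambda>_. vs ! \<sigma> k) x
                                # arg \<sigma> (k + 1) (k + l))))
        + (if k = 0 then 0 else ((- 1) ^ (k * l) / (fact (k - 1) * fact l)) *\<^sub>R
            (\<Sum>\<sigma>\<in>P. s \<sigma> *\<^sub>R K x (lie_bracket (\<lambda>y. L y (arg \<sigma> 0 l)) (\<lambda>_. vs ! \<sigma> l) x
                                # arg \<sigma> (l + 1) (k + l))))))"


section \<open>Linear foliations and their isotropy at the origin\<close>

definition gl_subalgebra :: "('v::real_vector \<Rightarrow> 'v) set \<Rightarrow> bool" where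
  "gl_subalgebra g \<longleftrightarrow> (\<forall>A\<in>g. linear A) \<and> (\<lambda>_. 0) \<in> g \<and>
     (\<forall>A\<in>g. \<forall>B\<in>g. (\<lambda>v. A v + B v) \<in> g) \<and>
     (\<forall>A\<in>g. \<forall>c. (\<lambda>v. c *\<^sub>R A v) \<in> g) \<and>
     (\<forall>A\<in>g. \<forall>B\<in>g. (\<lambda>v. A (B v) - B (A v)) \<in> g)"

text \<open>An endomorphism \<open>A\<close>, read as a vector field, is the linear vector field \<open>x \<mapsto> A x\<close>; the sign
  convention for infinitesimal actions does not affect the generated module.\<close>

definition linear_foliation :: "('v::real_normed_vector \<Rightarrow> 'v) set \<Rightarrow> bool" where
  "linear_foliation F \<longleftrightarrow>
     (\<exists>g. gl_subalgebra g \<and> F = generated_submodule smooth_ring vector_fields g)"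

definition foliation_module ::
  "('v::real_normed_vector \<Rightarrow> 'v) set \<Rightarrow> ('v \<Rightarrow> real, 'v \<Rightarrow> 'v) module" where
  "foliation_module F = vector_fields\<lparr>carrier := F\<rparr>"

definition foliation_lie :: "('v::real_normed_vector \<Rightarrow> 'v) set \<Rightarrow> ('v \<Rightarrow> 'v) lie_alg" where
  "foliation_lie F = module.extend (real_form (foliation_module F)) \<lparr>lbr = lie_bracket\<rparr>"

definition vanishing_ideal :: "'v::real_normed_vector \<Rightarrow> ('v \<Rightarrow> real) set" where
  "vanishing_ideal p = {f. smooth f \<and> f p = 0}"

definition ideal_times :: "'v::real_normed_vector \<Rightarrow> ('v \<Rightarrow> 'v) set \<Rightarrow> ('v \<Rightarrow> 'v) set" where
  "ideal_times p F = generated_submodule smooth_ring vector_fields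
     {(\<lambda>x. f x *\<^sub>R X x) | f X. f \<in> vanishing_ideal p \<and> X \<in> F}"

definition isotropy ::
  "'v::real_normed_vector \<Rightarrow> ('v \<Rightarrow> 'v) set \<Rightarrow> ('v \<Rightarrow> 'v) set lie_alg" where
  "isotropy p F = lie_quot (foliation_lie F) (ideal_times p F)"

definition isotropy_class ::
  "'v::real_normed_vector \<Rightarrow> ('v \<Rightarrow> 'v) set \<Rightarrow> ('v \<Rightarrow> 'v) \<Rightarrow> ('v \<Rightarrow> 'v) set" where
  "isotropy_class p F X = ideal_times p F +>\<^bsub>foliation_lie F\<^esub> X"


section \<open>The Koszul complex with coefficients in the foliation\<close>

definition koszul ::
  "('v::real_normed_vector \<Rightarrow> 'v) set \<Rightarrow> nat \<Rightarrow> ('v \<Rightarrow> real, ('v form \<times> ('v \<Rightarrow> 'v)) list set) module"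
  where
  "koszul F i = tensor_module smooth_ring (forms i) (foliation_module F)"

definition koszul_pure ::
  "('v::real_normed_vector \<Rightarrow> 'v) set \<Rightarrow> nat \<Rightarrow> 'v form \<Rightarrow> ('v \<Rightarrow> 'v) \<Rightarrow>
    ('v form \<times> ('v \<Rightarrow> 'v)) list set" where
  "koszul_pure F i = pure_tensor smooth_ring (forms i) (foliation_module F)"

text \<open>\<open>koszul_d F i\<close> is \<open>d\<^sub>i \<otimes> id\<close> for \<open>i \<ge> 1\<close>. As \<open>\<wedge>\<^sup>-\<^sup>1V\<^sup>* = 0\<close>, all elements of degree \<open>0\<close> are cycles.\<close>

definition koszul_d ::
  "('v::real_normed_vector \<Rightarrow> 'v) set \<Rightarrow> nat \<Rightarrow> ('v form \<times> ('v \<Rightarrow> 'v)) list set \<Rightarrow>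
    ('v form \<times> ('v \<Rightarrow> 'v)) list set" where
  "koszul_d F i = tensor_map_left smooth_ring (forms (i - 1)) (foliation_module F) euler_contraction"

definition koszul_cycles ::
  "('v::real_normed_vector \<Rightarrow> 'v) set \<Rightarrow> nat \<Rightarrow> ('v form \<times> ('v \<Rightarrow> 'v)) list set set" where
  "koszul_cycles F i = (if i = 0 then carrier (koszul F 0)
     else {t \<in> carrier (koszul F i). koszul_d F i t = \<zero>\<^bsub>koszul F (i - 1)\<^esub>})"

definition koszul_boundaries ::
  "('v::real_normed_vector \<Rightarrow> 'v) set \<Rightarrow> nat \<Rightarrow> ('v form \<times> ('v \<Rightarrow> 'v)) list set set" where
  "koszul_boundaries F i = koszul_d F (i + 1) ` carrier (koszul F (i + 1))"

definition koszul_homology ::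
  "('v::real_normed_vector \<Rightarrow> 'v) set \<Rightarrow> nat \<Rightarrow> (real, ('v form \<times> ('v \<Rightarrow> 'v)) list set set) module"
  where
  "koszul_homology F i =
     real_form (quot_module ((koszul F i)\<lparr>carrier := koszul_cycles F i\<rparr>) (koszul_boundaries F i))"


section \<open>Vector bundles\<close>

text \<open>A vector bundle over \<open>V\<close> is a family of vector spaces (realised as subspaces of a common real
  vector space, which need not carry a topology) with an atlas of local frames: \<open>(U, r, b)\<close> in
  \<open>frames E\<close> says that \<open>b\<^sub>0, \<dots>, b\<^sub>r\<^sub>-\<^sub>1\<close> is a smooth frame over the open set \<open>U\<close>. Smoothness of
  sections is tested by their coefficients in these frames.\<close>

record ('v, 'e) vbundle =
  fibre :: "'v \<Rightarrow> 'e set"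
  frames :: "('v set \<times> nat \<times> (nat \<Rightarrow> 'v \<Rightarrow> 'e)) set"

definition vector_bundle :: "('v::real_normed_vector, 'e::real_vector) vbundle \<Rightarrow> bool" where
  "vector_bundle E \<longleftrightarrow>
     (\<Union>(U, r, b)\<in>frames E. U) = UNIV \<and>
     (\<forall>(U, r, b)\<in>frames E. open U \<and> (\<forall>x\<in>U.
        inj_on (\<lambda>j. b j x) {..<r} \<and> independent ((\<lambda>j. b j x) ` {..<r}) \<and>
        span ((\<lambda>j. b j x) ` {..<r}) = fibre E x)) \<and>
     (\<forall>(U, r, b)\<in>frames E. \<forall>(U', r', b')\<in>frames E. \<exists>g.
        (\<forall>j<r. \<forall>k<r'. smooth_on (U \<inter> U') (g j k :: 'v \<Rightarrow> real)) \<and>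
        (\<forall>x\<in>U \<inter> U'. \<forall>k<r'. b' k x = (\<Sum>j<r. g j k x *\<^sub>R b j x)))"

definition sections ::
  "('v::real_normed_vector, 'e::real_vector) vbundle \<Rightarrow> ('v \<Rightarrow> real, 'v \<Rightarrow> 'e) module" where
  "sections E = \<lparr>carrier = {s. (\<forall>x. s x \<in> fibre E x) \<and>
        (\<forall>(U, r, b)\<in>frames E. \<exists>c. (\<forall>j<r. smooth_on U (c j :: 'v \<Rightarrow> real)) \<and>
           (\<forall>x\<in>U. s x = (\<Sum>j<r. c j x *\<^sub>R b j x)))},
     mult = undefined, one = undefined, zero = (\<lambda>_. 0),
     add = (\<lambda>s t x. s x + t x), smult = (\<lambda>f s x. f x *\<^sub>R s x)\<rparr>"

definition fibre_space :: "('v, 'e::real_vector) vbundle \<Rightarrow> 'v \<Rightarrow> (real, 'e) module" where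
  "fibre_space E p = \<lparr>carrier = fibre E p, mult = undefined, one = undefined, zero = 0,
     add = (+), smult = (*\<^sub>R)\<rparr>"

definition tangent_bundle :: "('v::real_normed_vector, 'v) vbundle" where
  "tangent_bundle = \<lparr>fibre = (\<lambda>_. UNIV),
     frames = {(UNIV, r, \<lambda>j _. b j) | r b.
       inj_on b {..<r} \<and> independent (b ` {..<r}) \<and> span (b ` {..<r}) = UNIV}\<rparr>"

text \<open>A fibrewise linear map is smooth iff it maps smooth sections to smooth sections.\<close>

definition bundle_map ::
  "('v::real_normed_vector, 'e::real_vector) vbundle \<Rightarrow> ('v, 'f::real_vector) vbundle \<Rightarrow>
    ('v \<Rightarrow> 'e \<Rightarrow> 'f) \<Rightarrow> bool" where
  "bundle_map E E' \<phi> \<longleftrightarrow>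
     (\<forall>x. \<phi> x \<in> linear_maps real_ring (fibre_space E x) (fibre_space E' x)) \<and>
     (\<forall>s\<in>carrier (sections E). (\<lambda>x. \<phi> x (s x)) \<in> carrier (sections E'))"


section \<open>Resolutions and L-infinity-algebroids\<close>

text \<open>The complex is extended by \<open>E\<^sub>i = 0\<close> for \<open>i > n\<close>; \<open>\<delta> i\<close> goes from \<open>E\<^sub>i\<close> to \<open>E\<^sub>i\<^sub>-\<^sub>1\<close>.\<close>

definition resolution ::
  "('v::real_normed_vector \<Rightarrow> 'v) set \<Rightarrow> nat \<Rightarrow> (nat \<Rightarrow> ('v, 'e::real_vector) vbundle) \<Rightarrow>
    (nat \<Rightarrow> 'v \<Rightarrow> 'e \<Rightarrow> 'e) \<Rightarrow> ('v \<Rightarrow> 'e \<Rightarrow> 'v) \<Rightarrow> bool" where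
  "resolution F n E \<delta> \<rho> \<longleftrightarrow>
     (\<forall>i. vector_bundle (E i)) \<and> (\<forall>i>n. \<forall>x. fibre (E i) x = {0}) \<and>
     (\<forall>i\<ge>1. bundle_map (E i) (E (i - 1)) (\<delta> i)) \<and> bundle_map (E 0) tangent_bundle \<rho> \<and>
     (\<lambda>s x. \<rho> x (s x)) ` carrier (sections (E 0)) = F \<and>
     {s \<in> carrier (sections (E 0)). \<forall>x. \<rho> x (s x) = 0}
       = (\<lambda>s x. \<delta> 1 x (s x)) ` carrier (sections (E 1)) \<and>
     (\<forall>i\<ge>1. {s \<in> carrier (sections (E i)). \<forall>x. \<delta> i x (s x) = 0}
       = (\<lambda>s x. \<delta> (i + 1) x (s x)) ` carrier (sections (E (i + 1))))"

definition minimal_at ::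
  "'v::real_normed_vector \<Rightarrow> (nat \<Rightarrow> ('v, 'e::real_vector) vbundle) \<Rightarrow> (nat \<Rightarrow> 'v \<Rightarrow> 'e \<Rightarrow> 'e) \<Rightarrow> bool"
  where
  "minimal_at p E \<delta> \<longleftrightarrow> (\<forall>i\<ge>1. \<forall>u\<in>fibre (E i) p. \<delta> i p u = 0)"

text \<open>\<open>br [(i\<^sub>1, s\<^sub>1), \<dots>, (i\<^sub>k, s\<^sub>k)]\<close> is the \<open>k\<close>-ary bracket \<open>l\<^sub>k\<close> of \<open>s\<^sub>j \<in> \<Gamma>(E\<^bsub>i\<^sub>j\<^esub>)\<close>, where \<open>E\<^sub>i\<close> sits in degree \<open>-i\<close>;
  since \<open>l\<^sub>k\<close> has degree \<open>2 - k\<close>, its value is a section of \<open>E\<^sub>m\<close> with \<open>m = i\<^sub>1 + \<dots> + i\<^sub>k + k - 2\<close>.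
  (The only case in which this number is negative is \<open>k = 1\<close>, \<open>i\<^sub>1 = 0\<close>; there \<open>l\<^sub>1 = 0\<close>, and the
  truncated subtraction is harmless.)\<close>

type_synonym ('v, 'e) multibracket = "(nat \<times> ('v \<Rightarrow> 'e)) list \<Rightarrow> 'v \<Rightarrow> 'e"

definition graded_sections ::
  "(nat \<Rightarrow> ('v::real_normed_vector, 'e::real_vector) vbundle) \<Rightarrow> (nat \<times> ('v \<Rightarrow> 'e)) set" where
  "graded_sections E = {(i, s). s \<in> carrier (sections (E i))}"

definition bracket_index :: "(nat \<times> 'a) list \<Rightarrow> nat" where
  "bracket_index as = sum_list (map fst as) + length as - 2"

text \<open>A \<open>(k, N - k)\<close>-shuffle corresponds to the set \<open>S \<subseteq> {..<N}\<close>, \<open>card S = k\<close>, of the positions moved to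
  the front. The factor \<open>sgn \<sigma> \<cdot> \<epsilon>(\<sigma>)\<close> (signature times Koszul sign) is the product of the
  signs \<open>-(-1)\<^bsup>|a||b|\<^esup>\<close> over the inversions.\<close>

definition shuffle_sign :: "(nat \<times> 'a) list \<Rightarrow> nat set \<Rightarrow> real" where
  "shuffle_sign as S = (\<Prod>(a, b)\<in>{(a, b). a \<in> S \<and> b < a \<and> b \<notin> S}. - ((- 1) ^ (fst (as ! a) * fst (as ! b))))"

text \<open>The higher Jacobi identity for \<open>N\<close> arguments is
  \<open>\<Sum>\<^bsub>k + j = N + 1\<^esub> \<Sum>\<^bsub>\<sigma> \<in> Sh(k, N - k)\<^esub> (-1)\<^bsup>k (j - 1)\<^esup> sgn \<sigma> \<epsilon>(\<sigma>)
    l\<^sub>j (l\<^sub>k (a\<^bsub>\<sigma>(1)\<^esub>, \<dots>, a\<^bsub>\<sigma>(k)\<^esub>), a\<^bsub>\<sigma>(k+1)\<^esub>, \<dots>, a\<^bsub>\<sigma>(N)\<^esub>) = 0\<close>.\<close>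

definition higher_jacobi :: "('v, 'e::real_vector) multibracket \<Rightarrow> (nat \<times> ('v \<Rightarrow> 'e)) list \<Rightarrow> bool" where
  "higher_jacobi br as \<longleftrightarrow> (\<forall>x.
     (\<Sum>S\<in>Pow {..<length as} - {{}}.
        ((- 1) ^ (card S * (length as - card S)) * shuffle_sign as S) *\<^sub>R
          br ((bracket_index (nths as S), br (nths as S)) # nths as (- S)) x) = 0)"

text \<open>\<open>\<real>\<close>-linearity of the binary bracket is the case of constant \<open>f\<close> in the Leibniz rule.\<close>

definition linf_algebroid ::
  "(nat \<Rightarrow> ('v::real_normed_vector, 'e::real_vector) vbundle) \<Rightarrow> (nat \<Rightarrow> 'v \<Rightarrow> 'e \<Rightarrow> 'e) \<Rightarrow>
    ('v \<Rightarrow> 'e \<Rightarrow> 'v) \<Rightarrow> ('v, 'e) multibracket \<Rightarrow> bool" where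
  "linf_algebroid E \<delta> \<rho> br \<longleftrightarrow>
     (\<forall>as. as \<noteq> [] \<and> set as \<subseteq> graded_sections E \<longrightarrow>
        br as \<in> carrier (sections (E (bracket_index as)))) \<and>
     (\<forall>(i, s)\<in>graded_sections E. br [(i, s)] = (if i = 0 then (\<lambda>_. 0) else (\<lambda>x. \<delta> i x (s x)))) \<and>
     (\<forall>as bs i j s t. set as \<union> set bs \<union> {(i, s), (j, t)} \<subseteq> graded_sections E \<longrightarrow>
        br (as @ [(i, s), (j, t)] @ bs)
          = (\<lambda>x. (- ((- 1) ^ (i * j))) *\<^sub>R br (as @ [(j, t), (i, s)] @ bs) x)) \<and>
     (\<forall>as bs i s t. set as \<union> set bs \<union> {(i, s), (i, t)} \<subseteq> graded_sections E \<longrightarrow>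
        br (as @ [(i, \<lambda>x. s x + t x)] @ bs)
          = (\<lambda>x. br (as @ [(i, s)] @ bs) x + br (as @ [(i, t)] @ bs) x)) \<and>
     (\<forall>as bs i s f. set as \<union> set bs \<union> {(i, s)} \<subseteq> graded_sections E \<and> smooth f \<and>
          length as + length bs \<noteq> 1 \<longrightarrow>
        br (as @ [(i, \<lambda>x. f x *\<^sub>R s x)] @ bs) = (\<lambda>x. f x *\<^sub>R br (as @ [(i, s)] @ bs) x)) \<and>
     (\<forall>i j s t f. {(i, s), (j, t)} \<subseteq> graded_sections E \<and> smooth f \<longrightarrow>
        br [(i, s), (j, \<lambda>x. f x *\<^sub>R t x)]
          = (\<lambda>x. f x *\<^sub>R br [(i, s), (j, t)] x +
              (if i = 0 then frechet_derivative f (at x) (\<rho> x (s x)) *\<^sub>R t x else 0))) \<and>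
     (\<forall>as. as \<noteq> [] \<and> set as \<subseteq> graded_sections E \<longrightarrow> higher_jacobi br as)"


section \<open>The action of the isotropy on the fibres\<close>

text \<open>The restriction of \<open>l\<^sub>2\<close> to the fibres at \<open>p\<close>, computed on sections through the given points.\<close>

definition fibre_bracket ::
  "'v::real_normed_vector \<Rightarrow> (nat \<Rightarrow> ('v, 'e::real_vector) vbundle) \<Rightarrow> ('v, 'e) multibracket \<Rightarrow>
    nat \<Rightarrow> nat \<Rightarrow> 'e \<Rightarrow> 'e \<Rightarrow> 'e" where
  "fibre_bracket p E br i j u w = (SOME z. \<exists>s\<in>carrier (sections (E i)). \<exists>t\<in>carrier (sections (E j)).
     s p = u \<and> t p = w \<and> z = br [(i, s), (j, t)] p)"

text \<open>The canonical identification \<open>(E\<^sub>0)\<^sub>p \<rightarrow> F / I\<^sub>p F\<close>, \<open>e(p) \<mapsto> \<rho>(e) + I\<^sub>p F\<close>.\<close>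

definition anchor_iso ::
  "'v::real_normed_vector \<Rightarrow> ('v \<Rightarrow> 'v) set \<Rightarrow> (nat \<Rightarrow> ('v, 'e::real_vector) vbundle) \<Rightarrow>
    ('v \<Rightarrow> 'e \<Rightarrow> 'v) \<Rightarrow> 'e \<Rightarrow> ('v \<Rightarrow> 'v) set" where
  "anchor_iso p F E \<rho> u = (SOME C. \<exists>e\<in>carrier (sections (E 0)). e p = u \<and>
     C = isotropy_class p F (\<lambda>x. \<rho> x (e x)))"

definition fibre_action ::
  "'v::real_normed_vector \<Rightarrow> ('v \<Rightarrow> 'v) set \<Rightarrow> (nat \<Rightarrow> ('v, 'e::real_vector) vbundle) \<Rightarrow>
    ('v \<Rightarrow> 'e \<Rightarrow> 'v) \<Rightarrow> ('v, 'e) multibracket \<Rightarrow> nat \<Rightarrow> ('v \<Rightarrow> 'v) set \<Rightarrow> 'e \<Rightarrow> 'e" where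
  "fibre_action p F E \<rho> br i C u =
     fibre_bracket p E br 0 i (inv_into (fibre (E 0) p) (anchor_iso p F E \<rho>) C) u"

end

theory Submission
  imports Defs
begin

text \<open>
  The linear part. By induction on its generation, a field \<open>X\<close> of the foliation differs from its linear part by an
  element of \<open>I\<^sub>0F\<close> (\<open>diff_lin_part\<close>). Hence \<open>I\<^sub>0F\<close> is the kernel of the linear part on \<open>F\<close>, and the isotropy Lie algebra
  is identified with the algebra \<open>g\<close> of linear fields that generates \<open>F\<close>. This gives the injective homomorphism, and
  reduces the action of the isotropy to that of linear fields.

  A model of the tensor products. An element of \<open>\<Gamma>(\<and>\<^sup>iV\<^sup>*) \<otimes> F\<close> is the same as an alternating form with values in \<open>F\<close>: two
  formal sums of tensors are congruent iff they define the same form (\<open>teq_iff\<close>), because \<open>\<Gamma>(\<and>\<^sup>iV\<^sup>*)\<close> is free. On forms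
  with values in any module of functions the differential is \<open>\<alpha> \<mapsto> \<alpha>\<^sub>x(x, \<dots>)\<close>, and a linear field \<open>A\<close> together with a
  derivation \<open>D\<close> of the module over \<open>A\<close> acts by \<open>D \<alpha>(v\<^sub>1, \<dots>) + \<Sum>\<^sub>j \<alpha>(\<dots>, A v\<^sub>j, \<dots>)\<close>. The Euler field commutes with \<open>A\<close>, so
  this action commutes with the differential. For \<open>D = [A, -]\<close> on \<open>F\<close> it is the Froelicher--Nijenhuis bracket with \<open>A\<close>.

  Koszul exactness. The Koszul complex of smooth forms resolves \<open>\<real> = C\<^sup>\<infinity>(V)/I\<^sub>0\<close>: a cycle \<open>\<alpha>\<close> is the contraction of the
  average of its exterior derivative along the rays from the origin (\<open>koszul_exact_smooth\<close>). The same holds with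
  coefficients in the sections of a vector bundle (\<open>koszul_exact_sections\<close>): a cycle is cut into a part near the origin,
  where a frame reduces the claim to scalar forms, and a part multiplied by a function that vanishes at the origin,
  and such functions annihilate Koszul homology.

  Comparison with the fibres. Both \<open>H\<^sub>i(\<Gamma>(\<and>V\<^sup>*) \<otimes> F)\<close> and \<open>(E\<^sub>i)\<^sub>0\<close> compute \<open>Tor\<^sub>i(\<real>, F)\<close>. Concretely, let \<open>M\<^sub>j\<close> be the image of
  \<open>\<partial>\<^sub>j\<close> and \<open>M\<^sub>0 = F\<close>. The exact sequences \<open>0 \<rightarrow> M\<^sub>j\<^sub>+\<^sub>1 \<rightarrow> \<Gamma>(E\<^sub>j) \<rightarrow> M\<^sub>j \<rightarrow> 0\<close>, whose middle term has no Koszul homology in positive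
  degrees, give \<open>H\<^sub>i(M\<^sub>j) \<cong> H\<^sub>i\<^sub>-\<^sub>1(M\<^sub>j\<^sub>+\<^sub>1)\<close> (\<open>homology_map_shift\<close>); for \<open>i = 1\<close> this uses that the elements of \<open>M\<^sub>j\<^sub>+\<^sub>1\<close> vanish at
  the origin by minimality. For the same reason \<open>H\<^sub>0(M\<^sub>i) \<cong> (E\<^sub>i)\<^sub>0\<close> (\<open>homology_map_degree_0\<close>). So \<open>H\<^sub>i(F) \<cong> (E\<^sub>i)\<^sub>0\<close>.

  Equivariance. A section \<open>e\<close> of \<open>E\<^sub>0\<close> with linear anchor \<open>A\<close> acts on every \<open>\<Gamma>(E\<^sub>j)\<close> by the derivation \<open>l\<^sub>2(e, -)\<close> over \<open>A\<close>. The
  Jacobi identity for two arguments says that these derivations commute with the maps \<open>\<partial>\<^sub>j\<close> (\<open>\<delta>_ell\<close>), and the one for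
  three arguments that the anchor turns them into \<open>[A, -]\<close> (\<open>anchor_ell\<close>). Thus every step of the comparison respects
  the actions, and at the last one \<open>l\<^sub>2(e, -)\<close> is evaluated at the origin, which is the action on the fibre. That this
  action is a representation follows by transport along the comparison map.
\<close>

section \<open>Coordinates on a finite-dimensional normed space\<close>

text \<open>A ball around \<open>a\<close> avoids the closed set \<open>span S\<close>; the general inequality follows by scaling.\<close>

lemma dist_span_pos:
  fixes a :: "'v::real_normed_vector"
  assumes "complete (span S)" "a \<notin> span S"
  obtains d where "d > 0" "\<And>c s. s \<in> span S \<Longrightarrow> \<bar>c\<bar> * d \<le> norm (c *\<^sub>R a + s)"
proof -
  have cl: "closed (span S)" using assms(1) by (rule complete_imp_closed)
  then obtain d where d: "d > 0" "ball a d \<subseteq> - span S"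
    using assms(2) by (metis ComplI closed_def openE)
  have "\<bar>c\<bar> * d \<le> norm (c *\<^sub>R a + s)" if s: "s \<in> span S" for c s
  proof (cases "c = 0")
    case False
    have "- ((1 / c) *\<^sub>R s) \<in> span S"
      using s by (simp add: span_neg span_scale)
    then have "- ((1 / c) *\<^sub>R s) \<notin> ball a d" using d by blast
    then have "d \<le> norm (a + (1 / c) *\<^sub>R s)" by (simp add: dist_norm)
    then have "\<bar>c\<bar> * d \<le> \<bar>c\<bar> * norm (a + (1 / c) *\<^sub>R s)" by (simp add: mult_left_mono)
    also have "\<dots> = norm (c *\<^sub>R (a + (1 / c) *\<^sub>R s))" by simp
    also have "c *\<^sub>R (a + (1 / c) *\<^sub>R s) = c *\<^sub>R a + s" using False by (simp add: scaleR_add_right)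
    finally show ?thesis .
  qed simp
  then show thesis using that d(1) by blast
qed

lemma Cauchy_dominated:
  fixes f :: "nat \<Rightarrow> 'a::real_normed_vector" and g :: "nat \<Rightarrow> 'b::real_normed_vector"
  assumes "Cauchy f" "\<And>m n. norm (g m - g n) \<le> K * norm (f m - f n)"
  shows "Cauchy g"
proof (rule CauchyI)
  fix e :: real assume "e > 0"
  then have "e / (\<bar>K\<bar> + 1) > 0" by simp
  then obtain M where M: "\<And>m n. m \<ge> M \<Longrightarrow> n \<ge> M \<Longrightarrow> norm (f m - f n) < e / (\<bar>K\<bar> + 1)"
    using CauchyD[OF assms(1)] by blast
  have "norm (g m - g n) < e" if "m \<ge> M" "n \<ge> M" for m n
  proof -
    have "K * norm (f m - f n) \<le> (\<bar>K\<bar> + 1) * norm (f m - f n)" by (intro mult_right_mono) auto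
    moreover have "(\<bar>K\<bar> + 1) * norm (f m - f n) < e" using M[OF that] by (simp add: field_simps)
    ultimately show ?thesis using assms(2)[of m n] by linarith
  qed
  then show "\<exists>M. \<forall>m\<ge>M. \<forall>n\<ge>M. norm (g m - g n) < e" by blast
qed

text \<open>By the previous estimate the coefficients of a Cauchy sequence along a new spanning vector form a Cauchy sequence
  themselves.\<close>

lemma complete_span_finite:
  fixes S :: "'v::real_normed_vector set"
  assumes "finite S"
  shows "complete (span S)"
  using assms
proof (induction S)
  case empty
  then show ?case by (simp add: finite_imp_compact compact_imp_complete)
next
  case (insert a S)
  show ?case
  proof (cases "a \<in> span S")
    case True
    then show ?thesis using insert by (simp add: span_redundant)
  next
    case False
    obtain d where d: "d > 0" "\<And>c s. s \<in> span S \<Longrightarrow> \<bar>c\<bar> * d \<le> norm (c *\<^sub>R a + s)"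
      using dist_span_pos[OF insert.IH False] by blast
    show ?thesis unfolding complete_def
    proof (intro allI impI, elim conjE)
      fix f :: "nat \<Rightarrow> 'v" assume f: "\<forall>n. f n \<in> span (insert a S)" and cau: "Cauchy f"
      have "\<forall>n. \<exists>k. f n - k *\<^sub>R a \<in> span S"
        using f by (simp add: span_breakdown_eq)
      then obtain c where c: "\<And>n. f n - c n *\<^sub>R a \<in> span S" by metis
      define s where "s n = f n - c n *\<^sub>R a" for n
      have "\<bar>c m - c n\<bar> * d \<le> norm (f m - f n)" for m n
      proof -
        have "s m - s n \<in> span S" unfolding s_def by (intro span_diff c)
        moreover have "(c m - c n) *\<^sub>R a + (s m - s n) = f m - f n" by (simp add: s_def algebra_simps)
        ultimately show ?thesis using d(2)[of "s m - s n" "c m - c n"] by simp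
      qed
      then have le: "norm (c m - c n) \<le> norm (f m - f n) / d" for m n
        using d(1) by (simp add: field_simps)
      then have "Cauchy c" by (intro Cauchy_dominated[OF cau, of _ "1 / d"]) simp
      then obtain c0 where c0: "c \<longlonglongrightarrow> c0" using real_Cauchy_convergent convergent_def by blast
      have "norm (s m - s n) \<le> (1 + norm a / d) * norm (f m - f n)" for m n
      proof -
        have "s m - s n = (f m - f n) - (c m - c n) *\<^sub>R a" by (simp add: s_def algebra_simps)
        then have "norm (s m - s n) \<le> norm (f m - f n) + norm (c m - c n) * norm a"
          using norm_triangle_ineq4[of "f m - f n" "(c m - c n) *\<^sub>R a"] by simp
        also have "\<dots> \<le> norm (f m - f n) + norm (f m - f n) / d * norm a"
          using le by (intro add_left_mono mult_right_mono) auto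
        finally show ?thesis by (simp add: algebra_simps)
      qed
      then have "Cauchy s" by (rule Cauchy_dominated[OF cau])
      moreover have "\<forall>n. s n \<in> span S" using c by (simp add: s_def)
      ultimately obtain s0 where s0: "s0 \<in> span S" "s \<longlonglongrightarrow> s0"
        using insert.IH[unfolded complete_def, rule_format, of s] by blast
      have "(\<lambda>n. s n + c n *\<^sub>R a) \<longlonglongrightarrow> s0 + c0 *\<^sub>R a"
        by (intro tendsto_intros s0 c0)
      then have "f \<longlonglongrightarrow> s0 + c0 *\<^sub>R a" by (simp add: s_def)
      moreover have "s0 + c0 *\<^sub>R a \<in> span (insert a S)"
        unfolding span_breakdown_eq by (rule exI[of _ c0]) (use s0(1) in simp)
      ultimately show "\<exists>l\<in>span (insert a S). f \<longlonglongrightarrow> l" by blast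
    qed
  qed
qed

text \<open>The norm of the model space is arbitrary, so it is accessed through a basis and the dual coordinates.\<close>

locale finite_basis =
  fixes B :: "'v::real_normed_vector set"
  assumes finite_B: "finite B" and indep_B: "independent B" and span_B: "span B = UNIV"
begin

definition crd :: "'v \<Rightarrow> 'v \<Rightarrow> real" where
  "crd b x = representation B x b"

lemma crd_expand: "(\<Sum>b\<in>B. crd b x *\<^sub>R b) = x"
  unfolding crd_def using sum_representation_eq[OF indep_B _ finite_B subset_refl] span_B by simp

lemma crd_linear: "linear (crd b)"
  unfolding crd_def
  by (rule linearI) (use span_B indep_B in \<open>auto simp: representation_add representation_scale\<close>)

text \<open>The span of the other basis vectors is complete, hence closed, so the distance of \<open>b\<close> to it is positive.\<close>

lemma crd_bounded_linear: "bounded_linear (crd b)"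
proof (cases "b \<in> B")
  case True
  have "b \<notin> span (B - {b})" using indep_B True dependent_def by blast
  then obtain d where d: "d > 0" "\<And>c s. s \<in> span (B - {b}) \<Longrightarrow> \<bar>c\<bar> * d \<le> norm (c *\<^sub>R b + s)"
    using dist_span_pos complete_span_finite finite_B by (metis finite_Diff)
  have "norm (crd b x) \<le> norm x * (1 / d)" for x
  proof -
    have "(\<Sum>c\<in>B - {b}. crd c x *\<^sub>R c) \<in> span (B - {b})"
      by (intro span_sum span_scale span_base)
    then have "\<bar>crd b x\<bar> * d \<le> norm (crd b x *\<^sub>R b + (\<Sum>c\<in>B - {b}. crd c x *\<^sub>R c))" by (rule d)
    also have "crd b x *\<^sub>R b + (\<Sum>c\<in>B - {b}. crd c x *\<^sub>R c) = x"
      using crd_expand[of x] sum.remove[OF finite_B True, of "\<lambda>c. crd c x *\<^sub>R c"] by simp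
    finally show ?thesis using d(1) by (simp add: field_simps)
  qed
  then show ?thesis
    using crd_linear by (intro bounded_linear_intro[where K = "1 / d"]) (auto simp: linear_add linear_scale)
next
  case False
  then have "crd b = (\<lambda>_. 0)" unfolding crd_def using representation_ne_zero by fastforce
  then show ?thesis by simp
qed

lemma linear_expand: "linear f \<Longrightarrow> f x = (\<Sum>b\<in>B. crd b x *\<^sub>R f b)"
proof -
  assume f: "linear f"
  have "f (\<Sum>b\<in>B. crd b x *\<^sub>R b) = (\<Sum>b\<in>B. crd b x *\<^sub>R f b)"
    by (simp only: linear_sum[OF f] linear_scale[OF f])
  then show ?thesis by (simp only: crd_expand)
qed

lemma linear_bounded:
  fixes f :: "'v \<Rightarrow> 'w::real_normed_vector"
  assumes "linear f" shows "bounded_linear f"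
proof -
  have *: "(\<lambda>x. \<Sum>b\<in>B. crd b x *\<^sub>R f b) = f" by (rule ext) (rule linear_expand[OF assms, symmetric])
  moreover have "bounded_linear (\<lambda>x. \<Sum>b\<in>B. crd b x *\<^sub>R f b)"
    by (rule bounded_linear_sum, rule bounded_linear_scaleR_const, rule crd_bounded_linear)
  ultimately show ?thesis by (simp only: *)
qed

lemma eq_if_crd: "(\<And>b. b \<in> B \<Longrightarrow> crd b x = crd b y) \<Longrightarrow> x = y"
  by (metis (no_types, lifting) crd_expand sum.cong)

end

section \<open>Smooth functions\<close>

lemma has_derivative_cong_open:
  assumes "open U" "x \<in> U" "\<And>y. y \<in> U \<Longrightarrow> f y = g y"
  shows "(f has_derivative D) (at x) \<longleftrightarrow> (g has_derivative D) (at x)"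
proof
  show "(f has_derivative D) (at x) \<Longrightarrow> (g has_derivative D) (at x)"
    using has_derivative_transform_within_open[of f D x UNIV U g] assms by auto
  show "(g has_derivative D) (at x) \<Longrightarrow> (f has_derivative D) (at x)"
    using has_derivative_transform_within_open[of g D x UNIV U f] assms by auto
qed

lemma frechet_derivative_cong_open:
  assumes "open U" "x \<in> U" "\<And>y. y \<in> U \<Longrightarrow> f y = g y"
  shows "frechet_derivative f (at x) = frechet_derivative g (at x)"
  unfolding frechet_derivative_def using has_derivative_cong_open[OF assms] by simp

lemma differentiable_cong_open:
  assumes "open U" "x \<in> U" "\<And>y. y \<in> U \<Longrightarrow> f y = g y"
  shows "f differentiable (at x) \<longleftrightarrow> g differentiable (at x)"
  unfolding differentiable_def using has_derivative_cong_open[OF assms] by simp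

lemma frechet_derivativeI: "(f has_derivative D) (at x) \<Longrightarrow> frechet_derivative f (at x) = D"
  by (metis frechet_derivative_at)

lemma Ck_on_cong:
  assumes "open U" "\<And>x. x \<in> U \<Longrightarrow> f x = g x"
  shows "Ck_on k U f \<longleftrightarrow> Ck_on k U g"
  using assms(2)
proof (induction k arbitrary: f g)
  case 0
  then show ?case using continuous_on_cong[of U U f g] by simp
next
  case (Suc k)
  have "Ck_on k U (\<lambda>x. frechet_derivative f (at x) v) \<longleftrightarrow> Ck_on k U (\<lambda>x. frechet_derivative g (at x) v)" for v
  proof (rule Suc.IH)
    fix x assume x: "x \<in> U"
    show "frechet_derivative f (at x) v = frechet_derivative g (at x) v"
      using frechet_derivative_cong_open[OF assms(1) x Suc.prems] by simp
  qed
  moreover have "x \<in> U \<Longrightarrow> f differentiable (at x) \<longleftrightarrow> g differentiable (at x)" for x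
    using Suc.prems by (intro differentiable_cong_open[OF assms(1)])
  ultimately show ?case by auto
qed

lemma Ck_on_SucI:
  assumes "open U" "\<And>x. x \<in> U \<Longrightarrow> (f has_derivative f' x) (at x)" "\<And>v. Ck_on k U (\<lambda>x. f' x v)"
  shows "Ck_on (Suc k) U f"
proof -
  have "Ck_on k U (\<lambda>x. frechet_derivative f (at x) v)" for v
    using Ck_on_cong[OF assms(1), of "\<lambda>x. frechet_derivative f (at x) v" "\<lambda>x. f' x v"]
      assms(2,3) frechet_derivativeI by metis
  moreover have "f differentiable (at x)" if "x \<in> U" for x
    using assms(2)[OF that] differentiableI by blast
  ultimately show ?thesis by simp
qed

lemma Ck_on_SucD:
  assumes "Ck_on (Suc k) U f"
  shows "x \<in> U \<Longrightarrow> (f has_derivative frechet_derivative f (at x)) (at x)"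
    and "Ck_on k U (\<lambda>x. frechet_derivative f (at x) v)"
  using assms by (auto simp: frechet_derivative_works)

lemma Ck_on_lower: "Ck_on (Suc k) U f \<Longrightarrow> Ck_on k U f"
proof (induction k arbitrary: f)
  case 0
  then show ?case
    by (auto intro!: differentiable_imp_continuous_on simp: differentiable_on_def differentiable_at_withinI)
next
  case (Suc k)
  then show ?case by (metis Ck_on.simps(2))
qed

lemma Ck_on_subset: "Ck_on k U f \<Longrightarrow> W \<subseteq> U \<Longrightarrow> Ck_on k W f"
  by (induction k arbitrary: f) (auto intro: continuous_on_subset)

lemma Ck_on_Un: "open U \<Longrightarrow> open W \<Longrightarrow> Ck_on k U f \<Longrightarrow> Ck_on k W f \<Longrightarrow> Ck_on k (U \<union> W) f"
  by (induction k arbitrary: f) (auto intro: continuous_on_open_Un)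

lemma Ck_on_const: "Ck_on k U (\<lambda>_. c)"
  by (induction k arbitrary: c) (auto simp: frechet_derivative_const)

lemma Ck_on_bounded_linear:
  assumes "open U" "bounded_linear L" "Ck_on k U f"
  shows "Ck_on k U (\<lambda>x. L (f x))"
  using assms(3)
proof (induction k arbitrary: f)
  case 0
  then show ?case using bounded_linear.continuous_on[OF assms(2)] by auto
next
  case (Suc k)
  show ?case
    by (rule Ck_on_SucI[OF assms(1) bounded_linear.has_derivative[OF assms(2) Ck_on_SucD(1)[OF Suc.prems]]])
      (auto intro!: Suc.IH Ck_on_SucD(2)[OF Suc.prems])
qed

lemma Ck_on_add:
  assumes "open U" "Ck_on k U f" "Ck_on k U g"
  shows "Ck_on k U (\<lambda>x. f x + g x)"
  using assms(2,3)
proof (induction k arbitrary: f g)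
  case 0
  then show ?case by (auto intro: continuous_intros)
next
  case (Suc k)
  show ?case
    by (rule Ck_on_SucI[OF assms(1) has_derivative_add[OF Ck_on_SucD(1)[OF Suc.prems(1)] Ck_on_SucD(1)[OF Suc.prems(2)]]])
      (auto intro!: Suc.IH Ck_on_SucD(2)[OF Suc.prems(1)] Ck_on_SucD(2)[OF Suc.prems(2)])
qed

lemma Ck_on_bilinear:
  assumes "open U" "bounded_bilinear P" "Ck_on k U f" "Ck_on k U g"
  shows "Ck_on k U (\<lambda>x. P (f x) (g x))"
  using assms(3,4)
proof (induction k arbitrary: f g)
  case 0
  then show ?case using bounded_bilinear.continuous_on[OF assms(2)] by auto
next
  case (Suc k)
  show ?case
    by (rule Ck_on_SucI[OF assms(1) bounded_bilinear.FDERIV[OF assms(2) Ck_on_SucD(1)[OF Suc.prems(1)] Ck_on_SucD(1)[OF Suc.prems(2)]]])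
      (auto intro!: Suc.IH Ck_on_add[OF assms(1)] Ck_on_SucD(2)[OF Suc.prems(1)] Ck_on_SucD(2)[OF Suc.prems(2)]
        Ck_on_lower[OF Suc.prems(1)] Ck_on_lower[OF Suc.prems(2)])
qed

lemma Ck_on_id: "open U \<Longrightarrow> Ck_on k U (\<lambda>x. x)"
  by (cases k) (auto intro!: Ck_on_SucI[where f' = "\<lambda>_ v. v"] Ck_on_const continuous_intros)

text \<open>A chain rule for real outer functions only; it serves to compose the flat exponential with a quadratic form.\<close>

lemma Ck_on_compose_real:
  assumes "open U" "Ck_on k UNIV (h :: real \<Rightarrow> real)" "Ck_on k U q"
  shows "Ck_on k U (\<lambda>x. h (q x))"
  using assms(2,3)
proof (induction k arbitrary: h q)
  case 0
  then show ?case by (auto intro: continuous_on_compose2)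
next
  case (Suc k)
  have h: "(h has_derivative frechet_derivative h (at t)) (at t)" for t
    using Ck_on_SucD(1)[OF Suc.prems(1)] by simp
  have lin: "frechet_derivative h (at t) r = r * frechet_derivative h (at t) 1" for t r
    using linear_scale[OF has_derivative_linear[OF h[of t]], of r 1] by simp
  have D: "((\<lambda>x. h (q x)) has_derivative
      (\<lambda>v. frechet_derivative q (at x) v * frechet_derivative h (at (q x)) 1)) (at x)" if "x \<in> U" for x
    by (rule has_derivative_eq_rhs[OF has_derivative_compose[OF Ck_on_SucD(1)[OF Suc.prems(2) that] h]])
      (rule ext, rule lin)
  show ?case
    by (rule Ck_on_SucI[OF assms(1) D], assumption, rule Ck_on_bilinear[OF assms(1) bounded_bilinear_mult],
        rule Ck_on_SucD(2)[OF Suc.prems(2)], rule Suc.IH[OF Ck_on_SucD(2)[OF Suc.prems(1)] Ck_on_lower[OF Suc.prems(2)]])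
qed

named_theorems smooth_intros

lemma smooth_on_cong: "open U \<Longrightarrow> (\<And>x. x \<in> U \<Longrightarrow> f x = g x) \<Longrightarrow> smooth_on U f \<longleftrightarrow> smooth_on U g"
  unfolding smooth_on_def using Ck_on_cong by blast

lemma smooth_on_subset: "smooth_on U f \<Longrightarrow> W \<subseteq> U \<Longrightarrow> smooth_on W f"
  unfolding smooth_on_def using Ck_on_subset by blast

lemma smooth_on_Un: "open U \<Longrightarrow> open W \<Longrightarrow> smooth_on U f \<Longrightarrow> smooth_on W f \<Longrightarrow> smooth_on (U \<union> W) f"
  unfolding smooth_on_def using Ck_on_Un by blast

lemma smooth_on_const [smooth_intros]: "smooth_on U (\<lambda>_. c)"
  unfolding smooth_on_def using Ck_on_const by blast

lemma smooth_on_id [smooth_intros]: "open U \<Longrightarrow> smooth_on U (\<lambda>x. x)"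
  unfolding smooth_on_def using Ck_on_id by blast

lemma smooth_on_bounded_linear: "open U \<Longrightarrow> bounded_linear L \<Longrightarrow> smooth_on U f \<Longrightarrow> smooth_on U (\<lambda>x. L (f x))"
  unfolding smooth_on_def using Ck_on_bounded_linear by blast

lemma smooth_on_add [smooth_intros]:
  "open U \<Longrightarrow> smooth_on U f \<Longrightarrow> smooth_on U g \<Longrightarrow> smooth_on U (\<lambda>x. f x + g x)"
  unfolding smooth_on_def using Ck_on_add by blast

lemma smooth_on_mult [smooth_intros]:
  "open U \<Longrightarrow> smooth_on U f \<Longrightarrow> smooth_on U g \<Longrightarrow> smooth_on U (\<lambda>x. f x * g x :: real)"
  unfolding smooth_on_def using Ck_on_bilinear[OF _ bounded_bilinear_mult] by blast

lemma smooth_on_scaleR [smooth_intros]: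
  "open U \<Longrightarrow> smooth_on U f \<Longrightarrow> smooth_on U g \<Longrightarrow> smooth_on U (\<lambda>x. f x *\<^sub>R g x)"
  unfolding smooth_on_def using Ck_on_bilinear[OF _ bounded_bilinear_scaleR] by blast

lemma smooth_on_minus [smooth_intros]: "open U \<Longrightarrow> smooth_on U f \<Longrightarrow> smooth_on U (\<lambda>x. - f x)"
  using smooth_on_bounded_linear[OF _ bounded_linear_minus[OF bounded_linear_ident]] by blast

lemma smooth_on_diff [smooth_intros]:
  "open U \<Longrightarrow> smooth_on U f \<Longrightarrow> smooth_on U g \<Longrightarrow> smooth_on U (\<lambda>x. f x - g x)"
  using smooth_on_add[of U f "\<lambda>x. - g x"] smooth_on_minus by auto

lemma smooth_on_sum [smooth_intros]:
  "open U \<Longrightarrow> (\<And>i. i \<in> I \<Longrightarrow> smooth_on U (f i)) \<Longrightarrow> smooth_on U (\<lambda>x. \<Sum>i\<in>I. f i x)"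
  by (induction I rule: infinite_finite_induct) (auto intro: smooth_intros)

lemma smooth_on_compose_real:
  "open U \<Longrightarrow> smooth (h :: real \<Rightarrow> real) \<Longrightarrow> smooth_on U q \<Longrightarrow> smooth_on U (\<lambda>x. h (q x))"
  unfolding smooth_on_def using Ck_on_compose_real by blast

lemma smooth_on_has_derivative:
  "smooth_on U f \<Longrightarrow> x \<in> U \<Longrightarrow> (f has_derivative frechet_derivative f (at x)) (at x)"
  unfolding smooth_on_def using Ck_on_SucD(1) by blast

lemma smooth_has_derivative: "smooth f \<Longrightarrow> (f has_derivative frechet_derivative f (at x)) (at x)"
  by (simp add: smooth_on_has_derivative)

lemma smooth_on_directional [smooth_intros]:
  "smooth_on U f \<Longrightarrow> smooth_on U (\<lambda>x. frechet_derivative f (at x) v)"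
  unfolding smooth_on_def using Ck_on_SucD(2) by blast

lemma smooth_on_continuous: "smooth_on U f \<Longrightarrow> continuous_on U f"
  unfolding smooth_on_def using Ck_on.simps(1) by blast

lemma smooth_linear_derivative: "smooth f \<Longrightarrow> linear (frechet_derivative f (at x))"
  using smooth_has_derivative has_derivative_linear by blast

lemma fd_add: "smooth f \<Longrightarrow> smooth g \<Longrightarrow> frechet_derivative (\<lambda>x. f x + g x) (at x) v
    = frechet_derivative f (at x) v + frechet_derivative g (at x) v"
  using frechet_derivativeI[OF has_derivative_add[OF smooth_has_derivative smooth_has_derivative]] by metis

lemma fd_diff: "smooth f \<Longrightarrow> smooth g \<Longrightarrow> frechet_derivative (\<lambda>x. f x - g x) (at x) v
    = frechet_derivative f (at x) v - frechet_derivative g (at x) v"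
  using frechet_derivativeI[OF has_derivative_diff[OF smooth_has_derivative smooth_has_derivative]] by metis

lemma fd_scaleR: "smooth f \<Longrightarrow> smooth g \<Longrightarrow> frechet_derivative (\<lambda>x. f x *\<^sub>R g x) (at x) v
    = f x *\<^sub>R frechet_derivative g (at x) v + frechet_derivative f (at x) v *\<^sub>R g x"
  using frechet_derivativeI[OF has_derivative_scaleR[OF smooth_has_derivative smooth_has_derivative]] by metis

lemma fd_mult: "smooth f \<Longrightarrow> smooth g \<Longrightarrow> frechet_derivative (\<lambda>x. f x * g x :: real) (at x) v
    = f x * frechet_derivative g (at x) v + frechet_derivative f (at x) v * g x"
  using fd_scaleR[of f g x v] by simp

lemma fd_sum: "finite I \<Longrightarrow> (\<And>i. i \<in> I \<Longrightarrow> smooth (f i)) \<Longrightarrow> frechet_derivative (\<lambda>x. \<Sum>i\<in>I. f i x) (at x) v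
    = (\<Sum>i\<in>I. frechet_derivative (f i) (at x) v)"
  by (induction I rule: finite_induct) (auto simp: fd_add smooth_on_sum frechet_derivative_const)

lemma fd_bounded_linear: "bounded_linear L \<Longrightarrow> smooth f \<Longrightarrow>
    frechet_derivative (\<lambda>x. L (f x)) (at x) v = L (frechet_derivative f (at x) v)"
  using frechet_derivativeI[OF bounded_linear.has_derivative[OF _ smooth_has_derivative]] by metis

lemma fd_linear: "bounded_linear L \<Longrightarrow> frechet_derivative L (at x) = L"
  using frechet_derivativeI bounded_linear_imp_has_derivative by blast

text \<open>Smoothness is local, and \<open>f\<close> is locally zero off \<open>K\<close>.\<close>

lemma smooth_on_extend_zero:
  assumes "open U" "closed K" "K \<subseteq> U" "smooth_on U f" "\<And>x. x \<notin> K \<Longrightarrow> f x = 0"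
  shows "smooth (f :: _ \<Rightarrow> 'w::real_normed_vector)"
proof -
  have "smooth_on (- K) f"
    using assms(2,5) smooth_on_const[of "- K" 0] smooth_on_cong[of "- K" f "\<lambda>_. 0"] by auto
  then have "smooth_on (U \<union> - K) f" using assms by (intro smooth_on_Un) auto
  moreover have "U \<union> - K = UNIV" using assms(3) by auto
  ultimately show ?thesis by simp
qed

section \<open>Bump functions\<close>

text \<open>The powers of \<open>t\<close> are carried along because the derivative of each of these functions is a combination of two others,
  so that smoothness of all of them follows by induction.\<close>

definition flat_exp :: "nat \<Rightarrow> real \<Rightarrow> real" where
  "flat_exp m t = (if t > 0 then exp (- 1 / t) / t ^ m else 0)"

lemma flat_exp_tendsto_0: "(flat_exp m \<longlongrightarrow> 0) (at 0)"
proof (rule filterlim_split_at_real)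
  show "(flat_exp m \<longlongrightarrow> 0) (at_left 0)"
    by (rule tendsto_eventually) (auto simp: eventually_at_left_field flat_exp_def intro!: exI[of _ "-1"])
  have "((\<lambda>t. inverse t ^ m / exp (inverse t)) \<longlongrightarrow> (0::real)) (at_right 0)"
    using filterlim_compose[OF tendsto_power_div_exp_0 filterlim_inverse_at_top_right] .
  then show "(flat_exp m \<longlongrightarrow> 0) (at_right 0)"
    by (rule Lim_transform_eventually)
      (auto simp: eventually_at_right_field flat_exp_def exp_minus field_simps intro!: exI[of _ 1])
qed

lemma flat_exp_has_derivative:
  "(flat_exp m has_derivative (\<lambda>v. v * (flat_exp (m + 2) t - real m * flat_exp (m + 1) t))) (at t)"
proof -
  consider "t > 0" | "t < 0" | "t = 0" by linarith
  then have "(flat_exp m has_real_derivative (flat_exp (m + 2) t - real m * flat_exp (m + 1) t)) (at t)"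
  proof cases
    case 1
    have "((\<lambda>t. exp (- 1 / t) / t ^ m) has_real_derivative (flat_exp (m + 2) t - real m * flat_exp (m + 1) t)) (at t)"
      using 1 by (auto intro!: derivative_eq_intros simp: flat_exp_def field_simps power2_eq_square)
         (cases m; simp add: field_simps)
    then show ?thesis
      by (rule has_field_derivative_transform_within_open[where S = "{0<..}"]) (use 1 in \<open>auto simp: flat_exp_def\<close>)
  next
    case 2
    have "((\<lambda>t. 0) has_real_derivative (flat_exp (m + 2) t - real m * flat_exp (m + 1) t)) (at t)"
      using 2 by (simp add: flat_exp_def)
    then show ?thesis
      by (rule has_field_derivative_transform_within_open[where S = "{..<0}"]) (use 2 in \<open>auto simp: flat_exp_def\<close>)
  next
    case 3
    have "(\<lambda>h. (flat_exp m (0 + h) - flat_exp m 0) / h) = flat_exp (m + 1)"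
      by (auto simp: flat_exp_def fun_eq_iff)
    then have "DERIV (flat_exp m) 0 :> 0"
      unfolding DERIV_def using flat_exp_tendsto_0[of "m + 1"] by (simp only:)
    then show ?thesis using 3 by (simp add: flat_exp_def)
  qed
  then show ?thesis unfolding has_field_derivative_def
    by (rule has_derivative_eq_rhs) (auto simp: mult.commute)
qed

lemma Ck_on_flat_exp: "Ck_on k UNIV (flat_exp m)"
proof (induction k arbitrary: m)
  case 0
  then show ?case
    using has_derivative_continuous[OF flat_exp_has_derivative]
    by (simp add: continuous_on_eq_continuous_at)
next
  case (Suc k)
  have "Ck_on k UNIV (\<lambda>t. v * (flat_exp (m + 2) t + (- real m) * flat_exp (m + 1) t))" for v
    by (intro Ck_on_bilinear[OF _ bounded_bilinear_mult] Ck_on_add Ck_on_const Suc.IH open_UNIV)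
  then show ?case
    by (intro Ck_on_SucI[OF open_UNIV flat_exp_has_derivative]) simp
qed

context finite_basis begin

lemma smooth_crd: "smooth (crd b)"
  using smooth_on_bounded_linear[OF open_UNIV crd_bounded_linear smooth_on_id] by simp

lemma smooth_on_crd_comp [smooth_intros]: "open U \<Longrightarrow> smooth_on U f \<Longrightarrow> smooth_on U (\<lambda>x. crd b (f x))"
  by (rule smooth_on_bounded_linear[OF _ crd_bounded_linear])

text \<open>The flat exponential is composed with a positive definite quadratic form in the coordinates, because the norm
  need not be smooth.\<close>

lemma bump_function:
  assumes "open U" "p \<in> U"
  shows "\<exists>(\<psi> :: 'v \<Rightarrow> real) K. smooth \<psi> \<and> \<psi> p = 1 \<and> closed K \<and> K \<subseteq> U \<and> (\<forall>x. x \<notin> K \<longrightarrow> \<psi> x = 0)"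
proof -
  obtain r where r: "r > 0" "ball p r \<subseteq> U" using assms by (meson openE)
  define q where "q x = (\<Sum>b\<in>B. crd b (x - p) * crd b (x - p))" for x
  define S where "S = (\<Sum>b\<in>B. norm b)"
\<comment> \<open>coordinates of size at most \<open>s\<close> give a vector of norm at most \<open>s S < r\<close>\<close>
  define s where "s = r / (2 * (1 + S))"
  have S: "S \<ge> 0" unfolding S_def by (intro sum_nonneg) auto
  then have s: "s > 0" using r by (simp add: s_def)
  have q: "smooth q" unfolding q_def by (intro smooth_intros) auto
  define \<psi> where "\<psi> x = flat_exp 0 (1 - (1 / s\<^sup>2) * q x) * exp 1" for x
  have "smooth (flat_exp 0)" unfolding smooth_on_def using Ck_on_flat_exp by blast
  moreover have "smooth (\<lambda>x. 1 - (1 / s\<^sup>2) * q x)" by (intro smooth_intros q) auto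
  ultimately have "smooth (\<lambda>x. flat_exp 0 (1 - (1 / s\<^sup>2) * q x))"
    by (rule smooth_on_compose_real[OF open_UNIV])
  then have "smooth \<psi>" unfolding \<psi>_def by (intro smooth_intros) auto
  moreover have "\<psi> p = 1" by (simp add: \<psi>_def q_def flat_exp_def linear_0[OF crd_linear] exp_minus)
  moreover have "closed {x. q x \<le> s\<^sup>2}"
    by (intro closed_Collect_le continuous_intros smooth_on_continuous[OF q])
  moreover have "{x. q x \<le> s\<^sup>2} \<subseteq> U"
  proof
    fix x assume "x \<in> {x. q x \<le> s\<^sup>2}"
    then have qx: "q x \<le> s\<^sup>2" by simp
    have le: "\<bar>crd b (x - p)\<bar> \<le> s" if "b \<in> B" for b
    proof -
      have "(crd b (x - p))\<^sup>2 \<le> q x" unfolding q_def power2_eq_square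
        by (rule member_le_sum[OF that]) (auto simp: finite_B)
      then show ?thesis using qx s abs_le_square_iff[of "crd b (x - p)" s] by simp
    qed
    have "norm (x - p) = norm (\<Sum>b\<in>B. crd b (x - p) *\<^sub>R b)" by (simp add: crd_expand)
    also have "\<dots> \<le> (\<Sum>b\<in>B. s * norm b)"
      by (rule sum_norm_le) (use le in \<open>auto intro: mult_right_mono\<close>)
    also have "\<dots> = s * S" by (simp add: S_def sum_distrib_left)
    also have "\<dots> < r" using r S by (simp add: s_def field_simps) (smt (verit) mult_nonneg_nonneg)
    finally show "x \<in> U" using r(2) by (auto simp: dist_norm norm_minus_commute)
  qed
  moreover have "\<psi> x = 0" if "x \<notin> {x. q x \<le> s\<^sup>2}" for x
  proof -
    have "1 \<le> q x / s\<^sup>2" using that s by (simp add: le_divide_eq)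
    then show ?thesis by (simp add: \<psi>_def flat_exp_def)
  qed
  ultimately show ?thesis by (intro exI[of _ \<psi>] exI[of _ "{x. q x \<le> s\<^sup>2}"]) simp
qed

end

section \<open>Symmetry of second derivatives\<close>

lemma has_real_derivative_along_line:
  assumes "smooth (f :: 'v::real_normed_vector \<Rightarrow> real)"
  shows "((\<lambda>t. f (x + t *\<^sub>R v)) has_real_derivative frechet_derivative f (at (x + t *\<^sub>R v)) v) (at t)"
proof -
  have "((\<lambda>t. x + t *\<^sub>R v) has_derivative (\<lambda>h. h *\<^sub>R v)) (at t)"
    by (auto intro!: derivative_eq_intros)
  from has_derivative_compose[OF this smooth_has_derivative[OF assms]]
  show ?thesis unfolding has_field_derivative_def
    by (rule has_derivative_eq_rhs)
      (auto simp: linear_scale[OF smooth_linear_derivative[OF assms]] mult.commute)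
qed

text \<open>The mean value theorem is applied twice: to \<open>s \<mapsto> f(x + h v + s u) - f(x + s u)\<close>, and then in the direction \<open>v\<close> to the
  derivative of \<open>f\<close> along \<open>u\<close>.\<close>

lemma second_difference_mvt:
  assumes f: "smooth (f :: 'v::real_normed_vector \<Rightarrow> real)" and h: "h > 0"
  obtains \<xi> \<eta> where "0 < \<xi>" "\<xi> < h" "0 < \<eta>" "\<eta> < h"
    "f (x + h *\<^sub>R u + h *\<^sub>R v) - f (x + h *\<^sub>R u) - f (x + h *\<^sub>R v) + f x
      = h\<^sup>2 * frechet_derivative (\<lambda>y. frechet_derivative f (at y) u) (at (x + \<xi> *\<^sub>R u + \<eta> *\<^sub>R v)) v"
proof -
  define D where "D y = frechet_derivative f (at y) u" for y
  have D: "smooth D" unfolding D_def by (intro smooth_intros f)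
  define \<phi> where "\<phi> s = f (x + h *\<^sub>R v + s *\<^sub>R u) - f (x + s *\<^sub>R u)" for s
  have d\<phi>: "(\<phi> has_real_derivative D (x + h *\<^sub>R v + s *\<^sub>R u) - D (x + s *\<^sub>R u)) (at s)" for s
    unfolding \<phi>_def D_def by (intro derivative_intros has_real_derivative_along_line f)
  obtain \<xi> where \<xi>: "0 < \<xi>" "\<xi> < h" "\<phi> h - \<phi> 0 = (h - 0) * (D (x + h *\<^sub>R v + \<xi> *\<^sub>R u) - D (x + \<xi> *\<^sub>R u))"
    using MVT2[OF h d\<phi>] by auto
  obtain \<eta> where \<eta>: "0 < \<eta>" "\<eta> < h" "D (x + \<xi> *\<^sub>R u + h *\<^sub>R v) - D (x + \<xi> *\<^sub>R u + 0 *\<^sub>R v)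
      = (h - 0) * frechet_derivative D (at (x + \<xi> *\<^sub>R u + \<eta> *\<^sub>R v)) v"
    using MVT2[OF h has_real_derivative_along_line[OF D]] by blast
  have "f (x + h *\<^sub>R u + h *\<^sub>R v) - f (x + h *\<^sub>R u) - f (x + h *\<^sub>R v) + f x = \<phi> h - \<phi> 0"
    by (simp add: \<phi>_def algebra_simps)
  also have "\<dots> = h * (D (x + \<xi> *\<^sub>R u + h *\<^sub>R v) - D (x + \<xi> *\<^sub>R u + 0 *\<^sub>R v))"
    using \<xi>(3) by (simp add: algebra_simps)
  also have "\<dots> = h\<^sup>2 * frechet_derivative D (at (x + \<xi> *\<^sub>R u + \<eta> *\<^sub>R v)) v"
    by (simp only: \<eta>(3)) (simp add: power2_eq_square)
  finally show thesis using that \<xi>(1,2) \<eta>(1,2) unfolding D_def by blast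
qed

text \<open>The second difference is symmetric in \<open>u\<close> and \<open>v\<close>, and both mixed derivatives are its limits by continuity.\<close>

lemma symmetric_second_derivative_real:
  assumes f: "smooth (f :: 'v::real_normed_vector \<Rightarrow> real)"
  shows "frechet_derivative (\<lambda>y. frechet_derivative f (at y) u) (at x) v
    = frechet_derivative (\<lambda>y. frechet_derivative f (at y) v) (at x) u"
proof -
  define P where "P y = frechet_derivative (\<lambda>y. frechet_derivative f (at y) u) (at y) v" for y
  define Q where "Q y = frechet_derivative (\<lambda>y. frechet_derivative f (at y) v) (at y) u" for y
  have "smooth P" "smooth Q" unfolding P_def Q_def by (intro smooth_intros f)+
  then have PQ: "continuous_on UNIV P" "continuous_on UNIV Q" by (auto dest: smooth_on_continuous)
  have "\<exists>\<xi> \<eta> \<xi>' \<eta>'. \<xi> \<in> {0<..<h} \<and> \<eta> \<in> {0<..<h} \<and> \<xi>' \<in> {0<..<h} \<and> \<eta>' \<in> {0<..<h} \<and>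
      P (x + \<xi> *\<^sub>R u + \<eta> *\<^sub>R v) = Q (x + \<xi>' *\<^sub>R v + \<eta>' *\<^sub>R u)" if h: "h > 0" for h
  proof -
    obtain \<xi> \<eta> where 1: "0 < \<xi>" "\<xi> < h" "0 < \<eta>" "\<eta> < h"
      "f (x + h *\<^sub>R u + h *\<^sub>R v) - f (x + h *\<^sub>R u) - f (x + h *\<^sub>R v) + f x = h\<^sup>2 * P (x + \<xi> *\<^sub>R u + \<eta> *\<^sub>R v)"
      unfolding P_def using second_difference_mvt[OF f h] by blast
    obtain \<xi>' \<eta>' where 2: "0 < \<xi>'" "\<xi>' < h" "0 < \<eta>'" "\<eta>' < h"
      "f (x + h *\<^sub>R v + h *\<^sub>R u) - f (x + h *\<^sub>R v) - f (x + h *\<^sub>R u) + f x = h\<^sup>2 * Q (x + \<xi>' *\<^sub>R v + \<eta>' *\<^sub>R u)"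
      unfolding Q_def using second_difference_mvt[OF f h] by blast
    have "h\<^sup>2 * P (x + \<xi> *\<^sub>R u + \<eta> *\<^sub>R v) = h\<^sup>2 * Q (x + \<xi>' *\<^sub>R v + \<eta>' *\<^sub>R u)"
      using 1(5) 2(5) by (simp add: algebra_simps)
    then show ?thesis using h 1(1-4) 2(1-4)
      by (intro exI[of _ \<xi>] exI[of _ \<eta>] exI[of _ \<xi>'] exI[of _ \<eta>']) simp
  qed
  then have "\<forall>n. \<exists>\<xi> \<eta> \<xi>' \<eta>'. \<xi> \<in> {0<..<1 / real (Suc n)} \<and> \<eta> \<in> {0<..<1 / real (Suc n)} \<and>
      \<xi>' \<in> {0<..<1 / real (Suc n)} \<and> \<eta>' \<in> {0<..<1 / real (Suc n)} \<and>
      P (x + \<xi> *\<^sub>R u + \<eta> *\<^sub>R v) = Q (x + \<xi>' *\<^sub>R v + \<eta>' *\<^sub>R u)" by simp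
  then obtain a b c d where abcd: "\<And>n. a n \<in> {0<..<1 / real (Suc n)}" "\<And>n. b n \<in> {0<..<1 / real (Suc n)}"
      "\<And>n. c n \<in> {0<..<1 / real (Suc n)}" "\<And>n. d n \<in> {0<..<1 / real (Suc n)}"
    and eq: "\<And>n. P (x + a n *\<^sub>R u + b n *\<^sub>R v) = Q (x + c n *\<^sub>R v + d n *\<^sub>R u)"
    by metis
  have lim: "e \<longlonglongrightarrow> 0" if "\<And>n. e n \<in> {0<..<1 / real (Suc n)}" for e :: "nat \<Rightarrow> real"
    by (rule real_tendsto_sandwich[OF _ _ tendsto_const LIMSEQ_inverse_real_of_nat])
      (use that in \<open>auto simp: less_imp_le inverse_eq_divide\<close>)
  have "(\<lambda>n. x + a n *\<^sub>R u + b n *\<^sub>R v) \<longlonglongrightarrow> x + 0 *\<^sub>R u + 0 *\<^sub>R v"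
    by (intro tendsto_intros lim abcd)
  then have "(\<lambda>n. P (x + a n *\<^sub>R u + b n *\<^sub>R v)) \<longlonglongrightarrow> P x"
    by (intro continuous_on_tendsto_compose[OF PQ(1)]) auto
  moreover have "(\<lambda>n. x + c n *\<^sub>R v + d n *\<^sub>R u) \<longlonglongrightarrow> x + 0 *\<^sub>R v + 0 *\<^sub>R u"
    by (intro tendsto_intros lim abcd)
  then have "(\<lambda>n. Q (x + c n *\<^sub>R v + d n *\<^sub>R u)) \<longlonglongrightarrow> Q x"
    by (intro continuous_on_tendsto_compose[OF PQ(2)]) auto
  ultimately have "P x = Q x" unfolding eq by (rule LIMSEQ_unique)
  then show ?thesis by (simp add: P_def Q_def)
qed

section \<open>Derivatives along vector fields\<close>

context finite_basis begin

lemma fd_crd: "smooth f \<Longrightarrow> frechet_derivative (\<lambda>x. crd b (f x)) (at x) v = crd b (frechet_derivative f (at x) v)"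
  by (rule fd_bounded_linear[OF crd_bounded_linear])

lemma fd_expand: "smooth (f :: 'v \<Rightarrow> 'w::real_normed_vector) \<Longrightarrow> frechet_derivative f (at x) v = (\<Sum>b\<in>B. crd b v *\<^sub>R frechet_derivative f (at x) b)"
  by (rule linear_expand[OF smooth_linear_derivative])

lemma smooth_along [smooth_intros]:
  assumes "smooth (f :: 'v \<Rightarrow> 'w::real_normed_vector)" "smooth X"
  shows "smooth (\<lambda>x. frechet_derivative f (at x) (X x))"
proof -
  have "smooth (\<lambda>x. \<Sum>b\<in>B. crd b (X x) *\<^sub>R frechet_derivative f (at x) b)"
    by (intro smooth_intros assms) auto
  then show ?thesis by (simp add: fd_expand[OF assms(1), symmetric])
qed

lemma smooth_lie_bracket [smooth_intros]:
  "smooth (X :: 'v \<Rightarrow> 'v) \<Longrightarrow> smooth Y \<Longrightarrow> smooth (lie_bracket X Y)"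
  unfolding lie_bracket_def by (intro smooth_on_diff smooth_along) auto

text \<open>The product rule, after expanding the field in coordinates.\<close>

lemma fd_along:
  assumes f: "smooth (f :: 'v \<Rightarrow> 'w::real_normed_vector)" and X: "smooth X"
  shows "frechet_derivative (\<lambda>y. frechet_derivative f (at y) (X y)) (at x) v
    = frechet_derivative (\<lambda>y. frechet_derivative f (at y) (X x)) (at x) v
      + frechet_derivative f (at x) (frechet_derivative X (at x) v)"
proof -
  have s: "smooth (\<lambda>y. crd b (X y))" "smooth (\<lambda>y. frechet_derivative f (at y) b)" for b
    by (rule smooth_on_crd_comp[OF open_UNIV X], rule smooth_on_directional[OF f])
  have "frechet_derivative (\<lambda>y. frechet_derivative f (at y) (X y)) (at x) v
    = frechet_derivative (\<lambda>y. \<Sum>b\<in>B. crd b (X y) *\<^sub>R frechet_derivative f (at y) b) (at x) v"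
    by (simp add: fd_expand[OF f, symmetric])
  also have "\<dots> = (\<Sum>b\<in>B. crd b (X x) *\<^sub>R frechet_derivative (\<lambda>y. frechet_derivative f (at y) b) (at x) v
      + crd b (frechet_derivative X (at x) v) *\<^sub>R frechet_derivative f (at x) b)"
    using s by (simp add: fd_sum[OF finite_B] smooth_on_scaleR fd_scaleR fd_crd[OF X])
  also have "\<dots> = (\<Sum>b\<in>B. crd b (X x) *\<^sub>R frechet_derivative (\<lambda>y. frechet_derivative f (at y) b) (at x) v)
      + frechet_derivative f (at x) (frechet_derivative X (at x) v)"
    by (simp add: sum.distrib fd_expand[OF f, of _ "frechet_derivative X (at x) v"])
  also have "(\<Sum>b\<in>B. crd b (X x) *\<^sub>R frechet_derivative (\<lambda>y. frechet_derivative f (at y) b) (at x) v)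
    = frechet_derivative (\<lambda>y. \<Sum>b\<in>B. crd b (X x) *\<^sub>R frechet_derivative f (at y) b) (at x) v"
    using s by (simp add: fd_sum[OF finite_B] smooth_on_scaleR fd_scaleR smooth_on_const frechet_derivative_const)
  also have "\<dots> = frechet_derivative (\<lambda>y. frechet_derivative f (at y) (X x)) (at x) v"
    by (simp add: fd_expand[OF f, symmetric])
  finally show ?thesis .
qed

text \<open>The second derivatives of \<open>f\<close> cancel by symmetry.\<close>

lemma lie_bracket_derivation_real:
  assumes X: "smooth (X :: 'v \<Rightarrow> 'v)" and Y: "smooth Y" and f: "smooth (f :: 'v \<Rightarrow> real)"
  shows "frechet_derivative f (at x) (lie_bracket X Y x)
    = frechet_derivative (\<lambda>y. frechet_derivative f (at y) (Y y)) (at x) (X x)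
      - frechet_derivative (\<lambda>y. frechet_derivative f (at y) (X y)) (at x) (Y x)"
  by (simp add: fd_along[OF f] X Y lie_bracket_def linear_diff[OF smooth_linear_derivative[OF f]]
      symmetric_second_derivative_real[OF f, of "Y x"])

lemma crd_lie_bracket:
  assumes X: "smooth (X :: 'v \<Rightarrow> 'v)" and Y: "smooth Y"
  shows "crd b (lie_bracket X Y x) = frechet_derivative (\<lambda>y. crd b (Y y)) (at x) (X x)
     - frechet_derivative (\<lambda>y. crd b (X y)) (at x) (Y x)"
  by (simp add: lie_bracket_def linear_diff[OF crd_linear] fd_crd X Y)

text \<open>Each coordinate of an iterated bracket is a combination of iterated derivations of coordinate functions, and the
  combinations for the three cyclic permutations add up to zero.\<close>

lemma lie_bracket_jacobi:
  assumes X: "smooth (X :: 'v \<Rightarrow> 'v)" and Y: "smooth Y" and Z: "smooth Z"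
  shows "lie_bracket X (lie_bracket Y Z) x + lie_bracket Y (lie_bracket Z X) x + lie_bracket Z (lie_bracket X Y) x = 0"
proof (rule eq_if_crd)
  fix b
  define D where "D W f = (\<lambda>x. frechet_derivative f (at x) (W x :: 'v))" for W and f :: "'v \<Rightarrow> real"
  have c: "smooth (\<lambda>y. crd b (W y))" if "smooth W" for W :: "'v \<Rightarrow> 'v"
    using that by (intro smooth_intros) auto
  have sD: "smooth (D W f)" if "smooth W" "smooth f" for W f
    unfolding D_def by (intro smooth_intros that)
  have br: "(\<lambda>y. crd b (lie_bracket U W y)) = (\<lambda>y. D U (\<lambda>y. crd b (W y)) y - D W (\<lambda>y. crd b (U y)) y)"
    if "smooth U" "smooth W" for U W by (simp add: crd_lie_bracket[OF that] D_def)
  have br2: "D (lie_bracket U W) f x = D U (D W f) x - D W (D U f) x"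
    if "smooth U" "smooth W" "smooth f" for U W f
    using lie_bracket_derivation_real[OF that] by (simp add: D_def)
  have dd: "D W (\<lambda>y. f y - g y) x = D W f x - D W g x" if "smooth f" "smooth g" for W f g
    by (simp add: D_def fd_diff[OF that])
  have one: "crd b (lie_bracket U (lie_bracket V W) x)
     = D U (D V (\<lambda>y. crd b (W y))) x - D U (D W (\<lambda>y. crd b (V y))) x
       - (D V (D W (\<lambda>y. crd b (U y))) x - D W (D V (\<lambda>y. crd b (U y))) x)"
    if "smooth U" "smooth V" "smooth W" for U V W
  proof -
    have "crd b (lie_bracket U (lie_bracket V W) x)
      = D U (\<lambda>y. crd b (lie_bracket V W y)) x - D (lie_bracket V W) (\<lambda>y. crd b (U y)) x"
      using fun_cong[OF br[OF that(1) smooth_lie_bracket[OF that(2,3)]], of x] by simp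
    then show ?thesis
      by (simp add: br[OF that(2,3)] br2[OF that(2,3) c[OF that(1)]] dd sD c that)
  qed
  show "crd b (lie_bracket X (lie_bracket Y Z) x + lie_bracket Y (lie_bracket Z X) x
      + lie_bracket Z (lie_bracket X Y) x) = crd b 0"
    by (simp add: linear_add[OF crd_linear] linear_0[OF crd_linear] one X Y Z)
qed

lemma lie_bracket_add_left: "smooth X \<Longrightarrow> smooth X' \<Longrightarrow> smooth Y \<Longrightarrow>
    lie_bracket (\<lambda>x. X x + X' x) Y = (\<lambda>x. lie_bracket X Y x + lie_bracket X' Y x)"
  by (simp add: lie_bracket_def fun_eq_iff fd_add linear_add[OF smooth_linear_derivative])

lemma lie_bracket_add_right: "smooth X \<Longrightarrow> smooth Y \<Longrightarrow> smooth Y' \<Longrightarrow>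
    lie_bracket X (\<lambda>x. Y x + Y' x) = (\<lambda>x. lie_bracket X Y x + lie_bracket X Y' x)"
  by (simp add: lie_bracket_def fun_eq_iff fd_add linear_add[OF smooth_linear_derivative])

lemma lie_bracket_scale_left: "smooth X \<Longrightarrow> smooth Y \<Longrightarrow> smooth f \<Longrightarrow>
    lie_bracket (\<lambda>x. f x *\<^sub>R X x) Y
      = (\<lambda>x. f x *\<^sub>R lie_bracket X Y x + (- frechet_derivative f (at x) (Y x)) *\<^sub>R X x)"
  by (simp add: lie_bracket_def fun_eq_iff fd_scaleR linear_scale[OF smooth_linear_derivative] algebra_simps)

lemma lie_bracket_scale_right: "smooth X \<Longrightarrow> smooth Y \<Longrightarrow> smooth f \<Longrightarrow>
    lie_bracket X (\<lambda>x. f x *\<^sub>R Y x)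
      = (\<lambda>x. f x *\<^sub>R lie_bracket X Y x + frechet_derivative f (at x) (X x) *\<^sub>R Y x)"
  by (simp add: lie_bracket_def fun_eq_iff fd_scaleR linear_scale[OF smooth_linear_derivative] algebra_simps)

lemma smooth_linear: "linear A \<Longrightarrow> smooth (A :: 'v \<Rightarrow> 'w::real_normed_vector)"
  using smooth_on_bounded_linear[OF open_UNIV linear_bounded smooth_on_id] by simp

lemma fd_linear_map: "linear (A :: 'v \<Rightarrow> 'w::real_normed_vector) \<Longrightarrow> frechet_derivative A (at x) = A"
  by (rule fd_linear[OF linear_bounded])

lemma lie_bracket_linear: "linear (A :: 'v \<Rightarrow> 'v) \<Longrightarrow> linear C \<Longrightarrow> lie_bracket A C = (\<lambda>v. C (A v) - A (C v))"
  by (simp add: lie_bracket_def fd_linear_map fun_eq_iff)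

end

section \<open>Radial averages\<close>

text \<open>At every point of \<open>S\<close> continuity gives a radius that may depend on the point; the Lebesgue number of the
  cover of \<open>S\<close> by preimages of small balls is a common one, also towards points outside \<open>S\<close>.\<close>

lemma uniform_near_compact:
  fixes \<phi> :: "'v::metric_space \<Rightarrow> real"
  assumes "compact S" "continuous_on UNIV \<phi>" "e > 0"
  obtains d where "d > 0" "\<And>x y. x \<in> S \<Longrightarrow> dist x y < d \<Longrightarrow> \<bar>\<phi> y - \<phi> x\<bar> < e"
proof -
  define G where "G = {\<phi> -` ball c (e / 2) | c. True}"
  have "open T" if "T \<in> G" for T
    using that assms(2) by (auto simp: G_def intro: open_vimage)
  moreover have "S \<subseteq> \<Union>G"
  proof
    fix x assume "x \<in> S"
    have "x \<in> \<phi> -` ball (\<phi> x) (e / 2)" using assms(3) by simp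
    then show "x \<in> \<Union>G" unfolding G_def by blast
  qed
  ultimately obtain d where d: "d > 0" "\<And>x. x \<in> S \<Longrightarrow> \<exists>T\<in>G. ball x d \<subseteq> T"
    using Heine_Borel_lemma[OF assms(1), of G] by blast
  have "\<bar>\<phi> y - \<phi> x\<bar> < e" if x: "x \<in> S" and y: "dist x y < d" for x y
  proof -
    obtain c where "ball x d \<subseteq> \<phi> -` ball c (e / 2)" using d(2)[OF x] by (auto simp: G_def)
    then have "dist c (\<phi> x) < e / 2" "dist c (\<phi> y) < e / 2" using y d(1) by (auto simp: subset_iff)
    then show ?thesis unfolding dist_real_def by linarith
  qed
  then show thesis using that d(1) by blast
qed

context finite_basis begin

lemma crd_sum_bound: obtains C where "C > 0" "\<And>h. (\<Sum>b\<in>B. \<bar>crd b h\<bar>) \<le> C * norm h"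
proof -
  have "\<forall>b. \<exists>K>0. \<forall>h. norm (crd b h) \<le> norm h * K"
    using bounded_linear.pos_bounded[OF crd_bounded_linear] by blast
  then obtain K where K: "\<And>b. K b > 0" "\<And>b h. norm (crd b h) \<le> norm h * K b" by metis
  have "(\<Sum>b\<in>B. \<bar>crd b h\<bar>) \<le> (1 + (\<Sum>b\<in>B. K b)) * norm h" for h
  proof -
    have "(\<Sum>b\<in>B. \<bar>crd b h\<bar>) \<le> (\<Sum>b\<in>B. norm h * K b)" using K(2) by (intro sum_mono) simp
    also have "\<dots> \<le> (1 + (\<Sum>b\<in>B. K b)) * norm h" by (simp add: algebra_simps sum_distrib_left)
    finally show ?thesis .
  qed
  moreover have "(\<Sum>b\<in>B. K b) \<ge> 0" using K(1) by (intro sum_nonneg) (simp add: less_imp_le)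
  ultimately show thesis using that by (smt (verit))
qed

text \<open>The mean value theorem expresses the error by differences of partial derivatives, which are uniformly small
  near the compact segment. The uniformity in \<open>t\<close> is what permits differentiation under the integral sign.\<close>

lemma uniform_taylor:
  assumes g: "smooth (g :: 'v \<Rightarrow> real)" and e: "e > 0"
  obtains d where "d > 0" "\<And>t h. t \<in> {0..1} \<Longrightarrow> norm h < d \<Longrightarrow>
    \<bar>g (t *\<^sub>R (x + h)) - g (t *\<^sub>R x) - frechet_derivative g (at (t *\<^sub>R x)) (t *\<^sub>R h)\<bar> \<le> e * norm h"
proof -
  obtain C where C: "C > 0" "\<And>h. (\<Sum>b\<in>B. \<bar>crd b h\<bar>) \<le> C * norm h" using crd_sum_bound by blast
  have "compact ((\<lambda>t. t *\<^sub>R x) ` {0..1::real})"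
    by (intro compact_continuous_image continuous_intros) auto
  then have "\<forall>b. \<exists>d>0. \<forall>t\<in>{0..1}. \<forall>y. dist (t *\<^sub>R x) y < d \<longrightarrow>
      \<bar>frechet_derivative g (at y) b - frechet_derivative g (at (t *\<^sub>R x)) b\<bar> < e / C"
    using uniform_near_compact[of "(\<lambda>t. t *\<^sub>R x) ` {0..1::real}", of "\<lambda>y. frechet_derivative g (at y) _" "e / C"]
      smooth_on_continuous[OF smooth_on_directional[OF g]] e C(1)
    by (metis (no_types, lifting) divide_pos_pos imageI)
  then obtain D where D: "\<And>b. D b > 0" "\<And>b t y. t \<in> {0..1} \<Longrightarrow> dist (t *\<^sub>R x) y < D b \<Longrightarrow>
      \<bar>frechet_derivative g (at y) b - frechet_derivative g (at (t *\<^sub>R x)) b\<bar> < e / C" by metis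
  define d where "d = Min (insert 1 (D ` B))"
  have d: "d > 0" "\<And>b. b \<in> B \<Longrightarrow> d \<le> D b" using D(1) finite_B by (auto simp: d_def)
  have "\<bar>g (t *\<^sub>R (x + h)) - g (t *\<^sub>R x) - frechet_derivative g (at (t *\<^sub>R x)) (t *\<^sub>R h)\<bar> \<le> e * norm h"
    if t: "t \<in> {0..1}" and h: "norm h < d" for t h
  proof -
    obtain z where z: "0 < z" "z < 1"
      "g (t *\<^sub>R x + 1 *\<^sub>R (t *\<^sub>R h)) - g (t *\<^sub>R x + 0 *\<^sub>R (t *\<^sub>R h))
        = (1 - 0) * frechet_derivative g (at (t *\<^sub>R x + z *\<^sub>R (t *\<^sub>R h))) (t *\<^sub>R h)"
      using MVT2[OF _ has_real_derivative_along_line[OF g], of 0 1 "t *\<^sub>R x" "t *\<^sub>R h"] by auto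
    define y where "y = t *\<^sub>R x + z *\<^sub>R (t *\<^sub>R h)"
    have "norm ((z * t) *\<^sub>R h) \<le> 1 * norm h" unfolding norm_scaleR using z t
      by (intro mult_right_mono) (auto simp: abs_mult intro: mult_le_one)
    then have y: "dist (t *\<^sub>R x) y < d" using h by (simp add: y_def dist_norm)
    have "g (t *\<^sub>R (x + h)) - g (t *\<^sub>R x) - frechet_derivative g (at (t *\<^sub>R x)) (t *\<^sub>R h)
      = frechet_derivative g (at y) (t *\<^sub>R h) - frechet_derivative g (at (t *\<^sub>R x)) (t *\<^sub>R h)"
      using z(3) by (simp add: y_def scaleR_add_right)
    also have "\<dots> = (\<Sum>b\<in>B. crd b (t *\<^sub>R h) * (frechet_derivative g (at y) b - frechet_derivative g (at (t *\<^sub>R x)) b))"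
      by (simp add: fd_expand[OF g, of _ "t *\<^sub>R h"] sum_subtractf right_diff_distrib)
    also have "\<bar>\<dots>\<bar> \<le> (\<Sum>b\<in>B. \<bar>crd b (t *\<^sub>R h)\<bar> * (e / C))"
    proof (rule order_trans[OF sum_abs sum_mono])
      fix b assume b: "b \<in> B"
      show "\<bar>crd b (t *\<^sub>R h) * (frechet_derivative g (at y) b - frechet_derivative g (at (t *\<^sub>R x)) b)\<bar>
        \<le> \<bar>crd b (t *\<^sub>R h)\<bar> * (e / C)"
        unfolding abs_mult using D(2)[OF t, of y b] y d(2)[OF b] by (intro mult_left_mono) auto
    qed
    also have "\<dots> = (\<Sum>b\<in>B. \<bar>crd b (t *\<^sub>R h)\<bar>) * (e / C)" by (simp only: sum_distrib_right)
    also have "\<dots> \<le> (C * norm (t *\<^sub>R h)) * (e / C)"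
      by (rule mult_right_mono[OF C(2)]) (use C(1) e in auto)
    also have "\<dots> = norm (t *\<^sub>R h) * e" using C(1) by simp
    also have "\<dots> \<le> norm h * e" using t e by (intro mult_right_mono) (auto intro: mult_left_le_one_le)
    finally show ?thesis by (simp add: mult.commute)
  qed
  then show thesis using that d(1) by blast
qed

text \<open>The homotopy that contracts \<open>V\<close> along rays to the origin is built from these averages.\<close>

definition radial_average :: "nat \<Rightarrow> ('v \<Rightarrow> real) \<Rightarrow> 'v \<Rightarrow> real" where
  "radial_average m g x = integral {0..1} (\<lambda>t. t ^ m * g (t *\<^sub>R x))"

lemma radial_integrable:
  assumes "smooth g" shows "(\<lambda>t. t ^ m * g (t *\<^sub>R x)) integrable_on {0..1::real}"
  by (intro integrable_continuous_interval continuous_intros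
      continuous_on_compose2[OF smooth_on_continuous[OF assms]]) auto

text \<open>Differentiation under the integral produces a further factor \<open>t\<close>, so the family of all radial averages is closed under
  differentiation.\<close>

lemma radial_average_has_derivative:
  assumes g: "smooth g"
  shows "(radial_average m g has_derivative
    (\<lambda>v. \<Sum>b\<in>B. crd b v * radial_average (Suc m) (\<lambda>y. frechet_derivative g (at y) b) x)) (at x)"
  unfolding has_derivative_at_alt
proof (intro conjI allI impI)
  let ?D = "\<lambda>b y. frechet_derivative g (at y) b"
  let ?L = "\<lambda>v. \<Sum>b\<in>B. crd b v * radial_average (Suc m) (?D b) x"
  show "bounded_linear ?L"
    by (rule bounded_linear_sum, rule bounded_linear_mult_const, rule crd_bounded_linear)
  fix e :: real assume e: "e > 0"
  obtain d where d: "d > 0" "\<And>t h. t \<in> {0..1} \<Longrightarrow> norm h < d \<Longrightarrow>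
    \<bar>g (t *\<^sub>R (x + h)) - g (t *\<^sub>R x) - frechet_derivative g (at (t *\<^sub>R x)) (t *\<^sub>R h)\<bar> \<le> e * norm h"
    using uniform_taylor[OF g e] by blast
  have "norm (radial_average m g y - radial_average m g x - ?L (y - x)) \<le> e * norm (y - x)"
    if y: "norm (y - x) < d" for y
  proof -
    define h where "h = y - x"
    have I: "((\<lambda>t. t ^ k * f (t *\<^sub>R z)) has_integral radial_average k f z) {0..1}" if "smooth f" for k f z
      unfolding radial_average_def by (rule integrable_integral[OF radial_integrable[OF that]])
    have "((\<lambda>t. t ^ m * g (t *\<^sub>R y) - t ^ m * g (t *\<^sub>R x)
          - (\<Sum>b\<in>B. crd b h * (t ^ Suc m * ?D b (t *\<^sub>R x))))
        has_integral radial_average m g y - radial_average m g x - ?L h) {0..1}"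
      by (intro has_integral_diff has_integral_sum finite_B has_integral_mult_right I g smooth_on_directional)
    moreover have "norm (t ^ m * g (t *\<^sub>R y) - t ^ m * g (t *\<^sub>R x)
          - (\<Sum>b\<in>B. crd b h * (t ^ Suc m * ?D b (t *\<^sub>R x)))) \<le> e * norm h" if t: "t \<in> {0..1}" for t
    proof -
      have lin: "frechet_derivative g (at (t *\<^sub>R x)) (t *\<^sub>R h) = (\<Sum>b\<in>B. crd b h * (t * ?D b (t *\<^sub>R x)))"
        by (simp add: linear_scale[OF smooth_linear_derivative[OF g]] fd_expand[OF g, of _ h] sum_distrib_left ac_simps)
      have "t ^ m * g (t *\<^sub>R y) - t ^ m * g (t *\<^sub>R x) - (\<Sum>b\<in>B. crd b h * (t ^ Suc m * ?D b (t *\<^sub>R x)))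
        = t ^ m * (g (t *\<^sub>R (x + h)) - g (t *\<^sub>R x) - frechet_derivative g (at (t *\<^sub>R x)) (t *\<^sub>R h))"
        unfolding lin by (simp add: h_def right_diff_distrib sum_distrib_left ac_simps)
      also have "norm \<dots> \<le> 1 * (e * norm h)"
        unfolding norm_mult
      proof (rule mult_mono)
        show "norm (t ^ m) \<le> 1" using t by (simp add: power_le_one)
      qed (use t y d(2)[OF t, of h] in \<open>auto simp: h_def\<close>)
      finally show ?thesis by simp
    qed
    ultimately have "norm (radial_average m g y - radial_average m g x - ?L h) \<le> e * norm h * measure lborel {0..1::real}"
      using e by (intro has_integral_bound_real[where f = "\<lambda>t. t ^ m * g (t *\<^sub>R y) - t ^ m * g (t *\<^sub>R x)
          - (\<Sum>b\<in>B. crd b h * (t ^ Suc m * ?D b (t *\<^sub>R x)))"]) auto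
    then show ?thesis by (simp add: h_def)
  qed
  then show "\<exists>d>0. \<forall>y. norm (y - x) < d \<longrightarrow>
      norm (radial_average m g y - radial_average m g x - ?L (y - x)) \<le> e * norm (y - x)"
    using d(1) by blast
qed

lemma smooth_radial_average [smooth_intros]:
  assumes "smooth g" shows "smooth (radial_average m g)"
proof -
  have "Ck_on k UNIV (radial_average m g)" for k
    using assms
  proof (induction k arbitrary: m g)
    case 0
    show ?case
      using has_derivative_continuous[OF radial_average_has_derivative[OF 0]]
      by (simp add: continuous_on_eq_continuous_at)
  next
    case (Suc k)
    have "Ck_on k UNIV (\<lambda>x. crd b v * radial_average (Suc m) (\<lambda>y. frechet_derivative g (at y) b) x)" for b v
      using smooth_on_directional[OF Suc.prems] by (intro Ck_on_bilinear[OF _ bounded_bilinear_mult] Ck_on_const Suc.IH) auto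
    then have "Ck_on k UNIV (\<lambda>x. \<Sum>b\<in>C. crd b v * radial_average (Suc m) (\<lambda>y. frechet_derivative g (at y) b) x)" for v C
      by (induction C rule: infinite_finite_induct) (auto intro: Ck_on_add Ck_on_const)
    then show ?case
      by (intro Ck_on_SucI[OF open_UNIV radial_average_has_derivative[OF Suc.prems]]) auto
  qed
  then show ?thesis by (simp add: smooth_on_def)
qed

text \<open>The hypothesis says that the integrand is the derivative of \<open>t\<^sup>m f(t x)\<close> in \<open>t\<close>.\<close>

lemma radial_average_fundamental:
  assumes f: "smooth (f :: 'v \<Rightarrow> real)" and g: "smooth g"
    and eq: "\<And>t. 0 < t \<Longrightarrow> t < 1 \<Longrightarrow>
      t ^ m * g (t *\<^sub>R x) = real m * t ^ (m - 1) * f (t *\<^sub>R x) + t ^ m * frechet_derivative f (at (t *\<^sub>R x)) x"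
  shows "radial_average m g x = f x - 0 ^ m * f 0"
proof -
  have "((\<lambda>t. t ^ m * g (t *\<^sub>R x)) has_integral 1 ^ m * f (1 *\<^sub>R x) - 0 ^ m * f (0 *\<^sub>R x)) {0..1}"
  proof (rule fundamental_theorem_of_calculus_interior)
    show "continuous_on {0..1} (\<lambda>t. t ^ m * f (t *\<^sub>R x))"
      by (intro continuous_intros continuous_on_compose2[OF smooth_on_continuous[OF f]]) auto
    fix t :: real assume t: "t \<in> {0<..<1}"
    have "((\<lambda>t. t ^ m * f (0 + t *\<^sub>R x)) has_real_derivative
        real m * t ^ (m - 1) * f (0 + t *\<^sub>R x) + t ^ m * frechet_derivative f (at (0 + t *\<^sub>R x)) x) (at t)"
      by (rule DERIV_cong[OF DERIV_mult[OF DERIV_pow has_real_derivative_along_line[OF f]]]) simp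
    then show "((\<lambda>t. t ^ m * f (t *\<^sub>R x)) has_vector_derivative t ^ m * g (t *\<^sub>R x)) (at t)"
      using eq t by (simp add: has_real_derivative_iff_has_vector_derivative)
  qed simp
  then show ?thesis unfolding radial_average_def by (simp add: integral_unique)
qed


end

section \<open>Alternating maps\<close>

text \<open>The condition imposed on the values of scalar forms, for values in an arbitrary vector space: the coefficients will
  be vector fields and sections of bundles.\<close>

definition altmap :: "nat \<Rightarrow> ('v::real_vector list \<Rightarrow> 'w::real_vector) \<Rightarrow> bool" where
  "altmap i \<omega> \<longleftrightarrow>
     (\<forall>vs. length vs \<noteq> i \<longrightarrow> \<omega> vs = 0) \<and>
     (\<forall>vs j. length vs = i \<and> j < i \<longrightarrow> linear (\<lambda>v. \<omega> (vs[j := v]))) \<and>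
     (\<forall>vs. \<not> distinct vs \<longrightarrow> \<omega> vs = 0)"

lemma alternating_form_iff: "alternating_form i = altmap i"
  unfolding alternating_form_def altmap_def fun_eq_iff by simp

lemma altmapI:
  assumes "\<And>vs. length vs \<noteq> i \<Longrightarrow> \<omega> vs = 0"
    "\<And>vs j. length vs = i \<Longrightarrow> j < i \<Longrightarrow> linear (\<lambda>v. \<omega> (vs[j := v]))"
    "\<And>xs y ys zs. length (xs @ y # ys @ y # zs) = i \<Longrightarrow> \<omega> (xs @ y # ys @ y # zs) = 0"
  shows "altmap i \<omega>"
  unfolding altmap_def
proof (intro conjI allI impI)
  fix vs :: "'a list" assume "\<not> distinct vs"
  then obtain xs y ys zs where "vs = xs @ y # ys @ y # zs" using not_distinct_decomp by fastforce
  then show "\<omega> vs = 0" using assms(1,3) by metis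
qed (use assms in auto)

lemma altmap_length: "altmap i \<omega> \<Longrightarrow> length vs \<noteq> i \<Longrightarrow> \<omega> vs = 0"
  unfolding altmap_def by blast

lemma altmap_slot: "altmap i \<omega> \<Longrightarrow> length vs = i \<Longrightarrow> j < i \<Longrightarrow> linear (\<lambda>v. \<omega> (vs[j := v]))"
  unfolding altmap_def by blast

lemma altmap_not_distinct: "altmap i \<omega> \<Longrightarrow> \<not> distinct vs \<Longrightarrow> \<omega> vs = 0"
  unfolding altmap_def by blast

lemma linear_zero_map: "linear (\<lambda>_. 0)"
  by (rule linearI) auto

lemma linear_scaleR_vec: "linear f \<Longrightarrow> linear (\<lambda>v. f v *\<^sub>R c)"
  by (rule linearI) (simp_all add: linear_add linear_scale scaleR_add_left)

lemma altmap_linear: "altmap i \<omega> \<Longrightarrow> linear (\<lambda>v. \<omega> (xs @ v # ys))"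
  using altmap_slot[of i \<omega> "xs @ undefined # ys" "length xs"] linear_zero_map altmap_length[of i \<omega>]
  by (cases "length (xs @ undefined # ys) = i") (auto simp: list_update_append)

lemma altmap_linear_Cons: "altmap i \<omega> \<Longrightarrow> linear (\<lambda>v. \<omega> (v # ys))"
  using altmap_linear[of i \<omega> "[]"] by simp

text \<open>Polarisation: the form vanishes on the list in which both entries are \<open>a + b\<close>.\<close>

lemma altmap_swap:
  assumes "altmap i \<omega>"
  shows "\<omega> (xs @ a # ys @ b # zs) = - \<omega> (xs @ b # ys @ a # zs)"
proof -
  define f where "f u v = \<omega> (xs @ u # ys @ v # zs)" for u v
  have 1: "linear (\<lambda>u. f u v)" for v unfolding f_def by (rule altmap_linear[OF assms])
  have 2: "linear (\<lambda>v. f u v)" for u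
    unfolding f_def using altmap_linear[OF assms, of "xs @ u # ys" zs] by simp
  have 0: "f u u = 0" for u unfolding f_def by (rule altmap_not_distinct[OF assms]) simp
  have "f (a + b) (a + b) = f a a + f a b + (f b a + f b b)"
    by (simp only: linear_add[OF 1] linear_add[OF 2] ac_simps)
  then have "f a b + f b a = 0" by (simp add: 0)
  then show ?thesis unfolding f_def by (simp add: eq_neg_iff_add_eq_0)
qed

text \<open>One transposition of neighbours for each element of the block.\<close>

lemma altmap_move:
  assumes "altmap i \<omega>"
  shows "\<omega> (xs @ ys @ a # zs) = (- 1) ^ length ys *\<^sub>R \<omega> (xs @ a # ys @ zs)"
proof (induction ys arbitrary: xs)
  case (Cons y ys)
  have "\<omega> (xs @ (y # ys) @ a # zs) = (- 1) ^ length ys *\<^sub>R \<omega> (xs @ y # a # ys @ zs)"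
    using Cons.IH[of "xs @ [y]"] by simp
  also have "\<omega> (xs @ y # a # ys @ zs) = - \<omega> (xs @ a # y # ys @ zs)"
    using altmap_swap[OF assms, of xs y "[]" a "ys @ zs"] by simp
  finally show ?case by simp
qed simp

lemma altmap_zero: "altmap i (\<lambda>_. 0)"
  by (intro altmapI) (auto simp: linear_zero_map)

lemma altmap_add: "altmap i \<omega> \<Longrightarrow> altmap i \<eta> \<Longrightarrow> altmap i (\<lambda>vs. \<omega> vs + \<eta> vs)"
  unfolding altmap_def by (auto intro: linear_compose_add)

lemma altmap_scale: "altmap i \<omega> \<Longrightarrow> altmap i (\<lambda>vs. c *\<^sub>R \<omega> vs)"
  unfolding altmap_def by (auto intro: linear_compose_scale_right)

lemma altmap_sum: "(\<And>k. k \<in> I \<Longrightarrow> altmap i (\<omega> k)) \<Longrightarrow> altmap i (\<lambda>vs. \<Sum>k\<in>I. \<omega> k vs)"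
  by (induction I rule: infinite_finite_induct) (auto intro: altmap_zero altmap_add)

text \<open>Bundle maps are linear on fibres, which are only subsets of the type in which the values lie; this is the
  role of the set \<open>S\<close>.\<close>

lemma altmap_compose:
  assumes "altmap i \<omega>" "\<And>vs. \<omega> vs \<in> S"
    "\<And>u v. u \<in> S \<Longrightarrow> v \<in> S \<Longrightarrow> L (u + v) = L u + L v"
    "\<And>c u. u \<in> S \<Longrightarrow> L (c *\<^sub>R u) = c *\<^sub>R L u"
  shows "altmap i (\<lambda>vs. L (\<omega> vs))"
proof -
  have L0: "L 0 = 0" if "0 \<in> S" using assms(4)[OF that, of 0] by simp
  have *: "L (\<omega> vs) = 0" if "\<omega> vs = 0" for vs using assms(2)[of vs] L0 that by simp
  show ?thesis
  proof (rule altmapI)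
    fix vs :: "'a list" and j assume "length vs = i" "j < i"
    note lin = altmap_slot[OF assms(1) this]
    show "linear (\<lambda>v. L (\<omega> (vs[j := v])))"
      by (rule linearI) (simp_all add: linear_add[OF lin] linear_scale[OF lin] assms(2-4))
  qed (auto intro!: * intro: altmap_length[OF assms(1)] altmap_not_distinct[OF assms(1)])
qed

lemma altmap_scale_vec: "altmap i \<omega> \<Longrightarrow> altmap i (\<lambda>vs. \<omega> vs *\<^sub>R c)"
  by (rule altmap_compose[where S = UNIV]) (simp_all add: scaleR_add_left)

lemma altmap_contract: "altmap (Suc i) \<omega> \<Longrightarrow> altmap i (\<lambda>vs. \<omega> (v # vs))"
proof (rule altmapI)
  fix vs :: "'a list" and j assume "altmap (Suc i) \<omega>" "length vs = i" "j < i"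
  then show "linear (\<lambda>u. \<omega> (v # vs[j := u]))"
    using altmap_slot[of "Suc i" \<omega> "v # vs" "Suc j"] by simp
qed (auto intro: altmap_length altmap_not_distinct)

text \<open>This is the action of an endomorphism on alternating maps. On a list with a repeated vector only the two slots
  of its copies contribute, and their contributions cancel by skew-symmetry.\<close>

lemma altmap_derivation:
  fixes \<omega> :: "'v::real_vector list \<Rightarrow> 'w::real_vector"
  assumes "altmap i \<omega>" "linear A"
  shows "altmap i (\<lambda>vs. \<Sum>j<length vs. \<omega> (vs[j := A (vs ! j)]))"
proof (rule altmapI)
  fix vs :: "'v list" assume "length vs \<noteq> i"
  then show "(\<Sum>j<length vs. \<omega> (vs[j := A (vs ! j)])) = 0"
    by (intro sum.neutral ballI altmap_length[OF assms(1)]) simp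
next
  fix vs :: "'v list" and k assume vs: "length vs = i" "k < i"
  have "linear (\<lambda>v. \<omega> ((vs[k := v])[j := A (vs[k := v] ! j)]))" if "j < i" for j
  proof (cases "j = k")
    case True
    then show ?thesis
      using linear_compose[OF assms(2) altmap_slot[OF assms(1) vs]] vs by (simp add: o_def)
  next
    case False
    then show ?thesis
      using altmap_slot[OF assms(1), of "vs[j := A (vs ! j)]" k] vs by (simp add: list_update_swap)
  qed
  then show "linear (\<lambda>v. \<Sum>j<length (vs[k := v]). \<omega> ((vs[k := v])[j := A (vs[k := v] ! j)]))"
    using vs by (auto intro!: linear_compose_sum)
next
  fix xs ys zs :: "'v list" and y assume "length (xs @ y # ys @ y # zs) = i"
  define vs p q where "vs = xs @ y # ys @ y # zs" and "p = length xs" and "q = length xs + Suc (length ys)"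
  have nth: "vs ! p = y" "vs ! q = y" "p < length vs" "q < length vs" "p \<noteq> q"
    by (auto simp: vs_def p_def q_def nth_append)
  have "\<omega> (vs[j := A (vs ! j)]) = 0" if "j < length vs" "j \<noteq> p" "j \<noteq> q" for j
  proof (rule altmap_not_distinct[OF assms(1)])
    have "vs[j := A (vs ! j)] ! p = vs[j := A (vs ! j)] ! q" using that nth by simp
    then show "\<not> distinct (vs[j := A (vs ! j)])" using nth by (metis length_list_update nth_eq_iff_index_eq)
  qed
  then have "(\<Sum>j<length vs. \<omega> (vs[j := A (vs ! j)])) = (\<Sum>j\<in>{p, q}. \<omega> (vs[j := A (vs ! j)]))"
    using nth by (intro sum.mono_neutral_right) auto
  also have "\<dots> = \<omega> (vs[p := A y]) + \<omega> (vs[q := A y])" using nth by simp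
  also have "vs[p := A y] = xs @ A y # ys @ y # zs" by (simp add: vs_def p_def list_update_append)
  also have "vs[q := A y] = xs @ y # ys @ A y # zs" by (simp add: vs_def q_def list_update_append)
  also have "\<omega> (xs @ A y # ys @ y # zs) + \<omega> (xs @ y # ys @ A y # zs) = 0"
    using altmap_swap[OF assms(1), of xs y ys "A y" zs] by simp
  finally show "(\<Sum>j<length (xs @ y # ys @ y # zs). \<omega> ((xs @ y # ys @ y # zs)[j := A ((xs @ y # ys @ y # zs) ! j)])) = 0"
    unfolding vs_def .
qed

section \<open>Antisymmetrisation\<close>

definition del :: "nat \<Rightarrow> 'a list \<Rightarrow> 'a list" where
  "del j xs = take j xs @ drop (Suc j) xs"

lemma del_Cons [simp]: "del 0 (x # xs) = xs" "del (Suc j) (x # xs) = x # del j xs"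
  by (simp_all add: del_def)

lemma del_append: "del j (xs @ ys) = (if j < length xs then del j xs @ ys else xs @ del (j - length xs) ys)"
  by (auto simp: del_def Suc_diff_le)

lemma length_del [simp]: "j < length xs \<Longrightarrow> length (del j xs) = length xs - 1"
  by (simp add: del_def)

lemma del_update: "k < length xs \<Longrightarrow> j < length xs \<Longrightarrow> del j (xs[k := v])
    = (if j = k then del k xs else if j < k then (del j xs)[k - 1 := v] else (del j xs)[k := v])"
proof (induction xs arbitrary: j k)
  case (Cons x xs)
  then show ?case by (cases j; cases k) (auto split: nat.split)
qed simp

lemma altmap_front:
  assumes "altmap i \<omega>" "j < length vs"
  shows "\<omega> (vs ! j # del j vs) = (- 1) ^ j *\<^sub>R \<omega> vs"
proof -
  have "\<omega> vs = (- 1) ^ length (take j vs) *\<^sub>R \<omega> (vs ! j # take j vs @ drop (Suc j) vs)"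
    using altmap_move[OF assms(1), of "[]" "take j vs" "vs ! j" "drop (Suc j) vs"] assms(2)
    by (simp add: id_take_nth_drop[symmetric])
  then show ?thesis using assms(2) by (simp add: del_def)
qed

text \<open>Antisymmetrises a map that is already alternating in all arguments but the first. Applied to directional derivatives
  it gives the exterior derivative, applied to a product the wedge product with a one-form.\<close>

definition alternize :: "nat \<Rightarrow> ('v \<Rightarrow> 'v list \<Rightarrow> 'w::real_vector) \<Rightarrow> 'v list \<Rightarrow> 'w" where
  "alternize i A vs = (if length vs = Suc i then \<Sum>j<Suc i. (- 1) ^ j *\<^sub>R A (vs ! j) (del j vs) else 0)"

text \<open>Of the terms for a list with a repeated vector, only those remain that delete one of the two
  copies, and they cancel.\<close>

lemma altmap_alternize:
  fixes A :: "'v::real_vector \<Rightarrow> 'v list \<Rightarrow> 'w::real_vector"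
  assumes alt: "\<And>v. altmap i (A v)" and lin: "\<And>vs. linear (\<lambda>v. A v vs)"
  shows "altmap (Suc i) (alternize i A)"
proof (rule altmapI)
  fix vs :: "'v list" and k assume vs: "length vs = Suc i" "k < Suc i"
  have "linear (\<lambda>v. (- 1) ^ j *\<^sub>R A (vs[k := v] ! j) (del j (vs[k := v])))" if j: "j < Suc i" for j
  proof -
    consider "j = k" | "j < k" | "j > k" by linarith
    then have "linear (\<lambda>v. A (vs[k := v] ! j) (del j (vs[k := v])))"
    proof cases
      case 1
      then show ?thesis using vs lin by (simp add: del_update)
    next
      case 2
      then show ?thesis using vs j altmap_slot[OF alt, of "del j vs" "k - 1" "vs ! j"] by (simp add: del_update)
    next
      case 3
      then show ?thesis using vs j altmap_slot[OF alt, of "del j vs" k "vs ! j"] by (simp add: del_update)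
    qed
    then show ?thesis by (rule linear_compose_scale_right)
  qed
  then show "linear (\<lambda>v. alternize i A (vs[k := v]))"
    unfolding alternize_def using vs by (auto intro!: linear_compose_sum simp del: sum.lessThan_Suc)
next
  fix xs ys zs :: "'v list" and y assume len: "length (xs @ y # ys @ y # zs) = Suc i"
  define vs p q where "vs = xs @ y # ys @ y # zs" and "p = length xs" and "q = length xs + Suc (length ys)"
  have pq: "vs ! p = y" "vs ! q = y" "p < Suc i" "q < Suc i" "p \<noteq> q"
    using len by (auto simp: vs_def p_def q_def nth_append)
  have "A (vs ! j) (del j vs) = 0" if "j < Suc i" "j \<noteq> p" "j \<noteq> q" for j
  proof (rule altmap_not_distinct[OF alt])
    note jpq = that
    consider "j < length xs" | "j = length xs" | "length xs < j" "j < q" | "q < j"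
      using jpq(2,3) unfolding p_def by linarith
    then show "\<not> distinct (del j vs)"
    proof cases
      case 3
      then obtain m where "j = Suc (length xs + m)" by (metis less_imp_Suc_add)
      then show ?thesis using 3 by (simp add: vs_def q_def del_append)
    next
      case 4
      then obtain m where "j = Suc (length xs + Suc (length ys) + m)" unfolding q_def by (metis less_imp_Suc_add)
      then show ?thesis by (simp add: vs_def del_append)
    qed (use jpq in \<open>auto simp: vs_def del_append p_def\<close>)
  qed
  then have "(\<Sum>j<Suc i. (- 1) ^ j *\<^sub>R A (vs ! j) (del j vs)) = (\<Sum>j\<in>{p, q}. (- 1) ^ j *\<^sub>R A (vs ! j) (del j vs))"
    using pq(3,4) by (intro sum.mono_neutral_right) auto
  then have "alternize i A vs = (\<Sum>j\<in>{p, q}. (- 1) ^ j *\<^sub>R A (vs ! j) (del j vs))"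
    unfolding alternize_def using len by (simp only: vs_def simp_thms if_True)
  also have "\<dots> = (- 1) ^ p *\<^sub>R A y (del p vs) + (- 1) ^ q *\<^sub>R A y (del q vs)" using pq by simp
  also have "del p vs = xs @ ys @ y # zs" by (simp add: vs_def p_def del_append)
  also have "del q vs = xs @ y # ys @ zs" by (simp add: vs_def q_def del_append)
  also have "A y (xs @ ys @ y # zs) = (- 1) ^ length ys *\<^sub>R A y (xs @ y # ys @ zs)"
    by (rule altmap_move[OF alt])
  also have "(- 1) ^ p *\<^sub>R (- 1) ^ length ys *\<^sub>R A y (xs @ y # ys @ zs) + (- 1) ^ q *\<^sub>R A y (xs @ y # ys @ zs) = 0"
    by (simp add: p_def q_def power_add)
  finally show "alternize i A (xs @ y # ys @ y # zs) = 0" unfolding vs_def .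
qed (simp add: alternize_def)

text \<open>The term that deletes the new first vector is split off; in all others that vector stays in front and the signs
  shift by one.\<close>

lemma alternize_Cons:
  assumes "length vs = i"
  shows "alternize i A (x # vs) = A x vs - (\<Sum>j<i. (- 1) ^ j *\<^sub>R A (vs ! j) (x # del j vs))"
  using assms unfolding alternize_def
  by (simp add: sum.lessThan_Suc_shift sum_negf del: sum.lessThan_Suc)

section \<open>A dual basis of alternating forms\<close>

context finite_basis begin

text \<open>Up to the factor, the wedge product of the coordinate functions of the letters of a word. The expansion below runs
  over all words and not only over increasing ones, and the factors \<open>1/k\<close> compensate for the repetitions.\<close>

primrec dual_form :: "'v list \<Rightarrow> 'v list \<Rightarrow> real" where
  "dual_form [] vs = (if vs = [] then 1 else 0)"
| "dual_form (b # a) vs = (1 / real (Suc (length a))) *\<^sub>R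
     alternize (length a) (\<lambda>v ws. crd b v *\<^sub>R dual_form a ws) vs"

definition words :: "nat \<Rightarrow> 'v list set" where
  "words i = {a. set a \<subseteq> B \<and> length a = i}"

lemma finite_words: "finite (words i)"
  unfolding words_def using finite_lists_length_eq[OF finite_B] by simp

lemma words_Suc: "words (Suc i) = (\<lambda>(b, a). b # a) ` (B \<times> words i)"
  by (auto simp: words_def length_Suc_conv)

lemma words_0: "words 0 = {[]}"
  by (auto simp: words_def)

lemma altmap_dual_form: "altmap (length a) (dual_form a)"
proof (induction a)
  case Nil
  then show ?case by (intro altmapI) auto
next
  case (Cons b a)
  have "altmap (Suc (length a)) (alternize (length a) (\<lambda>v ws. crd b v *\<^sub>R dual_form a ws))"
    by (intro altmap_alternize altmap_scale Cons.IH linear_scaleR_vec crd_linear)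
  then have "altmap (Suc (length a)) (\<lambda>vs. (1 / real (Suc (length a))) *\<^sub>R
      alternize (length a) (\<lambda>v ws. crd b v *\<^sub>R dual_form a ws) vs)"
    by (rule altmap_scale)
  moreover have "dual_form (b # a) = (\<lambda>vs. (1 / real (Suc (length a))) *\<^sub>R
      alternize (length a) (\<lambda>v ws. crd b v *\<^sub>R dual_form a ws) vs)"
    by (rule ext) (rule dual_form.simps)
  ultimately show ?case by (simp only: length_Cons)
qed

text \<open>By induction on the degree. Bringing each of the \<open>i + 1\<close> vectors to the front gives \<open>i + 1\<close> copies of \<open>\<omega>(v\<^sub>0, \<dots>, v\<^sub>i)\<close>, and
  expanding the front vector in coordinates turns their sum into an antisymmetrisation.\<close>

lemma altmap_expand:
  assumes "altmap i \<omega>"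
  shows "\<omega> vs = (\<Sum>a\<in>words i. dual_form a vs *\<^sub>R \<omega> a)"
  using assms
proof (induction i arbitrary: \<omega> vs)
  case 0
  then show ?case using altmap_length[OF 0, of vs] by (auto simp: words_0)
next
  case (Suc i)
  show ?case
  proof (cases "length vs = Suc i")
    case False
    then have "dual_form a vs = 0" if "a \<in> words (Suc i)" for a
      using altmap_length[OF altmap_dual_form] that by (simp add: words_def)
    then show ?thesis using altmap_length[OF Suc.prems False] by simp
  next
    case True
    have *: "\<omega> (v # ws) = (\<Sum>b\<in>B. \<Sum>a\<in>words i. (crd b v *\<^sub>R dual_form a ws) *\<^sub>R \<omega> (b # a))" for v ws
    proof -
      have "\<omega> (v # ws) = (\<Sum>b\<in>B. crd b v *\<^sub>R \<omega> (b # ws))"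
        by (rule linear_expand[OF altmap_linear_Cons[OF Suc.prems]])
      also have "\<dots> = (\<Sum>b\<in>B. crd b v *\<^sub>R (\<Sum>a\<in>words i. dual_form a ws *\<^sub>R \<omega> (b # a)))"
        by (simp only: Suc.IH[OF altmap_contract[OF Suc.prems], of _ ws])
      finally show ?thesis by (simp add: scaleR_sum_right)
    qed
    have "real (Suc i) *\<^sub>R \<omega> vs = (\<Sum>j<Suc i. \<omega> vs)"
      by (simp add: sum_constant_scaleR del: sum.lessThan_Suc of_nat_Suc)
    also have "\<dots> = (\<Sum>j<Suc i. (- 1) ^ j *\<^sub>R \<omega> (vs ! j # del j vs))"
    proof (rule sum.cong[OF HOL.refl])
      fix j assume "j \<in> {..<Suc i}"
      then have "\<omega> (vs ! j # del j vs) = (- 1) ^ j *\<^sub>R \<omega> vs" using True by (intro altmap_front[OF Suc.prems]) simp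
      then show "\<omega> vs = (- 1) ^ j *\<^sub>R \<omega> (vs ! j # del j vs)" by simp
    qed
    also have "\<dots> = (\<Sum>j<Suc i. \<Sum>b\<in>B. \<Sum>a\<in>words i.
        ((- 1) ^ j *\<^sub>R crd b (vs ! j) *\<^sub>R dual_form a (del j vs)) *\<^sub>R \<omega> (b # a))"
    proof (rule sum.cong[OF HOL.refl])
      fix j
      show "(- 1) ^ j *\<^sub>R \<omega> (vs ! j # del j vs) = (\<Sum>b\<in>B. \<Sum>a\<in>words i.
          ((- 1) ^ j *\<^sub>R crd b (vs ! j) *\<^sub>R dual_form a (del j vs)) *\<^sub>R \<omega> (b # a))"
        by (simp only: *[of "vs ! j" "del j vs"] scaleR_sum_right scaleR_scaleR real_scaleR_def mult.assoc)
    qed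
    also have "\<dots> = (\<Sum>b\<in>B. \<Sum>j<Suc i. \<Sum>a\<in>words i.
        ((- 1) ^ j *\<^sub>R crd b (vs ! j) *\<^sub>R dual_form a (del j vs)) *\<^sub>R \<omega> (b # a))"
      by (rule sum.swap)
    also have "\<dots> = (\<Sum>b\<in>B. \<Sum>a\<in>words i. (real (Suc i) *\<^sub>R dual_form (b # a) vs) *\<^sub>R \<omega> (b # a))"
    proof (rule sum.cong[OF HOL.refl], subst sum.swap, rule sum.cong[OF HOL.refl])
      fix b a assume a: "a \<in> words i"
      have "real (Suc i) *\<^sub>R dual_form (b # a) vs = (\<Sum>j<Suc i. (- 1) ^ j *\<^sub>R crd b (vs ! j) *\<^sub>R dual_form a (del j vs))"
        using a True by (simp add: words_def alternize_def del: sum.lessThan_Suc of_nat_Suc)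
      then show "(\<Sum>j<Suc i. ((- 1) ^ j *\<^sub>R crd b (vs ! j) *\<^sub>R dual_form a (del j vs)) *\<^sub>R \<omega> (b # a))
          = (real (Suc i) *\<^sub>R dual_form (b # a) vs) *\<^sub>R \<omega> (b # a)"
        by (simp only: scaleR_sum_left)
    qed
    also have "\<dots> = real (Suc i) *\<^sub>R (\<Sum>b\<in>B. \<Sum>a\<in>words i. dual_form (b # a) vs *\<^sub>R \<omega> (b # a))"
      by (simp add: scaleR_sum_right del: dual_form.simps of_nat_Suc)
    also have "(\<Sum>b\<in>B. \<Sum>a\<in>words i. dual_form (b # a) vs *\<^sub>R \<omega> (b # a))
        = (\<Sum>a\<in>words (Suc i). dual_form a vs *\<^sub>R \<omega> a)"
      unfolding words_Suc
      by (subst sum.reindex) (auto simp: inj_on_def sum.cartesian_product finite_B finite_words intro!: sum.cong)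
    finally show ?thesis by simp
  qed
qed

end

section \<open>Forms with values in a module of functions\<close>

text \<open>Concrete modules over the ring of smooth functions, all of whose operations are pointwise: smooth functions, the
  foliation, sections of bundles and the images of bundle maps.\<close>

definition function_module :: "('v::real_normed_vector \<Rightarrow> 'w::real_vector) set \<Rightarrow> bool" where
  "function_module M \<longleftrightarrow> (\<lambda>_. 0) \<in> M \<and> (\<forall>s\<in>M. \<forall>t\<in>M. (\<lambda>x. s x + t x) \<in> M) \<and>
     (\<forall>f s. smooth f \<and> s \<in> M \<longrightarrow> (\<lambda>x. f x *\<^sub>R s x) \<in> M)"

lemma function_module_zero: "function_module M \<Longrightarrow> (\<lambda>_. 0) \<in> M"
  and function_module_add: "function_module M \<Longrightarrow> s \<in> M \<Longrightarrow> t \<in> M \<Longrightarrow> (\<lambda>x. s x + t x) \<in> M"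
  and function_module_smult: "function_module M \<Longrightarrow> smooth f \<Longrightarrow> s \<in> M \<Longrightarrow> (\<lambda>x. f x *\<^sub>R s x) \<in> M"
  unfolding function_module_def by blast+

lemma function_module_const: "function_module M \<Longrightarrow> s \<in> M \<Longrightarrow> (\<lambda>x. c *\<^sub>R s x) \<in> M"
  using function_module_smult[of M "\<lambda>_. c"] smooth_on_const by blast

lemma function_module_neg: "function_module M \<Longrightarrow> s \<in> M \<Longrightarrow> (\<lambda>x. - s x) \<in> M"
  using function_module_const[of M s "-1"] by simp

lemma function_module_diff: "function_module M \<Longrightarrow> s \<in> M \<Longrightarrow> t \<in> M \<Longrightarrow> (\<lambda>x. s x - t x) \<in> M"
  using function_module_add[of M s "\<lambda>x. - t x"] function_module_neg by auto

lemma function_module_sum: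
  "function_module M \<Longrightarrow> (\<And>k. k \<in> I \<Longrightarrow> s k \<in> M) \<Longrightarrow> (\<lambda>x. \<Sum>k\<in>I. s k x) \<in> M"
  by (induction I rule: infinite_finite_induct) (auto intro: function_module_zero function_module_add)

lemma function_module_smooth: "function_module {f :: 'v::real_normed_vector \<Rightarrow> 'w::real_normed_vector. smooth f}"
  unfolding function_module_def by (auto intro: smooth_intros)

text \<open>A concrete model of \<open>\<and>\<^sup>iV\<^sup>* \<otimes> M\<close>.\<close>

definition mforms :: "nat \<Rightarrow> ('v::real_normed_vector \<Rightarrow> 'w::real_vector) set \<Rightarrow> ('v \<Rightarrow> 'v list \<Rightarrow> 'w) set" where
  "mforms i M = {\<alpha>. (\<forall>x. altmap i (\<alpha> x)) \<and> (\<forall>vs. (\<lambda>x. \<alpha> x vs) \<in> M)}"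

lemma mformsI: "(\<And>x. altmap i (\<alpha> x)) \<Longrightarrow> (\<And>vs. (\<lambda>x. \<alpha> x vs) \<in> M) \<Longrightarrow> \<alpha> \<in> mforms i M"
  and mforms_altmap: "\<alpha> \<in> mforms i M \<Longrightarrow> altmap i (\<alpha> x)"
  and mforms_value: "\<alpha> \<in> mforms i M \<Longrightarrow> (\<lambda>x. \<alpha> x vs) \<in> M"
  unfolding mforms_def by blast+

lemma mforms_mono: "\<alpha> \<in> mforms i M \<Longrightarrow> M \<subseteq> N \<Longrightarrow> \<alpha> \<in> mforms i N"
  unfolding mforms_def by blast

lemma carrier_forms: "carrier (forms i) = mforms i {f. smooth f}"
  unfolding forms_def mforms_def alternating_form_iff by simp

lemma mforms_zero: "function_module M \<Longrightarrow> (\<lambda>_ _. 0) \<in> mforms i M"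
  by (intro mformsI altmap_zero function_module_zero)

lemma mforms_add: "function_module M \<Longrightarrow> \<alpha> \<in> mforms i M \<Longrightarrow> \<beta> \<in> mforms i M \<Longrightarrow> (\<lambda>x vs. \<alpha> x vs + \<beta> x vs) \<in> mforms i M"
  by (intro mformsI altmap_add function_module_add) (auto dest: mforms_altmap mforms_value)

lemma mforms_smult: "function_module M \<Longrightarrow> smooth f \<Longrightarrow> \<alpha> \<in> mforms i M \<Longrightarrow> (\<lambda>x vs. f x *\<^sub>R \<alpha> x vs) \<in> mforms i M"
  by (intro mformsI altmap_scale function_module_smult) (auto dest: mforms_altmap mforms_value)

lemma mforms_const: "function_module M \<Longrightarrow> \<alpha> \<in> mforms i M \<Longrightarrow> (\<lambda>x vs. c *\<^sub>R \<alpha> x vs) \<in> mforms i M"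
  by (rule mforms_smult) (auto intro: smooth_intros)

lemma mforms_diff: "function_module M \<Longrightarrow> \<alpha> \<in> mforms i M \<Longrightarrow> \<beta> \<in> mforms i M \<Longrightarrow> (\<lambda>x vs. \<alpha> x vs - \<beta> x vs) \<in> mforms i M"
  using mforms_add[of M \<alpha> i "\<lambda>x vs. (- 1) *\<^sub>R \<beta> x vs"] mforms_const[of M \<beta> i "-1"] by simp

text \<open>Contraction with the Euler vector field, for forms with values in any module.\<close>

definition euler_d :: "('v \<Rightarrow> 'v list \<Rightarrow> 'w) \<Rightarrow> 'v \<Rightarrow> 'v list \<Rightarrow> 'w" where
  "euler_d \<alpha> = (\<lambda>x vs. \<alpha> x (x # vs))"

lemma euler_contraction_eq_euler_d: "euler_contraction = euler_d"
  by (simp add: euler_contraction_def euler_d_def fun_eq_iff)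

lemma euler_d_euler_d: "\<alpha> \<in> mforms i M \<Longrightarrow> euler_d (euler_d \<alpha>) = (\<lambda>_ _. 0)"
  unfolding euler_d_def by (auto simp: fun_eq_iff intro!: altmap_not_distinct dest: mforms_altmap)

lemma euler_d_degree_0: "\<alpha> \<in> mforms 0 M \<Longrightarrow> euler_d \<alpha> = (\<lambda>_ _. 0)"
  unfolding euler_d_def by (auto simp: fun_eq_iff intro!: altmap_length dest: mforms_altmap)

lemma euler_d_add: "euler_d (\<lambda>x vs. \<alpha> x vs + \<beta> x vs) = (\<lambda>x vs. euler_d \<alpha> x vs + euler_d \<beta> x vs)"
  and euler_d_diff: "euler_d (\<lambda>x vs. \<gamma> x vs - \<eta> x vs) = (\<lambda>x vs. euler_d \<gamma> x vs - euler_d \<eta> x vs)"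
  and euler_d_smult: "euler_d (\<lambda>x vs. f x *\<^sub>R \<zeta> x vs) = (\<lambda>x vs. f x *\<^sub>R euler_d \<zeta> x vs)"
  and euler_d_zero: "euler_d (\<lambda>_ _. 0) = (\<lambda>_ _. 0)"
  by (simp_all add: euler_d_def)

text \<open>The Euler field vanishes at the origin.\<close>

lemma euler_d_at_0: "\<alpha> \<in> mforms i M \<Longrightarrow> euler_d \<alpha> 0 vs = 0"
  unfolding euler_d_def using linear_0[OF altmap_linear_Cons[OF mforms_altmap]] by metis

context finite_basis begin

lemma mforms_expand:
  "\<alpha> \<in> mforms i M \<Longrightarrow> \<alpha> x vs = (\<Sum>a\<in>words i. dual_form a vs *\<^sub>R \<alpha> x a)"
  by (rule altmap_expand[OF mforms_altmap])

lemma euler_d_expand: "\<alpha> \<in> mforms i M \<Longrightarrow> euler_d \<alpha> x vs = (\<Sum>b\<in>B. crd b x *\<^sub>R \<alpha> x (b # vs))"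
  unfolding euler_d_def by (rule linear_expand[OF altmap_linear_Cons[OF mforms_altmap]])

lemma euler_d_mforms:
  assumes "function_module (M :: ('v \<Rightarrow> 'w::real_vector) set)" "\<alpha> \<in> mforms (Suc i) M"
  shows "euler_d \<alpha> \<in> mforms i M"
proof (rule mformsI)
  show "altmap i (euler_d \<alpha> x)" for x
    unfolding euler_d_def by (rule altmap_contract[OF mforms_altmap[OF assms(2)]])
  show "(\<lambda>x. euler_d \<alpha> x vs) \<in> M" for vs
    unfolding euler_d_expand[OF assms(2)]
    by (intro function_module_sum function_module_smult smooth_crd assms(1) mforms_value[OF assms(2)])
qed

text \<open>Together with the basis expansion this shows that forms with values in \<open>M\<close> are a finite power of \<open>M\<close>.\<close>

lemma dual_form_combination:
  assumes "function_module (M :: ('v \<Rightarrow> 'w::real_vector) set)" "\<And>a. a \<in> words i \<Longrightarrow> s a \<in> M"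
  shows "(\<lambda>x vs. \<Sum>a\<in>words i. dual_form a vs *\<^sub>R s a x) \<in> mforms i M"
proof (rule mformsI)
  show "altmap i (\<lambda>vs. \<Sum>a\<in>words i. dual_form a vs *\<^sub>R s a x)" for x
    by (intro altmap_sum altmap_scale_vec) (use altmap_dual_form in \<open>auto simp: words_def\<close>)
  show "(\<lambda>x. \<Sum>a\<in>words i. dual_form a vs *\<^sub>R s a x) \<in> M" for vs
    by (intro function_module_sum function_module_const assms)
qed

end

section \<open>Exactness of the Koszul complex of smooth forms\<close>

context finite_basis begin

definition ext_deriv :: "nat \<Rightarrow> 'v form \<Rightarrow> 'v form" where
  "ext_deriv i \<alpha> x = alternize i (\<lambda>v ws. frechet_derivative (\<lambda>y. \<alpha> y ws) (at x) v)"

lemma altmap_directional: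
  assumes "\<alpha> \<in> mforms i {f :: 'v \<Rightarrow> 'w::real_normed_vector. smooth f}"
  shows "altmap i (\<lambda>ws. frechet_derivative (\<lambda>y. \<alpha> y ws) (at x) v)"
proof (rule altmapI)
  note alt = mforms_altmap[OF assms]
  have sm: "smooth (\<lambda>y. \<alpha> y ws)" for ws using mforms_value[OF assms] by blast
  fix ws :: "'v list" and j assume ws: "length ws = i" "j < i"
  have lin: "linear (\<lambda>u. \<alpha> y (ws[j := u]))" for y by (rule altmap_slot[OF alt ws])
  show "linear (\<lambda>u. frechet_derivative (\<lambda>y. \<alpha> y (ws[j := u])) (at x) v)"
  proof (rule linearI)
    show "frechet_derivative (\<lambda>y. \<alpha> y (ws[j := u + u'])) (at x) v
      = frechet_derivative (\<lambda>y. \<alpha> y (ws[j := u])) (at x) v + frechet_derivative (\<lambda>y. \<alpha> y (ws[j := u'])) (at x) v" for u u'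
      by (simp add: linear_add[OF lin] fd_add sm)
    show "frechet_derivative (\<lambda>y. \<alpha> y (ws[j := c *\<^sub>R u])) (at x) v
      = c *\<^sub>R frechet_derivative (\<lambda>y. \<alpha> y (ws[j := u])) (at x) v" for c u
      by (simp add: linear_scale[OF lin] fd_bounded_linear[OF bounded_linear_scaleR_right] sm)
  qed
qed (simp_all add: altmap_length[OF mforms_altmap[OF assms]] altmap_not_distinct[OF mforms_altmap[OF assms]]
    frechet_derivative_const)

lemma ext_deriv_mforms:
  assumes "\<alpha> \<in> mforms i {f. smooth f}"
  shows "ext_deriv i \<alpha> \<in> mforms (Suc i) {f. smooth f}"
proof (rule mformsI)
  have sm: "smooth (\<lambda>y. \<alpha> y ws)" for ws using mforms_value[OF assms] by blast
  show "altmap (Suc i) (ext_deriv i \<alpha> x)" for x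
    unfolding ext_deriv_def
    by (rule altmap_alternize[OF altmap_directional[OF assms] smooth_linear_derivative[OF sm]])
  show "(\<lambda>x. ext_deriv i \<alpha> x vs) \<in> {f. smooth f}" for vs
  proof -
    have "smooth (\<lambda>x. \<Sum>j<Suc i. (- 1) ^ j *\<^sub>R frechet_derivative (\<lambda>y. \<alpha> y (del j vs)) (at x) (vs ! j))"
      by (intro smooth_on_sum smooth_on_scaleR smooth_on_const smooth_on_directional sm open_UNIV)
    then show ?thesis
      unfolding ext_deriv_def alternize_def by (cases "length vs = Suc i") (simp_all add: smooth_on_const)
  qed
qed

text \<open>For \<open>\<beta>\<^sub>x = \<integral>\<^sub>0\<^sup>1 t\<^sup>i (d\<alpha>)\<^sub>t\<^sub>x dt\<close> the contraction with the Euler field is \<open>\<alpha>\<close>. Indeed, differentiating \<open>\<iota>\<^sub>E \<alpha> = 0\<close> in the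
  direction \<open>v\<close> gives \<open>(D\<^sub>v \<alpha>)(E, \<dots>) = - \<alpha>(v, \<dots>)\<close>, so that \<open>t\<^sup>i (d\<alpha>)\<^sub>t\<^sub>x(x, \<dots>)\<close> is the derivative of \<open>t\<^sup>i \<alpha>\<^sub>t\<^sub>x\<close> with respect to
  \<open>t\<close>; its integral is \<open>\<alpha>\<^sub>x\<close>, minus the value \<open>\<alpha>\<^sub>0\<close> if \<open>i = 0\<close>.\<close>

lemma koszul_exact_smooth:
  assumes \<alpha>: "\<alpha> \<in> mforms i {f :: 'v \<Rightarrow> real. smooth f}" and cyc: "euler_d \<alpha> = (\<lambda>_ _. 0)"
    and deg0: "i = 0 \<Longrightarrow> \<alpha> 0 [] = 0"
  obtains \<beta> where "\<beta> \<in> mforms (Suc i) {f. smooth f}" "euler_d \<beta> = \<alpha>"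
proof
  have sm: "smooth (\<lambda>y. \<alpha> y ws)" for ws using mforms_value[OF \<alpha>] by blast
  note alt = mforms_altmap[OF \<alpha>] and d\<alpha> = ext_deriv_mforms[OF \<alpha>]
  have smd: "smooth (\<lambda>y. ext_deriv i \<alpha> y vs)" for vs using mforms_value[OF d\<alpha>] by blast
  define \<beta> where "\<beta> x vs = radial_average i (\<lambda>y. ext_deriv i \<alpha> y vs) x" for x vs
  show "\<beta> \<in> mforms (Suc i) {f. smooth f}"
  proof (rule mformsI)
    have ra: "((\<lambda>t. t ^ i * ext_deriv i \<alpha> (t *\<^sub>R x) vs) has_integral \<beta> x vs) {0..1}" for x vs
      unfolding \<beta>_def radial_average_def by (rule integrable_integral[OF radial_integrable[OF smd]])
    show "altmap (Suc i) (\<beta> x)" for x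
    proof (rule altmapI)
      fix vs :: "'v list" and j assume vs: "length vs = Suc i" "j < Suc i"
      note lin = altmap_slot[OF mforms_altmap[OF d\<alpha>] vs]
      show "linear (\<lambda>v. \<beta> x (vs[j := v]))"
      proof (rule linearI)
        fix u v :: 'v and c :: real
        show "\<beta> x (vs[j := u + v]) = \<beta> x (vs[j := u]) + \<beta> x (vs[j := v])"
          using has_integral_add[OF ra[of x "vs[j := u]"] ra[of x "vs[j := v]"]]
          by (intro has_integral_unique[OF ra]) (simp add: linear_add[OF lin] distrib_left)
        show "\<beta> x (vs[j := c *\<^sub>R u]) = c *\<^sub>R \<beta> x (vs[j := u])"
          using has_integral_cmul[OF ra[of x "vs[j := u]"], of c]
          by (intro has_integral_unique[OF ra]) (simp add: linear_scale[OF lin] mult.left_commute)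
      qed
    qed (simp_all add: \<beta>_def radial_average_def altmap_length[OF mforms_altmap[OF d\<alpha>]]
        altmap_not_distinct[OF mforms_altmap[OF d\<alpha>]])
    show "(\<lambda>x. \<beta> x vs) \<in> {f. smooth f}" for vs
      unfolding \<beta>_def by (simp add: smooth_radial_average smd)
  qed
  have diff_cycle: "t * frechet_derivative (\<lambda>y. \<alpha> y (x # ws)) (at (t *\<^sub>R x)) v = - \<alpha> (t *\<^sub>R x) (v # ws)" for t x v ws
  proof -
    have lin: "linear (\<lambda>u. \<alpha> y (u # ws))" for y by (rule altmap_linear_Cons[OF alt])
    have e: "(\<Sum>b\<in>B. crd b y * \<alpha> y (b # ws)) = 0" for y
      using fun_cong[OF fun_cong[OF cyc, of y], of ws] euler_d_expand[OF \<alpha>, of y ws] by simp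
    have "0 = frechet_derivative (\<lambda>y. \<Sum>b\<in>B. crd b y * \<alpha> y (b # ws)) (at (t *\<^sub>R x)) v"
      by (simp add: e frechet_derivative_const)
    also have "\<dots> = (\<Sum>b\<in>B. crd b (t *\<^sub>R x) * frechet_derivative (\<lambda>y. \<alpha> y (b # ws)) (at (t *\<^sub>R x)) v
        + crd b v * \<alpha> (t *\<^sub>R x) (b # ws))"
      by (simp add: fd_sum[OF finite_B] smooth_on_mult smooth_crd sm fd_mult fd_linear_map[OF crd_linear])
    also have "\<dots> = (\<Sum>b\<in>B. crd b (t *\<^sub>R x) * frechet_derivative (\<lambda>y. \<alpha> y (b # ws)) (at (t *\<^sub>R x)) v)
        + \<alpha> (t *\<^sub>R x) (v # ws)"
      using linear_expand[OF lin, of "t *\<^sub>R x" v] by (simp add: sum.distrib)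
    also have "(\<Sum>b\<in>B. crd b (t *\<^sub>R x) * frechet_derivative (\<lambda>y. \<alpha> y (b # ws)) (at (t *\<^sub>R x)) v)
      = t * frechet_derivative (\<lambda>y. \<Sum>b\<in>B. crd b x * \<alpha> y (b # ws)) (at (t *\<^sub>R x)) v"
      by (simp add: fd_sum[OF finite_B] smooth_on_mult smooth_on_const sm fd_mult frechet_derivative_const
          linear_scale[OF crd_linear] sum_distrib_left mult.assoc)
    also have "(\<lambda>y. \<Sum>b\<in>B. crd b x * \<alpha> y (b # ws)) = (\<lambda>y. \<alpha> y (x # ws))"
      using linear_expand[OF lin, of _ x] by simp
    finally show ?thesis by simp
  qed
  show "euler_d \<beta> = \<alpha>"
  proof (intro ext)
    fix x :: 'v and vs :: "'v list"
    show "euler_d \<beta> x vs = \<alpha> x vs"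
    proof (cases "length vs = i")
      case False
      then show ?thesis
        by (simp add: euler_d_def \<beta>_def radial_average_def altmap_length[OF alt] altmap_length[OF mforms_altmap[OF d\<alpha>]])
    next
      case True
      have "t ^ i * ext_deriv i \<alpha> (t *\<^sub>R x) (x # vs) = real i * t ^ (i - 1) * \<alpha> (t *\<^sub>R x) vs
          + t ^ i * frechet_derivative (\<lambda>y. \<alpha> y vs) (at (t *\<^sub>R x)) x" if t: "0 < t" "t < 1" for t
      proof -
        let ?D = "\<lambda>v ws. frechet_derivative (\<lambda>y. \<alpha> y ws) (at (t *\<^sub>R x)) v"
        have "t * ext_deriv i \<alpha> (t *\<^sub>R x) (x # vs)
          = t * ?D x vs - (\<Sum>j<i. (- 1) ^ j * (t * ?D (vs ! j) (x # del j vs)))"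
          by (simp add: ext_deriv_def alternize_Cons[OF True] right_diff_distrib sum_distrib_left ac_simps)
        also have "(\<Sum>j<i. (- 1) ^ j * (t * ?D (vs ! j) (x # del j vs))) = (\<Sum>j<i. - \<alpha> (t *\<^sub>R x) vs)"
        proof (rule sum.cong[OF HOL.refl])
          fix j assume "j \<in> {..<i}"
          then have "\<alpha> (t *\<^sub>R x) (vs ! j # del j vs) = (- 1) ^ j *\<^sub>R \<alpha> (t *\<^sub>R x) vs"
            using True by (intro altmap_front[OF alt]) simp
          then show "(- 1) ^ j * (t * ?D (vs ! j) (x # del j vs)) = - \<alpha> (t *\<^sub>R x) vs"
            by (simp add: diff_cycle)
        qed
        finally have *: "t * ext_deriv i \<alpha> (t *\<^sub>R x) (x # vs) = t * ?D x vs + real i * \<alpha> (t *\<^sub>R x) vs" by simp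
        show ?thesis
        proof (cases i)
          case 0
          then show ?thesis using * t by simp
        next
          case (Suc k)
          have "t ^ i * ext_deriv i \<alpha> (t *\<^sub>R x) (x # vs) = t ^ k * (t * ext_deriv i \<alpha> (t *\<^sub>R x) (x # vs))"
            by (simp add: Suc)
          then show ?thesis unfolding * by (simp add: Suc algebra_simps)
        qed
      qed
      then have "euler_d \<beta> x vs = \<alpha> x vs - 0 ^ i * \<alpha> 0 vs"
        unfolding euler_d_def \<beta>_def by (rule radial_average_fundamental[OF sm smd])
      then show ?thesis using deg0 True by (cases "i = 0") auto
    qed
  qed
qed

text \<open>A function that vanishes at the origin kills the Koszul homology of every module: if \<open>f = \<iota>\<^sub>E \<phi>\<close>,
  then wedging with the one-form \<open>\<phi>\<close> is a homotopy.\<close>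

lemma koszul_homology_killed:
  assumes M: "function_module (M :: ('v \<Rightarrow> 'w::real_vector) set)" and \<omega>: "\<omega> \<in> mforms i M"
    and cyc: "euler_d \<omega> = (\<lambda>_ _. 0)" and f: "smooth f" "f 0 = 0"
  obtains \<gamma> where "\<gamma> \<in> mforms (Suc i) M" "euler_d \<gamma> = (\<lambda>x vs. f x *\<^sub>R \<omega> x vs)"
proof -
  have "(\<lambda>x vs. if vs = [] then f x else 0) \<in> mforms 0 {f. smooth f}"
  proof (rule mformsI)
    show "(\<lambda>x. if vs = [] then f x else 0) \<in> {f. smooth f}" for vs :: "'v list"
      using f smooth_on_const by (cases "vs = []") auto
  qed (auto intro!: altmapI split: if_splits)
  then obtain \<phi> where \<phi>: "\<phi> \<in> mforms (Suc 0) {f. smooth f}" "euler_d \<phi> = (\<lambda>x vs. if vs = [] then f x else 0)"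
    by (rule koszul_exact_smooth) (auto simp: euler_d_def f(2))
  define \<gamma> where "\<gamma> x = alternize i (\<lambda>v ws. \<phi> x [v] *\<^sub>R \<omega> x ws)" for x
  have "\<gamma> \<in> mforms (Suc i) M"
  proof (rule mformsI)
    show "altmap (Suc i) (\<gamma> x)" for x
      unfolding \<gamma>_def
      by (intro altmap_alternize altmap_scale mforms_altmap[OF \<omega>] linear_scaleR_vec
          altmap_linear_Cons[OF mforms_altmap[OF \<phi>(1)]])
    have sm: "smooth (\<lambda>x. \<phi> x [v])" for v using mforms_value[OF \<phi>(1)] by blast
    show "(\<lambda>x. \<gamma> x vs) \<in> M" for vs
    proof (cases "length vs = Suc i")
      case True
      have "(\<lambda>x. \<Sum>j<Suc i. (- 1) ^ j *\<^sub>R \<phi> x [vs ! j] *\<^sub>R \<omega> x (del j vs)) \<in> M"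
        by (intro function_module_sum M function_module_const function_module_smult sm mforms_value[OF \<omega>])
      then show ?thesis unfolding \<gamma>_def alternize_def if_P[OF True] .
    next
      case False
      then show ?thesis using function_module_zero[OF M] by (simp add: \<gamma>_def alternize_def)
    qed
  qed
  moreover have "euler_d \<gamma> x vs = f x *\<^sub>R \<omega> x vs" for x vs
  proof (cases "length vs = i")
    case True
    have "\<omega> x (x # ws) = 0" for ws using fun_cong[OF fun_cong[OF cyc]] by (simp add: euler_d_def)
    moreover have "\<phi> x [x] = f x" using fun_cong[OF fun_cong[OF \<phi>(2), of x], of "[]"] by (simp add: euler_d_def)
    ultimately show ?thesis by (simp add: euler_d_def \<gamma>_def alternize_Cons[OF True])
  next
    case False
    then show ?thesis by (simp add: euler_d_def \<gamma>_def alternize_def altmap_length[OF mforms_altmap[OF \<omega>]])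
  qed
  ultimately show thesis using that by blast
qed

end

section \<open>Sections of vector bundles\<close>

lemma carrier_sections_iff: "s \<in> carrier (sections E) \<longleftrightarrow> (\<forall>x. s x \<in> fibre E x) \<and>
    (\<forall>(U, r, b)\<in>frames E. \<exists>c. (\<forall>j<r. smooth_on U (c j :: 'v \<Rightarrow> real)) \<and> (\<forall>x\<in>U. s x = (\<Sum>j<r. c j x *\<^sub>R b j x)))"
  for s :: "'v::real_normed_vector \<Rightarrow> 'e::real_vector"
  unfolding sections_def by simp

lemma bundle_frame_at:
  assumes "vector_bundle E"
  obtains U r b where "(U, r, b) \<in> frames E" "p \<in> U"
proof -
  have "p \<in> (\<Union>(U, r, b)\<in>frames E. U)" using assms unfolding vector_bundle_def by simp
  then show thesis using that by auto
qed

lemma bundle_frame: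
  assumes "vector_bundle E" "(U, r, b) \<in> frames E"
  shows "open U" "\<And>x. x \<in> U \<Longrightarrow> inj_on (\<lambda>j. b j x) {..<r}"
    "\<And>x. x \<in> U \<Longrightarrow> independent ((\<lambda>j. b j x) ` {..<r})" "\<And>x. x \<in> U \<Longrightarrow> span ((\<lambda>j. b j x) ` {..<r}) = fibre E x"
proof -
  have "\<forall>(U, r, b)\<in>frames E. open U \<and> (\<forall>x\<in>U.
        inj_on (\<lambda>j. b j x) {..<r} \<and> independent ((\<lambda>j. b j x) ` {..<r}) \<and>
        span ((\<lambda>j. b j x) ` {..<r}) = fibre E x)"
    using assms(1) unfolding vector_bundle_def by (elim conjE)
  from bspec[OF this assms(2)] show "open U" "\<And>x. x \<in> U \<Longrightarrow> inj_on (\<lambda>j. b j x) {..<r}"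
    "\<And>x. x \<in> U \<Longrightarrow> independent ((\<lambda>j. b j x) ` {..<r})"
    "\<And>x. x \<in> U \<Longrightarrow> span ((\<lambda>j. b j x) ` {..<r}) = fibre E x" by simp_all
qed

lemma bundle_transition:
  assumes "vector_bundle E" "(U, r, b) \<in> frames E" "(U', r', b') \<in> frames E"
  obtains g where "\<And>j k. j < r \<Longrightarrow> k < r' \<Longrightarrow> smooth_on (U \<inter> U') (g j k :: 'v::real_normed_vector \<Rightarrow> real)"
    "\<And>x k. x \<in> U \<inter> U' \<Longrightarrow> k < r' \<Longrightarrow> b' k x = (\<Sum>j<r. g j k x *\<^sub>R b j x)"
proof -
  have "\<forall>(U, r, b)\<in>frames E. \<forall>(U', r', b')\<in>frames E. \<exists>g.
        (\<forall>j<r. \<forall>k<r'. smooth_on (U \<inter> U') (g j k :: 'v \<Rightarrow> real)) \<and>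
        (\<forall>x\<in>U \<inter> U'. \<forall>k<r'. b' k x = (\<Sum>j<r. g j k x *\<^sub>R b j x))"
    using assms(1) unfolding vector_bundle_def by (elim conjE)
  from bspec[OF bspec[OF this assms(2), unfolded prod.case] assms(3)] obtain g where
    "\<forall>j<r. \<forall>k<r'. smooth_on (U \<inter> U') (g j k :: 'v \<Rightarrow> real)"
    "\<forall>x\<in>U \<inter> U'. \<forall>k<r'. b' k x = (\<Sum>j<r. g j k x *\<^sub>R b j x)" by auto
  then show thesis by (intro that[of g]) simp_all
qed

lemma fibre_subspace: "vector_bundle E \<Longrightarrow> subspace (fibre E x)"
  using bundle_frame_at[of E x] bundle_frame(4)[of E _ _ _ x] by (metis subspace_span)

lemma section_value: "s \<in> carrier (sections E) \<Longrightarrow> s x \<in> fibre E x"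
  by (simp add: carrier_sections_iff)

lemma section_coefficients:
  assumes "s \<in> carrier (sections E)" "(U, r, b) \<in> frames E"
  obtains c where "\<And>j. j < r \<Longrightarrow> smooth_on U (c j :: 'v::real_normed_vector \<Rightarrow> real)" "\<And>x. x \<in> U \<Longrightarrow> s x = (\<Sum>j<r. c j x *\<^sub>R b j x)"
proof -
  have "\<forall>(U, r, b)\<in>frames E. \<exists>c. (\<forall>j<r. smooth_on U (c j :: 'v \<Rightarrow> real)) \<and> (\<forall>x\<in>U. s x = (\<Sum>j<r. c j x *\<^sub>R b j x))"
    using assms(1) unfolding carrier_sections_iff by (rule conjunct2)
  from bspec[OF this assms(2)] obtain c where "\<forall>j<r. smooth_on U (c j :: 'v \<Rightarrow> real)"
    "\<forall>x\<in>U. s x = (\<Sum>j<r. c j x *\<^sub>R b j x)" by auto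
  then show thesis by (intro that[of c]) simp_all
qed

lemma function_module_sections:
  fixes E :: "('v::real_normed_vector, 'e::real_vector) vbundle"
  assumes E: "vector_bundle E"
  shows "function_module (carrier (sections E))"
  unfolding function_module_def
proof (intro conjI ballI allI impI)
  note sub = fibre_subspace[OF E]
  show "(\<lambda>_. 0) \<in> carrier (sections E)"
    unfolding carrier_sections_iff using subspace_0[OF sub]
    by (auto intro!: exI[of _ "\<lambda>_ _. 0"] smooth_on_const)
  show "(\<lambda>x. s x + t x) \<in> carrier (sections E)"
    if s: "s \<in> carrier (sections E)" and t: "t \<in> carrier (sections E)" for s t
    unfolding carrier_sections_iff
  proof (intro conjI allI ballI, goal_cases)
    case (1 x)
    then show ?case using subspace_add[OF sub] section_value[OF s] section_value[OF t] by blast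
  next
    case (2 F)
    obtain U r b where F: "F = (U, r, b)" using prod_cases3 by blast
    obtain c where c: "\<And>j. j < r \<Longrightarrow> smooth_on U (c j)" "\<And>x. x \<in> U \<Longrightarrow> s x = (\<Sum>j<r. c j x *\<^sub>R b j x)"
      using section_coefficients[OF s] 2 F by blast
    obtain d where d: "\<And>j. j < r \<Longrightarrow> smooth_on U (d j)" "\<And>x. x \<in> U \<Longrightarrow> t x = (\<Sum>j<r. d j x *\<^sub>R b j x)"
      using section_coefficients[OF t] 2 F by blast
    have "open U" using bundle_frame(1)[OF E] 2 F by blast
    then show ?case unfolding F using c d
      by (auto intro!: exI[of _ "\<lambda>j x. c j x + d j x"] smooth_on_add simp: scaleR_add_left sum.distrib)
  qed
  show "(\<lambda>x. f x *\<^sub>R s x) \<in> carrier (sections E)" if fs: "smooth f \<and> s \<in> carrier (sections E)" for f s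
    unfolding carrier_sections_iff
  proof (intro conjI allI ballI, goal_cases)
    case (1 x)
    then show ?case using subspace_scale[OF sub] section_value fs by blast
  next
    case (2 F)
    obtain U r b where F: "F = (U, r, b)" using prod_cases3 by blast
    obtain c where c: "\<And>j. j < r \<Longrightarrow> smooth_on U (c j)" "\<And>x. x \<in> U \<Longrightarrow> s x = (\<Sum>j<r. c j x *\<^sub>R b j x)"
      using section_coefficients[of s E] fs 2 F by blast
    have "open U" using bundle_frame(1)[OF E] 2 F by blast
    moreover have "smooth_on U f" using fs smooth_on_subset by blast
    ultimately show ?case unfolding F using c
      by (auto intro!: exI[of _ "\<lambda>j x. f x * c j x"] smooth_on_mult simp: scaleR_sum_right)
  qed
qed

text \<open>In any other frame the coefficients are obtained from the transition functions on the overlap, and are zero off \<open>K\<close>.\<close>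

lemma frame_combination_section:
  fixes E :: "('v::real_normed_vector, 'e::real_vector) vbundle"
  assumes E: "vector_bundle E" and fr: "(U, r, b) \<in> frames E" and K: "closed K" "K \<subseteq> U"
    and f: "\<And>j. j < r \<Longrightarrow> smooth (f j)" "\<And>j x. j < r \<Longrightarrow> x \<notin> K \<Longrightarrow> f j x = 0"
  shows "(\<lambda>x. \<Sum>j<r. f j x *\<^sub>R b j x) \<in> carrier (sections E)"
  unfolding carrier_sections_iff
proof (intro conjI allI ballI, goal_cases)
  case (1 x)
  show ?case
  proof (cases "x \<in> U")
    case True
    have "(\<Sum>j<r. f j x *\<^sub>R b j x) \<in> span ((\<lambda>j. b j x) ` {..<r})"
      by (intro span_sum span_scale span_base) auto
    then show ?thesis using bundle_frame(4)[OF E fr True] by simp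
  next
    case False
    then have "(\<Sum>j<r. f j x *\<^sub>R b j x) = 0" using K(2) f(2) by (intro sum.neutral) auto
    then show ?thesis using subspace_0[OF fibre_subspace[OF E]] by simp
  qed
next
  case (2 F)
  obtain U' r' b' where F: "F = (U', r', b')" using prod_cases3 by blast
  with 2 have fr': "(U', r', b') \<in> frames E" by simp
  obtain g where g: "\<And>j k. j < r' \<Longrightarrow> k < r \<Longrightarrow> smooth_on (U' \<inter> U) (g j k)"
    "\<And>x k. x \<in> U' \<inter> U \<Longrightarrow> k < r \<Longrightarrow> b k x = (\<Sum>j<r'. g j k x *\<^sub>R b' j x)"
    using bundle_transition[OF E fr' fr] by blast
  define c where "c j x = (if x \<in> U then \<Sum>k<r. f k x * g j k x else 0)" for j x
  have op: "open U" "open U'" using bundle_frame(1)[OF E] fr fr' by blast+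
  have "smooth_on U' (c j)" if j: "j < r'" for j
  proof -
    have "smooth_on (U' \<inter> U) (\<lambda>x. \<Sum>k<r. f k x * g j k x)"
      using op g(1)[OF j] f(1) by (intro smooth_on_sum smooth_on_mult) (auto intro: smooth_on_subset)
    then have "smooth_on (U' \<inter> U) (c j)"
      using smooth_on_cong[of "U' \<inter> U" "c j"] op by (simp add: c_def open_Int)
    moreover have "smooth_on (U' - K) (c j)"
    proof -
      have "c j x = 0" if "x \<in> U' - K" for x using that f(2) by (simp add: c_def)
      then show ?thesis
        using smooth_on_cong[of "U' - K" "c j" "\<lambda>_. 0"] op K(1) smooth_on_const by (simp add: open_Diff)
    qed
    ultimately have "smooth_on ((U' \<inter> U) \<union> (U' - K)) (c j)"
      using op K(1) by (intro smooth_on_Un) (auto simp: open_Int open_Diff)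
    moreover have "(U' \<inter> U) \<union> (U' - K) = U'" using K(2) by blast
    ultimately show ?thesis by simp
  qed
  moreover have "(\<Sum>k<r. f k x *\<^sub>R b k x) = (\<Sum>j<r'. c j x *\<^sub>R b' j x)" if x: "x \<in> U'" for x
  proof (cases "x \<in> U")
    case True
    have "(\<Sum>k<r. f k x *\<^sub>R b k x) = (\<Sum>k<r. \<Sum>j<r'. (f k x * g j k x) *\<^sub>R b' j x)"
      using g(2)[of x] x True by (simp add: scaleR_sum_right)
    also have "\<dots> = (\<Sum>j<r'. \<Sum>k<r. (f k x * g j k x) *\<^sub>R b' j x)" by (rule sum.swap)
    finally show ?thesis using True by (simp add: c_def scaleR_sum_left)
  next
    case False
    then have "f k x = 0" if "k < r" for k using K(2) f(2) that by blast
    then show ?thesis using False by (simp add: c_def)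
  qed
  ultimately show ?case unfolding F by blast
qed

lemma frame_coefficients_unique:
  assumes "vector_bundle E" "(U, r, b) \<in> frames E" "x \<in> U"
    "(\<Sum>j<r. c j *\<^sub>R b j x) = (\<Sum>j<r. d j *\<^sub>R b j x)" "j < r"
  shows "c j = d j"
proof -
  note fr = bundle_frame[OF assms(1,2)]
  let ?b = "\<lambda>j. b j x"
  define u where "u v = c (the_inv_into {..<r} ?b v) - d (the_inv_into {..<r} ?b v)" for v
  have u: "u (b k x) = c k - d k" if "k < r" for k
    using the_inv_into_f_f[OF fr(2)[OF assms(3)], of k] that by (simp add: u_def)
  have "(\<Sum>v\<in>?b ` {..<r}. u v *\<^sub>R v) = (\<Sum>k<r. (c k - d k) *\<^sub>R b k x)"
    unfolding sum.reindex[OF fr(2)[OF assms(3)]] o_def by (rule sum.cong) (simp_all add: u)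
  also have "\<dots> = 0" using assms(4) by (simp add: scaleR_diff_left sum_subtractf)
  finally have "u (b j x) = 0"
    using independentD[OF fr(3)[OF assms(3)] finite_imageI[OF finite_lessThan] subset_refl,
        of u "b j x"] assms(5) by simp
  then show ?thesis using u[OF assms(5)] by simp
qed

context finite_basis begin

text \<open>A combination of frame elements with constant coefficients, cut off by a bump function.\<close>

lemma section_through:
  fixes E :: "('v, 'e::real_vector) vbundle"
  assumes E: "vector_bundle E" and u: "u \<in> fibre E p"
  obtains s where "s \<in> carrier (sections E)" "s p = u"
proof -
  obtain U r b where fr: "(U, r, b) \<in> frames E" "p \<in> U" using bundle_frame_at[OF E] by blast
  obtain \<psi> :: "'v \<Rightarrow> real" and K where "smooth \<psi> \<and> \<psi> p = 1 \<and> closed K \<and> K \<subseteq> U \<and> (\<forall>x. x \<notin> K \<longrightarrow> \<psi> x = 0)"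
    using bump_function[OF bundle_frame(1)[OF E fr(1)] fr(2)] by blast
  then have \<psi>: "smooth \<psi>" "\<psi> p = 1" "closed K" "K \<subseteq> U" "\<And>x. x \<notin> K \<Longrightarrow> \<psi> x = 0" by simp_all
  have "u \<in> span ((\<lambda>j. b j p) ` {..<r})" using bundle_frame(4)[OF E fr] u by simp
  then obtain v where v: "u = (\<Sum>x\<in>(\<lambda>j. b j p) ` {..<r}. v x *\<^sub>R x)" by (auto simp: span_finite)
  have "u = (\<Sum>j<r. v (b j p) *\<^sub>R b j p)"
    by (simp only: v sum.reindex[OF bundle_frame(2)[OF E fr]] o_def)
  moreover have "(\<lambda>x. \<Sum>j<r. (\<psi> x * v (b j p)) *\<^sub>R b j x) \<in> carrier (sections E)"
    by (rule frame_combination_section[OF E fr(1) \<psi>(3,4)]) (auto intro!: smooth_intros \<psi>(1) simp: \<psi>(5))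
  ultimately show thesis using that \<psi>(2) by simp
qed

text \<open>With a bump function \<open>\<psi>\<close> supported in the domain of a frame at the origin, \<open>\<omega> = \<psi>\<^sup>2 \<omega> + (1 - \<psi>\<^sup>2) \<omega>\<close>. The coefficients of
  \<open>\<psi> \<omega>\<close> in the frame are global smooth cycles, hence boundaries; the second factor \<open>\<psi>\<close> turns their primitives into a
  section. The function \<open>1 - \<psi>\<^sup>2\<close> vanishes at the origin and kills homology.\<close>

lemma koszul_exact_sections:
  fixes E :: "('v, 'e::real_vector) vbundle"
  assumes E: "vector_bundle E" and \<omega>: "\<omega> \<in> mforms i (carrier (sections E))"
    and cyc: "euler_d \<omega> = (\<lambda>_ _. 0)" and deg0: "i = 0 \<Longrightarrow> \<omega> 0 [] = 0"
  obtains \<gamma> where "\<gamma> \<in> mforms (Suc i) (carrier (sections E))" "euler_d \<gamma> = \<omega>"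
proof -
  obtain U r b where fr: "(U, r, b) \<in> frames E" "0 \<in> U" using bundle_frame_at[OF E] by blast
  note frame = bundle_frame[OF E fr(1)]
  note M = function_module_sections[OF E]
  obtain \<psi> :: "'v \<Rightarrow> real" and K where "smooth \<psi> \<and> \<psi> 0 = 1 \<and> closed K \<and> K \<subseteq> U \<and> (\<forall>x. x \<notin> K \<longrightarrow> \<psi> x = 0)"
    using bump_function[OF frame(1) fr(2)] by blast
  then have \<psi>: "smooth \<psi>" "\<psi> 0 = 1" "closed K" "K \<subseteq> U" "\<And>x. x \<notin> K \<Longrightarrow> \<psi> x = 0" by simp_all
  \<comment> \<open>coefficients of a single vector; they are smooth in \<open>x\<close> along a section, by uniqueness\<close>
  define \<kappa> where "\<kappa> x u = (SOME c. u = (\<Sum>j<r. c j *\<^sub>R b j x))" for x u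
  have \<kappa>: "u = (\<Sum>j<r. \<kappa> x u j *\<^sub>R b j x)" if x: "x \<in> U" and u: "u \<in> fibre E x" for x u
  proof -
    obtain s where s: "s \<in> carrier (sections E)" "s x = u" using section_through[OF E u] by blast
    obtain c where "s x = (\<Sum>j<r. c j x *\<^sub>R b j x)" using section_coefficients[OF s(1) fr(1)] x by metis
    then show ?thesis unfolding \<kappa>_def s(2) by (rule someI[of _ "\<lambda>j. c j x"])
  qed
  have \<kappa>_eq: "\<kappa> x u j = c j" if "x \<in> U" "u \<in> fibre E x" "u = (\<Sum>j<r. c j *\<^sub>R b j x)" "j < r" for x u c j
    using frame_coefficients_unique[OF E fr(1) that(1) _ that(4)] \<kappa>[OF that(1,2)] that(3) by metis
  note \<omega>f = section_value[OF mforms_value[OF \<omega>]]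
  define \<alpha> where "\<alpha> j x vs = (if x \<in> U then \<psi> x * \<kappa> x (\<omega> x vs) j else 0)" for j x vs
  have \<alpha>: "\<alpha> j \<in> mforms i {f. smooth f}" if j: "j < r" for j
  proof (rule mformsI)
    fix x
    show "altmap i (\<alpha> j x)"
    proof (cases "x \<in> U")
      case True
      have "altmap i (\<lambda>vs. \<kappa> x (\<omega> x vs) j)"
      proof (rule altmap_compose[OF mforms_altmap[OF \<omega>] \<omega>f])
        fix u v assume uv: "u \<in> fibre E x" "v \<in> fibre E x"
        have "u + v = (\<Sum>j<r. (\<kappa> x u j + \<kappa> x v j) *\<^sub>R b j x)"
          using \<kappa>[OF True uv(1)] \<kappa>[OF True uv(2)] by (simp add: scaleR_add_left sum.distrib)
        from \<kappa>_eq[OF True subspace_add[OF fibre_subspace[OF E] uv] this j]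
        show "\<kappa> x (u + v) j = \<kappa> x u j + \<kappa> x v j" .
      next
        fix c :: real and u assume u: "u \<in> fibre E x"
        have "c *\<^sub>R u = c *\<^sub>R (\<Sum>j<r. \<kappa> x u j *\<^sub>R b j x)" using \<kappa>[OF True u] by simp
        then have "c *\<^sub>R u = (\<Sum>j<r. (c * \<kappa> x u j) *\<^sub>R b j x)" by (simp add: scaleR_sum_right)
        from \<kappa>_eq[OF True subspace_scale[OF fibre_subspace[OF E] u] this j]
        show "\<kappa> x (c *\<^sub>R u) j = c *\<^sub>R \<kappa> x u j" by simp
      qed
      from altmap_scale[OF this, of "\<psi> x"] show ?thesis using True by (simp add: \<alpha>_def[abs_def])
    qed (simp add: \<alpha>_def[abs_def] altmap_zero)
  next
    fix vs
    obtain c where c: "\<And>j. j < r \<Longrightarrow> smooth_on U (c j)" "\<And>x. x \<in> U \<Longrightarrow> \<omega> x vs = (\<Sum>j<r. c j x *\<^sub>R b j x)"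
      using section_coefficients[OF mforms_value[OF \<omega>] fr(1)] by blast
    have "smooth_on U (\<lambda>x. \<psi> x * c j x)"
      using c(1)[OF j] smooth_on_subset[OF \<psi>(1)] frame(1) by (intro smooth_on_mult) auto
    moreover have "\<alpha> j x vs = \<psi> x * c j x" if "x \<in> U" for x
      using \<kappa>_eq[OF that \<omega>f c(2)[OF that] j] that by (simp add: \<alpha>_def)
    ultimately have "smooth_on U (\<lambda>x. \<alpha> j x vs)" using smooth_on_cong[OF frame(1)] by (metis (no_types, lifting))
    then have "smooth (\<lambda>x. \<alpha> j x vs)"
      by (rule smooth_on_extend_zero[OF frame(1) \<psi>(3,4)]) (simp add: \<alpha>_def \<psi>(5))
    then show "(\<lambda>x. \<alpha> j x vs) \<in> {f. smooth f}" by simp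
  qed
  have \<kappa>0: "\<kappa> x 0 j = 0" if "x \<in> U" "j < r" for x j
    using \<kappa>_eq[OF that(1) subspace_0[OF fibre_subspace[OF E]], of "\<lambda>_. 0" j] that(2) by simp
  have "\<exists>\<beta>. \<beta> \<in> mforms (Suc i) {f. smooth f} \<and> euler_d \<beta> = \<alpha> j" if j: "j < r" for j
  proof -
    have "euler_d (\<alpha> j) = (\<lambda>_ _. 0)"
      using fun_cong[OF fun_cong[OF cyc]] by (simp add: euler_d_def fun_eq_iff \<alpha>_def \<kappa>0 j)
    moreover have "i = 0 \<Longrightarrow> \<alpha> j 0 [] = 0" using deg0 by (simp add: \<alpha>_def \<kappa>0 j)
    ultimately show ?thesis using koszul_exact_smooth[OF \<alpha>[OF j]] by metis
  qed
  then obtain \<beta> where \<beta>: "\<And>j. j < r \<Longrightarrow> \<beta> j \<in> mforms (Suc i) {f. smooth f}" "\<And>j. j < r \<Longrightarrow> euler_d (\<beta> j) = \<alpha> j"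
    by metis
  define \<gamma>1 where "\<gamma>1 x vs = (\<Sum>j<r. (\<psi> x * \<beta> j x vs) *\<^sub>R b j x)" for x vs
  have \<gamma>1: "\<gamma>1 \<in> mforms (Suc i) (carrier (sections E))"
  proof (rule mformsI)
    show "altmap (Suc i) (\<gamma>1 x)" for x
    proof -
      have "altmap (Suc i) (\<lambda>vs. \<Sum>j<r. (\<psi> x *\<^sub>R \<beta> j x vs) *\<^sub>R b j x)"
        using mforms_altmap[OF \<beta>(1)] by (intro altmap_sum altmap_scale_vec altmap_scale) auto
      then show ?thesis by (simp add: \<gamma>1_def[abs_def])
    qed
    show "(\<lambda>x. \<gamma>1 x vs) \<in> carrier (sections E)" for vs
      unfolding \<gamma>1_def using mforms_value[OF \<beta>(1)]
      by (intro frame_combination_section[OF E fr(1) \<psi>(3,4)] smooth_on_mult \<psi>(1)) (auto simp: \<psi>(5))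
  qed
  have euler_d\<gamma>1: "euler_d \<gamma>1 x vs = (\<psi> x * \<psi> x) *\<^sub>R \<omega> x vs" for x vs
  proof -
    have "euler_d \<gamma>1 x vs = (\<Sum>j<r. (\<psi> x * \<alpha> j x vs) *\<^sub>R b j x)"
      using fun_cong[OF fun_cong[OF \<beta>(2)]] by (simp add: euler_d_def \<gamma>1_def)
    also have "\<dots> = (\<psi> x * \<psi> x) *\<^sub>R \<omega> x vs"
    proof (cases "x \<in> U")
      case True
      have "(\<psi> x * \<psi> x) *\<^sub>R \<omega> x vs = (\<psi> x * \<psi> x) *\<^sub>R (\<Sum>j<r. \<kappa> x (\<omega> x vs) j *\<^sub>R b j x)"
        using \<kappa>[OF True \<omega>f] by simp
      then show ?thesis using True by (simp add: \<alpha>_def scaleR_sum_right ac_simps)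
    next
      case False
      then have "\<psi> x = 0" using \<psi>(4,5) by blast
      then show ?thesis by simp
    qed
    finally show ?thesis .
  qed
  have f: "smooth (\<lambda>x. 1 - \<psi> x * \<psi> x)" "1 - \<psi> 0 * \<psi> 0 = 0"
    by (intro smooth_on_diff smooth_on_mult smooth_on_const \<psi>(1) open_UNIV) (simp add: \<psi>(2))
  obtain \<gamma>2 where \<gamma>2: "\<gamma>2 \<in> mforms (Suc i) (carrier (sections E))" "euler_d \<gamma>2 = (\<lambda>x vs. (1 - \<psi> x * \<psi> x) *\<^sub>R \<omega> x vs)"
    using koszul_homology_killed[OF M \<omega> cyc, of "\<lambda>x. 1 - \<psi> x * \<psi> x"] f by blast
  have "euler_d (\<lambda>x vs. \<gamma>1 x vs + \<gamma>2 x vs) = \<omega>"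
    by (simp add: euler_d_add euler_d\<gamma>1 \<gamma>2(2) fun_eq_iff flip: scaleR_add_left)
  then show thesis using that mforms_add[OF M \<gamma>1 \<gamma>2(1)] by blast
qed

definition degree_0_form :: "('v \<Rightarrow> 'w::real_vector) \<Rightarrow> 'v \<Rightarrow> 'v list \<Rightarrow> 'w" where
  "degree_0_form s x vs = (if vs = [] then s x else 0)"

lemma degree_0_form_mforms: "function_module M \<Longrightarrow> s \<in> M \<Longrightarrow> degree_0_form s \<in> mforms 0 M"
proof (rule mformsI)
  show "function_module M \<Longrightarrow> s \<in> M \<Longrightarrow> (\<lambda>x. degree_0_form s x vs) \<in> M" for vs
    unfolding degree_0_form_def using function_module_zero by (cases "vs = []") auto
qed (auto intro!: altmapI simp: degree_0_form_def split: if_splits)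

lemma degree_0_form_eq: "\<alpha> \<in> mforms 0 M \<Longrightarrow> \<alpha> = degree_0_form (\<lambda>x. \<alpha> x [])"
  by (auto simp: degree_0_form_def fun_eq_iff intro: altmap_length dest: mforms_altmap)

text \<open>Hadamard's lemma for sections: exactness in degree zero.\<close>

lemma section_vanishing_at_0:
  fixes E :: "('v, 'e::real_vector) vbundle"
  assumes E: "vector_bundle E" and s: "s \<in> carrier (sections E)" "s 0 = 0"
  obtains \<sigma> where "\<sigma> \<in> mforms (Suc 0) (carrier (sections E))" "euler_d \<sigma> = degree_0_form s"
proof -
  have "euler_d (degree_0_form s) = (\<lambda>_ _. 0)" by (simp add: euler_d_def degree_0_form_def)
  moreover have "degree_0_form s 0 [] = 0" by (simp add: degree_0_form_def s(2))
  ultimately show thesis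
    using koszul_exact_sections[OF E degree_0_form_mforms[OF function_module_sections[OF E] s(1)]] that by blast
qed

lemma section_vanishing_expand:
  fixes E :: "('v, 'e::real_vector) vbundle"
  assumes E: "vector_bundle E" and s: "s \<in> carrier (sections E)" "s 0 = 0"
  obtains t where "\<And>b. t b \<in> carrier (sections E)" "s = (\<lambda>x. \<Sum>b\<in>B. crd b x *\<^sub>R t b x)"
proof -
  obtain \<sigma> where \<sigma>: "\<sigma> \<in> mforms (Suc 0) (carrier (sections E))" "euler_d \<sigma> = degree_0_form s"
    using section_vanishing_at_0[OF assms] by blast
  have "s x = (\<Sum>b\<in>B. crd b x *\<^sub>R \<sigma> x [b])" for x
    using euler_d_expand[OF \<sigma>(1), of x "[]"] by (simp add: \<sigma>(2) degree_0_form_def)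
  then show thesis using that[of "\<lambda>b x. \<sigma> x [b]"] mforms_value[OF \<sigma>(1)] by blast
qed

end

section \<open>Derivations acting on forms\<close>

text \<open>The Leibniz rule over a vector field \<open>A\<close>, as satisfied by \<open>[A, -]\<close> on vector fields and by \<open>l\<^sub>2(e, -)\<close> on sections if \<open>A\<close>
  is the anchor of \<open>e\<close>.\<close>

definition derivation_over ::
  "('v::real_normed_vector \<Rightarrow> 'v) \<Rightarrow> (('v \<Rightarrow> 'w::real_vector) \<Rightarrow> 'v \<Rightarrow> 'w) \<Rightarrow> ('v \<Rightarrow> 'w) set \<Rightarrow> bool" where
  "derivation_over A D M \<longleftrightarrow> (\<forall>s\<in>M. D s \<in> M) \<and>
     (\<forall>s\<in>M. \<forall>t\<in>M. D (\<lambda>x. s x + t x) = (\<lambda>x. D s x + D t x)) \<and>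
     (\<forall>f. \<forall>s\<in>M. smooth f \<longrightarrow>
        D (\<lambda>x. f x *\<^sub>R s x) = (\<lambda>x. f x *\<^sub>R D s x + frechet_derivative f (at x) (A x) *\<^sub>R s x))"

lemma derivation_closed: "derivation_over A D M \<Longrightarrow> s \<in> M \<Longrightarrow> D s \<in> M"
  and derivation_add: "derivation_over A D M \<Longrightarrow> s \<in> M \<Longrightarrow> t \<in> M \<Longrightarrow> D (\<lambda>x. s x + t x) = (\<lambda>x. D s x + D t x)"
  and derivation_smult: "derivation_over A D M \<Longrightarrow> smooth f \<Longrightarrow> s \<in> M \<Longrightarrow>
    D (\<lambda>x. f x *\<^sub>R s x) = (\<lambda>x. f x *\<^sub>R D s x + frechet_derivative f (at x) (A x) *\<^sub>R s x)"
  unfolding derivation_over_def by blast+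

lemma derivation_const: "derivation_over A D M \<Longrightarrow> s \<in> M \<Longrightarrow> D (\<lambda>x. c *\<^sub>R s x) = (\<lambda>x. c *\<^sub>R D s x)"
  using derivation_smult[of A D M "\<lambda>_. c" s] by (simp add: smooth_on_const frechet_derivative_const)

lemma derivation_zero: "derivation_over A D M \<Longrightarrow> function_module M \<Longrightarrow> D (\<lambda>_. 0) = (\<lambda>_. 0)"
  using derivation_const[of A D M "\<lambda>_. 0" 0] function_module_zero[of M] by auto

lemma derivation_sum:
  assumes "derivation_over A D M" "function_module M" "\<And>k. k \<in> I \<Longrightarrow> s k \<in> M"
  shows "D (\<lambda>x. \<Sum>k\<in>I. s k x) = (\<lambda>x. \<Sum>k\<in>I. D (s k) x)"
  using assms(3)
proof (induction I rule: infinite_finite_induct)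
  case (insert k I)
  then show ?case
    using derivation_add[OF assms(1), of "s k" "\<lambda>x. \<Sum>k\<in>I. s k x"] function_module_sum[OF assms(2), of I s] by simp
qed (simp_all add: derivation_zero[OF assms(1,2)])

text \<open>On \<open>\<alpha> \<otimes> Y\<close> with \<open>D = [A, -]\<close> this is \<open>\<L>\<^sub>A \<alpha> \<otimes> Y + \<alpha> \<otimes> [A, Y]\<close>. The sign of the sum comes from \<open>[A, v] = - A v\<close> for
  constant fields \<open>v\<close>.\<close>

definition form_act ::
  "('v \<Rightarrow> 'v) \<Rightarrow> (('v \<Rightarrow> 'w::real_vector) \<Rightarrow> 'v \<Rightarrow> 'w) \<Rightarrow> ('v \<Rightarrow> 'v list \<Rightarrow> 'w) \<Rightarrow> 'v \<Rightarrow> 'v list \<Rightarrow> 'w" where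
  "form_act A D \<alpha> = (\<lambda>x vs. D (\<lambda>y. \<alpha> y vs) x + (\<Sum>j<length vs. \<alpha> x (vs[j := A (vs ! j)])))"

lemma form_act_mforms:
  assumes D: "derivation_over A D M" and M: "function_module M" and A: "linear A" and \<alpha>: "\<alpha> \<in> mforms i M"
  shows "form_act A D \<alpha> \<in> mforms i M"
proof (rule mformsI)
  note alt = mforms_altmap[OF \<alpha>] and val = mforms_value[OF \<alpha>]
  fix x
  have "altmap i (\<lambda>vs. D (\<lambda>y. \<alpha> y vs) x)"
  proof (rule altmapI)
    fix vs :: "'a list" and j assume vs: "length vs = i" "j < i"
    have lin: "linear (\<lambda>v. \<alpha> y (vs[j := v]))" for y by (rule altmap_slot[OF alt vs])
    show "linear (\<lambda>v. D (\<lambda>y. \<alpha> y (vs[j := v])) x)"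
      by (rule linearI)
        (simp_all add: linear_add[OF lin] linear_scale[OF lin] derivation_add[OF D val val] derivation_const[OF D val])
  qed (simp_all add: altmap_length[OF alt] altmap_not_distinct[OF alt] derivation_zero[OF D M])
  then show "altmap i (form_act A D \<alpha> x)"
    unfolding form_act_def by (intro altmap_add altmap_derivation[OF alt A])
next
  show "(\<lambda>x. form_act A D \<alpha> x vs) \<in> M" for vs
    unfolding form_act_def
    by (intro function_module_add[OF M] function_module_sum[OF M] derivation_closed[OF D] mforms_value[OF \<alpha>])
qed

lemma form_act_add:
  assumes "derivation_over A D M" "\<alpha> \<in> mforms i M" "\<beta> \<in> mforms i M"
  shows "form_act A D (\<lambda>x vs. \<alpha> x vs + \<beta> x vs) = (\<lambda>x vs. form_act A D \<alpha> x vs + form_act A D \<beta> x vs)"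
  unfolding form_act_def
  by (simp add: fun_eq_iff derivation_add[OF assms(1) mforms_value[OF assms(2)] mforms_value[OF assms(3)]] sum.distrib)

lemma form_act_const:
  assumes "derivation_over A D M" "\<alpha> \<in> mforms i M"
  shows "form_act A D (\<lambda>x vs. c *\<^sub>R \<alpha> x vs) = (\<lambda>x vs. c *\<^sub>R form_act A D \<alpha> x vs)"
  unfolding form_act_def
  by (simp add: fun_eq_iff derivation_const[OF assms(1) mforms_value[OF assms(2)]] scaleR_add_right scaleR_sum_right)

text \<open>The Euler vector field commutes with every linear vector field, hence so do the contraction with
  it and the action.\<close>

lemma (in finite_basis) euler_d_form_act:
  assumes D: "derivation_over A D (M :: ('v \<Rightarrow> 'w::real_vector) set)" and M: "function_module M" and A: "linear A"
    and \<alpha>: "\<alpha> \<in> mforms i M"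
  shows "euler_d (form_act A D \<alpha>) = form_act A D (euler_d \<alpha>)"
proof (intro ext)
  fix x vs
  note val = mforms_value[OF \<alpha>]
  have "D (\<lambda>y. euler_d \<alpha> y vs) x = D (\<lambda>y. \<Sum>b\<in>B. crd b y *\<^sub>R \<alpha> y (b # vs)) x"
    using euler_d_expand[OF \<alpha>] by simp
  also have "\<dots> = (\<Sum>b\<in>B. D (\<lambda>y. crd b y *\<^sub>R \<alpha> y (b # vs)) x)"
    by (subst derivation_sum[OF D M]) (auto intro: function_module_smult[OF M smooth_crd val])
  also have "\<dots> = (\<Sum>b\<in>B. crd b x *\<^sub>R D (\<lambda>y. \<alpha> y (b # vs)) x) + (\<Sum>b\<in>B. crd b (A x) *\<^sub>R \<alpha> x (b # vs))"
    by (simp add: derivation_smult[OF D smooth_crd val] fd_linear_map[OF crd_linear] sum.distrib)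
  also have "(\<Sum>b\<in>B. crd b (A x) *\<^sub>R \<alpha> x (b # vs)) = \<alpha> x (A x # vs)"
    using linear_expand[OF altmap_linear_Cons[OF mforms_altmap[OF \<alpha>]]] by metis
  finally have *: "D (\<lambda>y. euler_d \<alpha> y vs) x = (\<Sum>b\<in>B. crd b x *\<^sub>R D (\<lambda>y. \<alpha> y (b # vs)) x) + \<alpha> x (A x # vs)" .
  have "euler_d (form_act A D \<alpha>) x vs = (\<Sum>b\<in>B. crd b x *\<^sub>R form_act A D \<alpha> x (b # vs))"
    by (rule euler_d_expand[OF form_act_mforms[OF D M A \<alpha>]])
  also have "\<dots> = (\<Sum>b\<in>B. crd b x *\<^sub>R D (\<lambda>y. \<alpha> y (b # vs)) x)
      + ((\<Sum>b\<in>B. crd b x *\<^sub>R \<alpha> x (A b # vs)) + (\<Sum>j<length vs. \<Sum>b\<in>B. crd b x *\<^sub>R \<alpha> x (b # vs[j := A (vs ! j)])))"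
  proof -
    have "form_act A D \<alpha> x (b # vs) = D (\<lambda>y. \<alpha> y (b # vs)) x
        + (\<alpha> x (A b # vs) + (\<Sum>j<length vs. \<alpha> x (b # vs[j := A (vs ! j)])))" for b
      by (simp add: form_act_def sum.lessThan_Suc_shift del: sum.lessThan_Suc)
    then have "(\<Sum>b\<in>B. crd b x *\<^sub>R form_act A D \<alpha> x (b # vs)) = (\<Sum>b\<in>B. crd b x *\<^sub>R D (\<lambda>y. \<alpha> y (b # vs)) x)
        + ((\<Sum>b\<in>B. crd b x *\<^sub>R \<alpha> x (A b # vs)) + (\<Sum>b\<in>B. \<Sum>j<length vs. crd b x *\<^sub>R \<alpha> x (b # vs[j := A (vs ! j)])))"
      by (simp only: scaleR_add_right scaleR_sum_right sum.distrib)
    also have "(\<Sum>b\<in>B. \<Sum>j<length vs. crd b x *\<^sub>R \<alpha> x (b # vs[j := A (vs ! j)]))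
        = (\<Sum>j<length vs. \<Sum>b\<in>B. crd b x *\<^sub>R \<alpha> x (b # vs[j := A (vs ! j)]))" by (rule sum.swap)
    finally show ?thesis .
  qed
  also have "(\<Sum>b\<in>B. crd b x *\<^sub>R \<alpha> x (A b # vs)) = \<alpha> x (A x # vs)"
    by (rule linear_expand[OF linear_compose[OF A altmap_linear_Cons[OF mforms_altmap[OF \<alpha>]]], unfolded o_def, symmetric])
  also have "(\<Sum>j<length vs. \<Sum>b\<in>B. crd b x *\<^sub>R \<alpha> x (b # vs[j := A (vs ! j)])) = (\<Sum>j<length vs. euler_d \<alpha> x (vs[j := A (vs ! j)]))"
    by (simp only: euler_d_expand[OF \<alpha>])
  finally show "euler_d (form_act A D \<alpha>) x vs = form_act A D (euler_d \<alpha>) x vs"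
    by (simp add: form_act_def * add.assoc)
qed

section \<open>Maps of coefficients\<close>

text \<open>Additivity and homogeneity are formulated for values of elements of \<open>N\<close>, since \<open>\<phi>\<^sub>x\<close> is linear only on the fibre at \<open>x\<close>.\<close>

definition module_map ::
  "('v \<Rightarrow> 'w::real_vector) set \<Rightarrow> ('v \<Rightarrow> 'w \<Rightarrow> 'u::real_vector) \<Rightarrow> ('v \<Rightarrow> 'u) set \<Rightarrow> bool" where
  "module_map N \<phi> M \<longleftrightarrow> (\<forall>s\<in>N. (\<lambda>x. \<phi> x (s x)) \<in> M) \<and>
     (\<forall>s\<in>N. \<forall>t\<in>N. \<forall>x. \<phi> x (s x + t x) = \<phi> x (s x) + \<phi> x (t x)) \<and>
     (\<forall>c. \<forall>s\<in>N. \<forall>x. \<phi> x (c *\<^sub>R s x) = c *\<^sub>R \<phi> x (s x))"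

definition push :: "('v \<Rightarrow> 'w \<Rightarrow> 'u) \<Rightarrow> ('v \<Rightarrow> 'v list \<Rightarrow> 'w) \<Rightarrow> 'v \<Rightarrow> 'v list \<Rightarrow> 'u" where
  "push \<phi> \<alpha> = (\<lambda>x vs. \<phi> x (\<alpha> x vs))"

lemma module_map_closed: "module_map N \<phi> M \<Longrightarrow> s \<in> N \<Longrightarrow> (\<lambda>x. \<phi> x (s x)) \<in> M"
  and module_map_add: "module_map N \<phi> M \<Longrightarrow> s \<in> N \<Longrightarrow> t \<in> N \<Longrightarrow> \<phi> x (s x + t x) = \<phi> x (s x) + \<phi> x (t x)"
  and module_map_scale: "module_map N \<phi> M \<Longrightarrow> s \<in> N \<Longrightarrow> \<phi> x (c *\<^sub>R s x) = c *\<^sub>R \<phi> x (s x)"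
  unfolding module_map_def by blast+

lemma module_map_zero: "module_map N \<phi> M \<Longrightarrow> function_module N \<Longrightarrow> \<phi> x 0 = 0"
  using module_map_scale[of N \<phi> M "\<lambda>_. 0" x 0] function_module_zero by auto

lemma module_map_sum:
  assumes "module_map N \<phi> M" "function_module N" "\<And>k. k \<in> I \<Longrightarrow> s k \<in> N"
  shows "\<phi> x (\<Sum>k\<in>I. s k x) = (\<Sum>k\<in>I. \<phi> x (s k x))"
  using assms(3)
proof (induction I rule: infinite_finite_induct)
  case (insert k I)
  then show ?case
    using module_map_add[OF assms(1), of "s k" "\<lambda>x. \<Sum>k\<in>I. s k x" x] function_module_sum[OF assms(2), of I s] by simp
qed (simp_all add: module_map_zero[OF assms(1,2)])

lemma module_map_diff:
  assumes "module_map N \<phi> M" "function_module N" "s \<in> N" "t \<in> N"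
  shows "\<phi> x (s x - t x) = \<phi> x (s x) - \<phi> x (t x)"
proof -
  have "(\<lambda>x. (- 1) *\<^sub>R t x) \<in> N" by (rule function_module_const[OF assms(2,4)])
  from module_map_add[OF assms(1,3) this, of x] module_map_scale[OF assms(1,4), of x "-1"] show ?thesis by simp
qed

lemma push_mforms:
  assumes \<phi>: "module_map N \<phi> M" and \<alpha>: "\<alpha> \<in> mforms i N"
  shows "push \<phi> \<alpha> \<in> mforms i M"
proof (rule mformsI)
  show "altmap i (push \<phi> \<alpha> x)" for x
    unfolding push_def
    by (rule altmap_compose[OF mforms_altmap[OF \<alpha>], where S = "{s x | s. s \<in> N}"])
      (auto intro: mforms_value[OF \<alpha>] module_map_add[OF \<phi>] module_map_scale[OF \<phi>])
  show "(\<lambda>x. push \<phi> \<alpha> x vs) \<in> M" for vs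
    unfolding push_def by (rule module_map_closed[OF \<phi> mforms_value[OF \<alpha>]])
qed

lemma euler_d_push: "euler_d (push \<phi> \<alpha>) = push \<phi> (euler_d \<alpha>)"
  by (simp add: euler_d_def push_def)

lemma push_form_act:
  assumes \<phi>: "module_map N \<phi> M" and N: "function_module N" and D: "derivation_over A D N"
    and comm: "\<And>s x. s \<in> N \<Longrightarrow> \<phi> x (D s x) = D' (\<lambda>x. \<phi> x (s x)) x" and \<alpha>: "\<alpha> \<in> mforms i N"
  shows "push \<phi> (form_act A D \<alpha>) = form_act A D' (push \<phi> \<alpha>)"
proof (intro ext)
  fix x vs
  note val = mforms_value[OF \<alpha>]
  have "push \<phi> (form_act A D \<alpha>) x vs
    = \<phi> x (D (\<lambda>y. \<alpha> y vs) x) + \<phi> x (\<Sum>j<length vs. \<alpha> x (vs[j := A (vs ! j)]))"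
    unfolding push_def form_act_def
    by (rule module_map_add[OF \<phi> derivation_closed[OF D val] function_module_sum[OF N]]) (rule val)
  also have "\<dots> = D' (\<lambda>y. \<phi> y (\<alpha> y vs)) x + (\<Sum>j<length vs. \<phi> x (\<alpha> x (vs[j := A (vs ! j)])))"
    using comm[OF val] module_map_sum[OF \<phi> N, of _ "\<lambda>j x. \<alpha> x (vs[j := A (vs ! j)])"] val by simp
  finally show "push \<phi> (form_act A D \<alpha>) x vs = form_act A D' (push \<phi> \<alpha>) x vs"
    by (simp add: form_act_def push_def)
qed

text \<open>Forms with values in a module are a finite power of that module: a lift can be chosen for the value on each word
  in the basis.\<close>

lemma (in finite_basis) push_lift:
  assumes \<phi>: "module_map N \<phi> (M :: ('v \<Rightarrow> 'u::real_vector) set)" and N: "function_module N"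
    and surj: "\<And>m. m \<in> M \<Longrightarrow> \<exists>s\<in>N. m = (\<lambda>x. \<phi> x (s x))" and z: "z \<in> mforms i M"
  obtains c where "c \<in> mforms i N" "push \<phi> c = z"
proof -
  have "\<forall>a. \<exists>s. s \<in> N \<and> (\<lambda>x. z x a) = (\<lambda>x. \<phi> x (s x))" using surj[OF mforms_value[OF z]] by blast
  then obtain s where s: "\<And>a. s a \<in> N" "\<And>a. (\<lambda>x. z x a) = (\<lambda>x. \<phi> x (s a x))" by metis
  define c where "c x vs = (\<Sum>a\<in>words i. dual_form a vs *\<^sub>R s a x)" for x vs
  have c: "c \<in> mforms i N" unfolding c_def by (rule dual_form_combination[OF N s(1)])
  have "push \<phi> c x vs = z x vs" for x vs
  proof -
    have "push \<phi> c x vs = (\<Sum>a\<in>words i. \<phi> x (dual_form a vs *\<^sub>R s a x))"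
      unfolding push_def c_def
      by (rule module_map_sum[OF \<phi> N, of _ "\<lambda>a x. dual_form a vs *\<^sub>R s a x"]) (rule function_module_const[OF N s(1)])
    also have "\<dots> = (\<Sum>a\<in>words i. dual_form a vs *\<^sub>R z x a)"
      using fun_cong[OF s(2)] by (simp add: module_map_scale[OF \<phi> s(1)])
    finally show ?thesis by (simp only: mforms_expand[OF z, of x vs])
  qed
  then show thesis using that[OF c] by blast
qed

section \<open>Dimension shifting\<close>

definition cycles :: "nat \<Rightarrow> ('v::real_normed_vector \<Rightarrow> 'w::real_vector) set \<Rightarrow> ('v \<Rightarrow> 'v list \<Rightarrow> 'w) set" where
  "cycles i M = {z \<in> mforms i M. euler_d z = (\<lambda>_ _. 0)}"

definition boundaries :: "nat \<Rightarrow> ('v::real_normed_vector \<Rightarrow> 'w::real_vector) set \<Rightarrow> ('v \<Rightarrow> 'v list \<Rightarrow> 'w) set" where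
  "boundaries i M = euler_d ` mforms (Suc i) M"

text \<open>Such a map on cycles induces an isomorphism of the \<open>i\<close>-th Koszul homology of \<open>M\<close> with \<open>W\<close> which intertwines the
  actions of all \<open>e\<close> in \<open>G\<close>. Working on cycles avoids quotients until the very end.\<close>

definition homology_map ::
  "'k set \<Rightarrow> ('k \<Rightarrow> 'v \<Rightarrow> 'v) \<Rightarrow> ('k \<Rightarrow> ('v::real_normed_vector \<Rightarrow> 'w::real_vector) \<Rightarrow> 'v \<Rightarrow> 'w) \<Rightarrow>
    ('v \<Rightarrow> 'w) set \<Rightarrow> nat \<Rightarrow> ('k \<Rightarrow> 'e \<Rightarrow> 'e) \<Rightarrow> 'e::real_vector set \<Rightarrow> (('v \<Rightarrow> 'v list \<Rightarrow> 'w) \<Rightarrow> 'e) \<Rightarrow> bool" where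
  "homology_map G A D M i L W h \<longleftrightarrow>
     h ` cycles i M = W \<and>
     (\<forall>z\<in>cycles i M. \<forall>z'\<in>cycles i M. h (\<lambda>x vs. z x vs + z' x vs) = h z + h z') \<and>
     (\<forall>c. \<forall>z\<in>cycles i M. h (\<lambda>x vs. c *\<^sub>R z x vs) = c *\<^sub>R h z) \<and>
     (\<forall>z\<in>cycles i M. h z = 0 \<longleftrightarrow> z \<in> boundaries i M) \<and>
     (\<forall>e\<in>G. \<forall>z\<in>cycles i M. h (form_act (A e) (D e) z) = L e (h z))"

text \<open>Degree zero: \<open>H\<^sub>0\<close> of the image of \<open>\<phi>\<close> is the space of values at the origin of the sections in \<open>N\<close>,
  because the kernel of \<open>\<phi>\<close> vanishes there.\<close>

lemma (in finite_basis) homology_map_degree_0: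
  fixes N :: "('v \<Rightarrow> 'e::real_vector) set" and M :: "('v \<Rightarrow> 'u::real_vector) set"
  assumes \<phi>: "module_map N \<phi> M" and N: "function_module N" and M: "function_module M"
    and surj: "\<And>m. m \<in> M \<Longrightarrow> \<exists>s\<in>N. m = (\<lambda>x. \<phi> x (s x))"
    and ker: "\<And>s. s \<in> N \<Longrightarrow> (\<And>x. \<phi> x (s x) = 0) \<Longrightarrow> s 0 = 0"
    and exact: "\<And>s. s \<in> N \<Longrightarrow> s 0 = 0 \<Longrightarrow> \<exists>\<sigma>\<in>mforms (Suc 0) N. euler_d \<sigma> = degree_0_form s"
    and D: "\<And>e. e \<in> G \<Longrightarrow> derivation_over (A e) (DN e) N"
    and comm: "\<And>e s x. e \<in> G \<Longrightarrow> s \<in> N \<Longrightarrow> \<phi> x (DN e s x) = D e (\<lambda>x. \<phi> x (s x)) x"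
    and L: "\<And>e s. e \<in> G \<Longrightarrow> s \<in> N \<Longrightarrow> L e (s 0) = DN e s 0"
    and W: "W = {s 0 | s. s \<in> N}"
  shows "\<exists>h. homology_map G A D M 0 L W h"
proof -
  define h where "h z = (SOME s. s \<in> N \<and> (\<lambda>x. z x []) = (\<lambda>x. \<phi> x (s x))) 0" for z :: "'v \<Rightarrow> 'v list \<Rightarrow> 'u"
  have h: "h z = s 0" if s: "s \<in> N" and z: "\<And>x. z x [] = \<phi> x (s x)" for z s
  proof -
    define t where "t = (SOME s. s \<in> N \<and> (\<lambda>x. z x []) = (\<lambda>x. \<phi> x (s x)))"
    have "t \<in> N \<and> (\<lambda>x. z x []) = (\<lambda>x. \<phi> x (t x))"
      unfolding t_def by (rule someI[of _ s]) (use s z in auto)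
    then have t: "t \<in> N" "\<And>x. z x [] = \<phi> x (t x)" by (auto dest: fun_cong)
    have "\<phi> x (t x - s x) = 0" for x using module_map_diff[OF \<phi> N t(1) s, of x] z t(2) by simp
    then have "t 0 - s 0 = 0" using ker[OF function_module_diff[OF N t(1) s]] by simp
    then show ?thesis by (simp add: h_def t_def)
  qed
  have lift: "\<exists>s\<in>N. \<forall>x. z x [] = \<phi> x (s x)" if "z \<in> mforms 0 M" for z
    using surj[OF mforms_value[OF that, of "[]"]] by (metis (no_types, lifting))
  have cyc: "cycles 0 M = mforms 0 M" unfolding cycles_def using euler_d_degree_0 by blast
  show ?thesis
    unfolding homology_map_def cyc
  proof (intro exI[of _ h] conjI ballI allI)
    show "h ` mforms 0 M = W"
    proof (intro equalityI subsetI)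
      fix w assume "w \<in> h ` mforms 0 M"
      then show "w \<in> W" unfolding W using lift h by blast
    next
      fix w assume "w \<in> W"
      then obtain s where s: "s \<in> N" "w = s 0" unfolding W by blast
      have "degree_0_form (\<lambda>x. \<phi> x (s x)) \<in> mforms 0 M"
        by (rule degree_0_form_mforms[OF M module_map_closed[OF \<phi> s(1)]])
      moreover have "h (degree_0_form (\<lambda>x. \<phi> x (s x))) = w"
        unfolding s(2) by (rule h[OF s(1)]) (simp add: degree_0_form_def)
      ultimately show "w \<in> h ` mforms 0 M" by blast
    qed
  next
    fix z z' assume "z \<in> mforms 0 M" "z' \<in> mforms 0 M"
    then obtain s s' where s: "s \<in> N" "\<And>x. z x [] = \<phi> x (s x)" "s' \<in> N" "\<And>x. z' x [] = \<phi> x (s' x)"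
      using lift by metis
    show "h (\<lambda>x vs. z x vs + z' x vs) = h z + h z'"
      unfolding h[of s z, OF s(1,2)] h[of s' z', OF s(3,4)]
      by (rule h[OF function_module_add[OF N s(1,3)]]) (simp add: s(2,4) module_map_add[OF \<phi> s(1,3)])
  next
    fix c z assume "z \<in> mforms 0 M"
    then obtain s where s: "s \<in> N" "\<And>x. z x [] = \<phi> x (s x)" using lift by metis
    show "h (\<lambda>x vs. c *\<^sub>R z x vs) = c *\<^sub>R h z"
      unfolding h[of s z, OF s]
      by (rule h[OF function_module_const[OF N s(1)]]) (simp add: s(2) module_map_scale[OF \<phi> s(1)])
  next
    fix z assume z: "z \<in> mforms 0 M"
    then obtain s where s: "s \<in> N" "\<And>x. z x [] = \<phi> x (s x)" using lift by metis
    have z_eq: "z = push \<phi> (degree_0_form s)"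
      by (subst degree_0_form_eq[OF z]) (auto simp: fun_eq_iff degree_0_form_def push_def s(2) module_map_zero[OF \<phi> N])
    show "(h z = 0) = (z \<in> boundaries 0 M)"
    proof
      assume "h z = 0"
      then obtain \<sigma> where \<sigma>: "\<sigma> \<in> mforms (Suc 0) N" "euler_d \<sigma> = degree_0_form s"
        using exact[OF s(1)] h[of s z, OF s] by auto
      then have "z = euler_d (push \<phi> \<sigma>)" by (simp add: euler_d_push z_eq)
      then show "z \<in> boundaries 0 M" unfolding boundaries_def using push_mforms[OF \<phi> \<sigma>(1)] by blast
    next
      assume "z \<in> boundaries 0 M"
      then obtain \<mu> where \<mu>: "\<mu> \<in> mforms (Suc 0) M" "z = euler_d \<mu>" unfolding boundaries_def by blast
      obtain c where c: "c \<in> mforms (Suc 0) N" "push \<phi> c = \<mu>" using push_lift[OF \<phi> N surj \<mu>(1)] by blast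
      have "h z = euler_d c 0 []"
        by (rule h[OF mforms_value[OF euler_d_mforms[OF N c(1)]]]) (simp add: \<mu>(2) c(2)[symmetric] euler_d_push, simp add: push_def)
      then show "h z = 0" by (simp add: euler_d_at_0[OF c(1)])
    qed
  next
    fix e z assume e: "e \<in> G" and z: "z \<in> mforms 0 M"
    then obtain s where s: "s \<in> N" "\<And>x. z x [] = \<phi> x (s x)" using lift by metis
    show "h (form_act (A e) (D e) z) = L e (h z)"
      unfolding h[of s z, OF s] L[OF e s(1)]
      by (rule h[OF derivation_closed[OF D[OF e] s(1)]]) (simp add: form_act_def s(2) comm[OF e s(1)])
  qed
qed

text \<open>The connecting homomorphism of \<open>0 \<rightarrow> ker \<phi> \<rightarrow> N \<rightarrow> M \<rightarrow> 0\<close> for a Koszul-acyclic \<open>N\<close>: lift a cycle along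
  \<open>\<phi>\<close> and contract.\<close>

lemma (in finite_basis) homology_map_shift:
  fixes N :: "('v \<Rightarrow> 'e::real_vector) set" and M :: "('v \<Rightarrow> 'u::real_vector) set" and h' :: "_ \<Rightarrow> 'f::real_vector"
  assumes \<phi>: "module_map N \<phi> M" and N: "function_module N" and M: "function_module M"
    and surj: "\<And>m. m \<in> M \<Longrightarrow> \<exists>s\<in>N. m = (\<lambda>x. \<phi> x (s x))"
    and K: "K = {s \<in> N. \<forall>x. \<phi> x (s x) = 0}"
    and ker: "\<And>s. s \<in> K \<Longrightarrow> s 0 = 0"
    and exact: "\<And>k \<omega>. \<omega> \<in> cycles k N \<Longrightarrow> (k = 0 \<Longrightarrow> \<omega> 0 [] = 0) \<Longrightarrow> \<exists>\<gamma>\<in>mforms (Suc k) N. euler_d \<gamma> = \<omega>"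
    and A: "\<And>e. e \<in> G \<Longrightarrow> linear (A e)"
    and D: "\<And>e. e \<in> G \<Longrightarrow> derivation_over (A e) (DN e) N"
    and comm: "\<And>e s x. e \<in> G \<Longrightarrow> s \<in> N \<Longrightarrow> \<phi> x (DN e s x) = D e (\<lambda>x. \<phi> x (s x)) x"
    and h': "homology_map G A DN K i L W h'"
  shows "\<exists>h. homology_map G A D M (Suc i) L W h"
proof -
  have KN: "K \<subseteq> N" unfolding K by blast
  have FK: "function_module K"
    unfolding K function_module_def
    using function_module_zero[OF N] function_module_add[OF N] function_module_smult[OF N]
    by (auto simp: module_map_zero[OF \<phi> N] module_map_add[OF \<phi>] module_map_scale[OF \<phi>])
  have h'_img: "h' ` cycles i K = W"
    and h'_add: "\<And>z z'. z \<in> cycles i K \<Longrightarrow> z' \<in> cycles i K \<Longrightarrow> h' (\<lambda>x vs. z x vs + z' x vs) = h' z + h' z'"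
    and h'_scale: "\<And>c z. z \<in> cycles i K \<Longrightarrow> h' (\<lambda>x vs. c *\<^sub>R z x vs) = c *\<^sub>R h' z"
    and h'_ker: "\<And>z. z \<in> cycles i K \<Longrightarrow> h' z = 0 \<longleftrightarrow> z \<in> boundaries i K"
    and h'_act: "\<And>e z. e \<in> G \<Longrightarrow> z \<in> cycles i K \<Longrightarrow> h' (form_act (A e) (DN e) z) = L e (h' z)"
    using h' unfolding homology_map_def by blast+
  have K_forms: "c \<in> mforms j K" if "c \<in> mforms j N" "push \<phi> c = (\<lambda>_ _. 0)" for c j
    unfolding mforms_def using mforms_altmap[OF that(1)] mforms_value[OF that(1)] fun_cong[OF fun_cong[OF that(2)]]
    by (simp add: K push_def)
  have dK: "euler_d c \<in> cycles i K" if c: "c \<in> mforms (Suc i) N" "push \<phi> c = z" "euler_d z = (\<lambda>_ _. 0)" for c z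
    unfolding cycles_def
    using K_forms[OF euler_d_mforms[OF N c(1)]] c(2,3) euler_d_euler_d[OF c(1)] by (simp add: euler_d_push[symmetric])
  have push_diff: "push \<phi> (\<lambda>x vs. c x vs - c' x vs) = (\<lambda>x vs. push \<phi> c x vs - push \<phi> c' x vs)"
    if "c \<in> mforms j N" "c' \<in> mforms j N" for c c' j
    unfolding push_def using module_map_diff[OF \<phi> N mforms_value[OF that(1)] mforms_value[OF that(2)]] by simp
  have dK0: "h' (euler_d c) = 0" if c: "c \<in> mforms (Suc i) N" "push \<phi> c = (\<lambda>_ _. 0)" for c
    using h'_ker[OF dK[OF c euler_d_zero]] K_forms[OF c] unfolding boundaries_def by blast
  define h where "h z = h' (euler_d (SOME c. c \<in> mforms (Suc i) N \<and> push \<phi> c = z))" for z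
  have h: "h z = h' (euler_d c)" if c: "c \<in> mforms (Suc i) N" "push \<phi> c = z" and z: "euler_d z = (\<lambda>_ _. 0)" for z c
  proof -
    define c' where "c' = (SOME c. c \<in> mforms (Suc i) N \<and> push \<phi> c = z)"
    have "c' \<in> mforms (Suc i) N \<and> push \<phi> c' = z"
      unfolding c'_def by (rule someI[of _ c]) (use c in auto)
    then have c': "c' \<in> mforms (Suc i) N" "push \<phi> c' = z" by auto
    \<comment> \<open>two lifts differ by a form with values in the kernel, and the contraction of the latter is a boundary\<close>
    have "0 = h' (euler_d (\<lambda>x vs. c' x vs - c x vs))"
      by (rule dK0[symmetric]) (simp_all add: mforms_diff[OF N c'(1) c(1)] push_diff[OF c'(1) c(1)] c'(2) c(2))
    moreover have "euler_d (\<lambda>x vs. c' x vs - c x vs) \<in> cycles i K"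
      by (rule dK[OF mforms_diff[OF N c'(1) c(1)] _ euler_d_zero]) (simp add: push_diff[OF c'(1) c(1)] c'(2) c(2))
    ultimately have "h' (\<lambda>x vs. euler_d (\<lambda>x vs. c' x vs - c x vs) x vs + euler_d c x vs) = h' (euler_d c)"
      by (subst h'_add[OF _ dK[OF c z]]) simp_all
    then have "h' (euler_d c') = h' (euler_d c)" by (simp add: euler_d_diff)
    then show ?thesis by (simp add: h_def c'_def)
  qed
  have lift: "\<exists>c. c \<in> mforms (Suc i) N \<and> push \<phi> c = z \<and> euler_d z = (\<lambda>_ _. 0)" if "z \<in> cycles (Suc i) M" for z
    using that push_lift[OF \<phi> N surj, of z "Suc i"] unfolding cycles_def by blast
  show ?thesis
    unfolding homology_map_def
  proof (intro exI[of _ h] conjI ballI allI)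
    show "h ` cycles (Suc i) M = W"
    proof (intro equalityI subsetI)
      fix w assume "w \<in> h ` cycles (Suc i) M"
      then obtain z where z: "z \<in> cycles (Suc i) M" "w = h z" by blast
      obtain c where c: "c \<in> mforms (Suc i) N" "push \<phi> c = z" "euler_d z = (\<lambda>_ _. 0)" using lift[OF z(1)] by blast
      show "w \<in> W" unfolding z(2) h[OF c] using dK[OF c] h'_img by blast
    next
      fix w assume "w \<in> W"
      then obtain y where y: "y \<in> cycles i K" "w = h' y" using h'_img by blast
      have "y \<in> cycles i N" using y(1) mforms_mono[OF _ KN] unfolding cycles_def by blast
      moreover have "y 0 [] = 0" using ker[OF mforms_value] y(1) unfolding cycles_def by blast
      ultimately obtain c where c: "c \<in> mforms (Suc i) N" "euler_d c = y" using exact by blast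
      have "y \<in> mforms i K" using y(1) unfolding cycles_def by blast
      from mforms_value[OF this] have "push \<phi> y = (\<lambda>_ _. 0)" unfolding push_def K by blast
      then have "euler_d (push \<phi> c) = (\<lambda>_ _. 0)" by (simp only: euler_d_push c(2))
      then have "push \<phi> c \<in> cycles (Suc i) M" "h (push \<phi> c) = w"
        using push_mforms[OF \<phi> c(1)] h[OF c(1) HOL.refl] by (auto simp: cycles_def c(2) y(2))
      then show "w \<in> h ` cycles (Suc i) M" by blast
    qed
  next
    fix z z' assume "z \<in> cycles (Suc i) M" "z' \<in> cycles (Suc i) M"
    then obtain c c' where c: "c \<in> mforms (Suc i) N" "push \<phi> c = z" "euler_d z = (\<lambda>_ _. 0)"
      and c': "c' \<in> mforms (Suc i) N" "push \<phi> c' = z'" "euler_d z' = (\<lambda>_ _. 0)" using lift by meson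
    have "h (\<lambda>x vs. z x vs + z' x vs) = h' (euler_d (\<lambda>x vs. c x vs + c' x vs))"
    proof (rule h[OF mforms_add[OF N c(1) c'(1)]])
      show "push \<phi> (\<lambda>x vs. c x vs + c' x vs) = (\<lambda>x vs. z x vs + z' x vs)"
        unfolding c(2)[symmetric] c'(2)[symmetric] push_def
        using module_map_add[OF \<phi> mforms_value[OF c(1)] mforms_value[OF c'(1)]] by simp
    qed (simp add: euler_d_add c(3) c'(3))
    also have "\<dots> = h' (euler_d c) + h' (euler_d c')" unfolding euler_d_add by (rule h'_add[OF dK[OF c] dK[OF c']])
    finally show "h (\<lambda>x vs. z x vs + z' x vs) = h z + h z'" unfolding h[OF c] h[OF c'] .
  next
    fix k z assume "z \<in> cycles (Suc i) M"
    then obtain c where c: "c \<in> mforms (Suc i) N" "push \<phi> c = z" "euler_d z = (\<lambda>_ _. 0)" using lift by meson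
    have "h (\<lambda>x vs. k *\<^sub>R z x vs) = h' (euler_d (\<lambda>x vs. k *\<^sub>R c x vs))"
    proof (rule h[OF mforms_const[OF N c(1)]])
      show "push \<phi> (\<lambda>x vs. k *\<^sub>R c x vs) = (\<lambda>x vs. k *\<^sub>R z x vs)"
        unfolding c(2)[symmetric] push_def using module_map_scale[OF \<phi> mforms_value[OF c(1)]] by simp
    qed (simp add: euler_d_smult c(3))
    also have "\<dots> = k *\<^sub>R h' (euler_d c)" unfolding euler_d_smult by (rule h'_scale[OF dK[OF c]])
    finally show "h (\<lambda>x vs. k *\<^sub>R z x vs) = k *\<^sub>R h z" unfolding h[OF c] .
  next
    fix z assume "z \<in> cycles (Suc i) M"
    then obtain c where c: "c \<in> mforms (Suc i) N" "push \<phi> c = z" "euler_d z = (\<lambda>_ _. 0)" using lift by meson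
    show "(h z = 0) = (z \<in> boundaries (Suc i) M)"
    proof
      assume "h z = 0"
      then have "euler_d c \<in> boundaries i K" using h'_ker[OF dK[OF c]] h[OF c] by simp
      then obtain \<mu> where \<mu>: "\<mu> \<in> mforms (Suc i) K" "euler_d c = euler_d \<mu>" unfolding boundaries_def by blast
      note \<mu>N = mforms_mono[OF \<mu>(1) KN]
      have "(\<lambda>x vs. c x vs - \<mu> x vs) \<in> cycles (Suc i) N"
        unfolding cycles_def using mforms_diff[OF N c(1) \<mu>N] by (simp add: euler_d_diff \<mu>(2))
      then obtain \<gamma> where \<gamma>: "\<gamma> \<in> mforms (Suc (Suc i)) N" "euler_d \<gamma> = (\<lambda>x vs. c x vs - \<mu> x vs)"
        using exact by blast
      have "push \<phi> \<mu> = (\<lambda>_ _. 0)" unfolding push_def using mforms_value[OF \<mu>(1)] unfolding K by blast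
      then have "z = euler_d (push \<phi> \<gamma>)" unfolding euler_d_push \<gamma>(2) push_diff[OF c(1) \<mu>N] c(2) by simp
      then show "z \<in> boundaries (Suc i) M" unfolding boundaries_def using push_mforms[OF \<phi> \<gamma>(1)] by blast
    next
      assume "z \<in> boundaries (Suc i) M"
      then obtain \<zeta> where \<zeta>: "\<zeta> \<in> mforms (Suc (Suc i)) M" "z = euler_d \<zeta>" unfolding boundaries_def by blast
      obtain \<gamma> where \<gamma>: "\<gamma> \<in> mforms (Suc (Suc i)) N" "push \<phi> \<gamma> = \<zeta>" using push_lift[OF \<phi> N surj \<zeta>(1)] by blast
      have "h z = h' (euler_d (euler_d \<gamma>))"
        by (rule h[OF euler_d_mforms[OF N \<gamma>(1)] _ c(3)]) (simp add: euler_d_push[symmetric] \<gamma>(2) \<zeta>(2))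
      also have "\<dots> = h' (euler_d (\<lambda>_ _. 0))" by (simp add: euler_d_euler_d[OF \<gamma>(1)] euler_d_zero)
      also have "\<dots> = 0"
        by (rule dK0[OF mforms_zero[OF N]]) (simp add: push_def module_map_zero[OF \<phi> N])
      finally show "h z = 0" .
    qed
  next
    fix e z assume e: "e \<in> G" and "z \<in> cycles (Suc i) M"
    then obtain c where c: "c \<in> mforms (Suc i) N" "push \<phi> c = z" "euler_d z = (\<lambda>_ _. 0)" using lift by meson
    note De = D[OF e] and Ae = A[OF e]
    have p: "push \<phi> (form_act (A e) (DN e) c) = form_act (A e) (D e) z"
      using push_form_act[OF \<phi> N De comm[OF e] c(1)] c(2) by simp
    have "euler_d (form_act (A e) (D e) z) = push \<phi> (form_act (A e) (DN e) (euler_d c))"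
      unfolding p[symmetric] euler_d_push euler_d_form_act[OF De N Ae c(1)] ..
    also have "\<dots> = form_act (A e) (D e) (push \<phi> (euler_d c))"
      by (rule push_form_act[OF \<phi> N De comm[OF e] euler_d_mforms[OF N c(1)]])
    also have "push \<phi> (euler_d c) = push \<phi> (\<lambda>_ _. 0)"
      using c(2,3) by (simp add: euler_d_push[symmetric]) (simp add: push_def module_map_zero[OF \<phi> N])
    also have "form_act (A e) (D e) (push \<phi> (\<lambda>_ _. 0)) = push \<phi> (form_act (A e) (DN e) (\<lambda>_ _. 0))"
      by (rule push_form_act[OF \<phi> N De comm[OF e] mforms_zero[OF N, of 0], symmetric])
    also have "\<dots> = (\<lambda>_ _. 0)"
      by (simp add: push_def form_act_def derivation_zero[OF De N] module_map_zero[OF \<phi> N])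
    finally have "h (form_act (A e) (D e) z) = h' (euler_d (form_act (A e) (DN e) c))"
      by (rule h[OF form_act_mforms[OF De N Ae c(1)] p])
    also have "\<dots> = L e (h' (euler_d c))"
      unfolding euler_d_form_act[OF De N Ae c(1)] by (rule h'_act[OF e dK[OF c]])
    finally show "h (form_act (A e) (D e) z) = L e (h z)" unfolding h[OF c] .
  qed
qed

section \<open>Transport of algebraic structure along surjections\<close>

text \<open>Additive inverses are multiples by \<open>- 1\<close>.\<close>

lemma submodule_criterion:
  assumes M: "Module.module R M" and H: "H \<subseteq> carrier M" "\<zero>\<^bsub>M\<^esub> \<in> H"
    "\<And>a b. a \<in> H \<Longrightarrow> b \<in> H \<Longrightarrow> a \<oplus>\<^bsub>M\<^esub> b \<in> H" "\<And>a x. a \<in> carrier R \<Longrightarrow> x \<in> H \<Longrightarrow> a \<odot>\<^bsub>M\<^esub> x \<in> H"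
  shows "submodule H R M"
proof -
  interpret Module.module R M by (rule M)
  show ?thesis
  proof (rule submoduleI[OF H(1,2) _ H(3,4)])
    fix a assume a: "a \<in> H"
    have "(\<ominus>\<^bsub>R\<^esub> \<one>\<^bsub>R\<^esub>) \<odot>\<^bsub>M\<^esub> a = \<ominus>\<^bsub>M\<^esub> a"
      using a H(1) by (subst smult_l_minus) auto
    then show "\<ominus>\<^bsub>M\<^esub> a \<in> H" using H(4)[OF _ a, of "\<ominus>\<^bsub>R\<^esub> \<one>\<^bsub>R\<^esub>"] by simp
  qed
qed

text \<open>All axioms but the existence of inverses are equations between elements of the image.\<close>

lemma module_surj:
  assumes M: "Module.module R M" and surj: "f ` carrier M = carrier M'" and zero: "f \<zero>\<^bsub>M\<^esub> = \<zero>\<^bsub>M'\<^esub>"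
    and add: "\<And>x y. x \<in> carrier M \<Longrightarrow> y \<in> carrier M \<Longrightarrow> f (x \<oplus>\<^bsub>M\<^esub> y) = f x \<oplus>\<^bsub>M'\<^esub> f y"
    and smult: "\<And>r x. r \<in> carrier R \<Longrightarrow> x \<in> carrier M \<Longrightarrow> f (r \<odot>\<^bsub>M\<^esub> x) = r \<odot>\<^bsub>M'\<^esub> f x"
  shows "Module.module R M'"
proof -
  interpret Module.module R M by (rule M)
  have fc: "f x \<in> carrier M'" if "x \<in> carrier M" for x using that surj by blast
  have ex: "\<exists>y\<in>carrier M. x = f y" if "x \<in> carrier M'" for x using that surj by blast
  show ?thesis
  proof (rule moduleI)
    show "abelian_group M'"
    proof (rule abelian_groupI)
      fix x assume "x \<in> carrier M'"
      then obtain x' where x: "x' \<in> carrier M" "x = f x'" using ex by blast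
      show "\<zero>\<^bsub>M'\<^esub> \<oplus>\<^bsub>M'\<^esub> x = x" using x by (simp add: zero[symmetric] add[symmetric])
      have "f (\<ominus>\<^bsub>M\<^esub> x') \<oplus>\<^bsub>M'\<^esub> x = \<zero>\<^bsub>M'\<^esub>" using x by (simp add: zero[symmetric] add[symmetric] M.l_neg)
      then show "\<exists>y\<in>carrier M'. y \<oplus>\<^bsub>M'\<^esub> x = \<zero>\<^bsub>M'\<^esub>" using fc x(1) by blast
    next
      fix x y assume "x \<in> carrier M'" "y \<in> carrier M'"
      then obtain x' y' where x: "x' \<in> carrier M" "x = f x'" "y' \<in> carrier M" "y = f y'" using ex by metis
      show "x \<oplus>\<^bsub>M'\<^esub> y \<in> carrier M'" using x by (simp add: add[symmetric] fc)
      show "x \<oplus>\<^bsub>M'\<^esub> y = y \<oplus>\<^bsub>M'\<^esub> x" using x by (simp add: add[symmetric] M.a_comm)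
    next
      fix x y z assume "x \<in> carrier M'" "y \<in> carrier M'" "z \<in> carrier M'"
      then obtain x' y' z' where x: "x' \<in> carrier M" "x = f x'" "y' \<in> carrier M" "y = f y'"
        "z' \<in> carrier M" "z = f z'" using ex by metis
      show "x \<oplus>\<^bsub>M'\<^esub> y \<oplus>\<^bsub>M'\<^esub> z = x \<oplus>\<^bsub>M'\<^esub> (y \<oplus>\<^bsub>M'\<^esub> z)" using x by (simp add: add[symmetric] M.a_assoc)
    qed (use fc zero in \<open>auto simp: zero[symmetric]\<close>)
  next
    fix a x assume a: "a \<in> carrier R" and "x \<in> carrier M'"
    then obtain x' where x: "x' \<in> carrier M" "x = f x'" using ex by blast
    show "a \<odot>\<^bsub>M'\<^esub> x \<in> carrier M'" using x a by (simp add: smult[symmetric] fc)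
  next
    fix x assume "x \<in> carrier M'"
    then obtain x' where x: "x' \<in> carrier M" "x = f x'" using ex by blast
    show "\<one>\<^bsub>R\<^esub> \<odot>\<^bsub>M'\<^esub> x = x" using x by (simp add: smult[symmetric])
  next
    fix a b x assume a: "a \<in> carrier R" "b \<in> carrier R" and "x \<in> carrier M'"
    then obtain x' where x: "x' \<in> carrier M" "x = f x'" using ex by blast
    show "(a \<oplus>\<^bsub>R\<^esub> b) \<odot>\<^bsub>M'\<^esub> x = a \<odot>\<^bsub>M'\<^esub> x \<oplus>\<^bsub>M'\<^esub> b \<odot>\<^bsub>M'\<^esub> x"
      using x a by (simp add: smult[symmetric] add[symmetric] smult_l_distr)
    show "(a \<otimes>\<^bsub>R\<^esub> b) \<odot>\<^bsub>M'\<^esub> x = a \<odot>\<^bsub>M'\<^esub> (b \<odot>\<^bsub>M'\<^esub> x)"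
      using x a by (simp add: smult[symmetric] smult_assoc1)
  next
    fix a x y assume a: "a \<in> carrier R" and "x \<in> carrier M'" "y \<in> carrier M'"
    then obtain x' y' where x: "x' \<in> carrier M" "x = f x'" "y' \<in> carrier M" "y = f y'" using ex by metis
    show "a \<odot>\<^bsub>M'\<^esub> (x \<oplus>\<^bsub>M'\<^esub> y) = a \<odot>\<^bsub>M'\<^esub> x \<oplus>\<^bsub>M'\<^esub> a \<odot>\<^bsub>M'\<^esub> y"
      using x a by (simp add: smult[symmetric] add[symmetric] smult_r_distr)
  qed (use M in \<open>simp add: Module.module_def\<close>)
qed

lemma linear_mapsI:
  assumes "\<And>x. x \<in> carrier M \<Longrightarrow> f x \<in> carrier N"
    "\<And>x y. x \<in> carrier M \<Longrightarrow> y \<in> carrier M \<Longrightarrow> f (x \<oplus>\<^bsub>M\<^esub> y) = f x \<oplus>\<^bsub>N\<^esub> f y"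
    "\<And>r x. r \<in> carrier R \<Longrightarrow> x \<in> carrier M \<Longrightarrow> f (r \<odot>\<^bsub>M\<^esub> x) = r \<odot>\<^bsub>N\<^esub> f x"
  shows "f \<in> linear_maps R M N"
  unfolding linear_maps_def using assms by auto

lemma linear_mapsD:
  assumes "f \<in> linear_maps R M N"
  shows "x \<in> carrier M \<Longrightarrow> f x \<in> carrier N"
    "x \<in> carrier M \<Longrightarrow> y \<in> carrier M \<Longrightarrow> f (x \<oplus>\<^bsub>M\<^esub> y) = f x \<oplus>\<^bsub>N\<^esub> f y"
    "r \<in> carrier R \<Longrightarrow> x \<in> carrier M \<Longrightarrow> f (r \<odot>\<^bsub>M\<^esub> x) = r \<odot>\<^bsub>N\<^esub> f x"
  using assms unfolding linear_maps_def by auto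

lemma linear_maps_neg:
  assumes M: "Module.module R M" and N: "Module.module R N" and f: "f \<in> linear_maps R M N" and x: "x \<in> carrier M"
  shows "f (\<ominus>\<^bsub>M\<^esub> x) = \<ominus>\<^bsub>N\<^esub> f x" and "f \<zero>\<^bsub>M\<^esub> = \<zero>\<^bsub>N\<^esub>"
proof -
  interpret M: Module.module R M by (rule M)
  interpret N: Module.module R N by (rule N)
  note fD = linear_mapsD[OF f]
  have "\<ominus>\<^bsub>M\<^esub> x = (\<ominus>\<^bsub>R\<^esub> \<one>\<^bsub>R\<^esub>) \<odot>\<^bsub>M\<^esub> x" using x by (subst M.smult_l_minus) auto
  then have "f (\<ominus>\<^bsub>M\<^esub> x) = (\<ominus>\<^bsub>R\<^esub> \<one>\<^bsub>R\<^esub>) \<odot>\<^bsub>N\<^esub> f x" using x by (simp add: fD(3))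
  also have "\<dots> = \<ominus>\<^bsub>N\<^esub> f x" using fD(1)[OF x] by (subst N.smult_l_minus) auto
  finally show "f (\<ominus>\<^bsub>M\<^esub> x) = \<ominus>\<^bsub>N\<^esub> f x" .
  have "f (\<zero>\<^bsub>R\<^esub> \<odot>\<^bsub>M\<^esub> x) = \<zero>\<^bsub>R\<^esub> \<odot>\<^bsub>N\<^esub> f x" using x by (intro fD(3)) auto
  then show "f \<zero>\<^bsub>M\<^esub> = \<zero>\<^bsub>N\<^esub>" using x fD(1)[OF x] by simp
qed

lemma lie_algebra_surj:
  assumes L: "lie_algebra L" and f: "f \<in> linear_maps real_ring L L'" and surj: "f ` carrier L = carrier L'"
    and zero: "f \<zero>\<^bsub>L\<^esub> = \<zero>\<^bsub>L'\<^esub>"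
    and br: "\<And>x y. x \<in> carrier L \<Longrightarrow> y \<in> carrier L \<Longrightarrow> f (lbr L x y) = lbr L' (f x) (f y)"
  shows "lie_algebra L'"
proof -
  have modL: "Module.module real_ring L"
    and lr: "\<And>x. x \<in> carrier L \<Longrightarrow> lbr L x \<in> linear_maps real_ring L L"
    and ll: "\<And>x. x \<in> carrier L \<Longrightarrow> (\<lambda>y. lbr L y x) \<in> linear_maps real_ring L L"
    and alt: "\<And>x. x \<in> carrier L \<Longrightarrow> lbr L x x = \<zero>\<^bsub>L\<^esub>"
    and jac: "\<And>x y z. x \<in> carrier L \<Longrightarrow> y \<in> carrier L \<Longrightarrow> z \<in> carrier L \<Longrightarrow>
        lbr L x (lbr L y z) \<oplus>\<^bsub>L\<^esub> lbr L y (lbr L z x) \<oplus>\<^bsub>L\<^esub> lbr L z (lbr L x y) = \<zero>\<^bsub>L\<^esub>"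
    using L unfolding lie_algebra_def by blast+
  interpret L: Module.module real_ring L by (rule modL)
  note fD = linear_mapsD[OF f]
  note lc = linear_mapsD(1)[OF lr]
  have ex: "\<exists>y\<in>carrier L. x = f y" if "x \<in> carrier L'" for x using that surj by blast
  show ?thesis unfolding lie_algebra_def
  proof (intro conjI ballI)
    show "Module.module real_ring L'" by (rule module_surj[OF modL surj zero fD(2,3)])
    fix x assume "x \<in> carrier L'"
    then obtain x' where x: "x' \<in> carrier L" "x = f x'" using ex by blast
    show "lbr L' x x = \<zero>\<^bsub>L'\<^esub>" using x alt by (simp add: br[symmetric] zero)
    show "lbr L' x \<in> linear_maps real_ring L' L'"
    proof (rule linear_mapsI)
      fix y assume "y \<in> carrier L'"
      then obtain y' where y: "y' \<in> carrier L" "y = f y'" using ex by blast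
      show "lbr L' x y \<in> carrier L'" using x y by (simp add: br[symmetric] fD(1) lc)
      show "lbr L' x (r \<odot>\<^bsub>L'\<^esub> y) = r \<odot>\<^bsub>L'\<^esub> lbr L' x y" if "r \<in> carrier real_ring" for r
        using x y that by (simp add: br[symmetric] fD(3)[symmetric] lc linear_mapsD(3)[OF lr])
      fix z assume "z \<in> carrier L'"
      then obtain z' where z: "z' \<in> carrier L" "z = f z'" using ex by blast
      show "lbr L' x (y \<oplus>\<^bsub>L'\<^esub> z) = lbr L' x y \<oplus>\<^bsub>L'\<^esub> lbr L' x z"
        using x y z by (simp add: br[symmetric] fD(2)[symmetric] lc linear_mapsD(2)[OF lr])
    qed
    show "(\<lambda>y. lbr L' y x) \<in> linear_maps real_ring L' L'"
    proof (rule linear_mapsI)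
      fix y assume "y \<in> carrier L'"
      then obtain y' where y: "y' \<in> carrier L" "y = f y'" using ex by blast
      show "lbr L' y x \<in> carrier L'" using x y by (simp add: br[symmetric] fD(1) lc)
      show "lbr L' (r \<odot>\<^bsub>L'\<^esub> y) x = r \<odot>\<^bsub>L'\<^esub> lbr L' y x" if "r \<in> carrier real_ring" for r
        using x y that by (simp add: br[symmetric] fD(3)[symmetric] lc linear_mapsD(3)[OF ll])
      fix z assume "z \<in> carrier L'"
      then obtain z' where z: "z' \<in> carrier L" "z = f z'" using ex by blast
      show "lbr L' (y \<oplus>\<^bsub>L'\<^esub> z) x = lbr L' y x \<oplus>\<^bsub>L'\<^esub> lbr L' z x"
        using x y z by (simp add: br[symmetric] fD(2)[symmetric] lc linear_mapsD(2)[OF ll])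
    qed
    fix y z assume "y \<in> carrier L'" "z \<in> carrier L'"
    then obtain y' z' where y: "y' \<in> carrier L" "y = f y'" "z' \<in> carrier L" "z = f z'" using ex by metis
    show "lbr L' x (lbr L' y z) \<oplus>\<^bsub>L'\<^esub> lbr L' y (lbr L' z x) \<oplus>\<^bsub>L'\<^esub> lbr L' z (lbr L' x y) = \<zero>\<^bsub>L'\<^esub>"
      using jac[OF x(1) y(1,3)] x y by (simp add: br[symmetric] fD(2)[symmetric] lc zero)
  qed
qed

text \<open>The axioms are equations, so they pass to the image of a surjective equivariant map. In this way one representation
  on forms yields those on tensors, on homology and on the fibres of the resolution.\<close>

lemma lie_rep_surj:
  assumes rep: "lie_rep L W act" and W': "Module.module real_ring W'"
    and f: "f \<in> linear_maps real_ring W W'" and surj: "f ` carrier W = carrier W'"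
    and equiv: "\<And>x w. x \<in> carrier L \<Longrightarrow> w \<in> carrier W \<Longrightarrow> act' x (f w) = f (act x w)"
  shows "lie_rep L W' act'"
proof -
  have L: "lie_algebra L" and W: "Module.module real_ring W"
    and lin: "\<And>x. x \<in> carrier L \<Longrightarrow> act x \<in> linear_maps real_ring W W"
    and lin': "\<And>w. w \<in> carrier W \<Longrightarrow> (\<lambda>x. act x w) \<in> linear_maps real_ring L W"
    and com: "\<And>x y w. x \<in> carrier L \<Longrightarrow> y \<in> carrier L \<Longrightarrow> w \<in> carrier W \<Longrightarrow>
        act (lbr L x y) w = act x (act y w) \<ominus>\<^bsub>W\<^esub> act y (act x w)"
    using rep unfolding lie_rep_def by blast+
  interpret L: Module.module real_ring L using L unfolding lie_algebra_def by blast
  interpret W: Module.module real_ring W by (rule W)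
  note fD = linear_mapsD[OF f] and ac = linear_mapsD(1)[OF lin]
  have lbr: "lbr L x y \<in> carrier L" if "x \<in> carrier L" "y \<in> carrier L" for x y
    using L that unfolding lie_algebra_def by (meson linear_mapsD(1))
  have ex: "\<exists>y\<in>carrier W. x = f y" if "x \<in> carrier W'" for x using that surj by blast
  show ?thesis unfolding lie_rep_def
  proof (intro conjI ballI L W')
    fix x assume x: "x \<in> carrier L"
    show "act' x \<in> linear_maps real_ring W' W'"
    proof (rule linear_mapsI)
      fix w assume "w \<in> carrier W'"
      then obtain w' where w: "w' \<in> carrier W" "w = f w'" using ex by blast
      show "act' x w \<in> carrier W'" using x w by (simp add: equiv fD(1) ac)
      show "act' x (r \<odot>\<^bsub>W'\<^esub> w) = r \<odot>\<^bsub>W'\<^esub> act' x w" if r: "r \<in> carrier real_ring" for r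
        using x w r by (simp add: fD(3)[symmetric] equiv ac linear_mapsD(3)[OF lin])
      fix u assume "u \<in> carrier W'"
      then obtain u' where u: "u' \<in> carrier W" "u = f u'" using ex by blast
      show "act' x (w \<oplus>\<^bsub>W'\<^esub> u) = act' x w \<oplus>\<^bsub>W'\<^esub> act' x u"
        using x w u by (simp add: fD(2)[symmetric] equiv ac linear_mapsD(2)[OF lin])
    qed
    fix y w assume y: "y \<in> carrier L" and "w \<in> carrier W'"
    then obtain w' where w: "w' \<in> carrier W" "w = f w'" using ex by blast
    show "act' (lbr L x y) w = act' x (act' y w) \<ominus>\<^bsub>W'\<^esub> act' y (act' x w)"
      using x y w by (simp add: equiv lbr com ac a_minus_def fD(2) linear_maps_neg[OF W W' f])
  next
    fix w assume "w \<in> carrier W'"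
    then obtain w' where w: "w' \<in> carrier W" "w = f w'" using ex by blast
    show "(\<lambda>x. act' x w) \<in> linear_maps real_ring L W'"
    proof (rule linear_mapsI)
      fix x assume x: "x \<in> carrier L"
      show "act' x w \<in> carrier W'" using x w by (simp add: equiv fD(1) ac)
      show "act' (r \<odot>\<^bsub>L\<^esub> x) w = r \<odot>\<^bsub>W'\<^esub> act' x w" if r: "r \<in> carrier real_ring" for r
        using x w r by (simp add: fD(3)[symmetric] equiv ac linear_mapsD(3)[OF lin'])
      show "act' (x \<oplus>\<^bsub>L\<^esub> y) w = act' x w \<oplus>\<^bsub>W'\<^esub> act' y w" if "y \<in> carrier L" for y
        using x w that by (simp add: fD(2)[symmetric] equiv ac linear_mapsD(2)[OF lin'])
    qed
  qed
qed

section \<open>Quotients\<close>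

lemma coset_eq: "N +>\<^bsub>M\<^esub> x = {h \<oplus>\<^bsub>M\<^esub> x | h. h \<in> N}"
  unfolding a_r_coset_def r_coset_def by auto

context
  fixes R :: "('r, 'c) ring_scheme" and M :: "('r, 'm, 'd) module_scheme" and N
  assumes M: "Module.module R M" and N: "submodule N R M"
begin

interpretation Module.module R M by (rule M)
interpretation abelian_subgroup N M
  using N M by (auto simp: submodule_def Module.module_def intro!: abelian_subgroupI3 additive_subgroup.intro)

lemma coset_absorb: "x \<in> carrier M \<Longrightarrow> y \<in> N +>\<^bsub>M\<^esub> x \<Longrightarrow> N +>\<^bsub>M\<^esub> y = N +>\<^bsub>M\<^esub> x"
  by (rule a_repr_independence[OF _ _ a_subgroup, symmetric])

lemma coset_self: "x \<in> carrier M \<Longrightarrow> x \<in> N +>\<^bsub>M\<^esub> x"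
  by (rule a_rcos_self)

lemma coset_eq_iff:
  assumes "x \<in> carrier M" "y \<in> carrier M"
  shows "N +>\<^bsub>M\<^esub> x = N +>\<^bsub>M\<^esub> y \<longleftrightarrow> x \<ominus>\<^bsub>M\<^esub> y \<in> N"
proof -
  have "N +>\<^bsub>M\<^esub> x = N +>\<^bsub>M\<^esub> y \<longleftrightarrow> x \<in> N +>\<^bsub>M\<^esub> y"
    using coset_self[OF assms(1)] coset_absorb[OF assms(2)] by auto
  also have "\<dots> \<longleftrightarrow> x \<ominus>\<^bsub>M\<^esub> y \<in> N" unfolding a_minus_def by (rule a_rcos_module[OF assms(2,1)])
  finally show ?thesis .
qed

lemma coset_carrier: "x \<in> carrier M \<Longrightarrow> y \<in> N +>\<^bsub>M\<^esub> x \<Longrightarrow> y \<in> carrier M"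
  by (rule a_elemrcos_carrier)

lemma quot_carrier: "carrier (quot_module M N) = (\<lambda>x. N +>\<^bsub>M\<^esub> x) ` carrier M"
  unfolding quot_module_def A_RCOSETS_def' by auto

lemma quot_add: "x \<in> carrier M \<Longrightarrow> y \<in> carrier M \<Longrightarrow>
    N +>\<^bsub>M\<^esub> (x \<oplus>\<^bsub>M\<^esub> y) = (N +>\<^bsub>M\<^esub> x) \<oplus>\<^bsub>quot_module M N\<^esub> (N +>\<^bsub>M\<^esub> y)"
  unfolding quot_module_def by (simp add: a_rcos_sum)

lemma quot_zero: "N +>\<^bsub>M\<^esub> \<zero>\<^bsub>M\<^esub> = \<zero>\<^bsub>quot_module M N\<^esub>"
proof -
  have "N +>\<^bsub>M\<^esub> \<zero>\<^bsub>M\<^esub> = N" by (rule a_rcos_const[OF zero_closed])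
  then show ?thesis by (simp add: quot_module_def)
qed

lemma quot_union:
  assumes x: "x \<in> carrier M" and g: "\<And>y. y \<in> N +>\<^bsub>M\<^esub> x \<Longrightarrow> g y = g x"
  shows "(\<Union>y\<in>N +>\<^bsub>M\<^esub> x. g y) = g x"
proof (intro equalityI subsetI)
  fix a assume "a \<in> (\<Union>y\<in>N +>\<^bsub>M\<^esub> x. g y)"
  then obtain y where "y \<in> N +>\<^bsub>M\<^esub> x" "a \<in> g y" by blast
  then show "a \<in> g x" by (simp only: g[of y])
qed (use coset_self[OF x] in blast)

lemma quot_smult:
  assumes r: "r \<in> carrier R" and x: "x \<in> carrier M"
  shows "N +>\<^bsub>M\<^esub> (r \<odot>\<^bsub>M\<^esub> x) = r \<odot>\<^bsub>quot_module M N\<^esub> (N +>\<^bsub>M\<^esub> x)"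
proof -
  have "N +>\<^bsub>M\<^esub> (r \<odot>\<^bsub>M\<^esub> y) = N +>\<^bsub>M\<^esub> (r \<odot>\<^bsub>M\<^esub> x)" if "y \<in> N +>\<^bsub>M\<^esub> x" for y
  proof -
    from that obtain h where h: "h \<in> N" "y = h \<oplus>\<^bsub>M\<^esub> x" unfolding coset_eq by blast
    then have "r \<odot>\<^bsub>M\<^esub> y = r \<odot>\<^bsub>M\<^esub> h \<oplus>\<^bsub>M\<^esub> r \<odot>\<^bsub>M\<^esub> x" using a_subset r x by (simp add: smult_r_distr subset_iff)
    moreover have "r \<odot>\<^bsub>M\<^esub> h \<in> N" using submodule.smult_closed[OF N r h(1)] .
    ultimately have "r \<odot>\<^bsub>M\<^esub> y \<in> N +>\<^bsub>M\<^esub> (r \<odot>\<^bsub>M\<^esub> x)" unfolding coset_eq by blast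
    then show ?thesis using coset_absorb r x by simp
  qed
  from quot_union[where g = "\<lambda>y. N +>\<^bsub>M\<^esub> (r \<odot>\<^bsub>M\<^esub> y)", OF x this]
  show ?thesis unfolding quot_module_def by simp
qed

lemma module_quot: "Module.module R (quot_module M N)"
  by (rule module_surj[OF M quot_carrier[symmetric] quot_zero quot_add quot_smult])

end

section \<open>Smooth functions, vector fields and their real forms\<close>

lemma cring_real_ring: "cring real_ring"
proof (rule cringI)
  show "abelian_group real_ring"
  proof (rule abelian_groupI)
    fix x :: real
    show "\<exists>y\<in>carrier real_ring. y \<oplus>\<^bsub>real_ring\<^esub> x = \<zero>\<^bsub>real_ring\<^esub>"
      by (intro bexI[of _ "- x"]) (auto simp: real_ring_def)
  qed (auto simp: real_ring_def)
  show "Group.comm_monoid real_ring" by (rule comm_monoidI) (auto simp: real_ring_def)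
qed (auto simp: real_ring_def distrib_right)

lemma cring_smooth_ring: "cring (smooth_ring :: ('v::real_normed_vector \<Rightarrow> real) ring)"
proof (rule cringI)
  show "abelian_group (smooth_ring :: ('v \<Rightarrow> real) ring)"
  proof (rule abelian_groupI)
    fix f :: "'v \<Rightarrow> real" assume "f \<in> carrier smooth_ring"
    then show "\<exists>g\<in>carrier smooth_ring. g \<oplus>\<^bsub>smooth_ring\<^esub> f = \<zero>\<^bsub>smooth_ring\<^esub>"
      by (intro bexI[of _ "\<lambda>x. - f x"]) (auto simp: smooth_ring_def intro: smooth_intros)
  qed (auto simp: smooth_ring_def fun_eq_iff intro: smooth_intros)
  show "Group.comm_monoid (smooth_ring :: ('v \<Rightarrow> real) ring)"
    by (rule comm_monoidI) (auto simp: smooth_ring_def fun_eq_iff intro: smooth_intros)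
qed (auto simp: smooth_ring_def fun_eq_iff distrib_right)

lemma module_real_form:
  assumes "Module.module smooth_ring M" shows "Module.module real_ring (real_form M)"
proof -
  interpret Module.module smooth_ring M by (rule assms)
  have c: "(\<lambda>_. c) \<in> carrier smooth_ring" for c by (simp add: smooth_ring_def smooth_on_const)
  have "a \<oplus>\<^bsub>smooth_ring\<^esub> b = (\<lambda>x. a x + b x)" "a \<otimes>\<^bsub>smooth_ring\<^esub> b = (\<lambda>x. a x * b x)"
    "\<one>\<^bsub>smooth_ring\<^esub> = (\<lambda>_. 1)" for a b :: "'a \<Rightarrow> real" by (simp_all add: smooth_ring_def)
  note ops = this
  have "abelian_group (real_form M)"
    by (rule abelian_groupI)
      (auto simp: real_form_def M.a_ac intro: bexI[of _ "\<ominus>\<^bsub>M\<^esub> _"] M.l_neg)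
  then show ?thesis
    using smult_l_distr[OF c c] smult_assoc1[OF c c] smult_r_distr[OF c] smult_closed[OF c] smult_one
    by (intro moduleI cring_real_ring) (auto simp: real_form_def real_ring_def ops)
qed

lemma vector_fields_sel [simp]:
  "carrier vector_fields = {X. smooth X}" "\<zero>\<^bsub>vector_fields\<^esub> = (\<lambda>_. 0)"
  "X \<oplus>\<^bsub>vector_fields\<^esub> Y = (\<lambda>x. X x + Y x)" "f \<odot>\<^bsub>vector_fields\<^esub> X = (\<lambda>x. f x *\<^sub>R X x)"
  by (simp_all add: vector_fields_def)

lemma module_vector_fields: "Module.module smooth_ring (vector_fields :: ('v::real_normed_vector \<Rightarrow> real, 'v \<Rightarrow> 'v) module)"
proof (rule moduleI[OF cring_smooth_ring])
  show "abelian_group (vector_fields :: ('v \<Rightarrow> real, 'v \<Rightarrow> 'v) module)"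
  proof (rule abelian_groupI)
    fix X :: "'v \<Rightarrow> 'v" assume "X \<in> carrier vector_fields"
    then show "\<exists>Y\<in>carrier vector_fields. Y \<oplus>\<^bsub>vector_fields\<^esub> X = \<zero>\<^bsub>vector_fields\<^esub>"
      by (intro bexI[of _ "\<lambda>x. - X x"]) (auto intro: smooth_intros)
  qed (auto simp: fun_eq_iff intro: smooth_intros)
qed (auto simp: smooth_ring_def fun_eq_iff scaleR_add_left scaleR_add_right intro: smooth_intros)

text \<open>This identifies generated submodules with intersections of concrete modules, and so gives an induction principle.\<close>

lemma submodule_vector_fields_iff:
  "submodule N smooth_ring vector_fields \<longleftrightarrow> N \<subseteq> {X. smooth X} \<and> function_module N"
proof
  assume N: "submodule N smooth_ring vector_fields"
  interpret Module.module smooth_ring "vector_fields :: ('a \<Rightarrow> real, 'a \<Rightarrow> 'a) module" by (rule module_vector_fields)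
  note E = submoduleE[OF N]
  obtain X where "X \<in> N" using E(2) by blast
  from E(4)[OF _ this, of "\<lambda>_. 0"] have "(\<lambda>_. 0) \<in> N" by (simp add: smooth_ring_def smooth_on_const)
  then show "N \<subseteq> {X. smooth X} \<and> function_module N"
    using E(1,4,5) unfolding function_module_def by (auto simp: smooth_ring_def)
next
  assume "N \<subseteq> {X. smooth X} \<and> function_module N"
  then show "submodule N smooth_ring vector_fields"
    by (intro submodule_criterion[OF module_vector_fields]) (auto simp: smooth_ring_def function_module_def)
qed

lemma generated_eq:
  "generated_submodule smooth_ring vector_fields S = \<Inter>{N. N \<subseteq> {X. smooth X} \<and> function_module N \<and> S \<subseteq> N}"
  unfolding generated_submodule_def submodule_vector_fields_iff by (simp add: conj_assoc)

lemma generated_function_module: "function_module (generated_submodule smooth_ring vector_fields S)"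
  unfolding generated_eq function_module_def by auto

lemma generated_superset: "S \<subseteq> generated_submodule smooth_ring vector_fields S"
  unfolding generated_eq by blast

lemma generated_subset:
  "N \<subseteq> {X. smooth X} \<Longrightarrow> function_module N \<Longrightarrow> S \<subseteq> N \<Longrightarrow> generated_submodule smooth_ring vector_fields S \<subseteq> N"
  unfolding generated_eq by blast

section \<open>Linear parts and the isotropy Lie algebra\<close>

locale foliated_space = finite_basis B for B :: "'v::real_normed_vector set" +
  fixes g F :: "('v \<Rightarrow> 'v) set"
  assumes g: "gl_subalgebra g" and F: "F = generated_submodule smooth_ring vector_fields g"
begin

lemma g_linear: "A \<in> g \<Longrightarrow> linear A"
  and g_zero: "(\<lambda>_. 0) \<in> g"
  and g_add: "A \<in> g \<Longrightarrow> C \<in> g \<Longrightarrow> (\<lambda>v. A v + C v) \<in> g"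
  and g_scale: "A \<in> g \<Longrightarrow> (\<lambda>v. c *\<^sub>R A v) \<in> g"
  using g unfolding gl_subalgebra_def by auto

lemma g_bracket: "A \<in> g \<Longrightarrow> C \<in> g \<Longrightarrow> lie_bracket A C \<in> g"
  using g lie_bracket_linear[OF g_linear g_linear] unfolding gl_subalgebra_def by auto

lemma F_module: "function_module F"
  unfolding F by (rule generated_function_module)

lemma g_subset: "g \<subseteq> F"
  unfolding F by (rule generated_superset)

text \<open>The fields in \<open>F\<close> with the property \<open>P\<close> form a submodule that contains the generators.\<close>

lemma F_induct [consumes 1, case_names linear add smult]:
  assumes "X \<in> F" and lin: "\<And>A. A \<in> g \<Longrightarrow> P A"
    and add: "\<And>X Y. X \<in> F \<Longrightarrow> Y \<in> F \<Longrightarrow> smooth X \<Longrightarrow> smooth Y \<Longrightarrow> P X \<Longrightarrow> P Y \<Longrightarrow> P (\<lambda>x. X x + Y x)"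
    and smult: "\<And>f X. smooth f \<Longrightarrow> X \<in> F \<Longrightarrow> smooth X \<Longrightarrow> P X \<Longrightarrow> P (\<lambda>x. f x *\<^sub>R X x)"
  shows "P X"
proof -
  have "F \<subseteq> {X. smooth X}"
    unfolding F by (intro generated_subset function_module_smooth) (auto intro: smooth_linear g_linear)
  moreover have "generated_submodule smooth_ring vector_fields g \<subseteq> {X \<in> F. smooth X \<and> P X}"
  proof (rule generated_subset)
    show "function_module {X \<in> F. smooth X \<and> P X}"
      unfolding function_module_def
      using lin[OF g_zero] function_module_zero[OF F_module] function_module_add[OF F_module] function_module_smult[OF F_module]
      by (auto intro: smooth_intros add smult)
  qed (use g_subset lin smooth_linear g_linear in auto)
  ultimately show ?thesis using assms(1) unfolding F by blast
qed

lemma F_smooth: "X \<in> F \<Longrightarrow> smooth X"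
  by (induction rule: F_induct) (auto intro: smooth_intros smooth_linear g_linear)

lemma F_at_0: "X \<in> F \<Longrightarrow> X 0 = 0"
  by (induction rule: F_induct) (auto intro: linear_0 g_linear)

lemma lin_part_linear: "linear A \<Longrightarrow> lin_part (A :: 'v \<Rightarrow> 'v) = A"
  by (simp add: lin_part_def fd_linear_map)

lemma lin_part_add: "smooth X \<Longrightarrow> smooth Y \<Longrightarrow> lin_part (\<lambda>x. X x + Y x) = (\<lambda>v. lin_part X v + lin_part Y v)"
  by (simp add: lin_part_def fun_eq_iff fd_add)

lemma lin_part_smult: "smooth f \<Longrightarrow> X \<in> F \<Longrightarrow> lin_part (\<lambda>x. f x *\<^sub>R X x) = (\<lambda>v. f 0 *\<^sub>R lin_part X v)"
  by (simp add: lin_part_def fun_eq_iff fd_scaleR F_smooth F_at_0)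

lemma lin_part_const: "X \<in> F \<Longrightarrow> lin_part (\<lambda>x. c *\<^sub>R X x) = (\<lambda>v. c *\<^sub>R lin_part X v)"
  using lin_part_smult[of "\<lambda>_. c" X] by (simp add: smooth_on_const)

lemma lin_part_in_g: "X \<in> F \<Longrightarrow> lin_part X \<in> g"
  by (induction rule: F_induct) (auto simp: lin_part_linear g_linear lin_part_add lin_part_smult intro: g_add g_scale)

lemma lin_part_in_F: "X \<in> F \<Longrightarrow> lin_part X \<in> F"
  using lin_part_in_g g_subset by blast

lemma lin_part_linear_map: "X \<in> F \<Longrightarrow> linear (lin_part X)"
  using lin_part_in_g g_linear by blast

lemma lin_part_lin_part: "X \<in> F \<Longrightarrow> lin_part (lin_part X) = lin_part X"
  by (rule lin_part_linear[OF lin_part_linear_map])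

text \<open>By the Leibniz rule in each argument it suffices to consider generators.\<close>

lemma F_bracket: "X \<in> F \<Longrightarrow> Y \<in> F \<Longrightarrow> lie_bracket X Y \<in> F"
proof (induction X rule: F_induct)
  case (linear A)
  from linear(2,1) show ?case
  proof (induction Y rule: F_induct)
    case (linear C)
    then show ?case using g_bracket g_subset by blast
  next
    case (add X Y)
    then show ?case
      by (simp add: lie_bracket_add_right smooth_linear g_linear function_module_add[OF F_module])
  next
    case (smult f X)
    have "smooth (\<lambda>x. frechet_derivative f (at x) (A x))"
      by (intro smooth_along smult(1) smooth_linear g_linear[OF smult(5)])
    then show ?case using smult
      by (simp add: lie_bracket_scale_right smooth_linear g_linear function_module_add[OF F_module] function_module_smult[OF F_module])
  qed
next
  case (add X X')
  then show ?case by (simp add: lie_bracket_add_left F_smooth function_module_add[OF F_module])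
next
  case (smult f X)
  have "smooth (\<lambda>x. - frechet_derivative f (at x) (Y x))"
    by (intro smooth_on_minus smooth_along smult(1) F_smooth[OF smult(5)] open_UNIV)
  with smult have "(\<lambda>x. f x *\<^sub>R lie_bracket X Y x + (- frechet_derivative f (at x) (Y x)) *\<^sub>R X x) \<in> F"
    by (intro function_module_add[OF F_module] function_module_smult[OF F_module]) auto
  then show ?case using smult by (simp add: lie_bracket_scale_left F_smooth)
qed

text \<open>In the derivative of the bracket at the origin the second derivatives are multiplied by values of \<open>X\<close> and \<open>Y\<close>
  there, which are zero.\<close>

lemma lin_part_bracket:
  assumes X: "X \<in> F" and Y: "Y \<in> F"
  shows "lin_part (lie_bracket X Y) = lie_bracket (lin_part X) (lin_part Y)"
proof
  fix v
  note sm = F_smooth[OF X] F_smooth[OF Y]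
  have "lin_part (lie_bracket X Y) v = frechet_derivative (\<lambda>x. frechet_derivative Y (at x) (X x) - frechet_derivative X (at x) (Y x)) (at 0) v"
    by (simp add: lin_part_def lie_bracket_def[abs_def])
  also have "\<dots> = frechet_derivative Y (at 0) (frechet_derivative X (at 0) v) - frechet_derivative X (at 0) (frechet_derivative Y (at 0) v)"
    by (simp add: fd_diff smooth_along sm fd_along F_at_0 X Y linear_0[OF smooth_linear_derivative] frechet_derivative_const)
  finally show "lin_part (lie_bracket X Y) v = lie_bracket (lin_part X) (lin_part Y) v"
    by (simp add: lie_bracket_linear lin_part_linear_map X Y) (simp add: lin_part_def)
qed

abbreviation "I \<equiv> ideal_times 0 F"

lemma I_module: "function_module I"
  unfolding ideal_times_def by (rule generated_function_module)

lemma I_generator: "smooth f \<Longrightarrow> f 0 = 0 \<Longrightarrow> X \<in> F \<Longrightarrow> (\<lambda>x. f x *\<^sub>R X x) \<in> I"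
  using generated_superset[of "{(\<lambda>x. f x *\<^sub>R X x) | f X. f \<in> vanishing_ideal 0 \<and> X \<in> F}"]
  unfolding ideal_times_def vanishing_ideal_def by blast

text \<open>By induction on the generation of \<open>X\<close>, with the identity
  \<open>f X - f(0) X\<^sup>1 = (f - f(0)) X + f(0) (X - X\<^sup>1)\<close> for the linear part \<open>X\<^sup>1\<close>.\<close>

lemma diff_lin_part: "X \<in> F \<Longrightarrow> (\<lambda>x. X x - lin_part X x) \<in> I"
proof (induction rule: F_induct)
  case (linear A)
  then show ?case using function_module_zero[OF I_module] by (simp add: lin_part_linear g_linear)
next
  case (add X Y)
  then have "(\<lambda>x. (X x - lin_part X x) + (Y x - lin_part Y x)) \<in> I" by (intro function_module_add[OF I_module])
  then show ?case using add by (simp add: lin_part_add algebra_simps)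
next
  case (smult f X)
  have "(\<lambda>x. (f x - f 0) *\<^sub>R X x + f 0 *\<^sub>R (X x - lin_part X x)) \<in> I"
    using smult by (intro function_module_add[OF I_module] function_module_const[OF I_module] I_generator)
      (auto intro: smooth_intros)
  then show ?case using smult by (simp add: lin_part_smult algebra_simps)
qed

lemma I_eq: "I = {X \<in> F. lin_part X = (\<lambda>_. 0)}"
proof
  show "I \<subseteq> {X \<in> F. lin_part X = (\<lambda>_. 0)}"
    unfolding ideal_times_def
  proof (rule generated_subset)
    show "function_module {X \<in> F. lin_part X = (\<lambda>_. 0)}"
      unfolding function_module_def
      using function_module_zero[OF F_module] function_module_add[OF F_module] function_module_smult[OF F_module]
      by (auto simp: lin_part_add F_smooth lin_part_smult lin_part_linear[OF linear_zero_map])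
  qed (auto simp: F_smooth vanishing_ideal_def lin_part_smult intro: function_module_smult[OF F_module])
  show "{X \<in> F. lin_part X = (\<lambda>_. 0)} \<subseteq> I"
    using diff_lin_part by fastforce
qed

lemma foliation_lie_sel [simp]:
  "carrier (foliation_lie F) = F" "\<zero>\<^bsub>foliation_lie F\<^esub> = (\<lambda>_. 0)"
  "X \<oplus>\<^bsub>foliation_lie F\<^esub> Y = (\<lambda>x. X x + Y x)" "c \<odot>\<^bsub>foliation_lie F\<^esub> X = (\<lambda>x. c *\<^sub>R X x)"
  "lbr (foliation_lie F) = lie_bracket"
  by (simp_all add: foliation_lie_def module.extend_def real_form_def foliation_module_def)

lemma module_foliation: "Module.module smooth_ring (foliation_module F)"
proof -
  have "submodule F smooth_ring vector_fields"
    unfolding submodule_vector_fields_iff using F_smooth F_module by blast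
  from submodule.submodule_is_module[OF this module_vector_fields]
  show ?thesis unfolding foliation_module_def .
qed

lemma module_foliation_lie: "Module.module real_ring (foliation_lie F)"
  by (rule module_surj[OF module_real_form[OF module_foliation], of id])
    (simp_all add: real_form_def foliation_module_def)

lemma lie_algebra_foliation: "lie_algebra (foliation_lie F)"
  unfolding lie_algebra_def
proof (intro conjI ballI module_foliation_lie)
  fix X assume "X \<in> carrier (foliation_lie F)"
  then have X: "X \<in> F" by simp
  show "lbr (foliation_lie F) X X = \<zero>\<^bsub>foliation_lie F\<^esub>" by (simp add: lie_bracket_def fun_eq_iff)
  show "lbr (foliation_lie F) X \<in> linear_maps real_ring (foliation_lie F) (foliation_lie F)"
    using X by (intro linear_mapsI)
      (simp_all add: F_bracket lie_bracket_add_right lie_bracket_scale_right[where f = "\<lambda>_. _"] F_smooth smooth_on_const frechet_derivative_const)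
  show "(\<lambda>Y. lbr (foliation_lie F) Y X) \<in> linear_maps real_ring (foliation_lie F) (foliation_lie F)"
    using X by (intro linear_mapsI)
      (simp_all add: F_bracket lie_bracket_add_left lie_bracket_scale_left[where f = "\<lambda>_. _"] F_smooth smooth_on_const frechet_derivative_const)
qed (simp add: lie_bracket_jacobi F_smooth fun_eq_iff)

lemma I_submodule: "submodule I real_ring (foliation_lie F)"
  by (rule submodule_criterion[OF module_foliation_lie])
    (auto simp: I_eq[symmetric] function_module_zero[OF I_module] function_module_add[OF I_module]
      function_module_const[OF I_module], simp add: I_eq)

abbreviation "cls \<equiv> isotropy_class 0 F"

text \<open>The ideal is the kernel of the linear part on \<open>F\<close>.\<close>

lemma cls_eq_iff: "X \<in> F \<Longrightarrow> Y \<in> F \<Longrightarrow> cls X = cls Y \<longleftrightarrow> lin_part X = lin_part Y"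
proof -
  assume XY: "X \<in> F" "Y \<in> F"
  interpret Module.module real_ring "foliation_lie F" by (rule module_foliation_lie)
  have "(\<lambda>x. - Y x) \<oplus>\<^bsub>foliation_lie F\<^esub> Y = \<zero>\<^bsub>foliation_lie F\<^esub>" by simp
  from M.minus_equality[OF this] have "\<ominus>\<^bsub>foliation_lie F\<^esub> Y = (\<lambda>x. - Y x)"
    using XY function_module_neg[OF F_module] by simp
  then have m: "X \<ominus>\<^bsub>foliation_lie F\<^esub> Y = (\<lambda>x. X x - Y x)" by (simp add: a_minus_def)
  have "cls X = cls Y \<longleftrightarrow> (\<lambda>x. X x - Y x) \<in> I"
    unfolding isotropy_class_def using coset_eq_iff[OF module_foliation_lie I_submodule, of X Y] XY m by simp
  also have "\<dots> \<longleftrightarrow> lin_part (\<lambda>x. X x - Y x) = (\<lambda>_. 0)"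
    using function_module_diff[OF F_module XY] by (simp add: I_eq)
  also have "\<dots> \<longleftrightarrow> lin_part X = lin_part Y"
    using XY by (simp add: lin_part_def fun_eq_iff fd_diff F_smooth)
  finally show ?thesis .
qed

lemma cls_self: "X \<in> F \<Longrightarrow> X \<in> cls X"
  unfolding isotropy_class_def using coset_self[OF module_foliation_lie I_submodule] by simp

lemma cls_mem: "X \<in> F \<Longrightarrow> Y \<in> cls X \<Longrightarrow> Y \<in> F \<and> lin_part Y = lin_part X"
proof -
  assume X: "X \<in> F" and Y: "Y \<in> cls X"
  have "Y \<in> F" "cls Y = cls X"
    using coset_carrier[OF module_foliation_lie I_submodule, of X Y]
      coset_absorb[OF module_foliation_lie I_submodule, of X Y] X Y
    by (simp_all add: isotropy_class_def)
  then show ?thesis using cls_eq_iff X by blast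
qed

lemma isotropy_eq: "isotropy 0 F = module.extend (quot_module (foliation_lie F) I)
     \<lparr>lbr = (\<lambda>C D. \<Union>x\<in>C. \<Union>y\<in>D. cls (lie_bracket x y))\<rparr>"
  unfolding isotropy_def lie_quot_def isotropy_class_def by simp

lemma carrier_isotropy: "carrier (isotropy 0 F) = cls ` F"
  using quot_carrier[OF module_foliation_lie I_submodule]
  by (simp add: isotropy_eq module.extend_def isotropy_class_def[abs_def])

lemma isotropy_ops:
  shows "X \<in> F \<Longrightarrow> Y \<in> F \<Longrightarrow> cls X \<oplus>\<^bsub>isotropy 0 F\<^esub> cls Y = cls (\<lambda>x. X x + Y x)"
    and "X \<in> F \<Longrightarrow> c \<odot>\<^bsub>isotropy 0 F\<^esub> cls X = cls (\<lambda>x. c *\<^sub>R X x)"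
    and "\<zero>\<^bsub>isotropy 0 F\<^esub> = cls (\<lambda>_. 0)"
    and "X \<in> F \<Longrightarrow> Y \<in> F \<Longrightarrow> lbr (isotropy 0 F) (cls X) (cls Y) = cls (lie_bracket X Y)"
proof -
  show "X \<in> F \<Longrightarrow> Y \<in> F \<Longrightarrow> cls X \<oplus>\<^bsub>isotropy 0 F\<^esub> cls Y = cls (\<lambda>x. X x + Y x)"
    using quot_add[OF module_foliation_lie I_submodule, of X Y]
    by (simp add: isotropy_eq module.extend_def isotropy_class_def)
  show "X \<in> F \<Longrightarrow> c \<odot>\<^bsub>isotropy 0 F\<^esub> cls X = cls (\<lambda>x. c *\<^sub>R X x)"
    using quot_smult[OF module_foliation_lie I_submodule, of c X]
    by (simp add: isotropy_eq module.extend_def isotropy_class_def real_ring_def)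
  show "\<zero>\<^bsub>isotropy 0 F\<^esub> = cls (\<lambda>_. 0)"
    using quot_zero[OF module_foliation_lie I_submodule]
    by (simp add: isotropy_eq module.extend_def isotropy_class_def)
  assume XY: "X \<in> F" "Y \<in> F"
  have "cls (lie_bracket x y) = cls (lie_bracket X Y)" if "x \<in> cls X" "y \<in> cls Y" for x y
  proof -
    have x: "x \<in> F" "lin_part x = lin_part X" and y: "y \<in> F" "lin_part y = lin_part Y"
      using cls_mem[OF XY(1) that(1)] cls_mem[OF XY(2) that(2)] by blast+
    show ?thesis
      unfolding cls_eq_iff[OF F_bracket[OF x(1) y(1)] F_bracket[OF XY]]
        lin_part_bracket[OF x(1) y(1)] lin_part_bracket[OF XY] x(2) y(2) ..
  qed
  note eq = this
  have "(\<Union>x\<in>cls X. \<Union>y\<in>cls Y. cls (lie_bracket x y)) = cls (lie_bracket X Y)"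
  proof (intro equalityI subsetI)
    fix Z assume "Z \<in> (\<Union>x\<in>cls X. \<Union>y\<in>cls Y. cls (lie_bracket x y))"
    then obtain x y where xy: "x \<in> cls X" "y \<in> cls Y" "Z \<in> cls (lie_bracket x y)" by blast
    then show "Z \<in> cls (lie_bracket X Y)" by (simp only: eq[OF xy(1,2)])
  qed (use cls_self XY in blast)
  then show "lbr (isotropy 0 F) (cls X) (cls Y) = cls (lie_bracket X Y)"
    by (simp add: isotropy_eq module.extend_def)
qed

lemma cls_linear: "cls \<in> linear_maps real_ring (foliation_lie F) (isotropy 0 F)"
  by (rule linear_mapsI) (simp_all add: carrier_isotropy isotropy_ops)

lemma lie_algebra_isotropy: "lie_algebra (isotropy 0 F)"
  by (rule lie_algebra_surj[OF lie_algebra_foliation cls_linear])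
    (simp_all add: carrier_isotropy isotropy_ops)

text \<open>The choice of a representative is immaterial, since all elements of an isotropy class have the same linear part.\<close>

definition lin_bar :: "('v \<Rightarrow> 'v) set \<Rightarrow> 'v \<Rightarrow> 'v" where
  "lin_bar C = lin_part (SOME X. X \<in> C)"

lemma lin_bar_cls: "X \<in> F \<Longrightarrow> lin_bar (cls X) = lin_part X"
  unfolding lin_bar_def using cls_mem someI[of "\<lambda>Y. Y \<in> cls X", OF cls_self] by blast

lemma lin_bar_hom: "lie_hom (isotropy 0 F) (foliation_lie F) lin_bar"
  unfolding lie_hom_def
proof (intro conjI ballI lie_algebra_isotropy lie_algebra_foliation)
  show "lin_bar \<in> linear_maps real_ring (isotropy 0 F) (foliation_lie F)"
    by (rule linear_mapsI)
      (auto simp: carrier_isotropy isotropy_ops lin_bar_cls lin_part_in_F function_module_add[OF F_module]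
        function_module_const[OF F_module] lin_part_add F_smooth lin_part_const)
qed (auto simp: carrier_isotropy isotropy_ops lin_bar_cls F_bracket lin_part_bracket)

lemma lin_bar_inj: "inj_on lin_bar (carrier (isotropy 0 F))"
proof (rule inj_onI)
  fix C D assume "C \<in> carrier (isotropy 0 F)" "D \<in> carrier (isotropy 0 F)" and eq: "lin_bar C = lin_bar D"
  then obtain X Y where "X \<in> F" "Y \<in> F" "C = cls X" "D = cls Y" unfolding carrier_isotropy by blast
  then show "C = D" using eq by (simp add: lin_bar_cls cls_eq_iff)
qed

end

section \<open>The tensor product as a space of forms with values in the foliation\<close>

definition form_module ::
  "('v::real_normed_vector \<Rightarrow> 'v list \<Rightarrow> 'w::real_vector) set \<Rightarrow> ('v \<Rightarrow> real, 'v \<Rightarrow> 'v list \<Rightarrow> 'w) module" where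
  "form_module S = \<lparr>carrier = S, mult = undefined, one = undefined, zero = (\<lambda>_ _. 0),
     add = (\<lambda>\<alpha> \<beta> x vs. \<alpha> x vs + \<beta> x vs), smult = (\<lambda>f \<alpha> x vs. f x *\<^sub>R \<alpha> x vs)\<rparr>"

lemma form_module_sel [simp]:
  "carrier (form_module S) = S" "\<zero>\<^bsub>form_module S\<^esub> = (\<lambda>_ _. 0)"
  "\<alpha> \<oplus>\<^bsub>form_module S\<^esub> \<beta> = (\<lambda>x vs. \<alpha> x vs + \<beta> x vs)" "f \<odot>\<^bsub>form_module S\<^esub> \<alpha> = (\<lambda>x vs. f x *\<^sub>R \<alpha> x vs)"
  by (simp_all add: form_module_def)

lemma real_form_sel [simp]:
  "carrier (real_form M) = carrier M" "\<zero>\<^bsub>real_form M\<^esub> = \<zero>\<^bsub>M\<^esub>"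
  "x \<oplus>\<^bsub>real_form M\<^esub> y = x \<oplus>\<^bsub>M\<^esub> y" "c \<odot>\<^bsub>real_form M\<^esub> x = (\<lambda>_. c) \<odot>\<^bsub>M\<^esub> x"
  by (simp_all add: real_form_def)

lemma module_form_module:
  fixes S :: "('v::real_normed_vector \<Rightarrow> 'v list \<Rightarrow> 'w::real_vector) set"
  assumes "(\<lambda>_ _. 0) \<in> S" "\<And>\<alpha> \<beta>. \<alpha> \<in> S \<Longrightarrow> \<beta> \<in> S \<Longrightarrow> (\<lambda>x vs. \<alpha> x vs + \<beta> x vs) \<in> S"
    "\<And>f \<alpha>. smooth f \<Longrightarrow> \<alpha> \<in> S \<Longrightarrow> (\<lambda>x vs. f x *\<^sub>R \<alpha> x vs) \<in> S"
  shows "Module.module smooth_ring (form_module S)"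
proof (rule moduleI[OF cring_smooth_ring])
  show "abelian_group (form_module S)"
  proof (rule abelian_groupI)
    fix \<alpha> assume "\<alpha> \<in> carrier (form_module S)"
    then have "(\<lambda>x vs. (- 1) *\<^sub>R \<alpha> x vs) \<in> S" by (intro assms(3)) (auto intro: smooth_intros)
    then show "\<exists>\<beta>\<in>carrier (form_module S). \<beta> \<oplus>\<^bsub>form_module S\<^esub> \<alpha> = \<zero>\<^bsub>form_module S\<^esub>"
      by (intro bexI[of _ "\<lambda>x vs. (- 1) *\<^sub>R \<alpha> x vs"]) auto
  qed (auto simp: fun_eq_iff assms)
qed (auto simp: smooth_ring_def fun_eq_iff scaleR_add_left scaleR_add_right assms)

context foliated_space begin

lemma foliation_module_sel [simp]:
  "carrier (foliation_module F) = F" "\<zero>\<^bsub>foliation_module F\<^esub> = (\<lambda>_. 0)"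
  "X \<oplus>\<^bsub>foliation_module F\<^esub> Y = (\<lambda>x. X x + Y x)" "f \<odot>\<^bsub>foliation_module F\<^esub> X = (\<lambda>x. f x *\<^sub>R X x)"
  by (simp_all add: foliation_module_def)

lemma forms_sel [simp]:
  "\<zero>\<^bsub>forms i\<^esub> = (\<lambda>_ _. 0)" "\<alpha> \<oplus>\<^bsub>forms i\<^esub> \<beta> = (\<lambda>x vs. \<alpha> x vs + \<beta> x vs)"
  "f \<odot>\<^bsub>forms i\<^esub> \<alpha> = (\<lambda>x vs. f x * \<alpha> x vs)"
  by (simp_all add: forms_def)

lemma smooth_ring_carrier: "carrier smooth_ring = {f. smooth f}"
  by (simp add: smooth_ring_def)

abbreviation "smooth_forms i \<equiv> mforms i {f :: 'v \<Rightarrow> real. smooth f}"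

definition tensors :: "nat \<Rightarrow> ('v form \<times> ('v \<Rightarrow> 'v)) list set" where
  "tensors i = {xs. set xs \<subseteq> smooth_forms i \<times> F}"

text \<open>The form with values in vector fields that is represented by a formal sum of tensors.\<close>

definition tval :: "('v form \<times> ('v \<Rightarrow> 'v)) list \<Rightarrow> 'v vform" where
  "tval xs x vs = (\<Sum>(\<alpha>, Y)\<leftarrow>xs. \<alpha> x vs *\<^sub>R Y x)"

lemma tval_simps: "tval [] = (\<lambda>_ _. 0)" "tval ((\<alpha>, Y) # xs) = (\<lambda>x vs. \<alpha> x vs *\<^sub>R Y x + tval xs x vs)"
    "tval (xs @ ys) = (\<lambda>x vs. tval xs x vs + tval ys x vs)"
  by (auto simp: tval_def fun_eq_iff)

abbreviation "teq i \<equiv> tensor_eq smooth_ring (forms i) (foliation_module F)"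

lemma teq_tval: "teq i xs ys \<Longrightarrow> xs \<in> tensors i \<and> ys \<in> tensors i \<and> tval xs = tval ys"
proof (induction rule: tensor_eq.induct)
  case (add_left m m' n)
  then show ?case
    using mforms_add[OF function_module_smooth, of m i m'] by (auto simp: tensors_def tval_simps carrier_forms scaleR_add_left)
next
  case (add_right m n n')
  then show ?case
    using function_module_add[OF F_module, of n n'] by (auto simp: tensors_def tval_simps carrier_forms scaleR_add_right)
next
  case (balanced r m n)
  then show ?case
    using mforms_smult[OF function_module_smooth, of r m i] function_module_smult[OF F_module, of r n]
    by (auto simp: tensors_def tval_simps carrier_forms smooth_ring_carrier mult.commute)
next
  case (zero n)
  then show ?case using mforms_zero[OF function_module_smooth] by (auto simp: tensors_def tval_simps)
next
  case (commute xs ys)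
  then show ?case by (auto simp: tensors_def tval_simps carrier_forms add.commute)
qed (auto simp: tensors_def tval_simps carrier_forms)

lemma tval_mforms: "xs \<in> tensors i \<Longrightarrow> tval xs \<in> mforms i F"
proof (induction xs)
  case Nil
  then show ?case using mforms_zero[OF F_module] by (simp add: tval_simps)
next
  case (Cons p xs)
  obtain \<alpha> Y where p: "p = (\<alpha>, Y)" by fastforce
  have \<alpha>: "\<alpha> \<in> smooth_forms i" and Y: "Y \<in> F" and xs: "xs \<in> tensors i" using Cons.prems by (auto simp: tensors_def p)
  have "(\<lambda>x vs. \<alpha> x vs *\<^sub>R Y x) \<in> mforms i F"
  proof (rule mformsI)
    show "altmap i (\<lambda>vs. \<alpha> x vs *\<^sub>R Y x)" for x by (rule altmap_scale_vec[OF mforms_altmap[OF \<alpha>]])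
    show "(\<lambda>x. \<alpha> x vs *\<^sub>R Y x) \<in> F" for vs
      using mforms_value[OF \<alpha>] by (intro function_module_smult[OF F_module] Y) auto
  qed
  then show ?case unfolding p tval_simps by (rule mforms_add[OF F_module _ Cons.IH[OF xs]])
qed

definition dual_field :: "'v list \<Rightarrow> 'v form" where
  "dual_field a = (\<lambda>_. dual_form a)"

lemma dual_field_form: "a \<in> words i \<Longrightarrow> dual_field a \<in> smooth_forms i"
  unfolding dual_field_def words_def
  by (rule mformsI) (use altmap_dual_form smooth_on_const in auto)

lemma teq_refl: "xs \<in> tensors i \<Longrightarrow> teq i xs xs"
  by (rule tensor_eq.refl) (simp add: tensors_def carrier_forms)

lemma teq_zero_right: "m \<in> smooth_forms i \<Longrightarrow> teq i [(m, \<lambda>_. 0)] []"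
proof -
  assume m: "m \<in> smooth_forms i"
  have 1: "teq i [((\<lambda>_. 0) \<odot>\<^bsub>forms i\<^esub> m, \<lambda>_. 0)] [(m, (\<lambda>_. 0) \<odot>\<^bsub>foliation_module F\<^esub> (\<lambda>_. 0))]"
    using m function_module_zero[OF F_module]
    by (intro tensor_eq.balanced) (auto simp: smooth_ring_carrier smooth_on_const carrier_forms)
  have 2: "teq i [(\<zero>\<^bsub>forms i\<^esub>, \<lambda>_. 0)] []"
    using function_module_zero[OF F_module] by (intro tensor_eq.zero) simp
  have 3: "teq i [(\<lambda>_ _. 0, \<lambda>_. 0)] [(m, \<lambda>_. 0)]" using 1 by simp
  show ?thesis using tensor_eq.trans[OF tensor_eq.sym[OF 3]] 2 by simp
qed

text \<open>Balancedness moves the coefficients of a combination of dual basis forms to the right factor.\<close>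

lemma teq_spread:
  assumes "set as \<subseteq> words i" "\<And>a. smooth (f a)" "Y \<in> F"
  shows "teq i [(\<lambda>x vs. \<Sum>a\<leftarrow>as. f a x * dual_form a vs, Y)] (map (\<lambda>a. (dual_field a, \<lambda>x. f a x *\<^sub>R Y x)) as)"
  using assms(1)
proof (induction as)
  case Nil
  then show ?case using tensor_eq.zero[of Y "foliation_module F" smooth_ring "forms i"] assms(3) by simp
next
  case (Cons a as)
  have a: "dual_field a \<in> smooth_forms i" using Cons.prems dual_field_form by simp
  have 1: "(\<lambda>x vs. f a x * dual_form a vs) \<in> smooth_forms i"
    using mforms_smult[OF function_module_smooth assms(2) a, of a] by (simp add: dual_field_def)
  have IH: "teq i [(\<lambda>x vs. \<Sum>a\<leftarrow>as. f a x * dual_form a vs, Y)] (map (\<lambda>a. (dual_field a, \<lambda>x. f a x *\<^sub>R Y x)) as)"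
    using Cons by simp
  have 2: "(\<lambda>x vs. \<Sum>a\<leftarrow>as. f a x * dual_form a vs) \<in> smooth_forms i"
    using teq_tval[OF IH] by (simp add: tensors_def)
  have 3: "teq i [((\<lambda>x vs. f a x * dual_form a vs) \<oplus>\<^bsub>forms i\<^esub> (\<lambda>x vs. \<Sum>a\<leftarrow>as. f a x * dual_form a vs), Y)]
      ([(\<lambda>x vs. f a x * dual_form a vs, Y), (\<lambda>x vs. \<Sum>a\<leftarrow>as. f a x * dual_form a vs, Y)])"
    using 1 2 assms(3) by (intro tensor_eq.add_left) (simp_all add: carrier_forms)
  have "teq i [(f a \<odot>\<^bsub>forms i\<^esub> dual_field a, Y)] [(dual_field a, f a \<odot>\<^bsub>foliation_module F\<^esub> Y)]"
    using a assms(2,3) by (intro tensor_eq.balanced) (simp_all add: carrier_forms smooth_ring_carrier)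
  from tensor_eq.append[OF this IH]
  have 4: "teq i [(\<lambda>x vs. f a x * dual_form a vs, Y), (\<lambda>x vs. \<Sum>a\<leftarrow>as. f a x * dual_form a vs, Y)]
      (map (\<lambda>a. (dual_field a, \<lambda>x. f a x *\<^sub>R Y x)) (a # as))"
    by (simp add: dual_field_def)
  show ?case using tensor_eq.trans[OF 3 4] by simp
qed

lemma teq_merge:
  assumes "set as \<subseteq> words i" "\<And>a. u a \<in> F" "\<And>a. w a \<in> F"
  shows "teq i (map (\<lambda>a. (dual_field a, u a)) as @ map (\<lambda>a. (dual_field a, w a)) as)
    (map (\<lambda>a. (dual_field a, \<lambda>x. u a x + w a x)) as)"
  using assms(1)
proof (induction as)
  case (Cons a as)
  let ?U = "map (\<lambda>a. (dual_field a, u a)) as" and ?W = "map (\<lambda>a. (dual_field a, w a)) as"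
  have a: "dual_field a \<in> smooth_forms i" using Cons.prems dual_field_form by simp
  have UW: "?U \<in> tensors i" "?W \<in> tensors i" using Cons.prems assms(2,3) dual_field_form by (auto simp: tensors_def)
  have uw: "[(dual_field a, u a)] \<in> tensors i" "[(dual_field a, w a)] \<in> tensors i"
    using a assms(2,3) by (auto simp: tensors_def)
  have "teq i (?U @ [(dual_field a, w a)]) ([(dual_field a, w a)] @ ?U)"
    using UW uw by (intro tensor_eq.commute) (simp_all add: tensors_def carrier_forms)
  from tensor_eq.append[OF tensor_eq.append[OF teq_refl[OF uw(1)] this] teq_refl[OF UW(2)]]
  have 1: "teq i (((dual_field a, u a) # ?U) @ (dual_field a, w a) # ?W)
      ([(dual_field a, u a), (dual_field a, w a)] @ (?U @ ?W))" by simp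
  have split: "teq i [(dual_field a, u a \<oplus>\<^bsub>foliation_module F\<^esub> w a)] [(dual_field a, u a), (dual_field a, w a)]"
    using a assms(2,3) by (intro tensor_eq.add_right) (simp_all add: carrier_forms)
  have "set as \<subseteq> words i" using Cons.prems by simp
  from tensor_eq.append[OF tensor_eq.sym[OF split] Cons.IH[OF this]]
  have 2: "teq i ([(dual_field a, u a), (dual_field a, w a)] @ (?U @ ?W))
      (map (\<lambda>a. (dual_field a, \<lambda>x. u a x + w a x)) (a # as))" by simp
  show ?case using tensor_eq.trans[OF 1 2] by simp
qed (simp add: teq_refl tensors_def)

text \<open>Every formal sum of tensors is congruent to an expansion in the dual basis whose right factors are the values of the
  represented form; that form therefore determines the congruence class.\<close>

lemma teq_normal_form:
  assumes as: "set as = words i" "distinct as" and xs: "xs \<in> tensors i"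
  shows "teq i xs (map (\<lambda>a. (dual_field a, \<lambda>x. tval xs x a)) as)"
  using xs
proof (induction xs)
  case Nil
  have "set bs \<subseteq> words i \<Longrightarrow> teq i [] (map (\<lambda>a. (dual_field a, \<lambda>x. 0)) bs)" for bs
  proof (induction bs)
    case (Cons b bs)
    then have "dual_field b \<in> smooth_forms i" using dual_field_form by simp
    from tensor_eq.append[OF tensor_eq.sym[OF teq_zero_right[OF this]] Cons.IH] Cons.prems show ?case by simp
  qed (simp add: teq_refl tensors_def)
  then show ?case using as(1) by (simp add: tval_simps)
next
  case (Cons p xs)
  obtain \<alpha> Y where p: "p = (\<alpha>, Y)" by fastforce
  have \<alpha>: "\<alpha> \<in> smooth_forms i" and Y: "Y \<in> F" and xs: "xs \<in> tensors i" using Cons.prems by (auto simp: tensors_def p)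
  have sm: "smooth (\<lambda>x. \<alpha> x a)" for a using mforms_value[OF \<alpha>] by simp
  have "\<alpha> = (\<lambda>x vs. \<Sum>a\<leftarrow>as. \<alpha> x a * dual_form a vs)"
  proof (intro ext)
    fix x vs
    have "\<alpha> x vs = (\<Sum>a\<in>words i. dual_form a vs *\<^sub>R \<alpha> x a)" by (rule mforms_expand[OF \<alpha>])
    also have "\<dots> = (\<Sum>a\<leftarrow>as. \<alpha> x a * dual_form a vs)"
      by (simp add: sum_list_distinct_conv_sum_set[OF as(2)] as(1) mult.commute)
    finally show "\<alpha> x vs = (\<Sum>a\<leftarrow>as. \<alpha> x a * dual_form a vs)" .
  qed
  moreover have "teq i [(\<lambda>x vs. \<Sum>a\<leftarrow>as. \<alpha> x a * dual_form a vs, Y)] (map (\<lambda>a. (dual_field a, \<lambda>x. \<alpha> x a *\<^sub>R Y x)) as)"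
    by (rule teq_spread[where f = "\<lambda>a x. \<alpha> x a"]) (use as(1) sm Y in auto)
  ultimately have "teq i [p] (map (\<lambda>a. (dual_field a, \<lambda>x. \<alpha> x a *\<^sub>R Y x)) as)" by (simp only: p)
  from tensor_eq.append[OF this Cons.IH[OF xs]]
  have 1: "teq i (p # xs) (map (\<lambda>a. (dual_field a, \<lambda>x. \<alpha> x a *\<^sub>R Y x)) as @ map (\<lambda>a. (dual_field a, \<lambda>x. tval xs x a)) as)"
    by simp
  have 2: "teq i (map (\<lambda>a. (dual_field a, \<lambda>x. \<alpha> x a *\<^sub>R Y x)) as @ map (\<lambda>a. (dual_field a, \<lambda>x. tval xs x a)) as)
     (map (\<lambda>a. (dual_field a, \<lambda>x. \<alpha> x a *\<^sub>R Y x + tval xs x a)) as)"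
    using as(1) by (intro teq_merge function_module_smult[OF F_module sm Y] mforms_value[OF tval_mforms[OF xs]]) auto
  show ?case using tensor_eq.trans[OF 1 2] by (simp add: p tval_simps)
qed

lemma teq_iff: "xs \<in> tensors i \<Longrightarrow> teq i xs ys \<longleftrightarrow> ys \<in> tensors i \<and> tval ys = tval xs"
proof
  assume xs: "xs \<in> tensors i" and ys: "ys \<in> tensors i \<and> tval ys = tval xs"
  obtain as where as: "set as = words i" "distinct as" using finite_distinct_list[OF finite_words] by blast
  have "teq i ys (map (\<lambda>a. (dual_field a, \<lambda>x. tval xs x a)) as)"
    using teq_normal_form[OF as, of ys] ys by simp
  then show "teq i xs ys" by (rule tensor_eq.trans[OF teq_normal_form[OF as xs] tensor_eq.sym])
qed (auto dest: teq_tval)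

text \<open>The inverse of the previous passage: the congruence class that represents a given form.\<close>

definition tens :: "nat \<Rightarrow> 'v vform \<Rightarrow> ('v form \<times> ('v \<Rightarrow> 'v)) list set" where
  "tens i \<omega> = {xs \<in> tensors i. tval xs = \<omega>}"

lemma tensor_class_eq: "xs \<in> tensors i \<Longrightarrow> tensor_class smooth_ring (forms i) (foliation_module F) xs = tens i (tval xs)"
  unfolding tensor_class_def tens_def using teq_iff by blast

lemma tval_surj:
  assumes "\<omega> \<in> mforms i F"
  obtains xs where "xs \<in> tens i \<omega>"
proof -
  obtain as where as: "set as = words i" "distinct as" using finite_distinct_list[OF finite_words] by blast
  define xs where "xs = map (\<lambda>a. (dual_field a, \<lambda>x. \<omega> x a)) as"
  have "xs \<in> tensors i"
    using as(1) dual_field_form mforms_value[OF assms] by (auto simp: xs_def tensors_def)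
  moreover have "tval xs x vs = \<omega> x vs" for x vs
  proof -
    have "tval xs x vs = (\<Sum>a\<in>words i. dual_form a vs *\<^sub>R \<omega> x a)"
      by (simp add: xs_def tval_def o_def dual_field_def sum_list_distinct_conv_sum_set[OF as(2)] as(1))
    then show ?thesis by (simp only: mforms_expand[OF assms, of x vs])
  qed
  ultimately show thesis using that by (auto simp: tens_def fun_eq_iff)
qed

lemma tens_inj: "\<omega> \<in> mforms i F \<Longrightarrow> tens i \<omega> = tens i \<omega>' \<Longrightarrow> \<omega> = \<omega>'"
  by (erule tval_surj) (auto simp: tens_def)

lemma union_tens: "\<omega> \<in> mforms i F \<Longrightarrow> (\<And>xs. xs \<in> tens i \<omega> \<Longrightarrow> f xs = c) \<Longrightarrow> (\<Union>xs\<in>tens i \<omega>. f xs) = c"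
  by (erule tval_surj) auto

lemma carrier_koszul: "carrier (koszul F i) = tens i ` mforms i F"
proof -
  have "carrier (koszul F i) = tensor_class smooth_ring (forms i) (foliation_module F) ` tensors i"
    unfolding koszul_def tensor_module_def tensors_def by (simp add: carrier_forms)
  also have "\<dots> = (\<lambda>xs. tens i (tval xs)) ` tensors i" by (rule image_cong) (simp_all add: tensor_class_eq)
  also have "\<dots> = tens i ` mforms i F"
    using tval_mforms by (auto simp: tens_def elim: tval_surj)
  finally show ?thesis .
qed

lemma koszul_zero: "\<zero>\<^bsub>koszul F i\<^esub> = tens i (\<lambda>_ _. 0)"
  unfolding koszul_def tensor_module_def using tensor_class_eq[of "[]" i] by (simp add: tval_simps tensors_def)

lemma koszul_add:
  assumes "\<omega> \<in> mforms i F" "\<omega>' \<in> mforms i F"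
  shows "tens i \<omega> \<oplus>\<^bsub>koszul F i\<^esub> tens i \<omega>' = tens i (\<lambda>x vs. \<omega> x vs + \<omega>' x vs)"
proof -
  have "(\<Union>xs\<in>tens i \<omega>. \<Union>ys\<in>tens i \<omega>'. tensor_class smooth_ring (forms i) (foliation_module F) (xs @ ys))
      = tens i (\<lambda>x vs. \<omega> x vs + \<omega>' x vs)"
  proof (rule union_tens[OF assms(1)], rule union_tens[OF assms(2)])
    fix xs ys assume "xs \<in> tens i \<omega>" "ys \<in> tens i \<omega>'"
    then have "xs @ ys \<in> tensors i" "tval (xs @ ys) = (\<lambda>x vs. \<omega> x vs + \<omega>' x vs)"
      by (auto simp: tens_def tensors_def tval_simps)
    then show "tensor_class smooth_ring (forms i) (foliation_module F) (xs @ ys) = tens i (\<lambda>x vs. \<omega> x vs + \<omega>' x vs)"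
      by (simp add: tensor_class_eq)
  qed
  then show ?thesis by (simp add: koszul_def tensor_module_def)
qed

lemma koszul_smult:
  assumes "smooth f" "\<omega> \<in> mforms i F"
  shows "f \<odot>\<^bsub>koszul F i\<^esub> tens i \<omega> = tens i (\<lambda>x vs. f x *\<^sub>R \<omega> x vs)"
proof -
  let ?m = "map (\<lambda>(\<alpha>, Y). (f \<odot>\<^bsub>forms i\<^esub> \<alpha>, Y))"
  have "(\<Union>xs\<in>tens i \<omega>. tensor_class smooth_ring (forms i) (foliation_module F) (?m xs)) = tens i (\<lambda>x vs. f x *\<^sub>R \<omega> x vs)"
  proof (rule union_tens[OF assms(2)])
    fix xs assume xs: "xs \<in> tens i \<omega>"
    have "tval (?m xs) = (\<lambda>x vs. f x *\<^sub>R tval xs x vs)"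
      by (induction xs) (auto simp: tval_simps scaleR_add_right)
    moreover have "?m xs \<in> tensors i"
      using xs mforms_smult[OF function_module_smooth assms(1), of _ i] by (auto simp: tens_def tensors_def)
    ultimately show "tensor_class smooth_ring (forms i) (foliation_module F) (?m xs) = tens i (\<lambda>x vs. f x *\<^sub>R \<omega> x vs)"
      using xs by (simp add: tensor_class_eq tens_def[of _ \<omega>])
  qed
  then show ?thesis by (simp add: koszul_def tensor_module_def)
qed

lemma koszul_pure_eq:
  assumes "\<alpha> \<in> smooth_forms i" "Y \<in> F"
  shows "koszul_pure F i \<alpha> Y = tens i (\<lambda>x vs. \<alpha> x vs *\<^sub>R Y x)"
  unfolding koszul_pure_def pure_tensor_def
  using tensor_class_eq[of "[(\<alpha>, Y)]" i] assms by (simp add: tensors_def tval_simps)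

lemma koszul_d_eq:
  assumes "\<omega> \<in> mforms (Suc i) F"
  shows "koszul_d F (Suc i) (tens (Suc i) \<omega>) = tens i (euler_d \<omega>)"
proof -
  let ?m = "map (\<lambda>(\<alpha>, Y). (euler_d \<alpha>, Y))"
  have "(\<Union>xs\<in>tens (Suc i) \<omega>. tensor_class smooth_ring (forms i) (foliation_module F) (?m xs)) = tens i (euler_d \<omega>)"
  proof (rule union_tens[OF assms])
    fix xs assume xs: "xs \<in> tens (Suc i) \<omega>"
    have "tval (?m xs) = euler_d (tval xs)" by (induction xs) (auto simp: tval_simps euler_d_def)
    moreover have "?m xs \<in> tensors i"
      using xs euler_d_mforms[OF function_module_smooth, of _ i] by (auto simp: tens_def tensors_def)
    ultimately show "tensor_class smooth_ring (forms i) (foliation_module F) (?m xs) = tens i (euler_d \<omega>)"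
      using xs by (simp add: tensor_class_eq tens_def[of _ \<omega>])
  qed
  then show ?thesis by (simp add: koszul_d_def tensor_map_left_def euler_contraction_eq_euler_d)
qed

lemma koszul_cycles_eq: "koszul_cycles F i = tens i ` cycles i F"
proof (cases i)
  case 0
  have "cycles 0 F = mforms 0 F" unfolding cycles_def using euler_d_degree_0 by blast
  then show ?thesis by (simp add: 0 koszul_cycles_def carrier_koszul)
next
  case (Suc k)
  have "koszul_d F (Suc k) (tens (Suc k) \<omega>) = \<zero>\<^bsub>koszul F k\<^esub> \<longleftrightarrow> euler_d \<omega> = (\<lambda>_ _. 0)" if "\<omega> \<in> mforms (Suc k) F" for \<omega>
    unfolding koszul_d_eq[OF that] koszul_zero using tens_inj[OF euler_d_mforms[OF F_module that]] by metis
  then show ?thesis unfolding koszul_cycles_def Suc cycles_def by (auto simp: carrier_koszul)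
qed

lemma koszul_boundaries_eq: "koszul_boundaries F i = tens i ` boundaries i F"
  unfolding koszul_boundaries_def carrier_koszul boundaries_def image_image
  by (rule image_cong) (simp_all add: koszul_d_eq)

end

section \<open>Permuting arguments and the Froelicher--Nijenhuis bracket\<close>

definition reindex_list :: "nat \<Rightarrow> (nat \<Rightarrow> nat) \<Rightarrow> 'a list \<Rightarrow> 'a list" where
  "reindex_list i \<sigma> vs = map (\<lambda>j. vs ! \<sigma> j) [0..<i]"

lemma reindex_list_nth [simp]: "j < i \<Longrightarrow> reindex_list i \<sigma> vs ! j = vs ! \<sigma> j"
  and length_reindex_list [simp]: "length (reindex_list i \<sigma> vs) = i"
  by (simp_all add: reindex_list_def)

lemma permutes_less: "\<sigma> permutes {..<i} \<Longrightarrow> j < i \<Longrightarrow> \<sigma> j < i"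
  using permutes_in_image by fastforce

lemma altmap_transpose:
  assumes \<omega>: "altmap i \<omega>" and vs: "length vs = i" and ab: "a < i" "b < i" "a \<noteq> b"
  shows "\<omega> (reindex_list i (Transposition.transpose a b) vs) = - \<omega> vs"
proof -
  define f where "f u v = \<omega> (vs[a := u, b := v])" for u v
  have 1: "linear (\<lambda>v. f u v)" for u
    unfolding f_def using altmap_slot[OF \<omega>, of "vs[a := u]" b] vs ab by simp
  have 2: "linear (\<lambda>u. f u v)" for v
    unfolding f_def using altmap_slot[OF \<omega>, of "vs[b := v]" a] vs ab by (simp add: list_update_swap)
  have 0: "f u u = 0" for u unfolding f_def
  proof (rule altmap_not_distinct[OF \<omega>])
    have "vs[a := u, b := u] ! a = vs[a := u, b := u] ! b" using vs ab by (simp add: nth_list_update)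
    then show "\<not> distinct (vs[a := u, b := u])" using vs ab by (metis length_list_update nth_eq_iff_index_eq)
  qed
  have "f (u + v) (u + v) = f u u + f u v + (f v u + f v v)" for u v
    by (simp only: linear_add[OF 1] linear_add[OF 2] ac_simps)
  then have anti: "f u v = - f v u" for u v by (simp add: 0 eq_neg_iff_add_eq_0)
  have "reindex_list i (Transposition.transpose a b) vs = vs[a := vs ! b, b := vs ! a]"
    by (rule nth_equalityI) (use vs ab in \<open>auto simp: nth_list_update Transposition.transpose_def\<close>)
  then show ?thesis using anti[of "vs ! b" "vs ! a"] by (simp add: f_def)
qed

lemma reindex_list_comp: "\<tau> permutes {..<i} \<Longrightarrow> reindex_list i (\<sigma> \<circ> \<tau>) vs = reindex_list i \<tau> (reindex_list i \<sigma> vs)"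
  by (rule nth_equalityI) (auto dest: permutes_less)

lemma altmap_permute:
  assumes \<omega>: "altmap i \<omega>" and vs: "length vs = i" and \<sigma>: "\<sigma> permutes {..<i}"
  shows "\<omega> (reindex_list i \<sigma> vs) = real_of_int (sign \<sigma>) *\<^sub>R \<omega> vs"
  using finite_lessThan \<sigma>
proof (induction rule: permutes_rev_induct)
  case id
  have "reindex_list i id vs = vs" by (rule nth_equalityI) (use vs in auto)
  then show ?case by (simp only: sign_id of_int_1 scaleR_one)
next
  case (swap a b p)
  have t: "Transposition.transpose a b permutes {..<i}" using swap by (intro permutes_swap_id)
  have "\<omega> (reindex_list i (p \<circ> Transposition.transpose a b) vs) = - \<omega> (reindex_list i p vs)"
    unfolding reindex_list_comp[OF t] by (rule altmap_transpose[OF \<omega>]) (use swap in auto)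
  also have "\<dots> = real_of_int (sign (p \<circ> Transposition.transpose a b)) *\<^sub>R \<omega> vs"
    using swap permutes_imp_permutation[OF finite_lessThan] t by (simp add: sign_compose sign_swap_id)
  finally show ?case .
qed

text \<open>The antisymmetrised sum in the Froelicher--Nijenhuis bracket only changes the first argument. By
  symmetry each slot contributes equally, so that it is the derivation extending \<open>A\<close>.\<close>

lemma sum_permutations_derivation:
  fixes \<alpha> :: "'v::real_vector list \<Rightarrow> real"
  assumes \<alpha>: "altmap (Suc m) \<alpha>" and A: "linear A" and vs: "length vs = Suc m"
  shows "(\<Sum>\<sigma> | \<sigma> permutes {..<Suc m}. real_of_int (sign \<sigma>) * \<alpha> ((reindex_list (Suc m) \<sigma> vs)[0 := A (vs ! \<sigma> 0)]))
    = fact m * (\<Sum>j<Suc m. \<alpha> (vs[j := A (vs ! j)]))"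
proof -
  let ?P = "{\<sigma>. \<sigma> permutes {..<Suc m}}" and ?p = "\<lambda>\<sigma>. reindex_list (Suc m) \<sigma>"
  define \<beta> where "\<beta> j ws = \<alpha> (ws[j := A (ws ! j)])" for j and ws :: "'v list"
  define S where "S j = (\<Sum>\<sigma>\<in>?P. real_of_int (sign \<sigma>) * \<beta> j (?p \<sigma> vs))" for j
  have "S 0 = S j" if j: "j < Suc m" for j
  proof (cases "j = 0")
    case False
    let ?t = "Transposition.transpose 0 j"
    have t: "?t permutes {..<Suc m}" using j by (intro permutes_swap_id) auto
    \<comment> \<open>composing \<open>\<sigma>\<close> with the transposition of \<open>0\<close> and \<open>j\<close> flips both signs and moves \<open>A\<close> to slot \<open>j\<close>\<close>
    have "real_of_int (sign (\<sigma> \<circ> ?t)) * \<beta> 0 (?p (\<sigma> \<circ> ?t) vs) = real_of_int (sign \<sigma>) * \<beta> j (?p \<sigma> vs)" if "\<sigma> \<in> ?P" for \<sigma>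
    proof -
      let ?ws = "?p \<sigma> vs"
      have "(?p ?t ?ws)[0 := A ((?p ?t ?ws) ! 0)] = ?p ?t (?ws[j := A (?ws ! j)])"
        by (rule nth_equalityI) (use j False in \<open>auto simp: nth_list_update Transposition.transpose_def\<close>)
      then have "\<beta> 0 (?p (\<sigma> \<circ> ?t) vs) = \<alpha> (?p ?t (?ws[j := A (?ws ! j)]))"
        unfolding \<beta>_def reindex_list_comp[OF t] by simp
      also have "\<dots> = - \<beta> j ?ws"
        unfolding \<beta>_def using altmap_transpose[OF \<alpha>, of "?ws[j := A (?ws ! j)]" 0 j] j False by simp
      finally show ?thesis
        using that permutes_imp_permutation[OF finite_lessThan] t False by (simp add: sign_compose sign_swap_id)
    qed
    then show ?thesis unfolding S_def by (subst sum_permutations_compose_right[OF t]) (rule sum.cong, auto)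
  qed simp
  then have "(\<Sum>j<Suc m. S j) = (\<Sum>j<Suc m. S 0)" by (intro sum.cong) auto
  then have "real (Suc m) * S 0 = (\<Sum>j<Suc m. S j)" by (simp del: sum.lessThan_Suc)
  also have "\<dots> = (\<Sum>\<sigma>\<in>?P. real_of_int (sign \<sigma>) * (\<Sum>j<Suc m. \<beta> j (?p \<sigma> vs)))"
    unfolding S_def by (subst sum.swap) (simp add: sum_distrib_left del: sum.lessThan_Suc)
  also have "\<dots> = (\<Sum>\<sigma>\<in>?P. \<Sum>j<Suc m. \<beta> j vs)"
  proof (rule sum.cong[OF HOL.refl])
    fix \<sigma> assume "\<sigma> \<in> ?P"
    then have "(\<Sum>j<Suc m. \<beta> j (?p \<sigma> vs)) = real_of_int (sign \<sigma>) *\<^sub>R (\<Sum>j<Suc m. \<beta> j vs)"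
      using altmap_permute[OF altmap_derivation[OF \<alpha> A] vs, of \<sigma>] vs by (simp add: \<beta>_def del: sum.lessThan_Suc)
    moreover have "real_of_int (sign \<sigma>) * real_of_int (sign \<sigma>) = 1"
      unfolding of_int_mult[symmetric] by simp
    ultimately show "real_of_int (sign \<sigma>) * (\<Sum>j<Suc m. \<beta> j (?p \<sigma> vs)) = (\<Sum>j<Suc m. \<beta> j vs)"
      by (simp add: mult.assoc[symmetric] del: sum.lessThan_Suc)
  qed
  also have "\<dots> = fact (Suc m) * (\<Sum>j<Suc m. \<beta> j vs)"
    using card_permutations[of "{..<Suc m}" "Suc m"] by (simp del: sum.lessThan_Suc fact_Suc)
  finally have "real (Suc m) * S 0 = real (Suc m) * (fact m * (\<Sum>j<Suc m. \<beta> j vs))" by (simp del: sum.lessThan_Suc)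
  then have "S 0 = fact m * (\<Sum>j<Suc m. \<beta> j vs)" by (simp only: mult_cancel_left) simp
  moreover have "S 0 = (\<Sum>\<sigma>\<in>?P. real_of_int (sign \<sigma>) * \<alpha> ((?p \<sigma> vs)[0 := A (vs ! \<sigma> 0)]))"
    unfolding S_def \<beta>_def by simp
  ultimately show ?thesis unfolding \<beta>_def by simp
qed

context finite_basis begin

lemma lie_derivative_eq:
  assumes A: "linear (A :: 'v \<Rightarrow> 'v)" and \<alpha>: "\<alpha> \<in> mforms i M"
  shows "lie_derivative A \<alpha> = form_act A (\<lambda>f x. frechet_derivative f (at x) (A x)) \<alpha>"
proof (intro ext)
  fix x vs
  have "\<alpha> x (vs[j := lie_bracket A (\<lambda>_. vs ! j) x]) = - \<alpha> x (vs[j := A (vs ! j)])" if j: "j < length vs" for j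
  proof (cases "length vs = i")
    case True
    have "lie_bracket A (\<lambda>_. vs ! j) x = - A (vs ! j)"
      by (simp add: lie_bracket_def fd_linear_map[OF A] frechet_derivative_const)
    then show ?thesis using linear_neg[OF altmap_slot[OF mforms_altmap[OF \<alpha>] True]] j True by simp
  next
    case False
    then show ?thesis by (simp add: altmap_length[OF mforms_altmap[OF \<alpha>]])
  qed
  then show "lie_derivative A \<alpha> x vs = form_act A (\<lambda>f x. frechet_derivative f (at x) (A x)) \<alpha> x vs"
    by (simp add: lie_derivative_def form_act_def sum_negf)
qed

lemma derivation_directional:
  assumes "linear (A :: 'v \<Rightarrow> 'v)"
  shows "derivation_over A (\<lambda>f x. frechet_derivative f (at x) (A x)) {f :: 'v \<Rightarrow> real. smooth f}"
  unfolding derivation_over_def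
  by (auto simp: fun_eq_iff fd_add fd_mult mult.commute intro: smooth_along smooth_linear[OF assms])

lemma lie_derivative_form:
  assumes "linear (A :: 'v \<Rightarrow> 'v)" "\<alpha> \<in> mforms i {f. smooth f}"
  shows "lie_derivative A \<alpha> \<in> mforms i {f. smooth f}"
  unfolding lie_derivative_eq[OF assms]
  by (rule form_act_mforms[OF derivation_directional[OF assms(1)] function_module_smooth assms])

lemma form_act_product:
  assumes A: "linear (A :: 'v \<Rightarrow> 'v)" and \<alpha>: "\<alpha> \<in> mforms i {f. smooth f}" and Y: "smooth Y"
  shows "form_act A (lie_bracket A) (\<lambda>x vs. \<alpha> x vs *\<^sub>R Y x)
    = (\<lambda>x vs. lie_derivative A \<alpha> x vs *\<^sub>R Y x + \<alpha> x vs *\<^sub>R lie_bracket A Y x)"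
proof (intro ext)
  fix x vs
  have "smooth (\<lambda>x. \<alpha> x vs)" using mforms_value[OF \<alpha>] by simp
  then show "form_act A (lie_bracket A) (\<lambda>x vs. \<alpha> x vs *\<^sub>R Y x) x vs
      = lie_derivative A \<alpha> x vs *\<^sub>R Y x + \<alpha> x vs *\<^sub>R lie_bracket A Y x"
    unfolding lie_derivative_eq[OF A \<alpha>] form_act_def
    by (simp add: lie_bracket_scale_right[OF smooth_linear[OF A] Y] scaleR_add_left scaleR_sum_left)
qed

text \<open>The first sum of the bracket runs over \<open>i!\<close> equal terms, namely the bracket of \<open>A\<close> with the value \<open>\<alpha>(v\<^sub>1, \<dots>) Y\<close>; the second
  is the one treated above.\<close>

lemma fn_bracket_linear_field:
  assumes A: "linear (A :: 'v \<Rightarrow> 'v)" and \<alpha>: "\<alpha> \<in> mforms i {f. smooth f}" and Y: "smooth Y"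
  shows "fn_bracket 0 i (field_as_vform A) (form_times_field \<alpha> Y)
    = (\<lambda>x vs. form_times_field (lie_derivative A \<alpha>) Y x vs + form_times_field \<alpha> (lie_bracket A Y) x vs)"
proof (intro ext)
  fix x vs
  note alt = mforms_altmap[OF \<alpha>]
  show "fn_bracket 0 i (field_as_vform A) (form_times_field \<alpha> Y) x vs
    = form_times_field (lie_derivative A \<alpha>) Y x vs + form_times_field \<alpha> (lie_bracket A Y) x vs"
  proof (cases "length vs = i")
    case False
    then show ?thesis
      by (simp add: fn_bracket_def form_times_field_def altmap_length[OF alt]
          altmap_length[OF mforms_altmap[OF lie_derivative_form[OF A \<alpha>]]])
  next
    case True
    let ?P = "{\<sigma>. \<sigma> permutes {..<i}}"
    have sm: "smooth (\<lambda>x. \<alpha> x vs)" using mforms_value[OF \<alpha>] by simp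
    have brA: "lie_bracket A (\<lambda>y. \<alpha> y vs *\<^sub>R Y y) x
        = \<alpha> x vs *\<^sub>R lie_bracket A Y x + frechet_derivative (\<lambda>y. \<alpha> y vs) (at x) (A x) *\<^sub>R Y x"
      by (simp add: lie_bracket_scale_right[OF smooth_linear[OF A] Y sm])
    have "real_of_int (sign \<sigma>) *\<^sub>R lie_bracket A (\<lambda>y. \<alpha> y (reindex_list i \<sigma> vs) *\<^sub>R Y y) x
        = lie_bracket A (\<lambda>y. \<alpha> y vs *\<^sub>R Y y) x" if \<sigma>: "\<sigma> \<in> ?P" for \<sigma>
    proof -
      have s: "real_of_int (sign \<sigma>) * real_of_int (sign \<sigma>) = 1" unfolding of_int_mult[symmetric] by simp
      have "lie_bracket A (\<lambda>y. \<alpha> y (reindex_list i \<sigma> vs) *\<^sub>R Y y) x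
        = lie_bracket A (\<lambda>y. real_of_int (sign \<sigma>) *\<^sub>R (\<alpha> y vs *\<^sub>R Y y)) x"
        using altmap_permute[OF alt True, of \<sigma>] \<sigma> by simp
      also have "\<dots> = real_of_int (sign \<sigma>) *\<^sub>R lie_bracket A (\<lambda>y. \<alpha> y vs *\<^sub>R Y y) x"
        using lie_bracket_scale_right[of A "\<lambda>y. \<alpha> y vs *\<^sub>R Y y" "\<lambda>_. real_of_int (sign \<sigma>)"]
        by (simp add: smooth_linear[OF A] smooth_on_scaleR sm Y smooth_on_const frechet_derivative_const)
      finally show ?thesis using s by simp
    qed
    then have "(\<Sum>\<sigma>\<in>?P. real_of_int (sign \<sigma>) *\<^sub>R lie_bracket A (\<lambda>y. \<alpha> y (reindex_list i \<sigma> vs) *\<^sub>R Y y) x)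
      = (\<Sum>\<sigma>\<in>?P. lie_bracket A (\<lambda>y. \<alpha> y vs *\<^sub>R Y y) x)" by (rule sum.cong[OF HOL.refl])
    also have "\<dots> = fact i *\<^sub>R lie_bracket A (\<lambda>y. \<alpha> y vs *\<^sub>R Y y) x"
      using card_permutations[of "{..<i}" i] by (simp add: sum_constant_scaleR)
    finally have first: "(1 / fact i) *\<^sub>R (\<Sum>\<sigma>\<in>?P. real_of_int (sign \<sigma>) *\<^sub>R
        lie_bracket A (\<lambda>y. \<alpha> y (reindex_list i \<sigma> vs) *\<^sub>R Y y) x) = lie_bracket A (\<lambda>y. \<alpha> y vs *\<^sub>R Y y) x"
      by simp
    have second: "(if i = 0 then 0 else (1 / fact (i - 1)) *\<^sub>R (\<Sum>\<sigma>\<in>?P. real_of_int (sign \<sigma>) *\<^sub>R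
        (\<alpha> x (lie_bracket A (\<lambda>_. vs ! \<sigma> 0) x # map (\<lambda>j. vs ! \<sigma> j) [1..<i]) *\<^sub>R Y x)))
      = - ((\<Sum>j<i. \<alpha> x (vs[j := A (vs ! j)])) *\<^sub>R Y x)"
    proof (cases i)
      case (Suc m)
      have "\<alpha> x (lie_bracket A (\<lambda>_. vs ! \<sigma> 0) x # map (\<lambda>j. vs ! \<sigma> j) [1..<i])
          = - \<alpha> x ((reindex_list (Suc m) \<sigma> vs)[0 := A (vs ! \<sigma> 0)])" for \<sigma>
      proof -
        have "lie_bracket A (\<lambda>_. vs ! \<sigma> 0) x = - A (vs ! \<sigma> 0)"
          by (simp add: lie_bracket_def fd_linear_map[OF A] frechet_derivative_const)
        moreover have "(reindex_list (Suc m) \<sigma> vs)[0 := A (vs ! \<sigma> 0)] = A (vs ! \<sigma> 0) # map (\<lambda>j. vs ! \<sigma> j) [1..<i]"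
          unfolding reindex_list_def Suc by (simp add: upt_conv_Cons del: upt_Suc)
        ultimately show ?thesis
          using linear_neg[OF altmap_linear_Cons[OF alt]] by simp
      qed
      then have "(\<Sum>\<sigma>\<in>?P. real_of_int (sign \<sigma>) *\<^sub>R
          (\<alpha> x (lie_bracket A (\<lambda>_. vs ! \<sigma> 0) x # map (\<lambda>j. vs ! \<sigma> j) [1..<i]) *\<^sub>R Y x))
        = - ((\<Sum>\<sigma>\<in>?P. real_of_int (sign \<sigma>) * \<alpha> x ((reindex_list (Suc m) \<sigma> vs)[0 := A (vs ! \<sigma> 0)])) *\<^sub>R Y x)"
        by (simp add: sum_negf scaleR_sum_left)
      also have "\<dots> = - ((fact m * (\<Sum>j<Suc m. \<alpha> x (vs[j := A (vs ! j)]))) *\<^sub>R Y x)"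
        using sum_permutations_derivation[of m "\<alpha> x" A vs] alt[of x] A True Suc by simp
      finally show ?thesis by (simp add: Suc del: sum.lessThan_Suc)
    qed simp
    have "fn_bracket 0 i (field_as_vform A) (form_times_field \<alpha> Y) x vs
      = lie_bracket A (\<lambda>y. \<alpha> y vs *\<^sub>R Y y) x + (\<Sum>j<i. \<alpha> x (vs[j := A (vs ! j)])) *\<^sub>R Y x"
      using first second True
      by (simp add: fn_bracket_def Let_def field_as_vform_def form_times_field_def reindex_list_def cong: if_cong)
    then show ?thesis
      by (simp add: brA form_times_field_def lie_derivative_eq[OF A \<alpha>] form_act_def True scaleR_add_left)
  qed
qed

end

section \<open>The representations on forms, on the Koszul complex and on its homology\<close>

lemma lie_bracket_antisym: "lie_bracket Y X = (\<lambda>x. - lie_bracket X Y x)"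
  by (simp add: lie_bracket_def fun_eq_iff)

context foliated_space begin

lemma derivation_bracket: "X \<in> F \<Longrightarrow> derivation_over X (lie_bracket X) F"
  unfolding derivation_over_def
  by (auto simp: F_bracket F_smooth lie_bracket_add_right lie_bracket_scale_right)

text \<open>For the parts that involve the derivations this is the Jacobi identity. In the double sum over slots the terms with
  distinct slots cancel, and those with equal slots combine to the commutator of the endomorphisms.\<close>

lemma form_act_commutator:
  assumes A: "A \<in> g" and C: "C \<in> g" and \<alpha>: "\<alpha> \<in> mforms i F"
  shows "form_act (lie_bracket A C) (lie_bracket (lie_bracket A C)) \<alpha> x vs
    = form_act A (lie_bracket A) (form_act C (lie_bracket C) \<alpha>) x vs
      - form_act C (lie_bracket C) (form_act A (lie_bracket A) \<alpha>) x vs"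
proof (cases "length vs = i")
  case False
  have "form_act X (lie_bracket X) \<beta> \<in> mforms i F" if "X \<in> g" "\<beta> \<in> mforms i F" for X \<beta>
    using that g_subset by (intro form_act_mforms derivation_bracket F_module g_linear) auto
  note closed = this
  show ?thesis
    using altmap_length[OF mforms_altmap False] closed g_bracket A C \<alpha> by (metis diff_self)
next
  case True
  have lin: "linear A" "linear C" using A C g_linear by blast+
  have AF: "A \<in> F" and CF: "C \<in> F" using A C g_subset by blast+
  note val = mforms_value[OF \<alpha>]
  note sm = F_smooth[OF AF] F_smooth[OF CF] F_smooth[OF val]
  have jac: "lie_bracket (lie_bracket A C) s x = lie_bracket A (lie_bracket C s) x - lie_bracket C (lie_bracket A s) x"
    if s: "s \<in> F" for s
  proof -
    have neg: "lie_bracket C (lie_bracket s A) x = - lie_bracket C (lie_bracket A s) x"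
      unfolding lie_bracket_antisym[of s A]
      using lie_bracket_scale_right[of C "lie_bracket A s" "\<lambda>_. - 1"] F_smooth[OF CF] F_smooth[OF F_bracket[OF AF s]]
      by (simp add: smooth_on_const frechet_derivative_const)
    have "lie_bracket A (lie_bracket C s) x + (- lie_bracket C (lie_bracket A s) x) + (- lie_bracket (lie_bracket A C) s x) = 0"
      using lie_bracket_jacobi[OF F_smooth[OF AF] F_smooth[OF CF] F_smooth[OF s], of x]
      unfolding lie_bracket_antisym[of s "lie_bracket A C"] neg .
    then show ?thesis by (metis add_uminus_conv_diff eq_iff_diff_eq_0)
  qed
  define T where "T P Q k j = \<alpha> x ((vs[k := P (vs ! k)])[j := Q (vs[k := P (vs ! k)] ! j)])" for P Q :: "'v \<Rightarrow> 'v" and k j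
  have expand: "form_act P (lie_bracket P) (form_act Q (lie_bracket Q) \<alpha>) x vs
      = lie_bracket P (lie_bracket Q (\<lambda>y. \<alpha> y vs)) x + (\<Sum>j<i. lie_bracket P (\<lambda>y. \<alpha> y (vs[j := Q (vs ! j)])) x)
        + ((\<Sum>k<i. lie_bracket Q (\<lambda>y. \<alpha> y (vs[k := P (vs ! k)])) x) + (\<Sum>k<i. \<Sum>j<i. T P Q k j))"
    if P: "P \<in> F" and Q: "Q \<in> F" for P Q
  proof -
    have "lie_bracket P (\<lambda>y. lie_bracket Q (\<lambda>y. \<alpha> y vs) y + (\<Sum>j<i. \<alpha> y (vs[j := Q (vs ! j)]))) x
      = lie_bracket P (lie_bracket Q (\<lambda>y. \<alpha> y vs)) x + (\<Sum>j<i. lie_bracket P (\<lambda>y. \<alpha> y (vs[j := Q (vs ! j)])) x)"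
      by (simp add: derivation_add[OF derivation_bracket[OF P] F_bracket[OF Q val] function_module_sum[OF F_module val]]
          derivation_sum[OF derivation_bracket[OF P] F_module val])
    then show ?thesis by (simp add: form_act_def True T_def sum.distrib)
  qed
  have "(\<Sum>k<i. \<Sum>j<i. T A C k j) - (\<Sum>k<i. \<Sum>j<i. T C A k j) = (\<Sum>k<i. \<Sum>j<i. T A C k j - T C A j k)"
    by (subst (2) sum.swap) (simp add: sum_subtractf)
  also have "\<dots> = (\<Sum>k<i. \<Sum>j<i. if j = k then \<alpha> x (vs[k := lie_bracket A C (vs ! k)]) else 0)"
  proof (intro sum.cong HOL.refl)
    fix k j assume kj: "k \<in> {..<i}" "j \<in> {..<i}"
    show "T A C k j - T C A j k = (if j = k then \<alpha> x (vs[k := lie_bracket A C (vs ! k)]) else 0)"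
    proof (cases "j = k")
      case jk: True
      have "linear (\<lambda>v. \<alpha> x (vs[k := v]))" by (rule altmap_slot[OF mforms_altmap[OF \<alpha>] True]) (use kj in simp)
      from linear_diff[OF this] show ?thesis
        using jk kj True by (simp add: T_def lie_bracket_linear[OF lin])
    next
      case False
      then show ?thesis using list_update_swap[of k j vs] by (simp add: T_def)
    qed
  qed
  also have "\<dots> = (\<Sum>k<i. \<alpha> x (vs[k := lie_bracket A C (vs ! k)]))" by simp
  finally have "(\<Sum>k<i. \<Sum>j<i. T A C k j) - (\<Sum>k<i. \<Sum>j<i. T C A k j) = (\<Sum>k<i. \<alpha> x (vs[k := lie_bracket A C (vs ! k)]))" .
  then show ?thesis
    unfolding expand[OF AF CF] expand[OF CF AF]
    by (simp add: form_act_def True jac[OF val])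
qed

definition form_rep :: "('v \<Rightarrow> 'v) set \<Rightarrow> 'v vform \<Rightarrow> 'v vform" where
  "form_rep C = form_act (lin_bar C) (lie_bracket (lin_bar C))"

lemma form_rep_cls: "X \<in> F \<Longrightarrow> form_rep (cls X) = form_act (lin_part X) (lie_bracket (lin_part X))"
  by (simp add: form_rep_def lin_bar_cls)

lemma form_rep_mforms: "C \<in> carrier (isotropy 0 F) \<Longrightarrow> \<alpha> \<in> mforms i F \<Longrightarrow> form_rep C \<alpha> \<in> mforms i F"
  by (auto simp: carrier_isotropy form_rep_cls
      intro!: form_act_mforms derivation_bracket lin_part_in_F F_module lin_part_linear_map)

lemma euler_d_form_rep: "C \<in> carrier (isotropy 0 F) \<Longrightarrow> \<alpha> \<in> mforms i F \<Longrightarrow> euler_d (form_rep C \<alpha>) = form_rep C (euler_d \<alpha>)"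
  by (auto simp: carrier_isotropy form_rep_cls
      intro!: euler_d_form_act[OF derivation_bracket] lin_part_in_F F_module lin_part_linear_map)

lemma lie_rep_forms:
  assumes sub: "S \<subseteq> mforms i F" and mod: "Module.module smooth_ring (form_module S)"
    and inv: "\<And>C \<alpha>. C \<in> carrier (isotropy 0 F) \<Longrightarrow> \<alpha> \<in> S \<Longrightarrow> form_rep C \<alpha> \<in> S"
  shows "lie_rep (isotropy 0 F) (real_form (form_module S)) form_rep"
  unfolding lie_rep_def
proof (intro conjI ballI lie_algebra_isotropy module_real_form[OF mod])
  let ?W = "real_form (form_module S)"
  interpret W: Module.module real_ring ?W by (rule module_real_form[OF mod])
  have neg: "\<ominus>\<^bsub>?W\<^esub> \<alpha> = (\<lambda>x vs. - \<alpha> x vs)" if "\<alpha> \<in> S" for \<alpha>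
  proof (rule W.M.minus_equality)
    have "(\<lambda>_. - 1) \<odot>\<^bsub>form_module S\<^esub> \<alpha> \<in> S"
      using Module.module.smult_closed[OF mod, of "\<lambda>_. - 1" \<alpha>] that by (simp add: smooth_ring_carrier smooth_on_const)
    then show "(\<lambda>x vs. - \<alpha> x vs) \<in> carrier ?W" by simp
  qed (use that in auto)
  fix C assume C: "C \<in> carrier (isotropy 0 F)"
  then obtain X where X: "X \<in> F" "C = cls X" unfolding carrier_isotropy by blast
  show "form_rep C \<in> linear_maps real_ring ?W ?W"
    using inv[OF C] sub X
    by (intro linear_mapsI)
      (auto simp: form_rep_cls form_act_add[OF derivation_bracket[OF lin_part_in_F] subsetD[OF sub] subsetD[OF sub]]
        form_act_const[OF derivation_bracket[OF lin_part_in_F] subsetD[OF sub]])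
  fix D \<alpha> assume D: "D \<in> carrier (isotropy 0 F)" and \<alpha>: "\<alpha> \<in> carrier ?W"
  then obtain Y where Y: "Y \<in> F" "D = cls Y" unfolding carrier_isotropy by blast
  have \<alpha>': "\<alpha> \<in> S" "\<alpha> \<in> mforms i F" using \<alpha> sub by auto
  show "form_rep (lbr (isotropy 0 F) C D) \<alpha> = form_rep C (form_rep D \<alpha>) \<ominus>\<^bsub>?W\<^esub> form_rep D (form_rep C \<alpha>)"
  proof -
    have "form_rep (lbr (isotropy 0 F) C D) \<alpha> = (\<lambda>x vs. form_rep C (form_rep D \<alpha>) x vs - form_rep D (form_rep C \<alpha>) x vs)"
      using form_act_commutator[OF lin_part_in_g[OF X(1)] lin_part_in_g[OF Y(1)] \<alpha>'(2)] X Y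
      by (intro ext) (simp add: isotropy_ops form_rep_cls F_bracket lin_part_bracket)
    then show ?thesis using neg[OF inv[OF D inv[OF C \<alpha>'(1)]]] by (simp add: a_minus_def)
  qed
next
  fix \<alpha> assume \<alpha>: "\<alpha> \<in> carrier (real_form (form_module S))"
  have \<alpha>': "\<alpha> \<in> mforms i F" using \<alpha> sub by auto
  have sm: "smooth (\<lambda>x. \<alpha> x vs)" for vs using F_smooth mforms_value[OF \<alpha>'] by blast
  have slot: "\<alpha> x (vs[j := lin_part X (vs ! j) + lin_part Y (vs ! j)])
      = \<alpha> x (vs[j := lin_part X (vs ! j)]) + \<alpha> x (vs[j := lin_part Y (vs ! j)])"
    "\<alpha> x (vs[j := c *\<^sub>R lin_part X (vs ! j)]) = c *\<^sub>R \<alpha> x (vs[j := lin_part X (vs ! j)])"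
    if "j < length vs" for x vs j X Y c
    using linear_add[OF altmap_slot[OF mforms_altmap[OF \<alpha>']]] linear_scale[OF altmap_slot[OF mforms_altmap[OF \<alpha>']]]
      altmap_length[OF mforms_altmap[OF \<alpha>']] that by (cases "length vs = i"; simp)+
  show "(\<lambda>C. form_rep C \<alpha>) \<in> linear_maps real_ring (isotropy 0 F) (real_form (form_module S))"
  proof (rule linear_mapsI)
    fix C assume C: "C \<in> carrier (isotropy 0 F)"
    then show "form_rep C \<alpha> \<in> carrier (real_form (form_module S))" using inv \<alpha> by simp
    obtain X where X: "X \<in> F" "C = cls X" using C unfolding carrier_isotropy by blast
    note sX = F_smooth[OF lin_part_in_F[OF X(1)]]
    show "form_rep (r \<odot>\<^bsub>isotropy 0 F\<^esub> C) \<alpha> = r \<odot>\<^bsub>real_form (form_module S)\<^esub> form_rep C \<alpha>" for r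
      using X lie_bracket_scale_left[OF sX sm, of "\<lambda>_. r"]
      by (simp add: isotropy_ops form_rep_cls function_module_const[OF F_module] lin_part_const form_act_def
          slot smooth_on_const frechet_derivative_const scaleR_add_right scaleR_sum_right)
    fix D assume "D \<in> carrier (isotropy 0 F)"
    then obtain Y where Y: "Y \<in> F" "D = cls Y" unfolding carrier_isotropy by blast
    note sY = F_smooth[OF lin_part_in_F[OF Y(1)]]
    show "form_rep (C \<oplus>\<^bsub>isotropy 0 F\<^esub> D) \<alpha> = form_rep C \<alpha> \<oplus>\<^bsub>real_form (form_module S)\<^esub> form_rep D \<alpha>"
      using X Y lie_bracket_add_left[OF sX sY sm]
      by (simp add: isotropy_ops form_rep_cls function_module_add[OF F_module] lin_part_add F_smooth form_act_def
          slot sum.distrib algebra_simps)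
  qed
qed

lemma module_mforms: "Module.module smooth_ring (form_module (mforms i F))"
  by (rule module_form_module) (auto intro: mforms_zero mforms_add mforms_smult F_module)

lemma module_cycles: "Module.module smooth_ring (form_module (cycles i F))"
  by (rule module_form_module)
    (auto simp: cycles_def euler_d_zero euler_d_add euler_d_smult intro: mforms_zero mforms_add mforms_smult F_module)

lemma cycles_mforms: "cycles i F \<subseteq> mforms i F"
  unfolding cycles_def by blast

lemma boundaries_cycles: "boundaries i F \<subseteq> cycles i F"
  unfolding boundaries_def cycles_def using euler_d_mforms[OF F_module] euler_d_euler_d by blast

lemma form_rep_zero: "C \<in> carrier (isotropy 0 F) \<Longrightarrow> form_rep C (\<lambda>_ _. 0) = (\<lambda>_ _. 0)"
  by (auto simp: carrier_isotropy form_rep_cls form_act_def fun_eq_iff derivation_zero[OF derivation_bracket F_module] lin_part_in_F)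

lemma form_rep_cycles: "C \<in> carrier (isotropy 0 F) \<Longrightarrow> \<alpha> \<in> cycles i F \<Longrightarrow> form_rep C \<alpha> \<in> cycles i F"
  using euler_d_form_rep[of C \<alpha> i] by (auto simp: cycles_def form_rep_mforms form_rep_zero)

lemma form_rep_boundaries: "C \<in> carrier (isotropy 0 F) \<Longrightarrow> \<alpha> \<in> boundaries i F \<Longrightarrow> form_rep C \<alpha> \<in> boundaries i F"
  unfolding boundaries_def using euler_d_form_rep[symmetric] form_rep_mforms by blast

text \<open>The action on tensors, through the forms that they represent.\<close>

definition koszul_rep ::
  "nat \<Rightarrow> ('v \<Rightarrow> 'v) set \<Rightarrow> ('v form \<times> ('v \<Rightarrow> 'v)) list set \<Rightarrow> ('v form \<times> ('v \<Rightarrow> 'v)) list set" where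
  "koszul_rep i C t = tens i (form_rep C (tval (SOME xs. xs \<in> t)))"

lemma koszul_rep_tens: "\<omega> \<in> mforms i F \<Longrightarrow> koszul_rep i C (tens i \<omega>) = tens i (form_rep C \<omega>)"
proof -
  assume "\<omega> \<in> mforms i F"
  then obtain xs where "xs \<in> tens i \<omega>" by (rule tval_surj)
  then have "(SOME xs. xs \<in> tens i \<omega>) \<in> tens i \<omega>" by (rule someI)
  then show ?thesis unfolding koszul_rep_def by (simp add: tens_def)
qed

lemma module_koszul: "Module.module smooth_ring (koszul F i)"
proof (rule module_surj[OF module_mforms, of "tens i"])
  fix \<alpha> assume \<alpha>: "\<alpha> \<in> carrier (form_module (mforms i F))"
  show "tens i (\<alpha> \<oplus>\<^bsub>form_module (mforms i F)\<^esub> \<beta>) = tens i \<alpha> \<oplus>\<^bsub>koszul F i\<^esub> tens i \<beta>"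
    if "\<beta> \<in> carrier (form_module (mforms i F))" for \<beta>
    using \<alpha> that koszul_add[of \<alpha> i \<beta>] by simp
  show "tens i (r \<odot>\<^bsub>form_module (mforms i F)\<^esub> \<alpha>) = r \<odot>\<^bsub>koszul F i\<^esub> tens i \<alpha>" if "r \<in> carrier smooth_ring" for r
    using \<alpha> that koszul_smult[of r \<alpha> i] by (simp add: smooth_ring_carrier)
qed (simp_all add: carrier_koszul koszul_zero)

lemma lie_rep_koszul: "lie_rep (isotropy 0 F) (real_form (koszul F i)) (koszul_rep i)"
  by (rule lie_rep_surj[OF lie_rep_forms[OF subset_refl module_mforms form_rep_mforms] module_real_form[OF module_koszul], where f = "tens i"])
    (auto intro!: linear_mapsI simp: carrier_koszul koszul_add koszul_smult smooth_on_const koszul_rep_tens)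

abbreviation "cycle_module i \<equiv> (koszul F i)\<lparr>carrier := koszul_cycles F i\<rparr>"

lemma module_koszul_cycles: "Module.module smooth_ring (cycle_module i)"
  by (rule module_surj[OF module_cycles, of "tens i"])
    (use cycles_mforms in \<open>auto simp: koszul_cycles_eq koszul_zero koszul_add koszul_smult smooth_ring_carrier subset_iff\<close>)

lemma submodule_boundaries: "submodule (koszul_boundaries F i) smooth_ring (cycle_module i)"
proof (rule submodule_criterion[OF module_koszul_cycles])
  show "koszul_boundaries F i \<subseteq> carrier (cycle_module i)"
    using boundaries_cycles by (auto simp: koszul_cycles_eq koszul_boundaries_eq)
  have z: "(\<lambda>_ _. 0) \<in> boundaries i F"
    unfolding boundaries_def by (rule image_eqI[where f = euler_d and x = "\<lambda>_ _. 0"]) (simp_all add: euler_d_zero mforms_zero[OF F_module])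
  then show "\<zero>\<^bsub>cycle_module i\<^esub> \<in> koszul_boundaries F i" by (simp add: koszul_boundaries_eq koszul_zero)
  have m: "\<alpha> \<in> mforms i F" if "\<alpha> \<in> boundaries i F" for \<alpha> using that boundaries_cycles cycles_mforms by blast
  fix a b assume a: "a \<in> koszul_boundaries F i"
  then obtain \<alpha> where \<alpha>: "\<alpha> \<in> mforms (Suc i) F" "a = tens i (euler_d \<alpha>)" unfolding koszul_boundaries_eq boundaries_def by blast
  then have k\<alpha>: "euler_d \<alpha> \<in> mforms i F" by (intro euler_d_mforms F_module)
  show "r \<odot>\<^bsub>cycle_module i\<^esub> a \<in> koszul_boundaries F i" if "r \<in> carrier smooth_ring" for r
  proof -
    have "(\<lambda>x vs. r x *\<^sub>R euler_d \<alpha> x vs) \<in> boundaries i F"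
      unfolding boundaries_def euler_d_smult[symmetric] using that \<alpha>(1)
      by (intro imageI mforms_smult F_module) (simp_all add: smooth_ring_carrier)
    then show ?thesis using that \<alpha>(2) k\<alpha> by (simp add: koszul_boundaries_eq koszul_smult smooth_ring_carrier)
  qed
  assume "b \<in> koszul_boundaries F i"
  then obtain \<beta> where \<beta>: "\<beta> \<in> mforms (Suc i) F" "b = tens i (euler_d \<beta>)" unfolding koszul_boundaries_eq boundaries_def by blast
  then have k\<beta>: "euler_d \<beta> \<in> mforms i F" by (intro euler_d_mforms F_module)
  have "(\<lambda>x vs. euler_d \<alpha> x vs + euler_d \<beta> x vs) \<in> boundaries i F"
    unfolding boundaries_def euler_d_add[symmetric] by (intro imageI mforms_add F_module \<alpha>(1) \<beta>(1))
  then show "a \<oplus>\<^bsub>cycle_module i\<^esub> b \<in> koszul_boundaries F i"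
    using \<alpha>(2) \<beta>(2) k\<alpha> k\<beta> by (simp add: koszul_boundaries_eq koszul_add)
qed

definition homology_class :: "nat \<Rightarrow> 'v vform \<Rightarrow> ('v form \<times> ('v \<Rightarrow> 'v)) list set set" where
  "homology_class i \<omega> = koszul_boundaries F i +>\<^bsub>koszul F i\<^esub> tens i \<omega>"

lemma homology_class_eq: "homology_class i \<omega> = koszul_boundaries F i +>\<^bsub>cycle_module i\<^esub> tens i \<omega>"
  unfolding homology_class_def coset_eq by simp

lemma tens_cycles: "\<omega> \<in> cycles i F \<Longrightarrow> tens i \<omega> \<in> carrier (cycle_module i)"
  by (simp add: koszul_cycles_eq)

lemma module_homology: "Module.module real_ring (koszul_homology F i)"
  unfolding koszul_homology_def
  by (rule module_real_form[OF module_quot[OF module_koszul_cycles submodule_boundaries]])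

lemma carrier_homology: "carrier (koszul_homology F i) = homology_class i ` cycles i F"
  unfolding koszul_homology_def real_form_sel quot_carrier[OF module_koszul_cycles submodule_boundaries]
  by (simp add: koszul_cycles_eq image_image homology_class_eq)

lemma homology_class_linear: "homology_class i \<in> linear_maps real_ring (real_form (form_module (cycles i F))) (koszul_homology F i)"
proof (rule linear_mapsI)
  fix \<omega> assume "\<omega> \<in> carrier (real_form (form_module (cycles i F)))"
  then have \<omega>: "\<omega> \<in> cycles i F" "\<omega> \<in> mforms i F" using cycles_mforms by auto
  then show "homology_class i \<omega> \<in> carrier (koszul_homology F i)" by (simp add: carrier_homology)
  show "homology_class i (r \<odot>\<^bsub>real_form (form_module (cycles i F))\<^esub> \<omega>) = r \<odot>\<^bsub>koszul_homology F i\<^esub> homology_class i \<omega>" for r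
    using quot_smult[OF module_koszul_cycles submodule_boundaries _ tens_cycles[OF \<omega>(1)], of "\<lambda>_. r"] \<omega>(2)
    by (simp add: koszul_homology_def homology_class_eq smooth_ring_carrier smooth_on_const koszul_smult)
  fix \<eta> assume "\<eta> \<in> carrier (real_form (form_module (cycles i F)))"
  then have \<eta>: "\<eta> \<in> cycles i F" "\<eta> \<in> mforms i F" using cycles_mforms by auto
  show "homology_class i (\<omega> \<oplus>\<^bsub>real_form (form_module (cycles i F))\<^esub> \<eta>)
      = homology_class i \<omega> \<oplus>\<^bsub>koszul_homology F i\<^esub> homology_class i \<eta>"
    using quot_add[OF module_koszul_cycles submodule_boundaries tens_cycles[OF \<omega>(1)] tens_cycles[OF \<eta>(1)]] \<omega>(2) \<eta>(2)
    by (simp add: koszul_homology_def homology_class_eq koszul_add)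
qed

lemma homology_class_mem:
  assumes "\<omega> \<in> cycles i F" "t \<in> homology_class i \<omega>"
  obtains \<beta> where "\<beta> \<in> boundaries i F" "t = tens i (\<lambda>x vs. \<beta> x vs + \<omega> x vs)"
proof -
  from assms(2) obtain h where "h \<in> koszul_boundaries F i" "t = h \<oplus>\<^bsub>koszul F i\<^esub> tens i \<omega>"
    unfolding homology_class_def coset_eq by blast
  moreover have "\<omega> \<in> mforms i F" "boundaries i F \<subseteq> mforms i F" using assms(1) boundaries_cycles cycles_mforms by blast+
  ultimately show thesis using that by (auto simp: koszul_boundaries_eq koszul_add subset_iff)
qed

lemma homology_class_shift:
  assumes "\<omega> \<in> cycles i F" "\<beta> \<in> boundaries i F"
  shows "homology_class i (\<lambda>x vs. \<beta> x vs + \<omega> x vs) = homology_class i \<omega>"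
proof -
  have "\<omega> \<in> mforms i F" "\<beta> \<in> mforms i F" using assms boundaries_cycles cycles_mforms by blast+
  then have "tens i (\<lambda>x vs. \<beta> x vs + \<omega> x vs) = tens i \<beta> \<oplus>\<^bsub>cycle_module i\<^esub> tens i \<omega>" by (simp add: koszul_add)
  then have "tens i (\<lambda>x vs. \<beta> x vs + \<omega> x vs) \<in> koszul_boundaries F i +>\<^bsub>cycle_module i\<^esub> tens i \<omega>"
    unfolding coset_eq koszul_boundaries_eq using assms(2) by blast
  from coset_absorb[OF module_koszul_cycles submodule_boundaries tens_cycles[OF assms(1)] this]
  show ?thesis by (simp add: homology_class_eq)
qed

text \<open>All representatives give the same class, because boundaries are preserved by the action.\<close>

lemma quot_act_homology_class:
  assumes C: "C \<in> carrier (isotropy 0 F)" and \<omega>: "\<omega> \<in> cycles i F"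
  shows "quot_act (koszul F i) (koszul_boundaries F i) (koszul_rep i) C (homology_class i \<omega>) = homology_class i (form_rep C \<omega>)"
proof -
  have *: "koszul_boundaries F i +>\<^bsub>koszul F i\<^esub> koszul_rep i C t = homology_class i (form_rep C \<omega>)"
    if t: "t \<in> homology_class i \<omega>" for t
  proof -
    obtain \<beta> where \<beta>: "\<beta> \<in> boundaries i F" "t = tens i (\<lambda>x vs. \<beta> x vs + \<omega> x vs)"
      using homology_class_mem[OF \<omega> t] by blast
    have m: "\<omega> \<in> mforms i F" "\<beta> \<in> mforms i F" using \<omega> \<beta>(1) boundaries_cycles cycles_mforms by blast+
    obtain X where X: "X \<in> F" "C = cls X" using C unfolding carrier_isotropy by blast
    have "koszul_rep i C t = tens i (\<lambda>x vs. form_rep C \<beta> x vs + form_rep C \<omega> x vs)"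
      unfolding \<beta>(2) koszul_rep_tens[OF mforms_add[OF F_module m(2,1)]] X(2) form_rep_cls[OF X(1)]
      using form_act_add[OF derivation_bracket[OF lin_part_in_F[OF X(1)]] m(2,1)] by simp
    then show ?thesis
      using homology_class_shift[OF form_rep_cycles[OF C \<omega>] form_rep_boundaries[OF C \<beta>(1)]]
      by (simp add: homology_class_def)
  qed
  have "tens i \<omega> \<in> homology_class i \<omega>"
    unfolding homology_class_eq by (rule coset_self[OF module_koszul_cycles submodule_boundaries tens_cycles[OF \<omega>]])
  then show ?thesis unfolding quot_act_def using * by blast
qed

lemma lie_rep_homology:
  "lie_rep (isotropy 0 F) (koszul_homology F i) (quot_act (koszul F i) (koszul_boundaries F i) (koszul_rep i))"
  by (rule lie_rep_surj[OF lie_rep_forms[OF cycles_mforms module_cycles form_rep_cycles] module_homology homology_class_linear])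
    (simp_all add: carrier_homology quot_act_homology_class)

end

section \<open>Resolutions with an L-infinity-algebroid structure\<close>

lemma fibre_space_sel [simp]:
  "carrier (fibre_space E x) = fibre E x" "\<zero>\<^bsub>fibre_space E x\<^esub> = 0"
  "u \<oplus>\<^bsub>fibre_space E x\<^esub> v = u + v" "c \<odot>\<^bsub>fibre_space E x\<^esub> u = c *\<^sub>R u"
  by (simp_all add: fibre_space_def)

lemma module_fibre_space:
  assumes "vector_bundle E" shows "Module.module real_ring (fibre_space E x)"
proof (rule moduleI[OF cring_real_ring])
  note sub = fibre_subspace[OF assms, of x]
  show "abelian_group (fibre_space E x)"
  proof (rule abelian_groupI)
    fix u assume "u \<in> carrier (fibre_space E x)"
    then show "\<exists>v\<in>carrier (fibre_space E x). v \<oplus>\<^bsub>fibre_space E x\<^esub> u = \<zero>\<^bsub>fibre_space E x\<^esub>"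
      using subspace_neg[OF sub] by (intro bexI[of _ "- u"]) auto
  qed (auto simp: subspace_add[OF sub] subspace_0[OF sub])
qed (auto simp: real_ring_def subspace_scale[OF fibre_subspace[OF assms]] scaleR_add_left scaleR_add_right)

lemma bundle_map_module_map:
  assumes "bundle_map E E' \<phi>"
  shows "module_map (carrier (sections E)) \<phi> (carrier (sections E'))"
proof -
  have lin: "\<And>x. \<phi> x \<in> linear_maps real_ring (fibre_space E x) (fibre_space E' x)"
    and cl: "\<And>s. s \<in> carrier (sections E) \<Longrightarrow> (\<lambda>x. \<phi> x (s x)) \<in> carrier (sections E')"
    using assms unfolding bundle_map_def by blast+
  show ?thesis
    unfolding module_map_def
  proof (intro conjI ballI allI)
    fix s t x assume s: "s \<in> carrier (sections E)" and t: "t \<in> carrier (sections E)"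
    show "\<phi> x (s x + t x) = \<phi> x (s x) + \<phi> x (t x)"
      using linear_mapsD(2)[OF lin[of x], of "s x" "t x"] section_value[OF s] section_value[OF t] by simp
  next
    fix c s x assume s: "s \<in> carrier (sections E)"
    show "\<phi> x (c *\<^sub>R s x) = c *\<^sub>R \<phi> x (s x)"
      using linear_mapsD(3)[OF lin[of x], of c "s x"] section_value[OF s] by (simp add: real_ring_def)
  qed (rule cl)
qed

locale linf_resolution = foliated_space B g F for B :: "'v::real_normed_vector set" and g F +
  fixes n :: nat and E :: "nat \<Rightarrow> ('v, 'e::real_vector) vbundle" and \<delta> \<rho> br
  assumes res: "resolution F n E \<delta> \<rho>" and min: "minimal_at 0 E \<delta>" and linf: "linf_algebroid E \<delta> \<rho> br"
begin

abbreviation "\<Gamma> i \<equiv> carrier (sections (E i))"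
abbreviation "anchor e \<equiv> \<lambda>x. \<rho> x (e x)"
abbreviation "ell e i s \<equiv> br [(0, e), (i, s)]"

lemma vbundle_E: "vector_bundle (E i)"
  and \<delta>_bundle: "i \<ge> 1 \<Longrightarrow> bundle_map (E i) (E (i - 1)) (\<delta> i)"
  and \<rho>_bundle: "bundle_map (E 0) tangent_bundle \<rho>"
  and anchor_image: "(\<lambda>s x. \<rho> x (s x)) ` \<Gamma> 0 = F"
  and anchor_kernel: "{s \<in> \<Gamma> 0. \<forall>x. \<rho> x (s x) = 0} = (\<lambda>s x. \<delta> 1 x (s x)) ` \<Gamma> 1"
  and \<delta>_kernel: "i \<ge> 1 \<Longrightarrow> {s \<in> \<Gamma> i. \<forall>x. \<delta> i x (s x) = 0} = (\<lambda>s x. \<delta> (i + 1) x (s x)) ` \<Gamma> (i + 1)"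
proof -
  note R1 = res[unfolded resolution_def]
  note R2 = R1[THEN conjunct2, THEN conjunct2]
  note R3 = R2[THEN conjunct2, THEN conjunct2]
  note R4 = R3[THEN conjunct2, THEN conjunct2]
  show "vector_bundle (E i)" using R1[THEN conjunct1] by (rule spec)
  show "i \<ge> 1 \<Longrightarrow> bundle_map (E i) (E (i - 1)) (\<delta> i)" using R2[THEN conjunct1] by simp
  show "bundle_map (E 0) tangent_bundle \<rho>" by (rule R2[THEN conjunct2, THEN conjunct1])
  show "(\<lambda>s x. \<rho> x (s x)) ` \<Gamma> 0 = F" by (rule R3[THEN conjunct1])
  show "{s \<in> \<Gamma> 0. \<forall>x. \<rho> x (s x) = 0} = (\<lambda>s x. \<delta> 1 x (s x)) ` \<Gamma> 1"
    by (rule R3[THEN conjunct2, THEN conjunct1])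
  show "i \<ge> 1 \<Longrightarrow> {s \<in> \<Gamma> i. \<forall>x. \<delta> i x (s x) = 0} = (\<lambda>s x. \<delta> (i + 1) x (s x)) ` \<Gamma> (i + 1)"
    by (rule R4[rule_format])
qed

lemma \<Gamma>_module: "function_module (\<Gamma> i)"
  by (rule function_module_sections[OF vbundle_E])

lemma anchor_F: "e \<in> \<Gamma> 0 \<Longrightarrow> anchor e \<in> F"
  using anchor_image by blast

lemma anchor_map: "module_map (\<Gamma> 0) \<rho> F"
  using bundle_map_module_map[OF \<rho>_bundle] anchor_F unfolding module_map_def by blast

lemma \<delta>_map: "i \<ge> 1 \<Longrightarrow> module_map (\<Gamma> i) (\<delta> i) (\<Gamma> (i - 1))"
  by (rule bundle_map_module_map[OF \<delta>_bundle])

lemma \<delta>_at_0: "i \<ge> 1 \<Longrightarrow> s \<in> \<Gamma> i \<Longrightarrow> \<delta> i 0 (s 0) = 0"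
  using min section_value unfolding minimal_at_def by blast

lemma graded_iff: "(i, s) \<in> graded_sections E \<longleftrightarrow> s \<in> \<Gamma> i"
  by (simp add: graded_sections_def)

lemma br_closed: "as \<noteq> [] \<Longrightarrow> set as \<subseteq> graded_sections E \<Longrightarrow> br as \<in> \<Gamma> (bracket_index as)"
proof -
  have "\<forall>as. as \<noteq> [] \<and> set as \<subseteq> graded_sections E \<longrightarrow> br as \<in> \<Gamma> (bracket_index as)"
    using linf unfolding linf_algebroid_def by (elim conjE)
  then show "as \<noteq> [] \<Longrightarrow> set as \<subseteq> graded_sections E \<Longrightarrow> br as \<in> \<Gamma> (bracket_index as)" by simp
qed

lemma br_unary: "s \<in> \<Gamma> i \<Longrightarrow> br [(i, s)] = (if i = 0 then (\<lambda>_. 0) else (\<lambda>x. \<delta> i x (s x)))"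
proof -
  assume "s \<in> \<Gamma> i"
  have "\<forall>(i, s)\<in>graded_sections E. br [(i, s)] = (if i = 0 then (\<lambda>_. 0) else (\<lambda>x. \<delta> i x (s x)))"
    using linf unfolding linf_algebroid_def by (elim conjE)
  then show ?thesis using \<open>s \<in> \<Gamma> i\<close> graded_iff by blast
qed

lemma br_skew:
  assumes "set as \<union> set bs \<union> {(i, s), (j, t)} \<subseteq> graded_sections E"
  shows "br (as @ [(i, s), (j, t)] @ bs) = (\<lambda>x. (- ((- 1) ^ (i * j))) *\<^sub>R br (as @ [(j, t), (i, s)] @ bs) x)"
proof -
  have "\<forall>as bs i j s t. set as \<union> set bs \<union> {(i, s), (j, t)} \<subseteq> graded_sections E \<longrightarrow>
        br (as @ [(i, s), (j, t)] @ bs) = (\<lambda>x. (- ((- 1) ^ (i * j))) *\<^sub>R br (as @ [(j, t), (i, s)] @ bs) x)"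
    using linf unfolding linf_algebroid_def by (elim conjE)
  from this[rule_format, OF assms] show ?thesis .
qed

lemma br_add:
  assumes "set as \<union> set bs \<union> {(i, s), (i, t)} \<subseteq> graded_sections E"
  shows "br (as @ [(i, \<lambda>x. s x + t x)] @ bs) = (\<lambda>x. br (as @ [(i, s)] @ bs) x + br (as @ [(i, t)] @ bs) x)"
proof -
  have "\<forall>as bs i s t. set as \<union> set bs \<union> {(i, s), (i, t)} \<subseteq> graded_sections E \<longrightarrow>
        br (as @ [(i, \<lambda>x. s x + t x)] @ bs) = (\<lambda>x. br (as @ [(i, s)] @ bs) x + br (as @ [(i, t)] @ bs) x)"
    using linf unfolding linf_algebroid_def by (elim conjE)
  from this[rule_format, OF assms] show ?thesis .
qed

lemma br_smult:
  assumes "set as \<union> set bs \<union> {(i, s)} \<subseteq> graded_sections E" "smooth f" "length as + length bs \<noteq> 1"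
  shows "br (as @ [(i, \<lambda>x. f x *\<^sub>R s x)] @ bs) = (\<lambda>x. f x *\<^sub>R br (as @ [(i, s)] @ bs) x)"
proof -
  have "\<forall>as bs i s f. set as \<union> set bs \<union> {(i, s)} \<subseteq> graded_sections E \<and> smooth f \<and> length as + length bs \<noteq> 1 \<longrightarrow>
        br (as @ [(i, \<lambda>x. f x *\<^sub>R s x)] @ bs) = (\<lambda>x. f x *\<^sub>R br (as @ [(i, s)] @ bs) x)"
    using linf unfolding linf_algebroid_def by (elim conjE)
  from this[rule_format, OF conjI[OF assms(1) conjI[OF assms(2,3)]]] show ?thesis .
qed

lemma br_leibniz:
  assumes "s \<in> \<Gamma> i" "t \<in> \<Gamma> j" "smooth f"
  shows "br [(i, s), (j, \<lambda>x. f x *\<^sub>R t x)] = (\<lambda>x. f x *\<^sub>R br [(i, s), (j, t)] x +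
    (if i = 0 then frechet_derivative f (at x) (\<rho> x (s x)) *\<^sub>R t x else 0))"
proof -
  have *: "\<forall>i j s t f. {(i, s), (j, t)} \<subseteq> graded_sections E \<and> smooth f \<longrightarrow>
        br [(i, s), (j, \<lambda>x. f x *\<^sub>R t x)] = (\<lambda>x. f x *\<^sub>R br [(i, s), (j, t)] x +
              (if i = 0 then frechet_derivative f (at x) (\<rho> x (s x)) *\<^sub>R t x else 0))"
    using linf unfolding linf_algebroid_def by (elim conjE)
  have "{(i, s), (j, t)} \<subseteq> graded_sections E \<and> smooth f" using assms by (simp add: graded_iff)
  from *[rule_format, OF this] show ?thesis .
qed

lemma br_jacobi: "as \<noteq> [] \<Longrightarrow> set as \<subseteq> graded_sections E \<Longrightarrow> higher_jacobi br as"
proof -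
  have "\<forall>as. as \<noteq> [] \<and> set as \<subseteq> graded_sections E \<longrightarrow> higher_jacobi br as"
    using linf unfolding linf_algebroid_def by (elim conjE)
  then show "as \<noteq> [] \<Longrightarrow> set as \<subseteq> graded_sections E \<Longrightarrow> higher_jacobi br as" by simp
qed

lemma br2_add: "s \<in> \<Gamma> i \<Longrightarrow> t \<in> \<Gamma> j \<Longrightarrow> t' \<in> \<Gamma> j \<Longrightarrow>
    br [(i, s), (j, \<lambda>x. t x + t' x)] = (\<lambda>x. br [(i, s), (j, t)] x + br [(i, s), (j, t')] x)"
  using br_add[of "[(i, s)]" "[]" j t t'] by (simp add: graded_iff)

lemma br2_zero: "s \<in> \<Gamma> i \<Longrightarrow> br [(i, s), (j, \<lambda>_. 0)] = (\<lambda>_. 0)"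
  using br_leibniz[of s i "\<lambda>_. 0" j "\<lambda>_. 0"] function_module_zero[OF \<Gamma>_module, of j]
  by (cases "i = 0") (simp_all add: smooth_on_const)

lemma br2_skew: "s \<in> \<Gamma> i \<Longrightarrow> e \<in> \<Gamma> 0 \<Longrightarrow> br [(i, s), (0, e)] = (\<lambda>x. - ell e i s x)"
  using br_skew[of "[]" "[]" i s 0 e] by (simp add: graded_iff)

lemma ell_closed: "e \<in> \<Gamma> 0 \<Longrightarrow> s \<in> \<Gamma> i \<Longrightarrow> ell e i s \<in> \<Gamma> i"
  using br_closed[of "[(0, e), (i, s)]"] by (simp add: graded_iff bracket_index_def)

lemma ell_derivation: "e \<in> \<Gamma> 0 \<Longrightarrow> derivation_over (anchor e) (ell e i) (\<Gamma> i)"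
  unfolding derivation_over_def by (auto simp: ell_closed br2_add br_leibniz)

text \<open>All anchors vanish at the origin; hence the binary bracket there only depends on the values of its
  arguments at the origin.\<close>

lemma br2_vanish:
  assumes s: "s \<in> \<Gamma> i" and t: "t \<in> \<Gamma> j" "t 0 = 0"
  shows "br [(i, s), (j, t)] 0 = 0"
proof -
  obtain u where u: "\<And>b. u b \<in> \<Gamma> j" "t = (\<lambda>x. \<Sum>b\<in>B. crd b x *\<^sub>R u b x)"
    using section_vanishing_expand[OF vbundle_E t] by blast
  have s0: "\<rho> 0 (s 0) = 0" if "i = 0" using F_at_0[OF anchor_F] s that by simp
  have cu: "(\<lambda>x. crd b x *\<^sub>R u b x) \<in> \<Gamma> j" for b by (rule function_module_smult[OF \<Gamma>_module smooth_crd u(1)])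
  have "br [(i, s), (j, \<lambda>x. \<Sum>b\<in>C. crd b x *\<^sub>R u b x)] 0 = 0" if "finite C" for C
    using that
  proof (induction C rule: finite_induct)
    case (insert b C)
    have "(\<lambda>x. \<Sum>b\<in>C. crd b x *\<^sub>R u b x) \<in> \<Gamma> j" by (rule function_module_sum[OF \<Gamma>_module cu])
    then have "br [(i, s), (j, \<lambda>x. \<Sum>b\<in>insert b C. crd b x *\<^sub>R u b x)] 0
        = br [(i, s), (j, \<lambda>x. crd b x *\<^sub>R u b x)] 0 + br [(i, s), (j, \<lambda>x. \<Sum>b\<in>C. crd b x *\<^sub>R u b x)] 0"
      using insert(1,2) br2_add[OF s cu] by simp
    also have "br [(i, s), (j, \<lambda>x. crd b x *\<^sub>R u b x)] 0 = 0"
      unfolding br_leibniz[OF s u(1) smooth_crd] using s0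
      by (simp add: linear_0[OF crd_linear] fd_linear_map[OF crd_linear])
    finally show ?case using insert by simp
  qed (simp add: br2_zero[OF s])
  then show ?thesis using u(2) finite_B by simp
qed

text \<open>The differences of the arguments vanish at the origin; skew-symmetry reduces the first argument to the second.\<close>

lemma ell_at_0:
  assumes e: "e \<in> \<Gamma> 0" "e' \<in> \<Gamma> 0" "e 0 = e' 0" and s: "s \<in> \<Gamma> i" "s' \<in> \<Gamma> i" "s 0 = s' 0"
  shows "ell e i s 0 = ell e' i s' 0"
proof -
  have D: "br [(k, t), (j, \<lambda>x. u x + (w x - u x))] 0 = br [(k, t), (j, u)] 0"
    if t: "t \<in> \<Gamma> k" and u: "u \<in> \<Gamma> j" "w \<in> \<Gamma> j" "u 0 = w 0" for k j t u w
  proof -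
    have "br [(k, t), (j, \<lambda>x. w x - u x)] 0 = 0"
      by (rule br2_vanish[OF t function_module_diff[OF \<Gamma>_module u(2,1)]]) (simp add: u(3))
    then show ?thesis using br2_add[OF t u(1) function_module_diff[OF \<Gamma>_module u(2,1)]] by simp
  qed
  have "ell e i s 0 = ell e i s' 0" using D[OF e(1) s] by simp
  also have "\<dots> = ell e' i s' 0" using D[OF s(2) e] e(1,2) s(2) by (simp add: br2_skew)
  finally show ?thesis .
qed

lemma fibre_bracket_eq:
  assumes "e \<in> \<Gamma> 0" "s \<in> \<Gamma> i"
  shows "fibre_bracket 0 E br 0 i (e 0) (s 0) = ell e i s 0"
  unfolding fibre_bracket_def
proof (rule some_equality)
  show "\<exists>e'\<in>\<Gamma> 0. \<exists>s'\<in>\<Gamma> i. e' 0 = e 0 \<and> s' 0 = s 0 \<and> ell e i s 0 = ell e' i s' 0"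
    using assms by blast
  show "\<And>z. \<exists>e'\<in>\<Gamma> 0. \<exists>s'\<in>\<Gamma> i. e' 0 = e 0 \<and> s' 0 = s 0 \<and> z = ell e' i s' 0 \<Longrightarrow> z = ell e i s 0"
    using ell_at_0 assms by metis
qed

text \<open>The Jacobi identity for two arguments: of its three terms, the one that contains the unary bracket of \<open>e\<close>
  vanishes.\<close>

lemma \<delta>_ell:
  assumes e: "e \<in> \<Gamma> 0" and s: "s \<in> \<Gamma> i" and i: "i \<ge> 1"
  shows "\<delta> i x (ell e i s x) = ell e (i - 1) (\<lambda>x. \<delta> i x (s x)) x"
proof -
  let ?as = "[(0, e), (i, s)]"
  have \<delta>s: "(\<lambda>x. \<delta> i x (s x)) \<in> \<Gamma> (i - 1)" by (rule module_map_closed[OF \<delta>_map[OF i] s])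
  have "{..<2} = {0, 1::nat}" by auto
  then have P: "Pow {..<2} - {{}} = {{0}, {1}, {0, 1::nat}}"
    by (simp only: Pow_insert Pow_empty image_insert image_empty) auto
  have sh: "shuffle_sign ?as {0} = 1" "shuffle_sign ?as {1} = - 1" "shuffle_sign ?as {0, 1} = 1"
  proof -
    have "{(a, b). a \<in> {0::nat} \<and> b < a \<and> b \<notin> {0}} = {}" by auto
    then show "shuffle_sign ?as {0} = 1" unfolding shuffle_sign_def by (simp only: prod.empty)
    have "{(a, b). a \<in> {1::nat} \<and> b < a \<and> b \<notin> {1}} = {(1, 0)}" by auto
    then show "shuffle_sign ?as {1} = - 1" unfolding shuffle_sign_def by (simp only:) simp
    have "{(a, b). a \<in> {0, 1::nat} \<and> b < a \<and> b \<notin> {0, 1}} = {}" by auto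
    then show "shuffle_sign ?as {0, 1} = 1" unfolding shuffle_sign_def by (simp only: prod.empty)
  qed
  have nt: "nths ?as {0} = [(0, e)]" "nths ?as (- {0}) = [(i, s)]" "nths ?as {1} = [(i, s)]" "nths ?as (- {1}) = [(0, e)]"
    "nths ?as {0, 1} = ?as" "nths ?as (- {0, 1}) = []" by (simp_all add: nths_Cons)
  have len: "length ?as = 2" by simp
  have "higher_jacobi br ?as" using e s by (intro br_jacobi) (auto simp: graded_iff)
  from spec[OF this[unfolded higher_jacobi_def], of x, unfolded len P] have "(\<Sum>S\<in>{{0}, {1}, {0, 1}}. ((- 1) ^ (card S * (2 - card S)) * shuffle_sign ?as S) *\<^sub>R
      br ((bracket_index (nths ?as S), br (nths ?as S)) # nths ?as (- S)) x) = 0"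
    .
  moreover have "(\<Sum>S\<in>{{0}, {1}, {0, 1::nat}}. f S) = f {0} + f {1} + f {0, 1}" for f :: "nat set \<Rightarrow> 'e"
    by (simp add: doubleton_eq_iff add.assoc)
  ultimately have "- br [(0, \<lambda>_. 0), (i, s)] x + br [(i - 1, \<lambda>x. \<delta> i x (s x)), (0, e)] x + br [(i, ell e i s)] x = 0"
    using e s i by (simp only: sh nt) (simp add: bracket_index_def br_unary)
  moreover have "br [(0, \<lambda>_. 0), (i, s)] x = 0"
  proof -
    have "br [(i, s), (0, \<lambda>_. 0)] x = - br [(0, \<lambda>_. 0), (i, s)] x"
      using br2_skew[OF s function_module_zero[OF \<Gamma>_module]] by simp
    then show ?thesis by (simp add: br2_zero[OF s])
  qed
  ultimately have "- ell e (i - 1) (\<lambda>x. \<delta> i x (s x)) x + \<delta> i x (ell e i s x) = 0"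
    using i br2_skew[OF \<delta>s e] by (simp add: br_unary[OF ell_closed[OF e s]])
  then show ?thesis by (metis add.commute add_uminus_conv_diff eq_iff_diff_eq_0)
qed

text \<open>The three terms of the Jacobi identity in which a unary bracket is inserted into the ternary one vanish, as
  the unary bracket is zero on \<open>E\<^sub>0\<close>; what remains is the ordinary Jacobi identity up to a boundary.\<close>

lemma jacobi_3:
  assumes e: "e \<in> \<Gamma> 0" "f \<in> \<Gamma> 0" "s \<in> \<Gamma> 0"
  shows "ell (ell e 0 f) 0 s x + ell f 0 (ell e 0 s) x - ell e 0 (ell f 0 s) x + \<delta> 1 x (br [(0, e), (0, f), (0, s)] x) = 0"
proof -
  let ?as = "[(0, e), (0, f), (0, s)]"
  have gr: "set ?as \<subseteq> graded_sections E" using e by (auto simp: graded_iff)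
  have "{..<3} = {0, 1, 2::nat}" by auto
  then have P: "Pow {..<3} - {{}} = {{0}, {1}, {2}, {0, 1}, {0, 2}, {1, 2}, {0, 1, 2::nat}}"
    by (simp only: Pow_insert Pow_empty image_insert image_empty) auto
  have sh: "shuffle_sign ?as S = (\<Prod>(a, b)\<in>{(a, b). a \<in> S \<and> b < a \<and> b \<notin> S}. - 1)" if "S \<subseteq> {0, 1, 2}" for S
    unfolding shuffle_sign_def
  proof (rule prod.cong[OF HOL.refl], clarify)
    fix a b assume "a \<in> S" "b < a" "b \<notin> S"
    then have "a \<in> {0, 1, 2}" using that by blast
    then show "- ((- 1) ^ (fst (?as ! a) * fst (?as ! b))) = - (1::real)" by auto
  qed
  have sh2: "shuffle_sign ?as {0, 1} = 1" "shuffle_sign ?as {0, 2} = - 1" "shuffle_sign ?as {1, 2} = 1" "shuffle_sign ?as {0, 1, 2} = 1"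
  proof -
    have "{(a, b). a \<in> {0, 1::nat} \<and> b < a \<and> b \<notin> {0, 1}} = {}" by auto
    then show "shuffle_sign ?as {0, 1} = 1" by (subst sh) (simp, simp only:, simp)
    have "{(a, b). a \<in> {0, 2::nat} \<and> b < a \<and> b \<notin> {0, 2}} = {(2, 1)}" by auto
    then show "shuffle_sign ?as {0, 2} = - 1" by (subst sh) (simp, simp only:, simp)
    have "{(a, b). a \<in> {1, 2::nat} \<and> b < a \<and> b \<notin> {1, 2}} = {(1, 0), (2, 0)}" by auto
    then show "shuffle_sign ?as {1, 2} = 1" by (subst sh) (simp, simp only:, simp)
    have "{(a, b). a \<in> {0, 1, 2::nat} \<and> b < a \<and> b \<notin> {0, 1, 2}} = {}" by auto
    then show "shuffle_sign ?as {0, 1, 2} = 1" by (subst sh) (simp, simp only:, simp)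
  qed
  have nt: "nths ?as {0} = [(0, e)]" "nths ?as (- {0}) = [(0, f), (0, s)]" "nths ?as {1} = [(0, f)]"
    "nths ?as (- {1}) = [(0, e), (0, s)]" "nths ?as {2} = [(0, s)]" "nths ?as (- {2}) = [(0, e), (0, f)]"
    "nths ?as {0, 1} = [(0, e), (0, f)]" "nths ?as (- {0, 1}) = [(0, s)]"
    "nths ?as {0, 2} = [(0, e), (0, s)]" "nths ?as (- {0, 2}) = [(0, f)]"
    "nths ?as {1, 2} = [(0, f), (0, s)]" "nths ?as (- {1, 2}) = [(0, e)]"
    "nths ?as {0, 1, 2} = ?as" "nths ?as (- {0, 1, 2}) = []" by (simp_all add: nths_Cons)
  have bi: "bracket_index [(0, u)] = 0" "bracket_index [(0, u), (0, v)] = 0" "bracket_index [(0, u), (0, v), (0, w)] = 1"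
    for u v w :: "'v \<Rightarrow> 'e" by (simp_all add: bracket_index_def)
  have z: "br [(0, \<lambda>_. 0), (0, u), (0, v)] = (\<lambda>_. 0)" if "u \<in> \<Gamma> 0" "v \<in> \<Gamma> 0" for u v
    using br_smult[of "[]" "[(0, u), (0, v)]" 0 "\<lambda>_. 0" "\<lambda>_. 0"] function_module_zero[OF \<Gamma>_module] that
    by (simp add: graded_iff smooth_on_const)
  have br3: "br ?as \<in> \<Gamma> 1" using br_closed[OF _ gr] by (simp add: bi)
  have len: "length ?as = 3" by simp
  have "higher_jacobi br ?as" by (intro br_jacobi gr) simp
  from spec[OF this[unfolded higher_jacobi_def], of x, unfolded len P] have "(\<Sum>S\<in>{{0}, {1}, {2}, {0, 1}, {0, 2}, {1, 2}, {0, 1, 2}}. ((- 1) ^ (card S * (3 - card S)) * shuffle_sign ?as S) *\<^sub>R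
      br ((bracket_index (nths ?as S), br (nths ?as S)) # nths ?as (- S)) x) = 0"
    .
  moreover have "(\<Sum>S\<in>{{0}, {1}, {2}, {0, 1}, {0, 2}, {1, 2}, {0, 1, 2::nat}}. h S)
      = h {0} + (h {1} + (h {2} + (h {0, 1} + (h {0, 2} + (h {1, 2} + h {0, 1, 2})))))" for h :: "nat set \<Rightarrow> 'e"
  proof -
    have "{0} \<notin> {{1}, {2}, {0, 1}, {0, 2}, {1, 2}, {0, 1, 2::nat}}" "{1} \<notin> {{2}, {0, 1}, {0, 2}, {1, 2}, {0, 1, 2::nat}}"
      "{2} \<notin> {{0, 1}, {0, 2}, {1, 2}, {0, 1, 2::nat}}" "{0, 1} \<notin> {{0, 2}, {1, 2}, {0, 1, 2::nat}}"
      "{0, 2} \<notin> {{1, 2}, {0, 1, 2::nat}}" "{1, 2} \<notin> {{0, 1, 2::nat}}"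
      by (simp_all add: set_eq_iff) presburger+
    then show ?thesis by (simp only: sum.insert finite.intros sum.empty add_0_right empty_iff simp_thms)
  qed
  ultimately have "br [(0, ell e 0 f), (0, s)] x - br [(0, ell e 0 s), (0, f)] x + br [(0, ell f 0 s), (0, e)] x
      + br [(1, br ?as)] x = 0"
    using e by (simp only: nt bi sh2) (simp add: z br_unary algebra_simps)
  then show ?thesis
    using e br3 by (simp add: br2_skew[OF ell_closed] br_unary)
qed

text \<open>Inserting \<open>h s\<close> for \<open>s\<close> into that identity, the terms without derivatives of \<open>h\<close> cancel, and the
  remaining ones show that the anchor is a bracket homomorphism.\<close>

lemma anchor_bracket_on_functions:
  assumes e: "e \<in> \<Gamma> 0" "f \<in> \<Gamma> 0" "s \<in> \<Gamma> 0" and h: "smooth h"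
  shows "(frechet_derivative h (at x) (anchor (ell e 0 f) x)
      - frechet_derivative h (at x) (lie_bracket (anchor e) (anchor f) x)) *\<^sub>R s x = 0"
proof -
  define X Y where "X = anchor e" and "Y = anchor f"
  have XY: "smooth X" "smooth Y" unfolding X_def Y_def using F_smooth anchor_F e by auto
  define D where "D Z k = (\<lambda>x. frechet_derivative k (at x) (Z x))" for Z :: "'v \<Rightarrow> 'v" and k :: "'v \<Rightarrow> real"
  have sD: "smooth (D Z k)" if "smooth Z" "smooth k" for Z k unfolding D_def by (intro smooth_along that)
  have L: "ell u 0 (\<lambda>x. k x *\<^sub>R t x) = (\<lambda>x. k x *\<^sub>R ell u 0 t x + D (anchor u) k x *\<^sub>R t x)"
    if "u \<in> \<Gamma> 0" "t \<in> \<Gamma> 0" "smooth k" for u t k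
    using br_leibniz[OF that] by (simp add: D_def)
  have LL: "ell u 0 (ell w 0 (\<lambda>x. h x *\<^sub>R s x)) x
      = h x *\<^sub>R ell u 0 (ell w 0 s) x + D (anchor u) h x *\<^sub>R ell w 0 s x
        + (D (anchor w) h x *\<^sub>R ell u 0 s x + D (anchor u) (D (anchor w) h) x *\<^sub>R s x)"
    if uw: "u \<in> \<Gamma> 0" "w \<in> \<Gamma> 0" for u w
  proof -
    have sw: "smooth (D (anchor w) h)" using sD[OF F_smooth[OF anchor_F[OF uw(2)]] h] .
    note c = ell_closed[OF uw(2) e(3)]
    show ?thesis
      unfolding L[OF uw(2) e(3) h]
        br2_add[OF uw(1) function_module_smult[OF \<Gamma>_module h c] function_module_smult[OF \<Gamma>_module sw e(3)]]
        L[OF uw(1) c h] L[OF uw(1) e(3) sw] ..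
  qed
  have 3: "br [(0, e), (0, f), (0, \<lambda>x. h x *\<^sub>R s x)] = (\<lambda>x. h x *\<^sub>R br [(0, e), (0, f), (0, s)] x)"
    using br_smult[of "[(0, e), (0, f)]" "[]" 0 s h] e h by (simp add: graded_iff)
  have "br [(0, e), (0, f), (0, s)] \<in> \<Gamma> (Suc 0)"
    using br_closed[of "[(0, e), (0, f), (0, s)]"] e by (simp add: graded_iff bracket_index_def)
  then have 4: "\<delta> 1 x (h x *\<^sub>R br [(0, e), (0, f), (0, s)] x) = h x *\<^sub>R \<delta> 1 x (br [(0, e), (0, f), (0, s)] x)"
    using module_map_scale[OF \<delta>_map[of 1]] by simp
  define P Q R T where "P = ell (ell e 0 f) 0 s x" and "Q = ell f 0 (ell e 0 s) x" and "R = ell e 0 (ell f 0 s) x"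
    and "T = \<delta> 1 x (br [(0, e), (0, f), (0, s)] x)"
  have J: "P + Q - R + T = 0" unfolding P_def Q_def R_def T_def by (rule jacobi_3[OF e])
  have "h x *\<^sub>R P + D (anchor (ell e 0 f)) h x *\<^sub>R s x
      + (h x *\<^sub>R Q + D Y h x *\<^sub>R ell e 0 s x + (D X h x *\<^sub>R ell f 0 s x + D Y (D X h) x *\<^sub>R s x))
      - (h x *\<^sub>R R + D X h x *\<^sub>R ell f 0 s x + (D Y h x *\<^sub>R ell e 0 s x + D X (D Y h) x *\<^sub>R s x)) + h x *\<^sub>R T = 0"
    using jacobi_3[OF e(1,2) function_module_smult[OF \<Gamma>_module h e(3)], of x]
    unfolding LL[OF e(1,2)] LL[OF e(2,1)] L[OF ell_closed[OF e(1,2)] e(3) h] 3 4 P_def Q_def R_def T_def X_def Y_def .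
  moreover have "h x *\<^sub>R P + D (anchor (ell e 0 f)) h x *\<^sub>R s x
      + (h x *\<^sub>R Q + D Y h x *\<^sub>R ell e 0 s x + (D X h x *\<^sub>R ell f 0 s x + D Y (D X h) x *\<^sub>R s x))
      - (h x *\<^sub>R R + D X h x *\<^sub>R ell f 0 s x + (D Y h x *\<^sub>R ell e 0 s x + D X (D Y h) x *\<^sub>R s x)) + h x *\<^sub>R T
    = h x *\<^sub>R (P + Q - R + T) + (D (anchor (ell e 0 f)) h x - (D X (D Y h) x - D Y (D X h) x)) *\<^sub>R s x"
    by (simp add: algebra_simps)
  ultimately have "(D (anchor (ell e 0 f)) h x - (D X (D Y h) x - D Y (D X h) x)) *\<^sub>R s x = 0"
    by (simp add: J)
  moreover have "D X (D Y h) x - D Y (D X h) x = frechet_derivative h (at x) (lie_bracket X Y x)"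
    unfolding D_def using lie_bracket_derivation_real[OF XY h] by simp
  ultimately show ?thesis by (simp add: D_def X_def Y_def)
qed

text \<open>At points where the fibre of \<open>E\<^sub>0\<close> is not zero, the preceding identity is applied to the coordinate functions and a section
  that does not vanish there. Elsewhere the rank of \<open>E\<^sub>0\<close> is zero in a neighbourhood, where all anchors vanish.\<close>

lemma anchor_ell:
  assumes e: "e \<in> \<Gamma> 0" "f \<in> \<Gamma> 0"
  shows "\<rho> x (ell e 0 f x) = lie_bracket (anchor e) (anchor f) x"
proof (cases "\<exists>u\<in>fibre (E 0) x. u \<noteq> 0")
  case True
  then obtain u where u: "u \<in> fibre (E 0) x" "u \<noteq> 0" by blast
  obtain s where s: "s \<in> \<Gamma> 0" "s x = u" using section_through[OF vbundle_E u(1)] by blast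
  show ?thesis
  proof (rule eq_if_crd)
    fix b
    show "crd b (\<rho> x (ell e 0 f x)) = crd b (lie_bracket (anchor e) (anchor f) x)"
      using anchor_bracket_on_functions[OF e s(1) smooth_crd, of b x] s(2) u(2)
      by (simp add: fd_linear_map[OF crd_linear])
  qed
next
  case False
  obtain U r b where fr: "(U, r, b) \<in> frames (E 0)" "x \<in> U" using bundle_frame_at[OF vbundle_E] by blast
  note frame = bundle_frame[OF vbundle_E fr(1)]
  have "r = 0"
  proof (rule ccontr)
    assume "r \<noteq> 0"
    then have "b 0 x \<in> (\<lambda>j. b j x) ` {..<r}" by blast
    then have "b 0 x \<noteq> 0" "b 0 x \<in> fibre (E 0) x"
      using frame(3,4)[OF fr(2)] dependent_zero span_base by metis+
    then show False using False by blast
  qed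
  then have "fibre (E 0) y = {0}" if "y \<in> U" for y using frame(4)[OF that] by simp
  then have zero: "\<rho> y (s y) = 0" if "s \<in> \<Gamma> 0" "y \<in> U" for s y
    using section_value[OF that(1), of y] that(2) module_map_zero[OF anchor_map \<Gamma>_module] by auto
  then have "lie_bracket (anchor e) (anchor f) x = 0"
    by (simp add: lie_bracket_def frechet_derivative_cong_open[OF frame(1) fr(2), of "anchor e" "\<lambda>_. 0"] e
        frechet_derivative_cong_open[OF frame(1) fr(2), of "anchor f" "\<lambda>_. 0"] frechet_derivative_const)
  then show ?thesis using zero[OF ell_closed[OF e] fr(2)] by simp
qed

end

section \<open>The homology of the Koszul complex as the fibre of the resolution\<close>

context linf_resolution begin

text \<open>These sections act compatibly on all modules of the resolution: by the binary bracket on sections and by the Lie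
  bracket of their anchor on the foliation. Every isotropy class is the class of the anchor of such a section.\<close>

definition linear_anchored :: "('v \<Rightarrow> 'e) set" where
  "linear_anchored = {e \<in> \<Gamma> 0. anchor e \<in> g}"

text \<open>The syzygy modules of the resolution.\<close>

definition \<delta>_image :: "nat \<Rightarrow> ('v \<Rightarrow> 'e) set" where
  "\<delta>_image j = (\<lambda>s x. \<delta> j x (s x)) ` \<Gamma> j"

lemma \<delta>_map_image: "j \<ge> 1 \<Longrightarrow> module_map (\<Gamma> j) (\<delta> j) (\<delta>_image j)"
  using \<delta>_map[of j] unfolding module_map_def \<delta>_image_def by blast

lemma \<delta>_image_at_0: "j \<ge> 1 \<Longrightarrow> s \<in> \<delta>_image j \<Longrightarrow> s 0 = 0"
  unfolding \<delta>_image_def using \<delta>_at_0 by auto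

lemma \<delta>_image_kernel: "j \<ge> 1 \<Longrightarrow> \<delta>_image (Suc j) = {s \<in> \<Gamma> j. \<forall>x. \<delta> j x (s x) = 0}"
  using \<delta>_kernel[of j] by (simp add: \<delta>_image_def)

lemma \<delta>_image_anchor_kernel: "\<delta>_image 1 = {s \<in> \<Gamma> 0. \<forall>x. \<rho> x (s x) = 0}"
  using anchor_kernel by (simp add: \<delta>_image_def)

lemma \<delta>_image_module: "j \<ge> 1 \<Longrightarrow> function_module (\<delta>_image j)"
proof -
  have ker: "function_module {s \<in> \<Gamma> k. \<forall>x. \<phi> x (s x) = 0}" if \<phi>: "module_map (\<Gamma> k) \<phi> (M :: ('v \<Rightarrow> 'u::real_vector) set)" for k \<phi> M
  proof -
    have "\<phi> x (f x *\<^sub>R s x) = f x *\<^sub>R \<phi> x (s x)" if "s \<in> \<Gamma> k" for f s x by (rule module_map_scale[OF \<phi> that])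
    then show ?thesis
      unfolding function_module_def
      using function_module_zero[OF \<Gamma>_module] function_module_add[OF \<Gamma>_module] function_module_smult[OF \<Gamma>_module]
      by (auto simp: module_map_zero[OF \<phi> \<Gamma>_module] module_map_add[OF \<phi>])
  qed
  assume j: "j \<ge> 1"
  show ?thesis
  proof (cases "j = 1")
    case True
    then show ?thesis using ker[OF anchor_map] \<delta>_image_anchor_kernel by simp
  next
    case False
    then obtain k where k: "j = Suc k" "k \<ge> 1" using j by (cases j) auto
    show ?thesis unfolding k(1) \<delta>_image_kernel[OF k(2)] by (rule ker[OF \<delta>_map[OF k(2)]])
  qed
qed

lemma koszul_exact_\<Gamma>:
  assumes "\<omega> \<in> cycles k (\<Gamma> j)" "k = 0 \<Longrightarrow> \<omega> 0 [] = 0"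
  shows "\<exists>\<gamma>\<in>mforms (Suc k) (\<Gamma> j). euler_d \<gamma> = \<omega>"
  using koszul_exact_sections[OF vbundle_E, of \<omega> k j] assms unfolding cycles_def by blast

lemma fibre_eq: "fibre (E i) 0 = {s 0 | s. s \<in> \<Gamma> i}"
  using section_through[OF vbundle_E] section_value by blast

lemma linear_anchoredD:
  assumes "e \<in> linear_anchored"
  shows "e \<in> \<Gamma> 0" "linear (anchor e)" "derivation_over (anchor e) (ell e j) (\<Gamma> j)"
  using assms g_linear ell_derivation unfolding linear_anchored_def by auto

abbreviation "fibre_act i \<equiv> (\<lambda>e. fibre_bracket 0 E br 0 i (e 0))"

text \<open>Induction on the homological degree, with one step of the resolution for each shift.\<close>

lemma homology_of_\<delta>_image:
  assumes "j \<ge> 1"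
  shows "\<exists>h. homology_map linear_anchored (\<lambda>e. anchor e) (\<lambda>e. ell e (j - 1)) (\<delta>_image j) i
    (fibre_act (i + j)) (fibre (E (i + j)) 0) h"
  using assms
proof (induction i arbitrary: j)
  case 0
  show ?case
  proof (rule homology_map_degree_0[OF \<delta>_map_image[OF 0] \<Gamma>_module \<delta>_image_module[OF 0], where DN = "\<lambda>e. ell e j"])
    show "\<exists>s\<in>\<Gamma> j. m = (\<lambda>x. \<delta> j x (s x))" if "m \<in> \<delta>_image j" for m
      using that unfolding \<delta>_image_def by blast
    show "s 0 = 0" if "s \<in> \<Gamma> j" "\<And>x. \<delta> j x (s x) = 0" for s
      using that \<delta>_image_kernel[OF 0] \<delta>_image_at_0[of "Suc j" s] by simp
    show "\<exists>\<sigma>\<in>mforms (Suc 0) (\<Gamma> j). euler_d \<sigma> = degree_0_form s" if "s \<in> \<Gamma> j" "s 0 = 0" for s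
      using section_vanishing_at_0[OF vbundle_E that] by blast
    show "\<delta> j x (ell e j s x) = ell e (j - 1) (\<lambda>x. \<delta> j x (s x)) x" if "e \<in> linear_anchored" "s \<in> \<Gamma> j" for e s x
      by (rule \<delta>_ell[OF linear_anchoredD(1)[OF that(1)] that(2) 0])
    show "fibre_act (0 + j) e (s 0) = ell e j s 0" if "e \<in> linear_anchored" "s \<in> \<Gamma> j" for e s
      using fibre_bracket_eq[OF linear_anchoredD(1)[OF that(1)] that(2)] by simp
  qed (use linear_anchoredD(3) fibre_eq in auto)
next
  case (Suc i)
  obtain h where h: "homology_map linear_anchored (\<lambda>e. anchor e) (\<lambda>e. ell e j) (\<delta>_image (Suc j)) i
      (fibre_act (Suc i + j)) (fibre (E (Suc i + j)) 0) h"
    using Suc.IH[of "Suc j"] by auto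
  show ?case
  proof (rule homology_map_shift[OF \<delta>_map_image[OF Suc.prems] \<Gamma>_module \<delta>_image_module[OF Suc.prems]
        _ \<delta>_image_kernel[OF Suc.prems] _ koszul_exact_\<Gamma> linear_anchoredD(2) linear_anchoredD(3) _ h])
    show "\<exists>s\<in>\<Gamma> j. m = (\<lambda>x. \<delta> j x (s x))" if "m \<in> \<delta>_image j" for m
      using that unfolding \<delta>_image_def by blast
    show "s 0 = 0" if "s \<in> \<delta>_image (Suc j)" for s using \<delta>_image_at_0[OF _ that] by simp
    show "\<delta> j x (ell e j s x) = ell e (j - 1) (\<lambda>x. \<delta> j x (s x)) x" if "e \<in> linear_anchored" "s \<in> \<Gamma> j" for e s x
      by (rule \<delta>_ell[OF linear_anchoredD(1)[OF that(1)] that(2) Suc.prems])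
  qed
qed

lemma homology_of_F:
  "\<exists>h. homology_map linear_anchored (\<lambda>e. anchor e) (\<lambda>e. lie_bracket (anchor e)) F i (fibre_act i) (fibre (E i) 0) h"
proof -
  have surj: "\<exists>s\<in>\<Gamma> 0. m = (\<lambda>x. \<rho> x (s x))" if "m \<in> F" for m using that anchor_image by blast
  have comm: "\<rho> x (ell e 0 s x) = lie_bracket (anchor e) (\<lambda>x. \<rho> x (s x)) x" if "e \<in> linear_anchored" "s \<in> \<Gamma> 0" for e s x
    by (rule anchor_ell[OF linear_anchoredD(1)[OF that(1)] that(2)])
  show ?thesis
  proof (cases i)
    case 0
    show ?thesis unfolding 0
    proof (rule homology_map_degree_0[OF anchor_map \<Gamma>_module F_module surj, where DN = "\<lambda>e. ell e 0"])
      show "s 0 = 0" if "s \<in> \<Gamma> 0" "\<And>x. \<rho> x (s x) = 0" for s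
        using that \<delta>_image_anchor_kernel \<delta>_image_at_0[of 1 s] by simp
      show "\<exists>\<sigma>\<in>mforms (Suc 0) (\<Gamma> 0). euler_d \<sigma> = degree_0_form s" if "s \<in> \<Gamma> 0" "s 0 = 0" for s
        using section_vanishing_at_0[OF vbundle_E that] by blast
      show "fibre_act 0 e (s 0) = ell e 0 s 0" if "e \<in> linear_anchored" "s \<in> \<Gamma> 0" for e s
        using fibre_bracket_eq[OF linear_anchoredD(1)[OF that(1)] that(2)] by simp
    qed (use linear_anchoredD(3) fibre_eq comm in auto)
  next
    case (Suc k)
    obtain h where h: "homology_map linear_anchored (\<lambda>e. anchor e) (\<lambda>e. ell e 0) (\<delta>_image 1) k
        (fibre_act i) (fibre (E i) 0) h"
      using homology_of_\<delta>_image[of 1 k] Suc by auto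
    show ?thesis unfolding Suc
      by (rule homology_map_shift[OF anchor_map \<Gamma>_module F_module surj \<delta>_image_anchor_kernel _ koszul_exact_\<Gamma>
            linear_anchoredD(2) linear_anchoredD(3) comm h[unfolded Suc]])
        (auto intro: \<delta>_image_at_0)
  qed
qed

section \<open>The isotropy action on the fibres\<close>

text \<open>The fields of the form \<open>\<rho>(t)\<close> with \<open>t(0) = 0\<close> form a submodule that contains the generators of \<open>I\<^sub>0F\<close>.\<close>

lemma I_anchor: "X \<in> I \<Longrightarrow> \<exists>t\<in>\<Gamma> 0. t 0 = 0 \<and> X = anchor t"
proof -
  let ?N = "{X. \<exists>t\<in>\<Gamma> 0. t 0 = 0 \<and> X = anchor t}"
  have "I \<subseteq> ?N"
    unfolding ideal_times_def
  proof (rule generated_subset)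
    show "?N \<subseteq> {X. smooth X}" using anchor_F F_smooth by blast
    show "function_module ?N"
      unfolding function_module_def
    proof (intro conjI ballI allI impI)
      show "(\<lambda>_. 0) \<in> ?N"
        using function_module_zero[OF \<Gamma>_module, of 0] module_map_zero[OF anchor_map \<Gamma>_module]
        by (auto intro!: bexI[of _ "\<lambda>_. 0"])
      show "(\<lambda>x. X x + Y x) \<in> ?N" if X: "X \<in> ?N" and Y: "Y \<in> ?N" for X Y :: "'v \<Rightarrow> 'v"
      proof -
        obtain s t where st: "s \<in> \<Gamma> 0" "s 0 = 0" "X = anchor s" "t \<in> \<Gamma> 0" "t 0 = 0" "Y = anchor t"
          using X Y by blast
        then show ?thesis
          using function_module_add[OF \<Gamma>_module st(1,4)] module_map_add[OF anchor_map st(1,4)]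
          by (auto intro!: bexI[of _ "\<lambda>x. s x + t x"])
      qed
      show "(\<lambda>x. f x *\<^sub>R X x) \<in> ?N" if fX: "smooth f \<and> X \<in> ?N" for f :: "'v \<Rightarrow> real" and X :: "'v \<Rightarrow> 'v"
      proof -
        obtain s where s: "s \<in> \<Gamma> 0" "s 0 = 0" "X = anchor s" using fX by blast
        then show ?thesis
          using function_module_smult[OF \<Gamma>_module _ s(1), of f] fX module_map_scale[OF anchor_map s(1)]
          by (auto intro!: bexI[of _ "\<lambda>x. f x *\<^sub>R s x"])
      qed
    qed
    show "{(\<lambda>x. f x *\<^sub>R X x) | f X. f \<in> vanishing_ideal 0 \<and> X \<in> F} \<subseteq> ?N"
    proof clarify
      fix f :: "'v \<Rightarrow> real" and X :: "'v \<Rightarrow> 'v" assume f: "f \<in> vanishing_ideal 0" and "X \<in> F"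
      then obtain s where s: "s \<in> \<Gamma> 0" "X = anchor s" using anchor_image by blast
      show "\<exists>t\<in>\<Gamma> 0. t 0 = 0 \<and> (\<lambda>x. f x *\<^sub>R X x) = anchor t"
        using function_module_smult[OF \<Gamma>_module _ s(1), of f] f module_map_scale[OF anchor_map s(1)] s(2)
        by (intro bexI[of _ "\<lambda>x. f x *\<^sub>R s x"]) (auto simp: vanishing_ideal_def)
    qed
  qed
  then show "X \<in> I \<Longrightarrow> \<exists>t\<in>\<Gamma> 0. t 0 = 0 \<and> X = anchor t" by blast
qed

text \<open>If \<open>\<rho>(e - f)\<close> lies in \<open>I\<^sub>0F\<close>, then \<open>e - f\<close> differs from a section vanishing at the origin by one in the kernel of the
  anchor, and the latter vanishes there by minimality. The converse is Hadamard's lemma.\<close>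

lemma anchor_class_iff:
  assumes e: "e \<in> \<Gamma> 0" "f \<in> \<Gamma> 0"
  shows "cls (anchor e) = cls (anchor f) \<longleftrightarrow> e 0 = f 0"
proof -
  have d: "(\<lambda>x. e x - f x) \<in> \<Gamma> 0" by (rule function_module_diff[OF \<Gamma>_module e])
  have ad: "anchor (\<lambda>x. e x - f x) = (\<lambda>x. anchor e x - anchor f x)"
    using module_map_diff[OF anchor_map \<Gamma>_module e] by simp
  have "lin_part (anchor (\<lambda>x. e x - f x)) = (\<lambda>v. lin_part (anchor e) v - lin_part (anchor f) v)"
    unfolding ad by (simp add: lin_part_def fun_eq_iff fd_diff F_smooth anchor_F e)
  then have "cls (anchor e) = cls (anchor f) \<longleftrightarrow> lin_part (anchor (\<lambda>x. e x - f x)) = (\<lambda>_. 0)"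
    by (simp add: cls_eq_iff anchor_F e fun_eq_iff)
  also have "\<dots> \<longleftrightarrow> anchor (\<lambda>x. e x - f x) \<in> I" using anchor_F[OF d] by (simp add: I_eq)
  also have "\<dots> \<longleftrightarrow> e 0 = f 0"
  proof
    assume "anchor (\<lambda>x. e x - f x) \<in> I"
    then obtain t where t: "t \<in> \<Gamma> 0" "t 0 = 0" "anchor (\<lambda>x. e x - f x) = anchor t" using I_anchor by blast
    have "\<rho> x (e x - f x - t x) = 0" for x
      using module_map_diff[OF anchor_map \<Gamma>_module d t(1), of x] fun_cong[OF t(3), of x] by simp
    then have "(\<lambda>x. e x - f x - t x) \<in> \<delta>_image 1"
      using function_module_diff[OF \<Gamma>_module d t(1)] \<delta>_image_anchor_kernel by simp
    from \<delta>_image_at_0[OF _ this] show "e 0 = f 0" using t(2) by simp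
  next
    assume "e 0 = f 0"
    then obtain u where u: "\<And>b. u b \<in> \<Gamma> 0" "(\<lambda>x. e x - f x) = (\<lambda>x. \<Sum>b\<in>B. crd b x *\<^sub>R u b x)"
      using section_vanishing_expand[OF vbundle_E d] by auto
    have cu: "(\<lambda>x. crd b x *\<^sub>R u b x) \<in> \<Gamma> 0" for b by (rule function_module_smult[OF \<Gamma>_module smooth_crd u(1)])
    have "anchor (\<lambda>x. e x - f x) = (\<lambda>x. \<Sum>b\<in>B. crd b x *\<^sub>R anchor (u b) x)"
    proof
      fix x
      have "\<rho> x (e x - f x) = \<rho> x (\<Sum>b\<in>B. crd b x *\<^sub>R u b x)" using fun_cong[OF u(2), of x] by simp
      also have "\<dots> = (\<Sum>b\<in>B. \<rho> x (crd b x *\<^sub>R u b x))" by (rule module_map_sum[OF anchor_map \<Gamma>_module cu])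
      finally show "\<rho> x (e x - f x) = (\<Sum>b\<in>B. crd b x *\<^sub>R anchor (u b) x)"
        by (simp only: module_map_scale[OF anchor_map u(1)])
    qed
    also have "\<dots> \<in> I"
      by (intro function_module_sum[OF I_module] I_generator smooth_crd anchor_F u(1)) (simp add: linear_0[OF crd_linear])
    finally show "anchor (\<lambda>x. e x - f x) \<in> I" .
  qed
  finally show ?thesis .
qed

lemma anchor_iso_eq:
  assumes "e \<in> \<Gamma> 0"
  shows "anchor_iso 0 F E \<rho> (e 0) = cls (anchor e)"
  unfolding anchor_iso_def
proof (rule some_equality)
  show "\<exists>f\<in>\<Gamma> 0. f 0 = e 0 \<and> cls (anchor e) = cls (anchor f)" using assms by blast
  show "\<And>C. \<exists>f\<in>\<Gamma> 0. f 0 = e 0 \<and> C = cls (anchor f) \<Longrightarrow> C = cls (anchor e)"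
    using anchor_class_iff assms by metis
qed

lemma fibre_action_eq:
  assumes e: "e \<in> \<Gamma> 0"
  shows "fibre_action 0 F E \<rho> br i (cls (anchor e)) = fibre_act i e"
proof -
  have "inj_on (anchor_iso 0 F E \<rho>) (fibre (E 0) 0)"
    by (rule inj_onI) (auto simp: fibre_eq anchor_iso_eq anchor_class_iff)
  then have "inv_into (fibre (E 0) 0) (anchor_iso 0 F E \<rho>) (anchor_iso 0 F E \<rho> (e 0)) = e 0"
    by (rule inv_into_f_f) (rule section_value[OF e])
  then show ?thesis by (simp add: fun_eq_iff fibre_action_def anchor_iso_eq[OF e])
qed

lemma isotropy_anchor:
  assumes "C \<in> carrier (isotropy 0 F)"
  obtains e where "e \<in> linear_anchored" "C = cls (anchor e)" "form_rep C = form_act (anchor e) (lie_bracket (anchor e))"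
proof -
  obtain X where X: "X \<in> F" "C = cls X" using assms unfolding carrier_isotropy by blast
  obtain e where e: "e \<in> \<Gamma> 0" "lin_part X = anchor e" using lin_part_in_F[OF X(1)] anchor_image by blast
  \<comment> \<open>the linear part of \<open>X\<close> represents the same class and is the anchor of a section\<close>
  have "cls X = cls (lin_part X)"
    using X by (simp add: cls_eq_iff lin_part_in_F lin_part_lin_part)
  have "form_rep C = form_act (anchor e) (lie_bracket (anchor e))" unfolding X(2) form_rep_cls[OF X(1)] e(2) ..
  moreover have "C = cls (anchor e)" using \<open>cls X = cls (lin_part X)\<close> X(2) e(2) by simp
  moreover have "e \<in> linear_anchored" using e lin_part_in_g[OF X(1)] by (simp add: linear_anchored_def)
  ultimately show thesis using that by blast
qed

text \<open>The map on cycles descends to homology classes because its kernel consists of the boundaries. It also transports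
  the representation from cycles to the fibre.\<close>

lemma homology_rep_equivalent:
  "rep_equivalent (isotropy 0 F) (koszul_homology F i)
     (quot_act (koszul F i) (koszul_boundaries F i) (koszul_rep i))
     (fibre_space (E i) 0) (fibre_action 0 F E \<rho> br i)"
proof -
  obtain h where "homology_map linear_anchored (\<lambda>e. anchor e) (\<lambda>e. lie_bracket (anchor e)) F i (fibre_act i) (fibre (E i) 0) h"
    using homology_of_F by blast
  then have img: "h ` cycles i F = fibre (E i) 0"
    and add: "\<And>z z'. z \<in> cycles i F \<Longrightarrow> z' \<in> cycles i F \<Longrightarrow> h (\<lambda>x vs. z x vs + z' x vs) = h z + h z'"
    and scale: "\<And>c z. z \<in> cycles i F \<Longrightarrow> h (\<lambda>x vs. c *\<^sub>R z x vs) = c *\<^sub>R h z"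
    and ker: "\<And>z. z \<in> cycles i F \<Longrightarrow> h z = 0 \<longleftrightarrow> z \<in> boundaries i F"
    and act: "\<And>e z. e \<in> linear_anchored \<Longrightarrow> z \<in> cycles i F \<Longrightarrow>
        h (form_act (anchor e) (lie_bracket (anchor e)) z) = fibre_act i e (h z)"
    unfolding homology_map_def by blast+
  have equiv: "fibre_action 0 F E \<rho> br i C (h z) = h (form_rep C z)"
    if C: "C \<in> carrier (isotropy 0 F)" and z: "z \<in> cycles i F" for C z
  proof -
    obtain e where e: "e \<in> linear_anchored" "C = cls (anchor e)"
      "form_rep C = form_act (anchor e) (lie_bracket (anchor e))" using isotropy_anchor[OF C] by blast
    show ?thesis unfolding e(3) act[OF e(1) z] unfolding e(2) fibre_action_eq[OF linear_anchoredD(1)[OF e(1)]] ..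
  qed
  have lin: "h \<in> linear_maps real_ring (real_form (form_module (cycles i F))) (fibre_space (E i) 0)"
    by (rule linear_mapsI) (use img in \<open>auto simp: add scale\<close>)
  have rep: "lie_rep (isotropy 0 F) (fibre_space (E i) 0) (fibre_action 0 F E \<rho> br i)"
    by (rule lie_rep_surj[OF lie_rep_forms[OF cycles_mforms module_cycles form_rep_cycles] module_fibre_space[OF vbundle_E] lin])
      (simp_all add: img equiv)
  have cyc_diff: "(\<lambda>x vs. z x vs - z' x vs) \<in> cycles i F" if "z \<in> cycles i F" "z' \<in> cycles i F" for z z'
    using that by (simp add: cycles_def mforms_diff[OF F_module] euler_d_diff)
  have class_iff: "homology_class i z = homology_class i z' \<longleftrightarrow> h z = h z'"
    if z: "z \<in> cycles i F" "z' \<in> cycles i F" for z z'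
  proof
    assume "homology_class i z = homology_class i z'"
    moreover have "tens i z \<in> homology_class i z"
      unfolding homology_class_eq by (rule coset_self[OF module_koszul_cycles submodule_boundaries tens_cycles[OF z(1)]])
    ultimately obtain \<beta> where \<beta>: "\<beta> \<in> boundaries i F" "tens i z = tens i (\<lambda>x vs. \<beta> x vs + z' x vs)"
      using homology_class_mem[OF z(2)] by blast
    have \<beta>c: "\<beta> \<in> cycles i F" using \<beta>(1) boundaries_cycles by blast
    have "z = (\<lambda>x vs. \<beta> x vs + z' x vs)" using tens_inj[OF _ \<beta>(2)] z(1) cycles_mforms by blast
    then have "h z = h \<beta> + h z'" using add[OF \<beta>c z(2)] by simp
    then show "h z = h z'" using ker[OF \<beta>c] \<beta>(1) by simp
  next
    assume eq: "h z = h z'"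
    define d where "d = (\<lambda>x vs. z x vs - z' x vs)"
    have d: "d \<in> cycles i F" unfolding d_def by (rule cyc_diff[OF z])
    have "h (\<lambda>x vs. d x vs + z' x vs) = h d + h z'" by (rule add[OF d z(2)])
    moreover have zd: "(\<lambda>x vs. d x vs + z' x vs) = z" by (simp add: d_def)
    ultimately have "h d = 0" using eq by simp
    then have "d \<in> boundaries i F" using ker[OF d] by simp
    from homology_class_shift[OF z(2) this] show "homology_class i z = homology_class i z'" unfolding zd .
  qed
  define \<phi> where "\<phi> K = h (SOME z. z \<in> cycles i F \<and> homology_class i z = K)" for K
  have \<phi>: "\<phi> (homology_class i z) = h z" if z: "z \<in> cycles i F" for z
  proof -
    have "(SOME y. y \<in> cycles i F \<and> homology_class i y = homology_class i z) \<in> cycles i F \<and>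
        homology_class i (SOME y. y \<in> cycles i F \<and> homology_class i y = homology_class i z) = homology_class i z"
      by (rule someI[of _ z]) (use z in simp)
    then show ?thesis unfolding \<phi>_def using class_iff z by blast
  qed
  note hl = linear_mapsD[OF homology_class_linear]
  have "\<phi> \<in> linear_maps real_ring (koszul_homology F i) (fibre_space (E i) 0)"
  proof (rule linear_mapsI)
    fix K assume "K \<in> carrier (koszul_homology F i)"
    then obtain z where z: "z \<in> cycles i F" "K = homology_class i z" unfolding carrier_homology by blast
    show "\<phi> K \<in> carrier (fibre_space (E i) 0)" using z img by (auto simp: \<phi>)
    show "\<phi> (r \<odot>\<^bsub>koszul_homology F i\<^esub> K) = r \<odot>\<^bsub>fibre_space (E i) 0\<^esub> \<phi> K" if r: "r \<in> carrier real_ring" for r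
    proof -
      have rz: "(\<lambda>x vs. r *\<^sub>R z x vs) \<in> cycles i F"
        using Module.module.smult_closed[OF module_real_form[OF module_cycles], of r z i] z(1) by (simp add: real_ring_def)
      have "r \<odot>\<^bsub>koszul_homology F i\<^esub> K = homology_class i (\<lambda>x vs. r *\<^sub>R z x vs)"
        unfolding z(2) using hl(3)[of r z i] r z(1) by simp
      then show ?thesis by (simp only: z(2) \<phi>[OF rz] \<phi>[OF z(1)] scale[OF z(1)] fibre_space_sel)
    qed
    fix K' assume "K' \<in> carrier (koszul_homology F i)"
    then obtain z' where z': "z' \<in> cycles i F" "K' = homology_class i z'" unfolding carrier_homology by blast
    have zz: "(\<lambda>x vs. z x vs + z' x vs) \<in> cycles i F"
      using z(1) z'(1) by (simp add: cycles_def mforms_add[OF F_module] euler_d_add)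
    have "K \<oplus>\<^bsub>koszul_homology F i\<^esub> K' = homology_class i (\<lambda>x vs. z x vs + z' x vs)"
      unfolding z(2) z'(2) using hl(2)[of z i z'] z(1) z'(1) by simp
    then show "\<phi> (K \<oplus>\<^bsub>koszul_homology F i\<^esub> K') = \<phi> K \<oplus>\<^bsub>fibre_space (E i) 0\<^esub> \<phi> K'"
      by (simp only: z(2) z'(2) \<phi>[OF zz] \<phi>[OF z(1)] \<phi>[OF z'(1)] add[OF z(1) z'(1)] fibre_space_sel)
  qed
  moreover have "bij_betw \<phi> (carrier (koszul_homology F i)) (carrier (fibre_space (E i) 0))"
    unfolding bij_betw_def
  proof
    show "inj_on \<phi> (carrier (koszul_homology F i))"
    proof (rule inj_onI)
      fix K K' assume "K \<in> carrier (koszul_homology F i)" "K' \<in> carrier (koszul_homology F i)" and eq: "\<phi> K = \<phi> K'"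
      then obtain z z' where z: "z \<in> cycles i F" "K = homology_class i z" "z' \<in> cycles i F" "K' = homology_class i z'"
        unfolding carrier_homology by blast
      have "h z = h z'" using eq unfolding z(2,4) \<phi>[OF z(1)] \<phi>[OF z(3)] .
      then show "K = K'" unfolding z(2,4) class_iff[OF z(1,3)] .
    qed
    show "\<phi> ` carrier (koszul_homology F i) = carrier (fibre_space (E i) 0)"
      unfolding carrier_homology image_image using img by (simp add: \<phi> cong: image_cong)
  qed
  moreover have "\<phi> (quot_act (koszul F i) (koszul_boundaries F i) (koszul_rep i) C K) = fibre_action 0 F E \<rho> br i C (\<phi> K)"
    if C: "C \<in> carrier (isotropy 0 F)" and K: "K \<in> carrier (koszul_homology F i)" for C K
  proof -
    obtain z where z: "z \<in> cycles i F" "K = homology_class i z" using K unfolding carrier_homology by blast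
    show ?thesis unfolding z(2) quot_act_homology_class[OF C z(1)] \<phi>[OF z(1)] \<phi>[OF form_rep_cycles[OF C z(1)]] equiv[OF C z(1)] ..
  qed
  ultimately show ?thesis unfolding rep_equivalent_def using lie_rep_homology rep by blast
qed

end

theorem proposition4p3:
  fixes F :: "('v::real_normed_vector \<Rightarrow> 'v) set"
    and n :: nat
    and E :: "nat \<Rightarrow> ('v, 'e::real_vector) vbundle"
    and \<delta> :: "nat \<Rightarrow> 'v \<Rightarrow> 'e \<Rightarrow> 'e"
    and \<rho> :: "'v \<Rightarrow> 'e \<Rightarrow> 'v"
    and br :: "('v, 'e) multibracket"
  assumes "\<exists>B::'v set. finite B \<and> span B = UNIV"
    and "linear_foliation F"
    and "resolution F n E \<delta> \<rho>"
    and "minimal_at 0 E \<delta>"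
    and "linf_algebroid E \<delta> \<rho> br"
  shows "lin_part ` F \<subseteq> F \<and>
    (\<exists>lin_bar. (\<forall>X\<in>F. lin_bar (isotropy_class 0 F X) = lin_part X) \<and>
       lie_hom (isotropy 0 F) (foliation_lie F) lin_bar \<and>
       inj_on lin_bar (carrier (isotropy 0 F))) \<and>
    (\<exists>act.
       (\<forall>i\<le>n.
          (\<forall>X\<in>F. \<forall>\<alpha>\<in>carrier (forms i). \<forall>Y\<in>F.
             act i (isotropy_class 0 F X) (koszul_pure F i \<alpha> Y)
               = koszul_pure F i (lie_derivative (lin_part X) \<alpha>) Y
                 \<oplus>\<^bsub>koszul F i\<^esub> koszul_pure F i \<alpha> (lie_bracket (lin_part X) Y) \<and>
             fn_bracket 0 i (field_as_vform (lin_part X)) (form_times_field \<alpha> Y)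
               = (\<lambda>x vs. form_times_field (lie_derivative (lin_part X) \<alpha>) Y x vs
                   + form_times_field \<alpha> (lie_bracket (lin_part X) Y) x vs)) \<and>
          lie_rep (isotropy 0 F) (real_form (koszul F i)) (act i) \<and>
          (\<forall>C\<in>carrier (isotropy 0 F). \<forall>t\<in>carrier (koszul F i).
             i \<ge> 1 \<longrightarrow> koszul_d F i (act i C t) = act (i - 1) C (koszul_d F i t)) \<and>
          (\<forall>C\<in>carrier (isotropy 0 F). \<forall>z\<in>koszul_cycles F i.
             act i C z \<in> koszul_cycles F i \<and>
             quot_act (koszul F i) (koszul_boundaries F i) (act i) C
                 (koszul_boundaries F i +>\<^bsub>koszul F i\<^esub> z)
               = koszul_boundaries F i +>\<^bsub>koszul F i\<^esub> act i C z) \<and>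
          lie_rep (isotropy 0 F) (koszul_homology F i)
            (quot_act (koszul F i) (koszul_boundaries F i) (act i))) \<and>
       (\<forall>i\<le>n.
          (\<forall>e\<in>carrier (sections (E 0)). \<forall>s\<in>carrier (sections (E i)).
             fibre_action 0 F E \<rho> br i (isotropy_class 0 F (\<lambda>x. \<rho> x (e x))) (s 0)
               = br [(0, e), (i, s)] 0) \<and>
          rep_equivalent (isotropy 0 F)
            (koszul_homology F i) (quot_act (koszul F i) (koszul_boundaries F i) (act i))
            (fibre_space (E i) 0) (fibre_action 0 F E \<rho> br i)))"
proof -
  obtain B0 :: "'v set" where B0: "finite B0" "span B0 = UNIV" using assms(1) by blast
  obtain B where B: "B \<subseteq> B0" "independent B" "B0 \<subseteq> span B" using maximal_independent_subset[of B0] by blast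
  have fB: "finite_basis B"
  proof
    show "span B = UNIV" using B(1,3) B0(2) by (metis span_mono span_span top.extremum_uniqueI)
  qed (use B B0 finite_subset in auto)
  obtain g where g: "gl_subalgebra g" "F = generated_submodule smooth_ring vector_fields g"
    using assms(2) unfolding linear_foliation_def by blast
  interpret linf_resolution B g F n E \<delta> \<rho> br
    using fB g assms(3-5)
    by (simp add: linf_resolution_def linf_resolution_axioms_def foliated_space_def foliated_space_axioms_def)
  have "\<exists>lin_bar. (\<forall>X\<in>F. lin_bar (isotropy_class 0 F X) = lin_part X) \<and>
       lie_hom (isotropy 0 F) (foliation_lie F) lin_bar \<and> inj_on lin_bar (carrier (isotropy 0 F))"
    using lin_bar_cls lin_bar_hom lin_bar_inj by blast
  moreover have "koszul_rep i (cls X) (koszul_pure F i \<alpha> Y)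
      = koszul_pure F i (lie_derivative (lin_part X) \<alpha>) Y \<oplus>\<^bsub>koszul F i\<^esub> koszul_pure F i \<alpha> (lie_bracket (lin_part X) Y)"
    if X: "X \<in> F" and \<alpha>: "\<alpha> \<in> carrier (forms i)" and Y: "Y \<in> F" for i X \<alpha> Y
  proof -
    have \<alpha>': "\<alpha> \<in> smooth_forms i" using \<alpha> by (simp add: carrier_forms)
    have L: "lie_derivative (lin_part X) \<alpha> \<in> smooth_forms i"
      by (rule lie_derivative_form[OF lin_part_linear_map[OF X] \<alpha>'])
    have br: "lie_bracket (lin_part X) Y \<in> F" by (rule F_bracket[OF lin_part_in_F[OF X] Y])
    have m: "(\<lambda>x vs. \<beta> x vs *\<^sub>R Z x) \<in> mforms i F" if "\<beta> \<in> smooth_forms i" "Z \<in> F" for \<beta> Z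
      using tval_mforms[of "[(\<beta>, Z)]" i] that by (simp add: tensors_def tval_simps)
    show ?thesis
      unfolding koszul_pure_eq[OF \<alpha>' Y] koszul_pure_eq[OF L Y] koszul_pure_eq[OF \<alpha>' br]
        koszul_rep_tens[OF m[OF \<alpha>' Y]] form_rep_cls[OF X] koszul_add[OF m[OF L Y] m[OF \<alpha>' br]]
        form_act_product[OF lin_part_linear_map[OF X] \<alpha>' F_smooth[OF Y]] ..
  qed
  moreover have "fn_bracket 0 i (field_as_vform (lin_part X)) (form_times_field \<alpha> Y)
      = (\<lambda>x vs. form_times_field (lie_derivative (lin_part X) \<alpha>) Y x vs
          + form_times_field \<alpha> (lie_bracket (lin_part X) Y) x vs)"
    if "X \<in> F" "\<alpha> \<in> carrier (forms i)" "Y \<in> F" for i X \<alpha> Y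
    by (rule fn_bracket_linear_field) (use that in \<open>simp_all add: carrier_forms lin_part_linear_map F_smooth\<close>)
  moreover have "koszul_d F i (koszul_rep i C t) = koszul_rep (i - 1) C (koszul_d F i t)"
    if C: "C \<in> carrier (isotropy 0 F)" and t: "t \<in> carrier (koszul F i)" and i: "i \<ge> 1" for i C t
  proof -
    obtain k where k: "i = Suc k" using i by (cases i) auto
    obtain \<omega> where \<omega>: "\<omega> \<in> mforms (Suc k) F" "t = tens (Suc k) \<omega>" using t by (auto simp: carrier_koszul k)
    show ?thesis
      using \<omega> C euler_d_mforms[OF F_module \<omega>(1)]
      by (simp add: k koszul_rep_tens koszul_d_eq form_rep_mforms euler_d_form_rep)
  qed
  moreover have "koszul_rep i C z \<in> koszul_cycles F i \<and>
      quot_act (koszul F i) (koszul_boundaries F i) (koszul_rep i) C (koszul_boundaries F i +>\<^bsub>koszul F i\<^esub> z)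
        = koszul_boundaries F i +>\<^bsub>koszul F i\<^esub> koszul_rep i C z"
    if C: "C \<in> carrier (isotropy 0 F)" and z: "z \<in> koszul_cycles F i" for i C z
  proof -
    obtain \<omega> where \<omega>: "\<omega> \<in> cycles i F" "z = tens i \<omega>" using z by (auto simp: koszul_cycles_eq)
    have "\<omega> \<in> mforms i F" using \<omega>(1) cycles_mforms by blast
    then show ?thesis
      using quot_act_homology_class[OF C \<omega>(1)] form_rep_cycles[OF C \<omega>(1)]
      by (simp add: \<omega>(2) koszul_rep_tens koszul_cycles_eq homology_class_def)
  qed
  moreover have "fibre_action 0 F E \<rho> br i (cls (anchor e)) (s 0) = br [(0, e), (i, s)] 0"
    if "e \<in> \<Gamma> 0" "s \<in> \<Gamma> i" for i e s
    unfolding fibre_action_eq[OF that(1)] by (rule fibre_bracket_eq[OF that])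
  moreover have "lin_part ` F \<subseteq> F" using lin_part_in_F by blast
  ultimately show ?thesis
    using lie_rep_koszul lie_rep_homology homology_rep_equivalent
    by (intro conjI exI[of _ koszul_rep] allI impI ballI) auto
qed

end
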